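(* Let $(M,\Pi)$ be a Poisson manifold of dimension $n$ and maximal rank $2r$, and let $\mathbf{F}=(f_1,\dots,f_s)$ be a Liouville integrable system on $(M,\Pi)$ (so $r+s=n$). Let $m\in M$ be a point such that $d_mf_1\wedge\cdots\wedge d_mf_s\neq 0$ and the rank of $\Pi$ at $m$ is $2r$, and suppose that the integral manifold $\mathcal{F}_m$, passing through $m$, of the distribution generated by $X_{f_1},\dots,X_{f_s}$ is compact. Then $\mathcal{F}_m$ is (diffeomorphic to) a torus $\mathbb{T}^r$ of dimension $r$.
   Context: A Poisson manifold $(M,\Pi)$ is a smooth manifold with a bivector field $\Pi$ such that the bracket $\{f,g\}:=\Pi(df,dg)$ on smooth functions satisfies the Jacobi identity. The Hamiltonian vector field of a smooth function $f$ is $X_f:=\Pi(df,\cdot)$. Let $(M,\Pi)$ be a Poisson manifold of (maximal) rank $2r$ and dimension $n$. An $s$-tuple of smooth functions $\mathbf{F}=(f_1,\dots,f_s)$ on $M$ is a Liouville integrable system on $(M,\Pi)$ if (1) $f_1,\dots,f_s$ are independent (i.e. their differentials are linearly independent on a dense open set) and (2) $f_1,\dots,f_s$ are pairwise in involution (i.e. $\{f_i,f_j\}=0$ for all $i,j$) and $r+s=n$. The integral manifold $\mathcal{F}_m$ is the maximal connected integral manifold through $m$ of the distribution spanned by $X_{f_1},\dots,X_{f_s}$. $\mathbb{T}^r=S^1\times\cdots\times S^1$ ($r$ factors). *)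

theory Defs
  imports "HOL-Analysis.Analysis" "HOL-Library.Function_Algebras" "HOL-Combinatorics.Permutations"
begin

subsection \<open>Smooth functions on open subsets of Euclidean space\<close>

text \<open>
  The model space of dimension \<open>n\<close> is \<^term>\<open>Euclidean_space n\<close>, the space of real sequences
  vanishing from index \<open>n\<close> on, so that dimensions are natural numbers and may be \<open>0\<close>.
  A function is \<open>C\<^sup>k\<close> if it and its iterated partial derivatives of order at most \<open>k\<close> exist and are
  continuous; the sets \<open>U\<close> below are open in the model space.
\<close>

definition partial_deriv :: "nat \<Rightarrow> ((nat \<Rightarrow> real) \<Rightarrow> real) \<Rightarrow> (nat \<Rightarrow> real) \<Rightarrow> real" where
  "partial_deriv i f x = deriv (\<lambda>t. f (x(i := t))) (x i)"

primrec Ck_on :: "nat \<Rightarrow> nat \<Rightarrow> (nat \<Rightarrow> real) set \<Rightarrow> ((nat \<Rightarrow> real) \<Rightarrow> real) \<Rightarrow> bool" where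
  "Ck_on 0 n U f \<longleftrightarrow> continuous_map (subtopology (Euclidean_space n) U) euclideanreal f"
| "Ck_on (Suc k) n U f \<longleftrightarrow>
     continuous_map (subtopology (Euclidean_space n) U) euclideanreal f \<and>
     (\<forall>i<n. (\<forall>x\<in>U. (\<lambda>t. f (x(i := t))) differentiable (at (x i))) \<and>
            Ck_on k n U (partial_deriv i f))"

definition smooth_on :: "nat \<Rightarrow> (nat \<Rightarrow> real) set \<Rightarrow> ((nat \<Rightarrow> real) \<Rightarrow> real) \<Rightarrow> bool" where
  "smooth_on n U f \<longleftrightarrow> openin (Euclidean_space n) U \<and> (\<forall>k. Ck_on k n U f)"


subsection \<open>Smooth manifolds and smooth maps\<close>

text \<open>A chart is a pair of its domain and the coordinate map; the atlas need not be maximal.\<close>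

type_synonym 'a chart = "'a set \<times> ('a \<Rightarrow> nat \<Rightarrow> real)"

record 'a manifold =
  mdim :: nat
  mtop :: "'a topology"
  mcharts :: "'a chart set"

abbreviation mcarrier :: "'a manifold \<Rightarrow> 'a set" where
  "mcarrier M \<equiv> topspace (mtop M)"

definition smooth_manifold :: "'a manifold \<Rightarrow> bool" where
  "smooth_manifold M \<longleftrightarrow>
     Hausdorff_space (mtop M) \<and> second_countable (mtop M) \<and>
     (\<Union>(U, \<phi>)\<in>mcharts M. U) = mcarrier M \<and>
     (\<forall>(U, \<phi>)\<in>mcharts M.
        openin (mtop M) U \<and> openin (Euclidean_space (mdim M)) (\<phi> ` U) \<and>
        homeomorphic_map (subtopology (mtop M) U)
          (subtopology (Euclidean_space (mdim M)) (\<phi> ` U)) \<phi>) \<and>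
     (\<forall>(U, \<phi>)\<in>mcharts M. \<forall>(V, \<psi>)\<in>mcharts M. \<forall>j<mdim M.
        smooth_on (mdim M) (\<phi> ` (U \<inter> V)) (\<lambda>x. \<psi> (inv_into U \<phi> x) j))"

definition smooth_map :: "'a manifold \<Rightarrow> 'b manifold \<Rightarrow> ('a \<Rightarrow> 'b) \<Rightarrow> bool" where
  "smooth_map M M' h \<longleftrightarrow>
     continuous_map (mtop M) (mtop M') h \<and>
     (\<forall>(U, \<phi>)\<in>mcharts M. \<forall>(V, \<psi>)\<in>mcharts M'. \<forall>j<mdim M'.
        smooth_on (mdim M) (\<phi> ` (U \<inter> h -` V)) (\<lambda>x. \<psi> (h (inv_into U \<phi> x)) j))"

definition diffeomorphic :: "'a manifold \<Rightarrow> 'b manifold \<Rightarrow> bool" where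
  "diffeomorphic M M' \<longleftrightarrow>
     (\<exists>h h'. smooth_map M M' h \<and> smooth_map M' M h' \<and>
             (\<forall>p\<in>mcarrier M. h' (h p) = p) \<and> (\<forall>q\<in>mcarrier M'. h (h' q) = q))"

definition smooth_fun_on :: "'a manifold \<Rightarrow> 'a set \<Rightarrow> ('a \<Rightarrow> real) \<Rightarrow> bool" where
  "smooth_fun_on M W f \<longleftrightarrow>
     openin (mtop M) W \<and>
     (\<forall>(U, \<phi>)\<in>mcharts M. smooth_on (mdim M) (\<phi> ` (U \<inter> W)) (\<lambda>x. f (inv_into U \<phi> x)))"

abbreviation smooth_fun :: "'a manifold \<Rightarrow> ('a \<Rightarrow> real) \<Rightarrow> bool" where
  "smooth_fun M f \<equiv> smooth_fun_on M (mcarrier M) f"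

definition smooth_at :: "'a manifold \<Rightarrow> 'a \<Rightarrow> ('a \<Rightarrow> real) \<Rightarrow> bool" where
  "smooth_at M p f \<longleftrightarrow> (\<exists>W. p \<in> W \<and> smooth_fun_on M W f)"


subsection \<open>Tangent vectors and covectors\<close>

text \<open>
  Real-valued functions on an arbitrary type form a real vector space under pointwise operations;
  tangent and cotangent spaces are subspaces of such function spaces.
\<close>

abbreviation fun_scale :: "real \<Rightarrow> ('b \<Rightarrow> real) \<Rightarrow> 'b \<Rightarrow> real" where
  "fun_scale c v \<equiv> (\<lambda>x. c * v x)"

interpretation fun_vs: vector_space "fun_scale :: real \<Rightarrow> ('b \<Rightarrow> real) \<Rightarrow> 'b \<Rightarrow> real"
  by unfold_locales (auto simp: algebra_simps)

type_synonym 'a tangent = "('a \<Rightarrow> real) \<Rightarrow> real"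
type_synonym 'a cotangent = "'a tangent \<Rightarrow> real"

text \<open>
  Tangent vectors at \<open>p\<close> are the derivations of the algebra of germs at \<open>p\<close> of smooth functions.
  The last clause fixes the irrelevant values on functions that are not smooth near \<open>p\<close>; likewise,
  covectors are given the value \<open>0\<close> outside the tangent space, so that equality of functions is
  equality of (co)vectors.
\<close>

definition tangent_space :: "'a manifold \<Rightarrow> 'a \<Rightarrow> 'a tangent set" where
  "tangent_space M p = {v.
     (\<forall>f g. smooth_at M p f \<longrightarrow> smooth_at M p g \<longrightarrow> v (\<lambda>x. f x + g x) = v f + v g) \<and>
     (\<forall>c f. smooth_at M p f \<longrightarrow> v (\<lambda>x. c * f x) = c * v f) \<and>
     (\<forall>f g. smooth_at M p f \<longrightarrow> smooth_at M p g \<longrightarrow>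
        v (\<lambda>x. f x * g x) = f p * v g + g p * v f) \<and>
     (\<forall>f g W. smooth_at M p f \<longrightarrow> openin (mtop M) W \<longrightarrow> p \<in> W \<longrightarrow> (\<forall>x\<in>W. f x = g x) \<longrightarrow>
        v f = v g) \<and>
     (\<forall>f. \<not> smooth_at M p f \<longrightarrow> v f = 0)}"

definition cotangent_space :: "'a manifold \<Rightarrow> 'a \<Rightarrow> 'a cotangent set" where
  "cotangent_space M p = {\<omega>.
     (\<forall>v\<in>tangent_space M p. \<forall>w\<in>tangent_space M p. \<omega> (v + w) = \<omega> v + \<omega> w) \<and>
     (\<forall>c. \<forall>v\<in>tangent_space M p. \<omega> (fun_scale c v) = c * \<omega> v) \<and>
     (\<forall>v. v \<notin> tangent_space M p \<longrightarrow> \<omega> v = 0)}"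

definition differential :: "'a manifold \<Rightarrow> ('a \<Rightarrow> real) \<Rightarrow> 'a \<Rightarrow> 'a cotangent" where
  "differential M f p = (\<lambda>v. if v \<in> tangent_space M p then v f else 0)"

definition pushforward :: "'a manifold \<Rightarrow> 'b manifold \<Rightarrow> ('a \<Rightarrow> 'b) \<Rightarrow> 'a \<Rightarrow> 'a tangent \<Rightarrow> 'b tangent"
  where
  "pushforward M M' h p v = (\<lambda>f. if smooth_at M' (h p) f then v (\<lambda>x. f (h x)) else 0)"

text \<open>The wedge product \<open>\<omega> 0 \<and> \<dots> \<and> \<omega> (s - 1)\<close> of covectors, as a multilinear form in the \<open>s\<close>
  tangent vectors \<open>v 0, \<dots>, v (s - 1)\<close>.\<close>

definition wedge :: "nat \<Rightarrow> (nat \<Rightarrow> 'a cotangent) \<Rightarrow> (nat \<Rightarrow> 'a tangent) \<Rightarrow> real" where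
  "wedge s \<omega> = (\<lambda>v. \<Sum>\<pi> | \<pi> permutes {..<s}. of_int (sign \<pi>) * (\<Prod>i<s. \<omega> i (v (\<pi> i))))"


subsection \<open>Poisson manifolds\<close>

text \<open>
  A bivector field assigns to each point \<open>p\<close> an alternating bilinear form on the cotangent space
  (extended by \<open>0\<close>), depending smoothly on \<open>p\<close>.  Applied to local coordinate functions, the
  smoothness clause says that the components of the bivector field in charts are smooth.
\<close>

type_synonym 'a bivector_field = "'a \<Rightarrow> 'a cotangent \<Rightarrow> 'a cotangent \<Rightarrow> real"

definition bivector_field :: "'a manifold \<Rightarrow> 'a bivector_field \<Rightarrow> bool" where
  "bivector_field M P \<longleftrightarrow>
     (\<forall>p\<in>mcarrier M.
        (\<forall>\<omega>\<in>cotangent_space M p. \<forall>\<eta>\<in>cotangent_space M p. \<forall>\<theta>\<in>cotangent_space M p.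
           P p (\<omega> + \<eta>) \<theta> = P p \<omega> \<theta> + P p \<eta> \<theta> \<and> P p \<theta> (\<omega> + \<eta>) = P p \<theta> \<omega> + P p \<theta> \<eta>) \<and>
        (\<forall>c. \<forall>\<omega>\<in>cotangent_space M p. \<forall>\<eta>\<in>cotangent_space M p.
           P p (fun_scale c \<omega>) \<eta> = c * P p \<omega> \<eta> \<and> P p \<omega> (fun_scale c \<eta>) = c * P p \<omega> \<eta>) \<and>
        (\<forall>\<omega>\<in>cotangent_space M p. P p \<omega> \<omega> = 0) \<and>
        (\<forall>\<omega> \<eta>. \<omega> \<notin> cotangent_space M p \<or> \<eta> \<notin> cotangent_space M p \<longrightarrow> P p \<omega> \<eta> = 0)) \<and>
     (\<forall>W f g. smooth_fun_on M W f \<longrightarrow> smooth_fun_on M W g \<longrightarrow>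
        smooth_fun_on M W (\<lambda>p. P p (differential M f p) (differential M g p)))"

definition poisson_bracket ::
  "'a manifold \<Rightarrow> 'a bivector_field \<Rightarrow> ('a \<Rightarrow> real) \<Rightarrow> ('a \<Rightarrow> real) \<Rightarrow> 'a \<Rightarrow> real" where
  "poisson_bracket M P f g = (\<lambda>p. P p (differential M f p) (differential M g p))"

definition poisson_manifold :: "'a manifold \<Rightarrow> 'a bivector_field \<Rightarrow> bool" where
  "poisson_manifold M P \<longleftrightarrow>
     smooth_manifold M \<and> bivector_field M P \<and>
     (\<forall>f g h. smooth_fun M f \<longrightarrow> smooth_fun M g \<longrightarrow> smooth_fun M h \<longrightarrow>
        (\<forall>p\<in>mcarrier M.
           poisson_bracket M P f (poisson_bracket M P g h) p +
           poisson_bracket M P g (poisson_bracket M P h f) p +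
           poisson_bracket M P h (poisson_bracket M P f g) p = 0))"

definition hamiltonian_vf ::
  "'a manifold \<Rightarrow> 'a bivector_field \<Rightarrow> ('a \<Rightarrow> real) \<Rightarrow> 'a \<Rightarrow> 'a tangent" where
  "hamiltonian_vf M P f p =
     (\<lambda>g. if smooth_at M p g then P p (differential M f p) (differential M g p) else 0)"

text \<open>The rank at \<open>p\<close> is the rank of the linear map sending a covector \<open>\<omega>\<close> to \<open>P p \<omega>\<close>.\<close>

definition rank_at :: "'a manifold \<Rightarrow> 'a bivector_field \<Rightarrow> 'a \<Rightarrow> nat" where
  "rank_at M P p = fun_vs.dim (P p ` cotangent_space M p)"

definition maximal_rank :: "'a manifold \<Rightarrow> 'a bivector_field \<Rightarrow> nat \<Rightarrow> bool" where
  "maximal_rank M P k \<longleftrightarrow>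
     (\<forall>p\<in>mcarrier M. rank_at M P p \<le> k) \<and> (\<exists>p\<in>mcarrier M. rank_at M P p = k)"


subsection \<open>Liouville integrable systems\<close>

text \<open>
  The functions of the tuple are \<open>f 0, \<dots>, f (s - 1)\<close>. The number \<open>r\<close> is determined by the maximal
  rank.
\<close>

definition functionally_independent :: "'a manifold \<Rightarrow> nat \<Rightarrow> (nat \<Rightarrow> 'a \<Rightarrow> real) \<Rightarrow> bool" where
  "functionally_independent M s f \<longleftrightarrow>
     (\<exists>U. openin (mtop M) U \<and> mtop M closure_of U = mcarrier M \<and>
        (\<forall>p\<in>U. inj_on (\<lambda>i. differential M (f i) p) {..<s} \<and>
               fun_vs.independent ((\<lambda>i. differential M (f i) p) ` {..<s})))"

definition liouville_integrable ::
  "'a manifold \<Rightarrow> 'a bivector_field \<Rightarrow> nat \<Rightarrow> (nat \<Rightarrow> 'a \<Rightarrow> real) \<Rightarrow> bool" where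
  "liouville_integrable M P s f \<longleftrightarrow>
     (\<forall>i<s. smooth_fun M (f i)) \<and>
     functionally_independent M s f \<and>
     (\<forall>i<s. \<forall>j<s. \<forall>p\<in>mcarrier M. poisson_bracket M P (f i) (f j) p = 0) \<and>
     (\<exists>r. maximal_rank M P (2 * r) \<and> r + s = mdim M)"

definition hamiltonian_distribution ::
  "'a manifold \<Rightarrow> 'a bivector_field \<Rightarrow> nat \<Rightarrow> (nat \<Rightarrow> 'a \<Rightarrow> real) \<Rightarrow> 'a \<Rightarrow> 'a tangent set" where
  "hamiltonian_distribution M P s f p =
     fun_vs.span ((\<lambda>i. hamiltonian_vf M P (f i) p) ` {..<s})"


subsection \<open>Integral manifolds\<close>

text \<open>
  An integral manifold is an injectively immersed submanifold: its points are points of \<open>M\<close>, but it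
  carries its own topology and smooth structure, and the inclusion is only required to be an
  immersion.
\<close>

definition integral_manifold :: "'a manifold \<Rightarrow> ('a \<Rightarrow> 'a tangent set) \<Rightarrow> 'a manifold \<Rightarrow> bool" where
  "integral_manifold M D N \<longleftrightarrow>
     smooth_manifold N \<and> mcarrier N \<subseteq> mcarrier M \<and> smooth_map N M (\<lambda>x. x) \<and>
     (\<forall>p\<in>mcarrier N. inj_on (pushforward N M (\<lambda>x. x) p) (tangent_space N p) \<and>
                    pushforward N M (\<lambda>x. x) p ` tangent_space N p = D p)"

definition maximal_integral_manifold ::
  "'a manifold \<Rightarrow> ('a \<Rightarrow> 'a tangent set) \<Rightarrow> 'a \<Rightarrow> 'a manifold \<Rightarrow> bool" where
  "maximal_integral_manifold M D m N \<longleftrightarrow>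
     integral_manifold M D N \<and> connected_space (mtop N) \<and> m \<in> mcarrier N \<and>
     (\<forall>N'. integral_manifold M D N' \<and> connected_space (mtop N') \<and> mcarrier N \<subseteq> mcarrier N' \<longrightarrow>
        mcarrier N' = mcarrier N)"


subsection \<open>The torus\<close>

text \<open>
  The product of \<open>r\<close> copies of the unit circle in the complex plane. The chart with parameter \<open>a\<close>
  is the product of the angle coordinates on the circle with values in
  \<open>(a i - pi, a i + pi)\<close>, for \<open>i < r\<close>.
\<close>

definition torus_chart :: "nat \<Rightarrow> (nat \<Rightarrow> real) \<Rightarrow> (nat \<Rightarrow> complex) chart" where
  "torus_chart r a =
     (\<Pi>\<^sub>E i\<in>{..<r}. sphere 0 1 - {- cis (a i)},
      \<lambda>z i. if i < r then a i + Arg (z i / cis (a i)) else 0)"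

definition torus :: "nat \<Rightarrow> (nat \<Rightarrow> complex) manifold" where
  "torus r =
     \<lparr>mdim = r,
      mtop = product_topology (\<lambda>i. top_of_set (sphere 0 1)) {..<r},
      mcharts = range (torus_chart r)\<rparr>"

end

theory Submission
  imports Defs "HOL-Homology.Invariance_of_Domain" "Jordan_Normal_Form.Determinant"
    "HOL-Computational_Algebra.Polynomial"
begin

text \<open>
  Restricted to the integral manifold \<open>N = F\<^sub>m\<close>, the Hamiltonian fields of the \<open>f i\<close> are smooth,
  commute by the Jacobi identity, and span every tangent space of \<open>N\<close>. At \<open>m\<close> the covectors
  \<open>d f i\<close> are independent and vanish on the tangent space of \<open>N\<close>, so \<open>dim N \<le> n - s = r\<close>; the
  kernel of \<open>P\<close> at \<open>m\<close> has dimension \<open>n - 2 r\<close>, so the \<open>s\<close> fields span a space of dimension at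
  least \<open>s - (n - 2 r) = r\<close>.

  Choose \<open>r\<close> of the fields that are a basis at \<open>m\<close>. In a commuting frame the coefficients of the
  remaining fields are locally constant, so the points where the chosen fields are a basis and the
  coefficients have their values at \<open>m\<close> form an open and closed set, hence all of \<open>N\<close>. The one-forms
  dual to this frame are closed; integrating them gives charts in which the frame is the standard
  one, and the transition maps between such charts are locally translations. This avoids the
  existence theory of ordinary differential equations: moving by a short vector \<open>w\<close> means adding
  \<open>w\<close> in a chart. By compactness there is a uniform size for the charts, and composing short
  moves yields a transitive action of \<open>\<real>\<^sup>r\<close> on \<open>N\<close> with discrete stabiliser. The stabiliser is a
  cocompact lattice; a basis of it identifies \<open>N\<close> with the torus.
\<close>

section \<open>Smooth functions on open sets of Euclidean space\<close>

text \<open>The Jacobi identity is given for globally smooth functions, whereas commutation is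
  needed on local coordinates; bump functions bridge this gap.

  Two analytic theorems are replaced by elementary arguments. The straightening map has an
  explicitly known inverse Jacobian, the frame matrix itself, so a Lipschitz estimate gives
  injectivity, invariance of domain gives openness, and the derivatives of the inverse are read off.
  Uniqueness of flow lines becomes a comparison of curves that are affine in charts differing by
  translations; it makes composed short moves independent of all choices of charts.

  Smoothness means existence and continuity of all iterated partial derivatives. It is proved
  throughout by exhibiting a class of continuous functions closed under partial differentiation.
  Dimension 0 is included, which is why some minima and intersections have an extra member.\<close>

abbreviation espace :: "nat \<Rightarrow> (nat \<Rightarrow> real) set" where
  "espace n \<equiv> {x. \<forall>i\<ge>n. x i = 0}"

text \<open>Open boxes in place of balls, because changing one coordinate, or following a segment to
  the centre, can be checked coordinate by coordinate. In dimension 0 every cube is the whole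
  one-point space, whatever its radius.\<close>

definition cube :: "nat \<Rightarrow> (nat \<Rightarrow> real) \<Rightarrow> real \<Rightarrow> (nat \<Rightarrow> real) set" where
  "cube n a e = {x \<in> espace n. \<forall>i<n. \<bar>x i - a i\<bar> < e}"

lemma cube_mono: "d \<le> e \<Longrightarrow> cube n a d \<subseteq> cube n a e"
  unfolding cube_def by force

lemma centre_in_cube: "a \<in> espace n \<Longrightarrow> 0 < e \<Longrightarrow> a \<in> cube n a e"
  unfolding cube_def by auto

lemma openin_cube: "openin (Euclidean_space n) (cube n a e)"
proof -
  have "openin (Euclidean_space n) {x \<in> topspace (Euclidean_space n). x i \<in> {a i - e<..<a i + e}}" for i
    by (rule openin_continuous_map_preimage[where Y = euclideanreal])
       (auto simp: Euclidean_space_def intro!: continuous_map_from_subtopology continuous_map_product_projection)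
  then have "openin (Euclidean_space n) (topspace (Euclidean_space n) \<inter>
      (\<Inter>i\<in>{..<n}. {x \<in> topspace (Euclidean_space n). x i \<in> {a i - e<..<a i + e}}))"
    by (cases "n = 0") (auto intro!: openin_Int openin_INT2 openin_INT)
  also have "topspace (Euclidean_space n) \<inter>
      (\<Inter>i\<in>{..<n}. {x \<in> topspace (Euclidean_space n). x i \<in> {a i - e<..<a i + e}}) = cube n a e"
    by (fastforce simp: cube_def topspace_Euclidean_space abs_diff_less_iff)
  finally show ?thesis .
qed

text \<open>On \<open>espace n\<close> the coordinates from \<open>n\<close> on are fixed at 0, so a
  basic open set of the product topology constrains only the \<open>n\<close> free ones, and the
  smallest of finitely many radii gives a cube inside it.\<close>

lemma openin_Euclidean_space_iff:
  "openin (Euclidean_space n) U \<longleftrightarrow> U \<subseteq> espace n \<and> (\<forall>x\<in>U. \<exists>e>0. cube n x e \<subseteq> U)"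
proof
  assume U: "openin (Euclidean_space n) U"
  then obtain T where T: "openin (powertop_real UNIV) T" "U = T \<inter> espace n"
    unfolding Euclidean_space_def openin_subtopology by auto
  show "U \<subseteq> espace n \<and> (\<forall>x\<in>U. \<exists>e>0. cube n x e \<subseteq> U)"
  proof (intro conjI ballI)
    show "U \<subseteq> espace n" using T by auto
    fix x assume x: "x \<in> U"
    then have "x \<in> T" "x \<in> espace n" using T by auto
    from product_topology_open_contains_basis[OF T(1) this(1)]
    obtain X where X: "x \<in> (\<Pi>\<^sub>E i\<in>UNIV. X i)" "\<And>i. open (X i)" "(\<Pi>\<^sub>E i\<in>UNIV. X i) \<subseteq> T"
      unfolding open_openin[symmetric] by blast
    have "\<exists>e>0. \<forall>y. \<bar>y - x i\<bar> < e \<longrightarrow> y \<in> X i" for i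
    proof -
      have "x i \<in> X i" using X(1) by (rule PiE_mem) simp
      with X(2)[of i] show ?thesis unfolding open_dist dist_real_def by blast
    qed
    then obtain e where e: "\<And>i. e i > 0" "\<And>i y. \<bar>y - x i\<bar> < e i \<Longrightarrow> y \<in> X i" by metis
    \<comment> \<open>The extra element 1 keeps the minimum meaningful when
      \<open>n = 0\<close>.\<close>
    define d where "d = Min (insert 1 (e ` {..<n}))"
    have d: "d > 0" "\<And>i. i < n \<Longrightarrow> d \<le> e i"
      unfolding d_def by (simp add: e(1), intro Min_le) auto
    have "cube n x d \<subseteq> U"
    proof
      fix y assume y: "y \<in> cube n x d"
      have "y i \<in> X i" for i
      proof (cases "i < n")
        case True
        then have "\<bar>y i - x i\<bar> < e i" using y d(2)[OF True] by (auto simp: cube_def)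
        then show ?thesis by (rule e(2))
      next
        case False
        then have "y i = x i" using y \<open>x \<in> espace n\<close> by (simp add: cube_def)
        then show ?thesis using e(2)[of "y i" i] e(1)[of i] by simp
      qed
      then show "y \<in> U" using X(3) y T(2) by (auto simp: cube_def)
    qed
    with d(1) show "\<exists>e>0. cube n x e \<subseteq> U" by blast
  qed
next
  assume *: "U \<subseteq> espace n \<and> (\<forall>x\<in>U. \<exists>e>0. cube n x e \<subseteq> U)"
  then obtain e where e: "\<And>x. x \<in> U \<Longrightarrow> e x > 0 \<and> cube n x (e x) \<subseteq> U" by metis
  have "U = (\<Union>x\<in>U. cube n x (e x))"
  proof
    show "U \<subseteq> (\<Union>x\<in>U. cube n x (e x))" using * e centre_in_cube[of _ n] by (intro subsetI UN_I) auto
    show "(\<Union>x\<in>U. cube n x (e x)) \<subseteq> U" using e by (intro UN_least) simp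
  qed
  moreover have "openin (Euclidean_space n) (\<Union>x\<in>U. cube n x (e x))"
    by (intro openin_Union) (auto intro: openin_cube)
  ultimately show "openin (Euclidean_space n) U" by simp
qed

text \<open>The type class topology on functions is the product topology, so a subspace of the model
  space is a \<open>top_of_set\<close>. This opens the calculus of \<open>continuous_on\<close> to
  the definition of \<open>Ck_on\<close>.\<close>

lemma continuous_map_Euclidean_subspace:
  assumes "U \<subseteq> espace n"
  shows "continuous_map (subtopology (Euclidean_space n) U) euclideanreal f \<longleftrightarrow> continuous_on U f"
proof -
  have "subtopology (Euclidean_space n) U = top_of_set U"
    using assms unfolding Euclidean_space_def euclidean_product_topology subtopology_subtopology
    by (simp add: inf.absorb2)
  then show ?thesis by simp
qed

lemma continuous_on_coordinate [continuous_intros]: "continuous_on U (\<lambda>x::nat \<Rightarrow> real. x i)"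
  by (rule continuous_on_subset[OF continuous_on_product_coordinates]) simp

lemma continuous_on_open_cube:
  assumes U: "openin (Euclidean_space n) U" and f: "continuous_on U (f :: _ \<Rightarrow> real)"
    and a: "a \<in> U" and e: "e > 0"
  obtains d where "d > 0" "cube n a d \<subseteq> U" "\<And>y. y \<in> cube n a d \<Longrightarrow> \<bar>f y - f a\<bar> < e"
proof -
  have "openin (subtopology (Euclidean_space n) U) {x \<in> topspace (subtopology (Euclidean_space n) U). f x \<in> ball (f a) e}"
    using f U by (intro openin_continuous_map_preimage[where Y = euclideanreal])
       (auto simp: continuous_map_Euclidean_subspace openin_Euclidean_space_iff)
  then have "openin (Euclidean_space n) {x \<in> topspace (subtopology (Euclidean_space n) U). f x \<in> ball (f a) e}"
    using U openin_trans_full by blast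
  moreover have "{x \<in> topspace (subtopology (Euclidean_space n) U). f x \<in> ball (f a) e}
     = {x \<in> U. \<bar>f x - f a\<bar> < e}"
    using openin_subset[OF U] by (auto simp: dist_real_def abs_minus_commute)
  ultimately have "openin (Euclidean_space n) {x \<in> U. \<bar>f x - f a\<bar> < e}" by simp
  moreover have "a \<in> {x \<in> U. \<bar>f x - f a\<bar> < e}" using a e by auto
  ultimately obtain d where "d > 0" "cube n a d \<subseteq> {x \<in> U. \<bar>f x - f a\<bar> < e}"
    unfolding openin_Euclidean_space_iff by blast
  then show thesis using that by blast
qed

section \<open>Partial derivatives and the coinduction principle for smoothness\<close>

lemma eventually_upd_in_open:
  assumes "openin (Euclidean_space n) U" "x \<in> U" "i < n"
  shows "\<forall>\<^sub>F t in nhds (x i). x(i := t) \<in> U"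
proof -
  obtain e where e: "e > 0" "cube n x e \<subseteq> U" using assms(1,2) unfolding openin_Euclidean_space_iff by blast
  have "x \<in> espace n" using assms unfolding openin_Euclidean_space_iff by blast
  then have "x(i := t) \<in> U" if "dist t (x i) < e" for t
    using that assms(3) e by (auto simp: cube_def dist_real_def intro!: subsetD[OF e(2)])
  then show ?thesis unfolding eventually_nhds_metric using e(1) by blast
qed

lemma has_derivative_upd_cong:
  assumes "openin (Euclidean_space n) U" "x \<in> U" "i < n" "\<And>y. y \<in> U \<Longrightarrow> f y = g y"
  shows "((\<lambda>t. f (x(i := t))) has_real_derivative D) (at (x i)) \<longleftrightarrow>
    ((\<lambda>t. g (x(i := t))) has_real_derivative D) (at (x i))"
  by (rule DERIV_cong_ev[OF refl _ refl])
     (use eventually_upd_in_open[OF assms(1-3)] in \<open>auto elim!: eventually_mono simp: assms(4)\<close>)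

lemma partial_deriv_eqI:
  "((\<lambda>t. f (x(i := t))) has_real_derivative D) (at (x i)) \<Longrightarrow> partial_deriv i f x = D"
  unfolding partial_deriv_def by (rule DERIV_imp_deriv)

lemma partial_deriv_cong:
  assumes "openin (Euclidean_space n) U" "x \<in> U" "i < n" "\<And>y. y \<in> U \<Longrightarrow> f y = g y"
  shows "partial_deriv i f x = partial_deriv i g x"
  unfolding partial_deriv_def
  by (rule deriv_cong_ev)
     (use eventually_upd_in_open[OF assms(1-3)] in \<open>auto elim!: eventually_mono simp: assms(4)\<close>)

lemma Ck_on_cong:
  assumes U: "openin (Euclidean_space n) U"
  shows "(\<And>y. y \<in> U \<Longrightarrow> f y = g y) \<Longrightarrow> Ck_on k n U f \<Longrightarrow> Ck_on k n U g"
proof (induction k arbitrary: f g)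
  case 0
  then show ?case using U continuous_map_Euclidean_subspace[of U n]
    by (simp add: openin_Euclidean_space_iff cong: continuous_on_cong)
next
  case (Suc k)
  have c: "continuous_on U f = continuous_on U g" using Suc.prems(1) by (auto cong: continuous_on_cong)
  have d: "(\<lambda>t. f (x(i := t))) differentiable at (x i) \<longleftrightarrow> (\<lambda>t. g (x(i := t))) differentiable at (x i)"
    if "x \<in> U" "i < n" for x i
    using has_derivative_upd_cong[OF U that, of f g] Suc.prems(1) unfolding real_differentiable_def by blast
  have "Ck_on k n U (partial_deriv i g)" if "i < n" for i
    using Suc.IH[of "partial_deriv i f" "partial_deriv i g"] partial_deriv_cong[OF U _ that Suc.prems(1)]
      Suc.prems(2) that by auto
  then show ?case using Suc.prems(2) U c d
    by (auto simp: continuous_map_Euclidean_subspace openin_Euclidean_space_iff)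
qed

lemma smooth_on_cong: "(\<And>y. y \<in> U \<Longrightarrow> f y = g y) \<Longrightarrow> smooth_on n U f \<Longrightarrow> smooth_on n U g"
  unfolding smooth_on_def using Ck_on_cong by blast

lemma smooth_on_open: "smooth_on n U f \<Longrightarrow> openin (Euclidean_space n) U"
  unfolding smooth_on_def by blast

lemma smooth_on_continuous: "smooth_on n U f \<Longrightarrow> continuous_on U f"
proof -
  assume f: "smooth_on n U f"
  then have "Ck_on 0 n U f" "U \<subseteq> espace n" unfolding smooth_on_def openin_Euclidean_space_iff by blast+
  then show ?thesis using continuous_map_Euclidean_subspace[of U n f] by simp
qed

lemma smooth_on_has_partial:
  assumes "smooth_on n U f" "i < n" "x \<in> U"
  shows "((\<lambda>t. f (x(i := t))) has_real_derivative partial_deriv i f x) (at (x i))"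
proof -
  have "Ck_on (Suc 0) n U f" using assms(1) unfolding smooth_on_def by blast
  then have "(\<lambda>t. f (x(i := t))) differentiable at (x i)" using assms by simp
  then show ?thesis unfolding partial_deriv_def
    using DERIV_deriv_iff_real_differentiable by blast
qed

lemma smooth_on_partial: "smooth_on n U f \<Longrightarrow> i < n \<Longrightarrow> smooth_on n U (partial_deriv i f)"
  unfolding smooth_on_def using Ck_on.simps(2) by blast

text \<open>If the members of \<open>S\<close> are continuous and have partial derivatives that
  again agree with members of \<open>S\<close>, then induction on \<open>k\<close>, for all members
  at once, makes them of class C^k. No formula for iterated derivatives is ever needed, only an
  invariant class.\<close>

lemma smooth_on_coinduct:
  assumes U: "openin (Euclidean_space n) U" and "f \<in> S"
    and c: "\<And>f. f \<in> S \<Longrightarrow> continuous_on U f"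
    and d: "\<And>f i. f \<in> S \<Longrightarrow> i < n \<Longrightarrow>
       \<exists>g\<in>S. \<forall>x\<in>U. ((\<lambda>t. f (x(i := t))) has_real_derivative g x) (at (x i))"
  shows "smooth_on n U f"
proof -
  have cm: "continuous_map (subtopology (Euclidean_space n) U) euclideanreal f" if "f \<in> S" for f
    using c[OF that] U by (simp add: continuous_map_Euclidean_subspace openin_Euclidean_space_iff)
  have "Ck_on k n U f" if "f \<in> S" for k f
    using that
  proof (induction k arbitrary: f)
    case 0
    then show ?case using cm by simp
  next
    case (Suc k)
    have "(\<forall>x\<in>U. (\<lambda>t. f (x(i := t))) differentiable at (x i)) \<and> Ck_on k n U (partial_deriv i f)" if "i < n" for i
    proof -
      obtain g where g: "g \<in> S" "\<forall>x\<in>U. ((\<lambda>t. f (x(i := t))) has_real_derivative g x) (at (x i))"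
        using d[OF Suc.prems \<open>i < n\<close>] by blast
      have "Ck_on k n U (partial_deriv i f)"
        by (rule Ck_on_cong[OF U _ Suc.IH[OF g(1)]]) (use g(2) partial_deriv_eqI in metis)
      then show ?thesis using g(2) by (auto simp: real_differentiable_def)
    qed
    then show ?case using cm[OF Suc.prems] by simp
  qed
  then show ?thesis using assms unfolding smooth_on_def by blast
qed

lemma smooth_on_subset:
  assumes "smooth_on n U f" "openin (Euclidean_space n) V" "V \<subseteq> U"
  shows "smooth_on n V f"
proof (rule smooth_on_coinduct[where S = "{f. smooth_on n U f}"])
  show "continuous_on V g" if "g \<in> {f. smooth_on n U f}" for g
    using that assms(3) smooth_on_continuous continuous_on_subset by blast
  show "\<exists>h\<in>{f. smooth_on n U f}. \<forall>x\<in>V. ((\<lambda>t. g (x(i := t))) has_real_derivative h x) (at (x i))"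
    if "g \<in> {f. smooth_on n U f}" "i < n" for g i
    using that smooth_on_partial smooth_on_has_partial assms(3)
    by (intro bexI[of _ "partial_deriv i g"]) (auto intro: smooth_on_has_partial)
qed (use assms in auto)

lemma continuous_map_locally:
  assumes "\<And>x. x \<in> topspace X \<Longrightarrow> \<exists>V. x \<in> V \<and> openin X V \<and> continuous_map (subtopology X V) Y f"
  shows "continuous_map X Y f"
  by (rule pasting_lemma[where I = "{V. openin X V \<and> continuous_map (subtopology X V) Y f}" and T = "\<lambda>V. V" and f = "\<lambda>_. f"])
     (use assms in auto)

text \<open>\<open>partial_deriv i f\<close> does not depend on the neighbourhood considered, so the
  functions that are smooth near each point of \<open>U\<close> form a class closed under partial
  differentiation.\<close>

lemma smooth_on_local:
  assumes "\<And>x. x \<in> U \<Longrightarrow> \<exists>V. x \<in> V \<and> V \<subseteq> U \<and> smooth_on n V f"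
  shows "smooth_on n U f"
proof -
  have U: "openin (Euclidean_space n) U"
    using assms smooth_on_open by (subst openin_subopen) metis
  have Us: "U \<subseteq> espace n" using U openin_Euclidean_space_iff by blast
  let ?S = "{f. \<forall>x\<in>U. \<exists>V. x \<in> V \<and> V \<subseteq> U \<and> smooth_on n V f}"
  show ?thesis
  proof (rule smooth_on_coinduct[OF U, where S = ?S])
    show "continuous_on U g" if g: "g \<in> ?S" for g
    proof -
      have "continuous_map (subtopology (Euclidean_space n) U) euclideanreal g"
      proof (rule continuous_map_locally)
        fix x assume "x \<in> topspace (subtopology (Euclidean_space n) U)"
        then obtain V where V: "x \<in> V" "V \<subseteq> U" "smooth_on n V g" using g by auto
        have "V \<subseteq> espace n" using V(2) Us by blast
        then have "continuous_map (subtopology (Euclidean_space n) V) euclideanreal g"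
          using smooth_on_continuous[OF V(3)] continuous_map_Euclidean_subspace by blast
        moreover have "openin (subtopology (Euclidean_space n) U) V"
          using V smooth_on_open[OF V(3)] by (simp add: openin_open_subtopology U)
        ultimately show "\<exists>V. x \<in> V \<and> openin (subtopology (Euclidean_space n) U) V \<and>
            continuous_map (subtopology (subtopology (Euclidean_space n) U) V) euclideanreal g"
          using V by (auto simp: subtopology_subtopology inf.absorb2)
      qed
      then show ?thesis using continuous_map_Euclidean_subspace[OF Us] by blast
    qed
    show "\<exists>h\<in>?S. \<forall>x\<in>U. ((\<lambda>t. g (x(i := t))) has_real_derivative h x) (at (x i))"
      if g: "g \<in> ?S" and i: "i < n" for g i
    proof (intro bexI[of _ "partial_deriv i g"] ballI)
      fix x assume "x \<in> U"
      then obtain V where "x \<in> V" "smooth_on n V g" using g by auto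
      then show "((\<lambda>t. g (x(i := t))) has_real_derivative partial_deriv i g x) (at (x i))"
        using smooth_on_has_partial i by blast
    qed (use g i smooth_on_partial in blast)
  qed (use assms in auto)
qed

text \<open>The affine form makes the class closed under partial derivatives, which are constants
  with coefficient \<open>c = 0\<close>. Constants and coordinate functions are then covered by a
  single coinduction.\<close>

lemma smooth_on_const_coordinate: "openin (Euclidean_space n) U \<Longrightarrow> smooth_on n U (\<lambda>x. c * x j + d)"
proof (rule smooth_on_coinduct[where S = "{f. \<exists>c d. f = (\<lambda>x. c * x j + d)}"])
  fix f :: "(nat \<Rightarrow> real) \<Rightarrow> real" and i assume "f \<in> {f. \<exists>c d. f = (\<lambda>x. c * x j + d)}"
  then obtain c d where f: "f = (\<lambda>x. c * x j + d)" by auto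
  show "\<exists>g\<in>{f. \<exists>c d. f = (\<lambda>x. c * x j + d)}.
      \<forall>x\<in>U. ((\<lambda>t. f (x(i := t))) has_real_derivative g x) (at (x i))"
  proof (rule bexI)
    show "\<forall>x\<in>U. ((\<lambda>t. f (x(i := t))) has_real_derivative 0 * x j + (if i = j then c else 0)) (at (x i))"
      by (auto simp: f fun_upd_def intro!: derivative_eq_intros)
  qed blast
qed (auto intro!: continuous_intros)

lemma smooth_on_const: "openin (Euclidean_space n) U \<Longrightarrow> smooth_on n U (\<lambda>x. c)"
  using smooth_on_const_coordinate[of n U 0 0 c] by simp

lemma smooth_on_coordinate: "openin (Euclidean_space n) U \<Longrightarrow> smooth_on n U (\<lambda>x. x j)"
  using smooth_on_const_coordinate[of n U 1 j 0] by simp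

text \<open>Moving from \<open>a\<close> to \<open>y\<close> one coordinate at a time, with the mean value theorem on each segment.\<close>

lemma cube_mean_value:
  assumes F: "smooth_on n U F" and a: "a \<in> espace n" and y: "y \<in> cube n a e" and e: "cube n a e \<subseteq> U"
  obtains \<xi> where "\<And>j d. j < n \<Longrightarrow> y \<in> cube n a d \<Longrightarrow> \<xi> j \<in> cube n a d"
    and "F y - F a = (\<Sum>j<n. partial_deriv j F (\<xi> j) * (y j - a j))"
proof -
  define z where "z k = (\<lambda>i. if i < k then y i else a i)" for k
  have ys: "y \<in> espace n" using y by (auto simp: cube_def)
  have ze: "z k \<in> espace n" for k using a ys by (auto simp: z_def)
  have step: "\<exists>p. (\<forall>d. y \<in> cube n a d \<longrightarrow> p \<in> cube n a d) \<and>
      F (z (Suc k)) - F (z k) = partial_deriv k F p * (y k - a k)" if k: "k < n" for k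
  proof -
    define h where "h t = (z k)(k := a k + t * (y k - a k))" for t
    have h_in: "h t \<in> cube n a d" if "y \<in> cube n a d" "0 \<le> t" "t \<le> 1" for t d
    proof -
      have d: "d > 0" using that k unfolding cube_def by force
      have "\<bar>t * (y k - a k)\<bar> \<le> 1 * \<bar>y k - a k\<bar>"
        unfolding abs_mult using that by (intro mult_right_mono) auto
      then show ?thesis using that d ze[of k] k ys unfolding cube_def h_def z_def
        by (auto simp: )
    qed
    have der: "((\<lambda>t. F (h t)) has_real_derivative partial_deriv k F (h t) * (y k - a k)) (at t)"
      if "0 \<le> t" "t \<le> 1" for t
    proof -
      have hU: "h t \<in> U" using h_in[OF y that] e by auto
      have "((\<lambda>s. F ((h t)(k := s))) has_real_derivative partial_deriv k F (h t)) (at (a k + t * (y k - a k)))"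
        using smooth_on_has_partial[OF F k hU] by (simp add: h_def)
      moreover have "((\<lambda>t. a k + t * (y k - a k)) has_real_derivative y k - a k) (at t)"
        by (auto intro!: derivative_eq_intros)
      ultimately have "((\<lambda>s. F ((h t)(k := a k + s * (y k - a k)))) has_real_derivative
          partial_deriv k F (h t) * (y k - a k)) (at t)"
        by (rule DERIV_chain2[where f = "\<lambda>s. F ((h t)(k := s))" and g = "\<lambda>t. a k + t * (y k - a k)"])
      then show ?thesis by (simp add: h_def)
    qed
    obtain t where t: "0 < t" "t < 1" "F (h 1) - F (h 0) = (1 - 0) * (partial_deriv k F (h t) * (y k - a k))"
      using MVT2[of 0 1 "\<lambda>t. F (h t)" "\<lambda>t. partial_deriv k F (h t) * (y k - a k)"] der by auto
    have "h 1 = z (Suc k)" "h 0 = z k" unfolding h_def z_def by (auto simp: less_Suc_eq)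
    then show ?thesis using t h_in[of _ t] by (intro exI[of _ "h t"]) auto
  qed
  then obtain \<xi> where \<xi>: "\<And>k d. k < n \<Longrightarrow> y \<in> cube n a d \<Longrightarrow> \<xi> k \<in> cube n a d"
      "\<And>k. k < n \<Longrightarrow> F (z (Suc k)) - F (z k) = partial_deriv k F (\<xi> k) * (y k - a k)"
    by metis
  have "z n = y" "z 0 = a" unfolding z_def using ys a by (auto simp: fun_eq_iff)
  then have "F y - F a = F (z n) - F (z 0)" by simp
  also have "\<dots> = (\<Sum>k<n. F (z (Suc k)) - F (z k))" by (rule sum_lessThan_telescope[symmetric])
  also have "\<dots> = (\<Sum>k<n. partial_deriv k F (\<xi> k) * (y k - a k))" using \<xi>(2) by simp
  finally show thesis using that \<xi>(1) by blast
qed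

text \<open>Total differentiability is avoided: the increment of \<open>F\<close> is expanded by
  mean values of partial derivatives. The intermediate points lie in every cube about \<gamma>(t0)
  that contains \<gamma>(t), so they converge to \<gamma>(t0), and continuity of the partial
  derivatives finishes the limit.\<close>

lemma smooth_on_chain_rule:
  assumes F: "smooth_on n U F" and x: "\<gamma> t0 \<in> U"
    and \<gamma>: "\<And>j. j < n \<Longrightarrow> ((\<lambda>t. \<gamma> t j) has_real_derivative v j) (at t0)"
    and sp: "\<forall>\<^sub>F t in at t0. \<gamma> t \<in> espace n"
  shows "((\<lambda>t. F (\<gamma> t)) has_real_derivative (\<Sum>j<n. partial_deriv j F (\<gamma> t0) * v j)) (at t0)"
proof -
  note U = smooth_on_open[OF F]
  have as: "\<gamma> t0 \<in> espace n" using U x openin_Euclidean_space_iff by blast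
  obtain e where e: "e > 0" "cube n (\<gamma> t0) e \<subseteq> U" using U x openin_Euclidean_space_iff by metis
  have ev: "\<forall>\<^sub>F t in at t0. \<gamma> t \<in> cube n (\<gamma> t0) d" if "d > 0" for d
  proof -
    have "\<forall>\<^sub>F t in at t0. \<forall>j\<in>{..<n}. \<bar>\<gamma> t j - \<gamma> t0 j\<bar> < d"
    proof (rule eventually_ball_finite)
      show "\<forall>j\<in>{..<n}. \<forall>\<^sub>F t in at t0. \<bar>\<gamma> t j - \<gamma> t0 j\<bar> < d"
        using \<gamma>[THEN DERIV_isCont] \<open>d > 0\<close> unfolding isCont_def tendsto_iff dist_real_def by auto
    qed auto
    with sp show ?thesis by eventually_elim (auto simp: cube_def)
  qed
  define Q where "Q t \<xi> \<longleftrightarrow> (\<forall>j d. j < n \<longrightarrow> \<gamma> t \<in> cube n (\<gamma> t0) d \<longrightarrow> \<xi> j \<in> cube n (\<gamma> t0) d) \<and>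
     F (\<gamma> t) - F (\<gamma> t0) = (\<Sum>j<n. partial_deriv j F (\<xi> j) * (\<gamma> t j - \<gamma> t0 j))" for t \<xi>
  \<comment> \<open>The implication stands inside the existential, so that choice yields a function
    of all t although the expansion is available only for \<gamma>(t) in the cube.\<close>
  have "\<exists>\<xi>. \<gamma> t \<in> cube n (\<gamma> t0) e \<longrightarrow> Q t \<xi>" for t
    unfolding Q_def using cube_mean_value[OF F as _ e(2), of "\<gamma> t"] by metis
  then obtain \<xi> where "\<And>t. \<gamma> t \<in> cube n (\<gamma> t0) e \<Longrightarrow> Q t (\<xi> t)" by metis
  then have \<xi>: "\<And>t j d. \<gamma> t \<in> cube n (\<gamma> t0) e \<Longrightarrow> j < n \<Longrightarrow> \<gamma> t \<in> cube n (\<gamma> t0) d \<Longrightarrow> \<xi> t j \<in> cube n (\<gamma> t0) d"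
     "\<And>t. \<gamma> t \<in> cube n (\<gamma> t0) e \<Longrightarrow> F (\<gamma> t) - F (\<gamma> t0) = (\<Sum>j<n. partial_deriv j F (\<xi> t j) * (\<gamma> t j - \<gamma> t0 j))"
    unfolding Q_def by blast+
  have lim: "((\<lambda>t. partial_deriv j F (\<xi> t j)) \<longlongrightarrow> partial_deriv j F (\<gamma> t0)) (at t0)" if j: "j < n" for j
    unfolding tendsto_iff dist_real_def
  proof safe
    fix \<epsilon> :: real assume "\<epsilon> > 0"
    from continuous_on_open_cube[OF U smooth_on_continuous[OF smooth_on_partial[OF F j]] x this]
    obtain d where d: "d > 0" "\<And>y. y \<in> cube n (\<gamma> t0) d \<Longrightarrow> \<bar>partial_deriv j F y - partial_deriv j F (\<gamma> t0)\<bar> < \<epsilon>"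
      by metis
    show "\<forall>\<^sub>F t in at t0. \<bar>partial_deriv j F (\<xi> t j) - partial_deriv j F (\<gamma> t0)\<bar> < \<epsilon>"
      using ev[OF d(1)] ev[OF e(1)] by eventually_elim (use \<xi>(1) d(2) j in blast)
  qed
  have "((\<lambda>t. \<Sum>j<n. partial_deriv j F (\<xi> t j) * ((\<gamma> t j - \<gamma> t0 j) / (t - t0))) \<longlongrightarrow>
     (\<Sum>j<n. partial_deriv j F (\<gamma> t0) * v j)) (at t0)"
    by (intro tendsto_sum tendsto_mult lim) (use \<gamma> in \<open>auto simp: has_field_derivative_iff\<close>)
  moreover have "\<forall>\<^sub>F t in at t0. (\<Sum>j<n. partial_deriv j F (\<xi> t j) * ((\<gamma> t j - \<gamma> t0 j) / (t - t0))) =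
      (F (\<gamma> t) - F (\<gamma> t0)) / (t - t0)"
    using ev[OF e(1)] by eventually_elim (simp add: \<xi>(2) sum_divide_distrib)
  ultimately show ?thesis unfolding has_field_derivative_iff by (rule Lim_transform_eventually)
qed

text \<open>This class is closed under partial differentiation, so coinduction shows at once that all its
  members are smooth.\<close>

inductive smooth_closure :: "nat \<Rightarrow> (nat \<Rightarrow> real) set \<Rightarrow> ((nat \<Rightarrow> real) \<Rightarrow> real) \<Rightarrow> bool"
  for n U where
  base: "smooth_on n U f \<Longrightarrow> smooth_closure n U f"
| add: "smooth_closure n U f \<Longrightarrow> smooth_closure n U g \<Longrightarrow> smooth_closure n U (\<lambda>x. f x + g x)"
| mult: "smooth_closure n U f \<Longrightarrow> smooth_closure n U g \<Longrightarrow> smooth_closure n U (\<lambda>x. f x * g x)"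
| inverse: "smooth_closure n U f \<Longrightarrow> (\<And>x. x \<in> U \<Longrightarrow> f x \<noteq> 0) \<Longrightarrow> smooth_closure n U (\<lambda>x. inverse (f x))"
| unary: "smooth_closure n U f \<Longrightarrow> (\<And>k y. (u k has_real_derivative u (Suc k) y) (at y)) \<Longrightarrow>
    smooth_closure n U (\<lambda>x. u (k::nat) (f x))"
| comp: "smooth_on m V F \<Longrightarrow> (\<And>j. j < m \<Longrightarrow> smooth_closure n U (\<lambda>x. g x j)) \<Longrightarrow>
    (\<And>x. x \<in> U \<Longrightarrow> g x \<in> V) \<Longrightarrow> smooth_closure n U (\<lambda>x. F (g x))"

lemma smooth_closure_sum:
  assumes "openin (Euclidean_space n) U" "finite I" "\<And>i. i \<in> I \<Longrightarrow> smooth_closure n U (f i)"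
  shows "smooth_closure n U (\<lambda>x. \<Sum>i\<in>I. f i x)"
  using assms(2,3)
proof (induction I rule: finite_induct)
  case (insert i I)
  have "smooth_closure n U (\<lambda>x. f i x + (\<Sum>i\<in>I. f i x))"
    by (rule smooth_closure.add) (use insert in auto)
  then show ?case using insert.hyps by simp
qed (simp add: smooth_closure.base[OF smooth_on_const] assms(1))

text \<open>Rule induction in which each rule answers with its own differentiation rule, and the
  derivative is rebuilt by the same rules. This is why \<open>unary\<close> carries a whole sequence
  of derivatives and why \<open>comp\<close> admits every smooth outer function: its derivative
  involves the partial derivatives of \<open>F\<close>.\<close>

lemma smooth_closure_has_partial:
  assumes U: "openin (Euclidean_space n) U"
  shows "smooth_closure n U f \<Longrightarrow> continuous_on U f \<and> (\<forall>i<n. \<exists>g. smooth_closure n U g \<and>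
     (\<forall>x\<in>U. ((\<lambda>t. f (x(i := t))) has_real_derivative g x) (at (x i))))"
proof (induction rule: smooth_closure.induct)
  case (base f)
  then show ?case using smooth_on_continuous smooth_on_has_partial smooth_on_partial
    by (blast intro: smooth_closure.base)
next
  case (add f g)
  have "\<exists>h. smooth_closure n U h \<and> (\<forall>x\<in>U. ((\<lambda>t. f (x(i := t)) + g (x(i := t))) has_real_derivative h x) (at (x i)))"
    if "i < n" for i
  proof -
    from add.IH(1) that obtain f' where f': "smooth_closure n U f'"
      "\<And>x. x \<in> U \<Longrightarrow> ((\<lambda>t. f (x(i := t))) has_real_derivative f' x) (at (x i))" by blast
    from add.IH(2) that obtain g' where g': "smooth_closure n U g'"
      "\<And>x. x \<in> U \<Longrightarrow> ((\<lambda>t. g (x(i := t))) has_real_derivative g' x) (at (x i))" by blast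
    note * = f'(1) g'(1) f'(2) g'(2)
    show ?thesis
      by (intro exI[of _ "\<lambda>x. f' x + g' x"] conjI ballI smooth_closure.add[OF *(1,2)] DERIV_add *(3,4))
  qed
  moreover have "continuous_on U (\<lambda>x. f x + g x)" using add.IH by (intro continuous_on_add) blast+
  ultimately show ?case by blast
next
  case (mult f g)
  have "\<exists>h. smooth_closure n U h \<and> (\<forall>x\<in>U. ((\<lambda>t. f (x(i := t)) * g (x(i := t))) has_real_derivative h x) (at (x i)))"
    if "i < n" for i
  proof -
    from mult.IH(1) that obtain f' where f': "smooth_closure n U f'"
      "\<And>x. x \<in> U \<Longrightarrow> ((\<lambda>t. f (x(i := t))) has_real_derivative f' x) (at (x i))" by blast
    from mult.IH(2) that obtain g' where g': "smooth_closure n U g'"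
      "\<And>x. x \<in> U \<Longrightarrow> ((\<lambda>t. g (x(i := t))) has_real_derivative g' x) (at (x i))" by blast
    note * = f'(1) g'(1) f'(2) g'(2)
    show ?thesis
    proof (intro exI[of _ "\<lambda>x. f' x * g x + g' x * f x"] conjI ballI)
      show "smooth_closure n U (\<lambda>x. f' x * g x + g' x * f x)"
        by (rule smooth_closure.add[OF smooth_closure.mult[OF *(1) mult.hyps(2)] smooth_closure.mult[OF *(2) mult.hyps(1)]])
      fix x assume x: "x \<in> U"
      show "((\<lambda>t. f (x(i := t)) * g (x(i := t))) has_real_derivative f' x * g x + g' x * f x) (at (x i))"
        using DERIV_mult[OF *(3)[OF x] *(4)[OF x]] by simp
    qed
  qed
  moreover have "continuous_on U (\<lambda>x. f x * g x)" using mult.IH by (intro continuous_on_mult) blast+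
  ultimately show ?case by blast
next
  case (inverse f)
  have "\<exists>h. smooth_closure n U h \<and> (\<forall>x\<in>U. ((\<lambda>t. inverse (f (x(i := t)))) has_real_derivative h x) (at (x i)))"
    if "i < n" for i
  proof -
    from inverse.IH that obtain f' where *: "smooth_closure n U f'"
      "\<And>x. x \<in> U \<Longrightarrow> ((\<lambda>t. f (x(i := t))) has_real_derivative f' x) (at (x i))" by blast
    show ?thesis
    proof (intro exI[of _ "\<lambda>x. (-1) * (inverse (f x) * f' x * inverse (f x))"] conjI ballI)
      show "smooth_closure n U (\<lambda>x. (-1) * (inverse (f x) * f' x * inverse (f x)))"
        by (rule smooth_closure.mult[OF smooth_closure.base[OF smooth_on_const[OF U]]
              smooth_closure.mult[OF smooth_closure.mult[OF smooth_closure.inverse *(1)] smooth_closure.inverse]])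
           (use inverse.hyps in auto)
      fix x assume x: "x \<in> U"
      show "((\<lambda>t. inverse (f (x(i := t)))) has_real_derivative (-1) * (inverse (f x) * f' x * inverse (f x))) (at (x i))"
        using DERIV_inverse'[OF *(2)[OF x]] inverse.hyps(2)[OF x] by simp
    qed
  qed
  moreover have "continuous_on U (\<lambda>x. inverse (f x))"
    using inverse.IH inverse.hyps(2) by (intro continuous_on_inverse) blast+
  ultimately show ?case by blast
next
  case (unary f u k)
  have "\<exists>h. smooth_closure n U h \<and> (\<forall>x\<in>U. ((\<lambda>t. u k (f (x(i := t)))) has_real_derivative h x) (at (x i)))"
    if "i < n" for i
  proof -
    from unary.IH that obtain f' where *: "smooth_closure n U f'"
      "\<And>x. x \<in> U \<Longrightarrow> ((\<lambda>t. f (x(i := t))) has_real_derivative f' x) (at (x i))" by blast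
    show ?thesis
    proof (intro exI[of _ "\<lambda>x. u (Suc k) (f x) * f' x"] conjI ballI)
      show "smooth_closure n U (\<lambda>x. u (Suc k) (f x) * f' x)"
        by (rule smooth_closure.mult[OF smooth_closure.unary[where u = u and k = "Suc k" and f = f, OF unary.hyps] *(1)])
      fix x assume x: "x \<in> U"
      have "(u k has_real_derivative u (Suc k) (f (x(i := x i)))) (at (f (x(i := x i))))"
        using unary.hyps(2) by simp
      from DERIV_chain2[where f = "u k" and g = "\<lambda>t. f (x(i := t))", OF this *(2)[OF x]]
      show "((\<lambda>t. u k (f (x(i := t)))) has_real_derivative u (Suc k) (f x) * f' x) (at (x i))" by simp
    qed
  qed
  moreover have "continuous_on U (\<lambda>x. u k (f x))"
  proof (rule continuous_on_compose2[of UNIV "u k"])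
    show "continuous_on UNIV (u k)"
      using unary.hyps(2) by (intro continuous_at_imp_continuous_on) (auto intro: DERIV_isCont)
  qed (use unary.IH in auto)
  ultimately show ?case by blast
next
  case (comp m V F g)
  note V = smooth_on_open[OF comp.hyps(1)]
  \<comment> \<open>The domain of \<open>F\<close> lies in the model space of dimension
    \<open>m\<close>, so the components of \<open>g\<close> from \<open>m\<close> on vanish and need
    no smoothness of their own.\<close>
  have gs: "g x j = 0" if "x \<in> U" "j \<ge> m" for x j
    using comp.hyps(3)[OF that(1)] V that(2) unfolding openin_Euclidean_space_iff by blast
  have "\<exists>h. smooth_closure n U h \<and> (\<forall>x\<in>U. ((\<lambda>t. F (g (x(i := t)))) has_real_derivative h x) (at (x i)))"
    if i: "i < n" for i
  proof -
    have "\<forall>j. \<exists>g'. j < m \<longrightarrow> smooth_closure n U g' \<and>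
      (\<forall>x\<in>U. ((\<lambda>t. g (x(i := t)) j) has_real_derivative g' x) (at (x i)))"
      using comp.IH i by blast
    from choice[OF this] obtain g' where g': "\<forall>j. j < m \<longrightarrow> smooth_closure n U (g' j) \<and>
      (\<forall>x\<in>U. ((\<lambda>t. g (x(i := t)) j) has_real_derivative g' j x) (at (x i)))" by blast
    then have *: "\<And>j. j < m \<Longrightarrow> smooth_closure n U (g' j)"
      "\<And>j x. j < m \<Longrightarrow> x \<in> U \<Longrightarrow> ((\<lambda>t. g (x(i := t)) j) has_real_derivative g' j x) (at (x i))"
      by blast+
    show ?thesis
    proof (intro exI[of _ "\<lambda>x. \<Sum>j<m. partial_deriv j F (g x) * g' j x"] conjI ballI)
      show "smooth_closure n U (\<lambda>x. \<Sum>j<m. partial_deriv j F (g x) * g' j x)"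
      proof (rule smooth_closure_sum[OF U finite_lessThan])
        fix j assume "j \<in> {..<m}"
        then have j: "j < m" by simp
        show "smooth_closure n U (\<lambda>x. partial_deriv j F (g x) * g' j x)"
          by (rule smooth_closure.mult[OF smooth_closure.comp[where g = g, OF smooth_on_partial[OF comp.hyps(1) j]
                  comp.hyps(2,3)] *(1)[OF j]])
      qed
      fix x assume x: "x \<in> U"
      have "\<forall>\<^sub>F t in at (x i). x(i := t) \<in> U"
        using eventually_upd_in_open[OF U x i] unfolding eventually_at_filter by (rule eventually_mono) simp
      then have "\<forall>\<^sub>F t in at (x i). g (x(i := t)) \<in> espace m"
        by eventually_elim (use gs in auto)
      then show "((\<lambda>t. F (g (x(i := t)))) has_real_derivative (\<Sum>j<m. partial_deriv j F (g x) * g' j x)) (at (x i))"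
        using smooth_on_chain_rule[OF comp.hyps(1), of "\<lambda>t. g (x(i := t))" "x i" "\<lambda>j. g' j x"] *(2) x
          comp.hyps(3) by simp
    qed
  qed
  moreover have "continuous_on U (\<lambda>x. F (g x))"
  proof (rule continuous_on_compose2[OF smooth_on_continuous[OF comp.hyps(1)]])
    have "continuous_on U (\<lambda>x. g x j)" for j
    proof (cases "j < m")
      case False
      then have "continuous_on U (\<lambda>x. g x j) = continuous_on U (\<lambda>x. 0 :: real)"
        using gs by (intro continuous_on_cong) auto
      then show ?thesis by simp
    qed (use comp.IH in blast)
    then show "continuous_on U g" by (rule continuous_on_coordinatewise_then_product)
  qed (use comp.hyps in auto)
  ultimately show ?case by blast
qed

lemma smooth_closure_smooth:
  assumes "openin (Euclidean_space n) U" "smooth_closure n U f"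
  shows "smooth_on n U f"
  by (rule smooth_on_coinduct[where S = "{f. smooth_closure n U f}"])
     (use assms smooth_closure_has_partial[OF assms(1)] in auto)

lemma
  assumes "smooth_on n U f" "smooth_on n U g"
  shows smooth_on_add: "smooth_on n U (\<lambda>x. f x + g x)"
    and smooth_on_mult: "smooth_on n U (\<lambda>x. f x * g x)"
  by (rule smooth_closure_smooth[OF smooth_on_open[OF assms(1)] smooth_closure.add[OF assms[THEN smooth_closure.base]]])
     (rule smooth_closure_smooth[OF smooth_on_open[OF assms(1)] smooth_closure.mult[OF assms[THEN smooth_closure.base]]])

lemma smooth_on_inverse:
  "smooth_on n U f \<Longrightarrow> (\<And>x. x \<in> U \<Longrightarrow> f x \<noteq> 0) \<Longrightarrow> smooth_on n U (\<lambda>x. inverse (f x))"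
  by (rule smooth_closure_smooth[OF smooth_on_open smooth_closure.inverse[OF smooth_closure.base]])

lemma smooth_on_unary:
  "smooth_on n U f \<Longrightarrow> (\<And>k y. (u k has_real_derivative u (Suc k) y) (at y)) \<Longrightarrow> smooth_on n U (\<lambda>x. u (k::nat) (f x))"
  by (rule smooth_closure_smooth[OF smooth_on_open smooth_closure.unary[OF smooth_closure.base]])

lemma smooth_on_comp:
  assumes "openin (Euclidean_space n) U" "smooth_on m V F" "\<And>j. j < m \<Longrightarrow> smooth_on n U (\<lambda>x. g x j)"
    "\<And>x. x \<in> U \<Longrightarrow> g x \<in> V"
  shows "smooth_on n U (\<lambda>x. F (g x))"
  by (rule smooth_closure_smooth[OF assms(1) smooth_closure.comp[OF assms(2) smooth_closure.base[OF assms(3)] assms(4)]])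

lemma smooth_on_sum:
  assumes "openin (Euclidean_space n) U" "\<And>i. i \<in> I \<Longrightarrow> smooth_on n U (f i)"
  shows "smooth_on n U (\<lambda>x. \<Sum>i\<in>I. f i x)"
  using assms(2)
proof (induction I rule: infinite_finite_induct)
  case (insert i I)
  have "smooth_on n U (\<lambda>x. f i x + (\<Sum>i\<in>I. f i x))"
    by (rule smooth_on_add) (use insert in auto)
  then show ?case using insert.hyps by simp
qed (simp_all add: smooth_on_const assms(1))

lemma smooth_on_prod:
  assumes "openin (Euclidean_space n) U" "\<And>i. i \<in> I \<Longrightarrow> smooth_on n U (f i)"
  shows "smooth_on n U (\<lambda>x. \<Prod>i\<in>I. f i x)"
  using assms(2)
proof (induction I rule: infinite_finite_induct)
  case (insert i I)
  have "smooth_on n U (\<lambda>x. f i x * (\<Prod>i\<in>I. f i x))"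
    by (rule smooth_on_mult) (use insert in auto)
  then show ?case using insert.hyps by simp
qed (simp_all add: smooth_on_const assms(1))

lemma smooth_on_cmult: "smooth_on n U f \<Longrightarrow> smooth_on n U (\<lambda>x. c * f x)"
  by (intro smooth_on_mult smooth_on_const smooth_on_open)

lemma smooth_on_diff: "smooth_on n U f \<Longrightarrow> smooth_on n U g \<Longrightarrow> smooth_on n U (\<lambda>x. f x - g x)"
  using smooth_on_add[of n U f "\<lambda>x. (-1) * g x"] smooth_on_cmult[of n U g "-1"] by simp

text \<open>The smoothness assumption concerns only the components below \<open>m\<close>; the
  remaining ones are forced to be 0 by the target.\<close>

lemma smooth_on_continuous_map:
  assumes "openin (Euclidean_space n) U" "\<And>j. j < m \<Longrightarrow> smooth_on n U (\<lambda>x. g x j)"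
    "\<And>x. x \<in> U \<Longrightarrow> g x \<in> espace m"
  shows "continuous_map (subtopology (Euclidean_space n) U) (Euclidean_space m) g"
proof -
  have "continuous_map (subtopology (Euclidean_space n) U) (Euclidean_space m) (\<lambda>x j. if j < m then g x j else 0)"
    unfolding continuous_map_componentwise_Euclidean_space
    using assms(1,2) continuous_map_Euclidean_subspace[of U n] smooth_on_continuous
    unfolding openin_Euclidean_space_iff by blast
  then show ?thesis
  proof (rule continuous_map_eq)
    fix x assume "x \<in> topspace (subtopology (Euclidean_space n) U)"
    then have "g x \<in> espace m" using assms(3) by simp
    then show "(\<lambda>j. if j < m then g x j else 0) = g x" by (simp add: fun_eq_iff)
  qed
qed

subsection \<open>Integrals along segments\<close>

definition seg :: "(nat \<Rightarrow> real) \<Rightarrow> real \<Rightarrow> (nat \<Rightarrow> real) \<Rightarrow> nat \<Rightarrow> real" where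
  "seg a t x = (\<lambda>i. a i + t * (x i - a i))"

lemma seg_in_cube:
  assumes "a \<in> espace n" "x \<in> cube n a e" "0 \<le> t" "t \<le> 1"
  shows "seg a t x \<in> cube n a e"
proof -
  have "\<bar>t * (x i - a i)\<bar> < e" if "i < n" for i
  proof -
    have "\<bar>t * (x i - a i)\<bar> \<le> 1 * \<bar>x i - a i\<bar>"
      unfolding abs_mult using assms by (intro mult_right_mono) auto
    also have "\<dots> < e" using assms(2) that by (auto simp: cube_def)
    finally show ?thesis .
  qed
  then show ?thesis using assms by (auto simp: cube_def seg_def)
qed

lemma seg_0 [simp]: "seg a 0 x = a" and seg_1 [simp]: "seg a 1 x = x"
  and seg_same [simp]: "seg a t a = a"
  by (auto simp: seg_def)

lemma seg_upd: "seg a t (x(i := s)) = (seg a t x)(i := a i + t * (s - a i))"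
  by (auto simp: seg_def)

lemma continuous_on_seg:
  assumes f: "continuous_on (cube n a e) (f :: _ \<Rightarrow> real)" and a: "a \<in> espace n"
    and x: "\<And>z. z \<in> Z \<Longrightarrow> x z \<in> cube n a e" "\<And>i. continuous_on Z (\<lambda>z. x z i)"
    and t: "continuous_on Z t" "\<And>z. z \<in> Z \<Longrightarrow> 0 \<le> t z \<and> t z \<le> 1"
  shows "continuous_on Z (\<lambda>z. f (seg a (t z) (x z)))"
proof (rule continuous_on_compose2[OF f])
  show "continuous_on Z (\<lambda>z. seg a (t z) (x z))"
    unfolding seg_def
    by (rule continuous_on_coordinatewise_then_product) (intro continuous_intros x t)
  show "(\<lambda>z. seg a (t z) (x z)) ` Z \<subseteq> cube n a e"
    using seg_in_cube[OF a x(1)] t(2) by blast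
qed

text \<open>Differentiation under the integral sign. The inner derivative of the segment contributes
  a factor \<open>t\<close>, which is why the integrals carry a power of \<open>t\<close>: with all
  powers allowed, the class is closed under partial derivatives.\<close>

lemma segment_integral_partial:
  assumes f: "smooth_on n (cube n a e) f" and a: "a \<in> espace n" and x: "x \<in> cube n a e" and i: "i < n"
  shows "((\<lambda>s. integral {0..1} (\<lambda>t. t ^ k * f (seg a t (x(i := s))))) has_real_derivative
     integral {0..1} (\<lambda>t. t ^ Suc k * partial_deriv i f (seg a t x))) (at (x i))"
proof -
  define I where "I = {a i - e<..<a i + e}"
  have xI: "x i \<in> I" using x i by (auto simp: I_def cube_def abs_diff_less_iff)
  have up: "x(i := s) \<in> cube n a e" if "s \<in> I" for s
    using x that i by (auto simp: I_def cube_def abs_diff_less_iff)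
  have cont: "continuous_on (I \<times> cbox 0 1) (\<lambda>(s, t). t ^ Suc k * g (seg a t (x(i := s))))"
    if "continuous_on (cube n a e) g" for g :: "_ \<Rightarrow> real" and k
  proof -
    have "continuous_on (I \<times> {0..1}) (\<lambda>z. g (seg a (snd z) (x(i := fst z))))"
    proof (rule continuous_on_seg[OF that a])
      show "continuous_on (I \<times> {0..1}) (\<lambda>z. (x(i := fst z)) j)" for j
        by (cases "j = i") (auto intro!: continuous_intros)
    qed (use up in \<open>auto intro!: continuous_intros\<close>)
    then show ?thesis by (auto simp: case_prod_beta cbox_interval intro!: continuous_intros)
  qed
  have "((\<lambda>s. integral (cbox 0 1) (\<lambda>t. t ^ k * f (seg a t (x(i := s))))) has_real_derivative
     integral (cbox 0 1) (\<lambda>t. t ^ Suc k * partial_deriv i f (seg a t (x(i := x i))))) (at (x i) within I)"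
  proof (rule leibniz_rule_field_derivative[where fx = "\<lambda>s t. t ^ Suc k * partial_deriv i f (seg a t (x(i := s)))"])
    fix s t :: real assume s: "s \<in> I" and t: "t \<in> cbox 0 1"
    define y where "y = seg a t (x(i := s))"
    have y: "y \<in> cube n a e" unfolding y_def by (rule seg_in_cube[OF a up[OF s]]) (use t in auto)
    have yi: "y i = a i + t * (s - a i)" by (simp add: y_def seg_def)
    have "((\<lambda>u. f (y(i := u))) has_real_derivative partial_deriv i f y) (at (a i + t * (s - a i)))"
      using smooth_on_has_partial[OF f i y] yi by simp
    moreover have "((\<lambda>s. a i + t * (s - a i)) has_real_derivative t) (at s)"
      by (auto intro!: derivative_eq_intros)
    ultimately have "((\<lambda>s. f (y(i := a i + t * (s - a i)))) has_real_derivative partial_deriv i f y * t) (at s)"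
      by (rule DERIV_chain2[where f = "\<lambda>u. f (y(i := u))" and g = "\<lambda>s. a i + t * (s - a i)"])
    moreover have "y(i := a i + t * (u - a i)) = seg a t (x(i := u))" for u
      by (simp add: y_def seg_upd)
    ultimately have "((\<lambda>s. f (seg a t (x(i := s)))) has_real_derivative partial_deriv i f y * t) (at s)" by simp
    from DERIV_cmult[OF this, of "t ^ k"]
    show "((\<lambda>s. t ^ k * f (seg a t (x(i := s)))) has_real_derivative
        t ^ Suc k * partial_deriv i f (seg a t (x(i := s)))) (at s within I)"
      by (auto simp: y_def algebra_simps intro: has_field_derivative_at_within)
  next
    fix s assume s: "s \<in> I"
    have "continuous_on {0..1} (\<lambda>t. t ^ k * f (seg a t (x(i := s))))"
      by (intro continuous_on_mult continuous_on_seg[OF smooth_on_continuous[OF f] a])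
         (use up[OF s] in \<open>auto intro!: continuous_intros\<close>)
    then show "(\<lambda>t. t ^ k * f (seg a t (x(i := s)))) integrable_on cbox 0 1"
      by (metis cbox_interval integrable_continuous_real)
  next
    show "continuous_on (I \<times> cbox 0 1) (\<lambda>(s, t). t ^ Suc k * partial_deriv i f (seg a t (x(i := s))))"
      by (rule cont[OF smooth_on_continuous[OF smooth_on_partial[OF f i]]])
  qed (use xI in \<open>auto simp: I_def\<close>)
  moreover have "at (x i) within I = at (x i)" using xI by (intro at_within_open) (auto simp: I_def)
  ultimately show ?thesis by (simp add: cbox_interval)
qed

lemma smooth_on_segment_integral:
  assumes "smooth_on n (cube n a e) f" and a: "a \<in> espace n"
  shows "smooth_on n (cube n a e) (\<lambda>x. integral {0..1} (\<lambda>t. t ^ k * f (seg a t x)))"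
proof (rule smooth_on_coinduct[OF openin_cube,
    where S = "{h. \<exists>f k. smooth_on n (cube n a e) f \<and> h = (\<lambda>x. integral {0..1} (\<lambda>t. t ^ k * f (seg a t x)))}"])
  fix h assume "h \<in> {h. \<exists>f k. smooth_on n (cube n a e) f \<and> h = (\<lambda>x. integral {0..1} (\<lambda>t. t ^ k * f (seg a t x)))}"
  then obtain f k where f: "smooth_on n (cube n a e) f" and h: "h = (\<lambda>x. integral {0..1} (\<lambda>t. t ^ k * f (seg a t x)))"
    by blast
  have "continuous_on (cube n a e \<times> {0..1}) (\<lambda>z. fst z i)" for i
    by (rule continuous_on_compose2[OF continuous_on_coordinate[of UNIV] continuous_on_fst[OF continuous_on_id]]) simp
  then have "continuous_on (cube n a e \<times> {0..1}) (\<lambda>z. f (seg a (snd z) (fst z)))"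
    by (intro continuous_on_seg[OF smooth_on_continuous[OF f] a]) (auto intro: continuous_on_snd)
  then have "continuous_on (cube n a e \<times> {0..1}) (\<lambda>z. (snd z) ^ k * f (seg a (snd z) (fst z)))"
    by (intro continuous_on_mult continuous_on_power continuous_on_snd continuous_on_id)
  then have "continuous_on (cube n a e \<times> cbox 0 1) (\<lambda>(x, t). t ^ k * f (seg a t x))"
    by (simp add: case_prod_beta cbox_interval)
  from integral_continuous_on_param[OF this]
  show "continuous_on (cube n a e) h" by (simp add: h cbox_interval)
  fix i assume i: "i < n"
  show "\<exists>g\<in>{h. \<exists>f k. smooth_on n (cube n a e) f \<and> h = (\<lambda>x. integral {0..1} (\<lambda>t. t ^ k * f (seg a t x)))}.
     \<forall>x\<in>cube n a e. ((\<lambda>t. h (x(i := t))) has_real_derivative g x) (at (x i))"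
    unfolding h
    by (rule bexI[of _ "\<lambda>x. integral {0..1} (\<lambda>t. t ^ Suc k * partial_deriv i f (seg a t x))"])
       (use segment_integral_partial[OF f a _ i] smooth_on_partial[OF f i] in blast)+
qed (use assms in blast)

lemma segment_derivative:
  assumes f: "smooth_on n (cube n a e) f" and a: "a \<in> espace n" and x: "x \<in> cube n a e"
    and t: "0 \<le> t" "t \<le> 1"
  shows "((\<lambda>t. f (seg a t x)) has_real_derivative (\<Sum>j<n. partial_deriv j f (seg a t x) * (x j - a j))) (at t)"
proof (rule smooth_on_chain_rule[where \<gamma> = "\<lambda>t. seg a t x", OF f seg_in_cube[OF a x t]])
  show "((\<lambda>t. seg a t x j) has_real_derivative x j - a j) (at t)" for j
    by (auto simp: seg_def intro!: derivative_eq_intros)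
  have "seg a t x \<in> espace n" for t using a x by (auto simp: seg_def cube_def)
  then show "\<forall>\<^sub>F t in at t. seg a t x \<in> espace n" by simp
qed

lemma segment_integrable:
  assumes f: "continuous_on (cube n a e) f" and a: "a \<in> espace n" and x: "x \<in> cube n a e"
  shows "(\<lambda>t. t ^ k * f (seg a t x) :: real) integrable_on {0..1}"
  by (intro integrable_continuous_real continuous_on_mult continuous_on_seg[OF f a])
     (use x in \<open>auto intro!: continuous_intros\<close>)

text \<open>The fundamental theorem of calculus along the segment from \<open>a\<close> to
  \<open>x\<close>, with \<open>g j\<close> the average of the j-th partial derivative over the
  segment. This expansion is what makes derivations of germs computable in coordinates.\<close>

lemma hadamard:
  assumes f: "smooth_on n (cube n a e) f" and a: "a \<in> espace n"
  obtains g where "\<And>j. j < n \<Longrightarrow> smooth_on n (cube n a e) (g j)"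
    "\<And>j. j < n \<Longrightarrow> g j a = partial_deriv j f a"
    "\<And>x. x \<in> cube n a e \<Longrightarrow> f x = f a + (\<Sum>j<n. (x j - a j) * g j x)"
proof
  let ?g = "\<lambda>j x. integral {0..1} (\<lambda>t. t ^ 0 * partial_deriv j f (seg a t x))"
  show "smooth_on n (cube n a e) (?g j)" if "j < n" for j
    by (rule smooth_on_segment_integral[OF smooth_on_partial[OF f that] a])
  show "?g j a = partial_deriv j f a" for j by simp
  fix x assume x: "x \<in> cube n a e"
  have "((\<lambda>t. \<Sum>j<n. partial_deriv j f (seg a t x) * (x j - a j)) has_integral f (seg a 1 x) - f (seg a 0 x)) {0..1}"
    by (rule fundamental_theorem_of_calculus[OF zero_le_one],
        unfold has_real_derivative_iff_has_vector_derivative[symmetric])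
       (simp add: has_field_derivative_at_within segment_derivative[OF f a x])
  then have "f x - f a = integral {0..1} (\<lambda>t. \<Sum>j<n. partial_deriv j f (seg a t x) * (x j - a j))"
    by (simp add: integral_unique)
  also have "\<dots> = (\<Sum>j<n. integral {0..1} (\<lambda>t. partial_deriv j f (seg a t x) * (x j - a j)))"
    using segment_integrable[OF smooth_on_continuous[OF smooth_on_partial[OF f]] a x, of _ 0]
    by (intro integral_sum) (auto intro!: integrable_on_mult_left)
  also have "\<dots> = (\<Sum>j<n. (x j - a j) * ?g j x)" by (intro sum.cong) (auto simp: mult.commute)
  finally show "f x = f a + (\<Sum>j<n. (x j - a j) * ?g j x)" by simp
qed

text \<open>The Poincare lemma in degree one by radial homotopy: \<open>g\<close> integrates the
  form along the segment from \<open>a\<close>. Closedness exchanges the index \<open>l\<close> of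
  the outer derivative with the index \<open>j\<close> of the direction, after which the integrand
  is the derivative of \<open>t * B l (seg a t x)\<close> with respect to \<open>t\<close>.\<close>

lemma poincare_one_forms:
  assumes B: "\<And>j. j < n \<Longrightarrow> smooth_on n (cube n a e) (B j)" and a: "a \<in> espace n"
    and closed: "\<And>i j x. i < n \<Longrightarrow> j < n \<Longrightarrow> x \<in> cube n a e \<Longrightarrow> partial_deriv i (B j) x = partial_deriv j (B i) x"
  obtains g where "smooth_on n (cube n a e) g"
    "\<And>l x. l < n \<Longrightarrow> x \<in> cube n a e \<Longrightarrow> partial_deriv l g x = B l x"
proof
  define J where "J k f x = integral {0..1} (\<lambda>t. t ^ k * f (seg a t x))" for k and f :: "_ \<Rightarrow> real" and x
  let ?g = "\<lambda>x. \<Sum>j<n. (x j - a j) * J 0 (B j) x"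
  show sm: "smooth_on n (cube n a e) ?g"
    unfolding J_def
    by (intro smooth_on_sum openin_cube smooth_on_mult smooth_on_diff smooth_on_coordinate smooth_on_const
        smooth_on_segment_integral[OF B a]) auto
  fix l x assume l: "l < n" and x: "x \<in> cube n a e"
  have "((\<lambda>s. ?g (x(l := s))) has_real_derivative
      (\<Sum>j<n. (if j = l then 1 else 0) * J 0 (B j) (x(l := x l)) + J 1 (partial_deriv l (B j)) x * ((x(l := x l)) j - a j))) (at (x l))"
  proof (intro DERIV_sum DERIV_mult)
    fix j assume "j \<in> {..<n}"
    then show "((\<lambda>s. J 0 (B j) (x(l := s))) has_real_derivative J 1 (partial_deriv l (B j)) x) (at (x l))"
      using segment_integral_partial[OF B a x l, of j 0] by (simp add: J_def)
    show "((\<lambda>s. (x(l := s)) j - a j) has_real_derivative (if j = l then 1 else 0)) (at (x l))"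
      by (auto intro!: derivative_eq_intros)
  qed
  then have "partial_deriv l ?g x = (\<Sum>j<n. (if j = l then 1 else 0) * J 0 (B j) x + J 1 (partial_deriv l (B j)) x * (x j - a j))"
    using partial_deriv_eqI by simp
  also have "\<dots> = J 0 (B l) x + (\<Sum>j<n. J 1 (partial_deriv l (B j)) x * (x j - a j))"
  proof -
    have "(\<Sum>j<n. (if j = l then 1 else 0) * J 0 (B j) x) = (\<Sum>j<n. if j = l then J 0 (B j) x else 0)"
      by (intro sum.cong) auto
    then show ?thesis using l by (simp add: sum.distrib)
  qed
  also have "(\<Sum>j<n. J 1 (partial_deriv l (B j)) x * (x j - a j)) = (\<Sum>j<n. J 1 (partial_deriv j (B l)) x * (x j - a j))"
    using closed[OF l _ seg_in_cube[OF a x]] by (auto simp: J_def intro!: sum.cong integral_cong)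
  also have "J 0 (B l) x + \<dots> = B l x"
  proof -
    note int = segment_integrable[OF smooth_on_continuous[OF B] a x, of _ 0]
      segment_integrable[OF smooth_on_continuous[OF smooth_on_partial[OF B[OF l]]] a x, of _ 1]
    have der: "((\<lambda>t. t * B l (seg a t x)) has_real_derivative
        B l (seg a t x) + (\<Sum>j<n. t * partial_deriv j (B l) (seg a t x) * (x j - a j))) (at t)" if "0 \<le> t" "t \<le> 1" for t
      using DERIV_mult[OF DERIV_ident segment_derivative[OF B[OF l] a x that]]
      by (simp add: sum_distrib_right sum_distrib_left mult.commute mult.left_commute)
    have "((\<lambda>t. B l (seg a t x) + (\<Sum>j<n. t * partial_deriv j (B l) (seg a t x) * (x j - a j))) has_integral
        1 * B l (seg a 1 x) - 0 * B l (seg a 0 x)) {0..1}"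
      by (rule fundamental_theorem_of_calculus[OF zero_le_one, of "\<lambda>t. t * B l (seg a t x)"],
          unfold has_real_derivative_iff_has_vector_derivative[symmetric])
         (simp add: has_field_derivative_at_within der)
    then have "B l x = integral {0..1} (\<lambda>t. B l (seg a t x) + (\<Sum>j<n. t * partial_deriv j (B l) (seg a t x) * (x j - a j)))"
      by (simp add: integral_unique)
    also have "\<dots> = integral {0..1} (\<lambda>t. B l (seg a t x)) +
        integral {0..1} (\<lambda>t. \<Sum>j<n. t * partial_deriv j (B l) (seg a t x) * (x j - a j))"
      using int l by (intro integral_add) (auto intro!: integrable_sum integrable_on_mult_left)
    also have "integral {0..1} (\<lambda>t. \<Sum>j<n. t * partial_deriv j (B l) (seg a t x) * (x j - a j)) =
        (\<Sum>j<n. integral {0..1} (\<lambda>t. t * partial_deriv j (B l) (seg a t x) * (x j - a j)))"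
      using int by (intro integral_sum) (auto intro!: integrable_on_mult_left)
    finally show ?thesis by (simp add: J_def)
  qed
  finally show "partial_deriv l ?g x = B l x" .
qed


subsection \<open>A smooth function vanishing exactly on a half-line\<close>

text \<open>Polynomials in \<open>1 / t\<close> are allowed in front of the exponential because this
  class, unlike the single function exp(-1/t), is closed under differentiation.\<close>

definition flat :: "real poly \<Rightarrow> real \<Rightarrow> real" where
  "flat p t = (if t > 0 then poly p (1 / t) * exp (- (1 / t)) else 0)"

lemma flat_tendsto_0: "(flat p \<longlongrightarrow> 0) (at 0)"
proof -
  have *: "((\<lambda>s. poly p s * exp (- s)) \<longlongrightarrow> 0) at_top" for p :: "real poly"
  proof -
    have "((\<lambda>s. \<Sum>i\<le>degree p. Polynomial.coeff p i * (s ^ i / exp s)) \<longlongrightarrow> (\<Sum>i\<le>degree p. Polynomial.coeff p i * 0)) at_top"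
      by (intro tendsto_intros tendsto_power_div_exp_0)
    then show ?thesis by (simp add: poly_altdef sum_distrib_right exp_minus divide_inverse mult.assoc)
  qed
  have "filterlim (\<lambda>t::real. 1 / t) at_top (at_right 0)"
    using filterlim_inverse_at_top_right by (simp add: inverse_eq_divide)
  from filterlim_compose[OF *[of p] this]
  have "((\<lambda>t. poly p (1 / t) * exp (- (1 / t))) \<longlongrightarrow> 0) (at_right 0)" .
  then have "(flat p \<longlongrightarrow> 0) (at_right 0)"
    by (rule Lim_transform_eventually) (auto simp: flat_def eventually_at_filter)
  moreover have "(flat p \<longlongrightarrow> 0) (at_left 0)"
    by (rule tendsto_eventually) (auto simp: flat_def eventually_at_filter)
  ultimately show ?thesis using filterlim_at_split by blast
qed

text \<open>With s = 1/t, the derivative of p(s) exp(-s) in t is s^2 (p(s) - p'(s)) exp(-s); the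
  polynomial in the statement is this factor. The gluing point 0 is handled by the vanishing limit
  of all functions of the class.\<close>

lemma flat_has_derivative: "(flat p has_real_derivative flat ([:0, 0, 1:] * (p - pderiv p)) t) (at t)"
proof (cases t "0 :: real" rule: linorder_cases)
  case less
  have "((\<lambda>_. 0) has_real_derivative 0) (at t)" by simp
  moreover have "\<forall>\<^sub>F s in nhds t. 0 = flat p s"
    using eventually_nhds_in_open[of "{..<0}" t] less by (auto elim!: eventually_mono simp: flat_def)
  ultimately have "(flat p has_real_derivative 0) (at t)"
    using DERIV_cong_ev[OF refl _ refl, of "\<lambda>_. 0" "flat p" t 0] by simp
  then show ?thesis using less by (simp add: flat_def)
next
  case equal
  \<comment> \<open>Dividing by \<open>h\<close> multiplies the polynomial by its variable, so the
    difference quotient at 0 is again a \<open>flat\<close> function.\<close>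
  have "((\<lambda>h. flat (pCons 0 p) h) \<longlongrightarrow> 0) (at 0)" by (rule flat_tendsto_0)
  then have "((\<lambda>h. (flat p h - flat p 0) / (h - 0)) \<longlongrightarrow> 0) (at 0)"
    by (rule Lim_transform_eventually) (auto simp: flat_def eventually_at_filter)
  then show ?thesis using equal by (simp add: has_field_derivative_iff flat_def)
next
  case greater
  have "((\<lambda>s. poly p (1 / s) * exp (- (1 / s))) has_real_derivative
      flat ([:0, 0, 1:] * (p - pderiv p)) t) (at t)"
    using greater
    by (auto intro!: derivative_eq_intros DERIV_chain2[OF poly_DERIV] simp: flat_def field_simps power2_eq_square)
  moreover have "\<forall>\<^sub>F s in nhds t. poly p (1 / s) * exp (- (1 / s)) = flat p s"
    using eventually_nhds_in_open[of "{0<..}" t] greater by (auto elim!: eventually_mono simp: flat_def)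
  ultimately show ?thesis 
    using DERIV_cong_ev[OF refl _ refl, of "\<lambda>s. poly p (1 / s) * exp (- (1 / s))" "flat p" t] by simp
qed

text \<open>The whole sequence of derivatives is exported because this is the form in which
  \<open>smooth_on_unary\<close> expects an outer function.\<close>

lemma smooth_half_line_function:
  obtains u :: "nat \<Rightarrow> real \<Rightarrow> real" where
    "\<And>k t. (u k has_real_derivative u (Suc k) t) (at t)" "\<And>t. t \<le> 0 \<Longrightarrow> u 0 t = 0" "\<And>t. t > 0 \<Longrightarrow> u 0 t \<noteq> 0"
proof
  let ?u = "\<lambda>k. flat (((\<lambda>p. [:0, 0, 1:] * (p - pderiv p)) ^^ k) 1)"
  show "(?u k has_real_derivative ?u (Suc k) t) (at t)" for k t
    by (simp only: funpow.simps comp_apply flat_has_derivative)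
  show "?u 0 t = 0" if "t \<le> 0" for t using that by (simp add: flat_def)
  show "?u 0 t \<noteq> 0" if "t > 0" for t using that by (simp add: flat_def)
qed

section \<open>Matrices indexed by natural numbers\<close>

text \<open>The Leibniz formula on plain functions: the size is a number computed from a manifold,
  and the entries will depend on a point, so smoothness follows from sums and products. The algebra
  is transferred from the matrix determinant.\<close>

definition mdet :: "nat \<Rightarrow> (nat \<Rightarrow> nat \<Rightarrow> real) \<Rightarrow> real" where
  "mdet n A = (\<Sum>\<pi> | \<pi> permutes {..<n}. of_int (sign \<pi>) * (\<Prod>i<n. A i (\<pi> i)))"

text \<open>The adjugate: the minor with row \<open>j\<close> and column \<open>i\<close> deleted,
  the two conditionals skipping these indices.\<close>

definition madj :: "nat \<Rightarrow> (nat \<Rightarrow> nat \<Rightarrow> real) \<Rightarrow> nat \<Rightarrow> nat \<Rightarrow> real" where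
  "madj n A i j = (-1) ^ (i + j) *
     mdet (n - 1) (\<lambda>k l. A (if k < j then k else Suc k) (if l < i then l else Suc l))"

lemma mdet_eq_det: "mdet n A = det (mat n n (\<lambda>(i, j). A i j))"
  unfolding mdet_def det_def'[OF mat_carrier] atLeast0LessThan
proof (rule sum.cong[OF refl])
  fix \<pi> assume "\<pi> \<in> {\<pi>. \<pi> permutes {..<n}}"
  then have "\<pi> i < n" if "i < n" for i using permutes_in_image[of \<pi> "{..<n}" i] that by simp
  then have "(\<Prod>i<n. A i (\<pi> i)) = (\<Prod>i<n. mat n n (\<lambda>(i, j). A i j) $$ (i, \<pi> i))" by (intro prod.cong) auto
  then show "of_int (sign \<pi>) * (\<Prod>i<n. A i (\<pi> i)) = of_int (sign \<pi>) * (\<Prod>i<n. mat n n (\<lambda>(i, j). A i j) $$ (i, \<pi> i))"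
    by (rule arg_cong)
qed

lemma madj_eq_adj_mat:
  assumes "i < n" "j < n"
  shows "madj n A i j = adj_mat (mat n n (\<lambda>(i, j). A i j)) $$ (i, j)"
proof -
  have "mat_delete (mat n n (\<lambda>(i, j). A i j)) j i =
      mat (n - 1) (n - 1) (\<lambda>(k, l). A (if k < j then k else Suc k) (if l < i then l else Suc l))"
    by (rule eq_matI) (auto simp: mat_delete_def)
  then show ?thesis using assms by (simp add: madj_def mdet_eq_det adj_mat_def cofactor_def add.commute)
qed

lemma madj_mult:
  assumes "i < n" "j < n"
  shows "(\<Sum>k<n. madj n A i k * A k j) = (if i = j then mdet n A else 0)"
    and "(\<Sum>k<n. A i k * madj n A k j) = (if i = j then mdet n A else 0)"
proof -
  let ?A = "mat n n (\<lambda>(i, j). A i j)"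
  have c: "?A \<in> carrier_mat n n" by simp
  note a = adj_mat[OF c]
  have "(adj_mat ?A * ?A) $$ (i, j) = (\<Sum>k<n. madj n A i k * A k j)"
    using assms a(1) by (simp add: scalar_prod_def atLeast0LessThan madj_eq_adj_mat del: a)
  then show "(\<Sum>k<n. madj n A i k * A k j) = (if i = j then mdet n A else 0)"
    using assms unfolding a(3) by (cases "i = j") (simp_all add: mdet_eq_det)
  have "(?A * adj_mat ?A) $$ (i, j) = (\<Sum>k<n. A i k * madj n A k j)"
    using assms a(1) by (simp add: scalar_prod_def atLeast0LessThan madj_eq_adj_mat del: a)
  then show "(\<Sum>k<n. A i k * madj n A k j) = (if i = j then mdet n A else 0)"
    using assms unfolding a(2) by (cases "i = j") (simp_all add: mdet_eq_det)
qed

lemma mdet_zero_kernel: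
  assumes "mdet n A = 0"
  obtains c where "\<exists>j<n. c j \<noteq> 0" "\<And>i. i < n \<Longrightarrow> (\<Sum>k<n. A i k * c k) = 0"
proof -
  let ?A = "mat n n (\<lambda>(i, j). A i j)"
  have c: "?A \<in> carrier_mat n n" by simp
  obtain v where v: "v \<in> carrier_vec n" "v \<noteq> 0\<^sub>v n" "?A *\<^sub>v v = 0\<^sub>v n"
    using assms det_0_iff_vec_prod_zero[OF c] unfolding mdet_eq_det by blast
  have "\<exists>j<n. v $ j \<noteq> 0"
  proof (rule ccontr)
    assume "\<not> (\<exists>j<n. v $ j \<noteq> 0)"
    then have "v = 0\<^sub>v n" using v(1) by (intro eq_vecI) auto
    then show False using v(2) by contradiction
  qed
  moreover have "(\<Sum>k<n. A i k * v $ k) = 0" if "i < n" for i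
  proof -
    have "(?A *\<^sub>v v) $ i = (\<Sum>k<n. A i k * v $ k)"
      using that v(1) by (simp add: scalar_prod_def atLeast0LessThan)
    then show ?thesis using that unfolding v(3) by simp
  qed
  ultimately show thesis by (rule that)
qed
text \<open>Multiplying the row relation by the adjugate from the right isolates \<open>c j\<close>
  times the determinant.\<close>

lemma mdet_rows_dependent:
  assumes "j < n" "c j \<noteq> 0" "\<And>k. k < n \<Longrightarrow> (\<Sum>i<n. c i * A i k) = 0"
  shows "mdet n A = 0"
proof -
  have "c j * mdet n A = (\<Sum>i<n. c i * (if i = j then mdet n A else 0))"
    using assms(1) by (simp add: if_distrib sum.delta cong: if_cong)
  also have "\<dots> = (\<Sum>i<n. c i * (\<Sum>k<n. A i k * madj n A k j))"
    using assms(1) by (intro sum.cong refl arg_cong2[where f = "(*)"]) (simp add: madj_mult(2))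
  also have "\<dots> = (\<Sum>k<n. (\<Sum>i<n. c i * A i k) * madj n A k j)"
    by (simp add: sum_distrib_left sum_distrib_right mult.assoc) (rule sum.swap)
  also have "\<dots> = 0" using assms(3) by simp
  finally show ?thesis using assms(2) by simp
qed

lemma smooth_on_mdet:
  assumes "openin (Euclidean_space d) U" "\<And>i j. i < n \<Longrightarrow> j < n \<Longrightarrow> smooth_on d U (\<lambda>x. A x i j)"
  shows "smooth_on d U (\<lambda>x. mdet n (A x))"
  unfolding mdet_def
proof (intro smooth_on_sum assms(1) smooth_on_cmult smooth_on_prod)
  fix \<pi> i assume "\<pi> \<in> {\<pi>. \<pi> permutes {..<n}}" "i \<in> {..<n}"
  then have "i < n" "\<pi> i < n" using permutes_in_image[of \<pi> "{..<n}" i] by auto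
  then show "smooth_on d U (\<lambda>x. A x i (\<pi> i))" by (rule assms(2))
qed

lemma smooth_on_madj:
  assumes "openin (Euclidean_space d) U" "\<And>i j. i < n \<Longrightarrow> j < n \<Longrightarrow> smooth_on d U (\<lambda>x. A x i j)"
    and "i < n" "j < n"
  shows "smooth_on d U (\<lambda>x. madj n (A x) i j)"
  unfolding madj_def by (intro smooth_on_cmult smooth_on_mdet assms(1,2)) (use assms(3,4) in auto)

text \<open>Cramer's rule in adjugate form. It displays the solution of a linear system as an
  expression smooth in the coefficients and the right-hand side.\<close>

lemma madj_solve:
  assumes "mdet n A \<noteq> 0" "\<And>k. k < n \<Longrightarrow> (\<Sum>j<n. x j * A j k) = b k" "j < n"
  shows "x j = inverse (mdet n A) * (\<Sum>k<n. b k * madj n A k j)"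
proof -
  have "(\<Sum>k<n. b k * madj n A k j) = (\<Sum>k<n. (\<Sum>i<n. x i * A i k) * madj n A k j)"
    using assms(2) by simp
  also have "\<dots> = (\<Sum>i<n. x i * (\<Sum>k<n. A i k * madj n A k j))"
    by (simp add: sum_distrib_left sum_distrib_right mult.assoc) (rule sum.swap)
  also have "\<dots> = (\<Sum>i<n. x i * (if i = j then mdet n A else 0))"
    using assms(3) by (intro sum.cong refl arg_cong2[where f = "(*)"]) (simp add: madj_mult(2))
  also have "\<dots> = x j * mdet n A"
    using assms(3) by (simp add: if_distrib sum.delta cong: if_cong)
  finally show ?thesis using assms(1) by simp
qed

section \<open>Smooth functions and tangent vectors on manifolds\<close>

locale smooth_mfd =
  fixes M :: "'a manifold"
  assumes smooth_M: "smooth_manifold M"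
begin

lemma Hausdorff_M: "Hausdorff_space (mtop M)"
  using smooth_M unfolding smooth_manifold_def by blast

lemma chart_exists:
  assumes "p \<in> mcarrier M"
  obtains U \<phi> where "(U, \<phi>) \<in> mcharts M" "p \<in> U"
proof -
  have "p \<in> (\<Union>(U, \<phi>)\<in>mcharts M. U)" using assms smooth_M unfolding smooth_manifold_def by blast
  then show thesis using that by auto
qed

lemma chart_props:
  assumes "(U, \<phi>) \<in> mcharts M"
  shows chart_open: "openin (mtop M) U" and chart_image_open: "openin (Euclidean_space (mdim M)) (\<phi> ` U)"
    and chart_homeo: "homeomorphic_map (subtopology (mtop M) U) (subtopology (Euclidean_space (mdim M)) (\<phi> ` U)) \<phi>"
  using assms smooth_M unfolding smooth_manifold_def by fast+

lemma chart_subset: "(U, \<phi>) \<in> mcharts M \<Longrightarrow> U \<subseteq> mcarrier M"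
  by (rule openin_subset[OF chart_open])

lemma chart_inj: "(U, \<phi>) \<in> mcharts M \<Longrightarrow> inj_on \<phi> U"
  using homeomorphic_imp_injective_map[OF chart_homeo] chart_subset
  by (metis Int_absorb1 inf_commute topspace_subtopology)

lemma chart_inv [simp]: "(U, \<phi>) \<in> mcharts M \<Longrightarrow> q \<in> U \<Longrightarrow> inv_into U \<phi> (\<phi> q) = q"
  by (rule inv_into_f_f[OF chart_inj])

lemma chart_espace: "(U, \<phi>) \<in> mcharts M \<Longrightarrow> q \<in> U \<Longrightarrow> \<phi> q \<in> espace (mdim M)"
  using chart_image_open unfolding openin_Euclidean_space_iff by blast

lemma chart_transition:
  assumes "(U, \<phi>) \<in> mcharts M" "(V, \<psi>) \<in> mcharts M" "j < mdim M"
  shows "smooth_on (mdim M) (\<phi> ` (U \<inter> V)) (\<lambda>x. \<psi> (inv_into U \<phi> x) j)"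
  using assms smooth_M unfolding smooth_manifold_def by fast

lemma chart_continuous:
  assumes "(U, \<phi>) \<in> mcharts M"
  shows "continuous_map (subtopology (mtop M) U) (Euclidean_space (mdim M)) \<phi>"
  using homeomorphic_imp_continuous_map[OF chart_homeo[OF assms]] continuous_map_in_subtopology by blast

lemma chart_inv_continuous:
  assumes "(U, \<phi>) \<in> mcharts M"
  shows "continuous_map (subtopology (Euclidean_space (mdim M)) (\<phi> ` U)) (mtop M) (inv_into U \<phi>)"
proof -
  obtain g where g: "homeomorphic_maps (subtopology (mtop M) U) (subtopology (Euclidean_space (mdim M)) (\<phi> ` U)) \<phi> g"
    using chart_homeo[OF assms] homeomorphic_map_maps by blast
  then have c: "continuous_map (subtopology (Euclidean_space (mdim M)) (\<phi> ` U)) (mtop M) g"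
    and gi: "\<forall>q\<in>topspace (subtopology (mtop M) U). g (\<phi> q) = q"
    unfolding homeomorphic_maps_def continuous_map_in_subtopology by blast+
  show ?thesis
  proof (rule continuous_map_eq[OF c])
    fix x assume "x \<in> topspace (subtopology (Euclidean_space (mdim M)) (\<phi> ` U))"
    then obtain q where "q \<in> U" "x = \<phi> q" by auto
    then show "g x = inv_into U \<phi> x" using gi chart_subset[OF assms] assms by auto
  qed
qed

lemma chart_open_image:
  assumes c: "(U, \<phi>) \<in> mcharts M" and W: "openin (mtop M) W" "W \<subseteq> U"
  shows "openin (Euclidean_space (mdim M)) (\<phi> ` W)"
proof -
  have "openin (subtopology (mtop M) U) W"
    using W chart_open[OF c] by (simp add: openin_open_subtopology)
  then have "openin (subtopology (Euclidean_space (mdim M)) (\<phi> ` U)) (\<phi> ` W)"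
    using homeomorphic_imp_open_map[OF chart_homeo[OF c]] unfolding open_map_def by blast
  then show ?thesis using openin_trans_full chart_image_open[OF c] by blast
qed

lemma chart_open_preimage:
  assumes c: "(U, \<phi>) \<in> mcharts M" and V: "openin (Euclidean_space (mdim M)) V"
  shows "openin (mtop M) {q \<in> U. \<phi> q \<in> V}"
proof -
  have "openin (subtopology (mtop M) U) {q \<in> topspace (subtopology (mtop M) U). \<phi> q \<in> V}"
    using chart_continuous[OF c] V by (rule openin_continuous_map_preimage)
  moreover have "topspace (subtopology (mtop M) U) = U" using chart_subset[OF c] by auto
  ultimately show ?thesis using openin_trans_full chart_open[OF c] by metis
qed

lemma chart_cube:
  assumes c: "(U, \<phi>) \<in> mcharts M" and W: "openin (mtop M) W" "p \<in> W" "p \<in> U"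
  obtains e where "e > 0" "cube (mdim M) (\<phi> p) e \<subseteq> \<phi> ` (U \<inter> W)"
proof -
  have "openin (Euclidean_space (mdim M)) (\<phi> ` (U \<inter> W))"
    by (rule chart_open_image[OF c]) (use W chart_open[OF c] in auto)
  moreover have "\<phi> p \<in> \<phi> ` (U \<inter> W)" using W by auto
  ultimately show thesis using that unfolding openin_Euclidean_space_iff by meson
qed

subsection \<open>Smooth functions\<close>

lemma smooth_fun_onD:
  "smooth_fun_on M W f \<Longrightarrow> (U, \<phi>) \<in> mcharts M \<Longrightarrow> smooth_on (mdim M) (\<phi> ` (U \<inter> W)) (\<lambda>x. f (inv_into U \<phi> x))"
  unfolding smooth_fun_on_def by blast

lemma smooth_fun_on_open: "smooth_fun_on M W f \<Longrightarrow> openin (mtop M) W"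
  unfolding smooth_fun_on_def by blast

text \<open>Since \<open>W\<close> lies in the domain of one chart, any other chart expression is
  obtained from this one by composing with a smooth transition map.\<close>

lemma smooth_fun_on_chartI:
  assumes c: "(U, \<phi>) \<in> mcharts M" and W: "openin (mtop M) W" "W \<subseteq> U"
    and f: "smooth_on (mdim M) (\<phi> ` W) (\<lambda>x. f (inv_into U \<phi> x))"
  shows "smooth_fun_on M W f"
  unfolding smooth_fun_on_def
proof (intro conjI W(1) ballI, clarify)
  fix V \<psi> assume d: "(V, \<psi>) \<in> mcharts M"
  have op: "openin (Euclidean_space (mdim M)) (\<psi> ` (V \<inter> W))"
    by (rule chart_open_image[OF d]) (use W chart_open[OF d] in auto)
  have "smooth_on (mdim M) (\<psi> ` (V \<inter> W)) (\<lambda>x. f (inv_into U \<phi> (\<phi> (inv_into V \<psi> x))))"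
  proof (rule smooth_on_comp[OF op f])
    show "smooth_on (mdim M) (\<psi> ` (V \<inter> W)) (\<lambda>x. \<phi> (inv_into V \<psi> x) j)" if "j < mdim M" for j
      by (rule smooth_on_subset[OF chart_transition[OF d c that] op]) (use W in auto)
    show "\<phi> (inv_into V \<psi> x) \<in> \<phi> ` W" if "x \<in> \<psi> ` (V \<inter> W)" for x
      using that d by auto
  qed
  then show "smooth_on (mdim M) (\<psi> ` (V \<inter> W)) (\<lambda>x. f (inv_into V \<psi> x))"
    by (rule smooth_on_cong[rotated]) (use c d W in auto)
qed

lemma smooth_fun_on_cong:
  assumes "smooth_fun_on M W f" "\<And>q. q \<in> W \<Longrightarrow> f q = g q"
  shows "smooth_fun_on M W g"
  unfolding smooth_fun_on_def
proof (intro conjI ballI, rule smooth_fun_on_open[OF assms(1)], clarify)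
  fix U \<phi> assume c: "(U, \<phi>) \<in> mcharts M"
  show "smooth_on (mdim M) (\<phi> ` (U \<inter> W)) (\<lambda>x. g (inv_into U \<phi> x))"
    by (rule smooth_on_cong[OF _ smooth_fun_onD[OF assms(1) c]]) (use c assms(2) in auto)
qed

lemma smooth_fun_on_subset:
  assumes "smooth_fun_on M W f" "openin (mtop M) W'" "W' \<subseteq> W"
  shows "smooth_fun_on M W' f"
  unfolding smooth_fun_on_def
proof (intro conjI ballI assms(2), clarify)
  fix U \<phi> assume c: "(U, \<phi>) \<in> mcharts M"
  show "smooth_on (mdim M) (\<phi> ` (U \<inter> W')) (\<lambda>x. f (inv_into U \<phi> x))"
    by (rule smooth_on_subset[OF smooth_fun_onD[OF assms(1) c]], rule chart_open_image[OF c])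
       (use assms chart_open[OF c] in auto)
qed

lemma smooth_fun_on_local:
  assumes "\<And>p. p \<in> W \<Longrightarrow> \<exists>W'. p \<in> W' \<and> W' \<subseteq> W \<and> smooth_fun_on M W' f"
  shows "smooth_fun_on M W f"
proof -
  have W: "openin (mtop M) W"
    using assms smooth_fun_on_open by (subst openin_subopen) blast
  show ?thesis
    unfolding smooth_fun_on_def
  proof (intro conjI ballI W, clarify)
    fix U \<phi> assume c: "(U, \<phi>) \<in> mcharts M"
    show "smooth_on (mdim M) (\<phi> ` (U \<inter> W)) (\<lambda>x. f (inv_into U \<phi> x))"
    proof (rule smooth_on_local)
      fix x assume "x \<in> \<phi> ` (U \<inter> W)"
      then obtain p where p: "p \<in> U" "p \<in> W" "x = \<phi> p" by auto
      then obtain W' where W': "p \<in> W'" "W' \<subseteq> W" "smooth_fun_on M W' f" using assms by blast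
      show "\<exists>V. x \<in> V \<and> V \<subseteq> \<phi> ` (U \<inter> W) \<and> smooth_on (mdim M) V (\<lambda>x. f (inv_into U \<phi> x))"
        by (rule exI[of _ "\<phi> ` (U \<inter> W')"]) (use p W' smooth_fun_onD[OF W'(3) c] in auto)
    qed
  qed
qed

lemma smooth_fun_on_add:
  assumes "smooth_fun_on M W f" "smooth_fun_on M W g" shows "smooth_fun_on M W (\<lambda>q. f q + g q)"
  using assms smooth_fun_on_open unfolding smooth_fun_on_def by (auto intro!: smooth_on_add)

lemma smooth_fun_on_mult:
  assumes "smooth_fun_on M W f" "smooth_fun_on M W g" shows "smooth_fun_on M W (\<lambda>q. f q * g q)"
  using assms smooth_fun_on_open unfolding smooth_fun_on_def by (auto intro!: smooth_on_mult)

lemma smooth_fun_on_unary: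
  assumes "smooth_fun_on M W f" "\<And>k y. (u k has_real_derivative u (Suc k) y) (at y)"
  shows "smooth_fun_on M W (\<lambda>q. u (k::nat) (f q))"
  unfolding smooth_fun_on_def
proof (intro conjI ballI smooth_fun_on_open[OF assms(1)], clarify)
  fix U \<phi> assume c: "(U, \<phi>) \<in> mcharts M"
  show "smooth_on (mdim M) (\<phi> ` (U \<inter> W)) (\<lambda>x. u k (f (inv_into U \<phi> x)))"
    by (rule smooth_on_unary[where f = "\<lambda>x. f (inv_into U \<phi> x)" and u = u, OF smooth_fun_onD[OF assms(1) c] assms(2)])
qed

lemma smooth_fun_on_const:
  assumes "openin (mtop M) W" shows "smooth_fun_on M W (\<lambda>q. c)"
  unfolding smooth_fun_on_def
proof (intro conjI ballI assms, clarify)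
  fix U \<phi> assume c: "(U, \<phi>) \<in> mcharts M"
  show "smooth_on (mdim M) (\<phi> ` (U \<inter> W)) (\<lambda>x. c)"
    by (rule smooth_on_const[OF chart_open_image[OF c]]) (use assms chart_open[OF c] in auto)
qed

lemma smooth_fun_on_cmult: "smooth_fun_on M W f \<Longrightarrow> smooth_fun_on M W (\<lambda>q. c * f q)"
  by (rule smooth_fun_on_mult[OF smooth_fun_on_const[OF smooth_fun_on_open]])

lemma smooth_fun_on_sum:
  assumes "openin (mtop M) W" "\<And>i. i \<in> I \<Longrightarrow> smooth_fun_on M W (f i)"
  shows "smooth_fun_on M W (\<lambda>q. \<Sum>i\<in>I. f i q)"
  using assms(2)
proof (induction I rule: infinite_finite_induct)
  case (insert i I)
  have "smooth_fun_on M W (\<lambda>q. f i q + (\<Sum>i\<in>I. f i q))"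
    by (rule smooth_fun_on_add) (use insert in auto)
  then show ?case using insert.hyps by simp
qed (simp_all add: smooth_fun_on_const assms(1))

lemma smooth_fun_on_chart_comp:
  assumes c: "(U, \<phi>) \<in> mcharts M" and F: "smooth_on (mdim M) V F"
  shows "smooth_fun_on M {q \<in> U. \<phi> q \<in> V} (\<lambda>q. F (\<phi> q))"
proof (rule smooth_fun_on_chartI[OF c chart_open_preimage[OF c smooth_on_open[OF F]]])
  have "openin (Euclidean_space (mdim M)) (\<phi> ` {q \<in> U. \<phi> q \<in> V})"
    by (rule chart_open_image[OF c chart_open_preimage[OF c smooth_on_open[OF F]]]) auto
  then have "smooth_on (mdim M) (\<phi> ` {q \<in> U. \<phi> q \<in> V}) F"
    by (rule smooth_on_subset[OF F]) auto
  then show "smooth_on (mdim M) (\<phi> ` {q \<in> U. \<phi> q \<in> V}) (\<lambda>x. F (\<phi> (inv_into U \<phi> x)))"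
    by (rule smooth_on_cong[rotated]) (use c in auto)
qed auto

lemma smooth_fun_on_coordinate:
  assumes c: "(U, \<phi>) \<in> mcharts M"
  shows "smooth_fun_on M U (\<lambda>q. \<phi> q j)"
proof -
  have "{q \<in> U. \<phi> q \<in> \<phi> ` U} = U" by auto
  with smooth_fun_on_chart_comp[OF c smooth_on_coordinate[OF chart_image_open[OF c]]]
  show ?thesis by simp
qed

lemma smooth_fun_on_continuous:
  assumes "smooth_fun_on M W f"
  shows "continuous_map (subtopology (mtop M) W) euclideanreal f"
proof (rule continuous_map_locally)
  fix p assume "p \<in> topspace (subtopology (mtop M) W)"
  then have p: "p \<in> W" "p \<in> mcarrier M" by auto
  then obtain U \<phi> where c: "(U, \<phi>) \<in> mcharts M" "p \<in> U" using chart_exists by blast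
  note W = smooth_fun_on_open[OF assms]
  have sm: "smooth_on (mdim M) (\<phi> ` (U \<inter> W)) (\<lambda>x. f (inv_into U \<phi> x))" by (rule smooth_fun_onD[OF assms c(1)])
  have sub: "\<phi> ` (U \<inter> W) \<subseteq> espace (mdim M)" using smooth_on_open[OF sm] unfolding openin_Euclidean_space_iff by blast
  have c1: "continuous_map (subtopology (Euclidean_space (mdim M)) (\<phi> ` (U \<inter> W))) euclideanreal (\<lambda>x. f (inv_into U \<phi> x))"
    unfolding continuous_map_Euclidean_subspace[OF sub] by (rule smooth_on_continuous[OF sm])
  have c2: "continuous_map (subtopology (mtop M) (U \<inter> W)) (subtopology (Euclidean_space (mdim M)) (\<phi> ` (U \<inter> W))) \<phi>"
    unfolding continuous_map_in_subtopology
    using continuous_map_from_subtopology_mono[OF chart_continuous[OF c(1)], of "U \<inter> W"] by auto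
  have "continuous_map (subtopology (mtop M) (U \<inter> W)) euclideanreal f"
    by (rule continuous_map_eq[OF continuous_map_compose[OF c2 c1]]) (use c(1) in auto)
  moreover have "openin (subtopology (mtop M) W) (U \<inter> W)"
    using openin_Int[OF chart_open[OF c(1)] W] by (simp add: openin_open_subtopology[OF W])
  ultimately show "\<exists>V. p \<in> V \<and> openin (subtopology (mtop M) W) V \<and>
      continuous_map (subtopology (subtopology (mtop M) W) V) euclideanreal f"
    using p c(2) by (intro exI[of _ "U \<inter> W"]) (simp add: subtopology_subtopology Int_absorb1)
qed

subsection \<open>Germs\<close>

lemma smooth_atI: "smooth_fun_on M W f \<Longrightarrow> p \<in> W \<Longrightarrow> smooth_at M p f"
  unfolding smooth_at_def by blast

lemma smooth_at_carrier: "smooth_at M p f \<Longrightarrow> p \<in> mcarrier M"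
  unfolding smooth_at_def using smooth_fun_on_open openin_subset by blast

lemma smooth_at_cong:
  assumes "smooth_at M p f" "openin (mtop M) W" "p \<in> W" "\<And>q. q \<in> W \<Longrightarrow> f q = g q"
  shows "smooth_at M p g"
proof -
  obtain V where V: "p \<in> V" "smooth_fun_on M V f" using assms(1) unfolding smooth_at_def by blast
  have "smooth_fun_on M (V \<inter> W) f"
    by (rule smooth_fun_on_subset[OF V(2)]) (use assms(2) smooth_fun_on_open[OF V(2)] in auto)
  then have "smooth_fun_on M (V \<inter> W) g" by (rule smooth_fun_on_cong) (use assms(4) in auto)
  then show ?thesis by (rule smooth_atI) (use V assms in auto)
qed

lemma smooth_at_binary:
  assumes "smooth_at M p f" "smooth_at M p g"
  obtains W where "p \<in> W" "smooth_fun_on M W f" "smooth_fun_on M W g"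
proof -
  obtain V W where V: "p \<in> V" "smooth_fun_on M V f" and W: "p \<in> W" "smooth_fun_on M W g"
    using assms unfolding smooth_at_def by blast
  have "openin (mtop M) (V \<inter> W)" using smooth_fun_on_open V(2) W(2) by blast
  then show thesis
    using that[of "V \<inter> W"] V W smooth_fun_on_subset by auto
qed

lemma smooth_at_add: "smooth_at M p f \<Longrightarrow> smooth_at M p g \<Longrightarrow> smooth_at M p (\<lambda>q. f q + g q)"
  by (erule (1) smooth_at_binary) (rule smooth_atI[OF smooth_fun_on_add])

lemma smooth_at_mult: "smooth_at M p f \<Longrightarrow> smooth_at M p g \<Longrightarrow> smooth_at M p (\<lambda>q. f q * g q)"
  by (erule (1) smooth_at_binary) (rule smooth_atI[OF smooth_fun_on_mult])

lemma smooth_at_const: "p \<in> mcarrier M \<Longrightarrow> smooth_at M p (\<lambda>q. c)"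
  by (rule smooth_atI[OF smooth_fun_on_const[OF openin_topspace]])

lemma smooth_at_cmult: "smooth_at M p f \<Longrightarrow> smooth_at M p (\<lambda>q. c * f q)"
  by (rule smooth_at_mult[OF smooth_at_const[OF smooth_at_carrier]])

lemma smooth_at_sum:
  assumes "p \<in> mcarrier M" "\<And>i. i \<in> I \<Longrightarrow> smooth_at M p (f i)"
  shows "smooth_at M p (\<lambda>q. \<Sum>i\<in>I. f i q)"
  using assms(2)
proof (induction I rule: infinite_finite_induct)
  case (insert i I)
  have "smooth_at M p (\<lambda>q. f i q + (\<Sum>i\<in>I. f i q))"
    by (rule smooth_at_add) (use insert in auto)
  then show ?case using insert.hyps by simp
qed (simp_all add: smooth_at_const assms(1))

lemma smooth_at_coordinate: "(U, \<phi>) \<in> mcharts M \<Longrightarrow> p \<in> U \<Longrightarrow> smooth_at M p (\<lambda>q. \<phi> q j)"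
  by (rule smooth_atI[OF smooth_fun_on_coordinate])

definition chart_partial :: "'a chart \<Rightarrow> nat \<Rightarrow> ('a \<Rightarrow> real) \<Rightarrow> 'a \<Rightarrow> real" where
  "chart_partial c j f p = partial_deriv j (\<lambda>x. f (inv_into (fst c) (snd c) x)) (snd c p)"

lemma chart_has_partial:
  assumes c: "(U, \<phi>) \<in> mcharts M" "p \<in> U" and f: "smooth_at M p f" and j: "j < mdim M"
  shows "((\<lambda>t. f (inv_into U \<phi> ((\<phi> p)(j := t)))) has_real_derivative chart_partial (U, \<phi>) j f p) (at (\<phi> p j))"
proof -
  obtain W where W: "p \<in> W" "smooth_fun_on M W f" using f unfolding smooth_at_def by blast
  show ?thesis unfolding chart_partial_def fst_conv snd_conv
    by (rule smooth_on_has_partial[OF smooth_fun_onD[OF W(2) c(1)] j]) (use W c in auto)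
qed

lemma smooth_fun_on_chart_partial:
  assumes c: "(U, \<phi>) \<in> mcharts M" and f: "smooth_fun_on M W f" and j: "j < mdim M"
  shows "smooth_fun_on M (U \<inter> W) (chart_partial (U, \<phi>) j f)"
proof -
  have "smooth_on (mdim M) (\<phi> ` (U \<inter> W)) (partial_deriv j (\<lambda>x. f (inv_into U \<phi> x)))"
    by (rule smooth_on_partial[OF smooth_fun_onD[OF f c] j])
  from smooth_fun_on_chart_comp[OF c this]
  have "smooth_fun_on M {q \<in> U. \<phi> q \<in> \<phi> ` (U \<inter> W)} (chart_partial (U, \<phi>) j f)"
    unfolding chart_partial_def fst_conv snd_conv .
  moreover have "{q \<in> U. \<phi> q \<in> \<phi> ` (U \<inter> W)} = U \<inter> W"
    using chart_inj[OF c] by (auto dest: inj_onD)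
  ultimately show ?thesis by simp
qed

lemma chart_partial_cong:
  assumes c: "(U, \<phi>) \<in> mcharts M" "p \<in> U" and j: "j < mdim M"
    and W: "openin (mtop M) W" "p \<in> W" "\<And>q. q \<in> W \<Longrightarrow> f q = g q"
  shows "chart_partial (U, \<phi>) j f p = chart_partial (U, \<phi>) j g p"
  unfolding chart_partial_def fst_conv snd_conv
proof (rule partial_deriv_cong[OF _ _ j])
  show "openin (Euclidean_space (mdim M)) (\<phi> ` (U \<inter> W))"
    by (rule chart_open_image[OF c(1)]) (use W chart_open[OF c(1)] in auto)
qed (use c W in auto)

lemma chart_partial_coordinate:
  assumes c: "(U, \<phi>) \<in> mcharts M" "p \<in> U" and j: "j < mdim M"
  shows "chart_partial (U, \<phi>) j (\<lambda>q. \<phi> q k) p = (if j = k then 1 else 0)"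
proof -
  have "chart_partial (U, \<phi>) j (\<lambda>q. \<phi> q k) p = partial_deriv j (\<lambda>x. x k) (\<phi> p)"
    unfolding chart_partial_def fst_conv snd_conv
  proof (rule partial_deriv_cong[OF chart_image_open[OF c(1)] _ j])
    show "\<phi> (inv_into U \<phi> x) k = x k" if "x \<in> \<phi> ` U" for x using that by (simp add: f_inv_into_f)
  qed (use c in auto)
  also have "\<dots> = (if j = k then 1 else 0)"
    by (rule partial_deriv_eqI) (auto simp: fun_upd_def intro!: derivative_eq_intros)
  finally show ?thesis .
qed

subsection \<open>Tangent vectors\<close>

text \<open>The value 0 on functions not smooth at \<open>p\<close> is what the last clause of
  \<open>tangent_space\<close> demands; thanks to it every tangent vector is literally equal to such
  a function.\<close>

definition tvec :: "'a chart \<Rightarrow> 'a \<Rightarrow> (nat \<Rightarrow> real) \<Rightarrow> 'a tangent" where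
  "tvec c p a = (\<lambda>f. if smooth_at M p f then \<Sum>j<mdim M. a j * chart_partial c j f p else 0)"

lemma tvec_tangent:
  assumes c: "(U, \<phi>) \<in> mcharts M" "p \<in> U"
  shows "tvec (U, \<phi>) p a \<in> tangent_space M p"
proof -
  have add: "chart_partial (U, \<phi>) j (\<lambda>q. f q + g q) p = chart_partial (U, \<phi>) j f p + chart_partial (U, \<phi>) j g p"
    and mult: "chart_partial (U, \<phi>) j (\<lambda>q. f q * g q) p = f p * chart_partial (U, \<phi>) j g p + g p * chart_partial (U, \<phi>) j f p"
    if "smooth_at M p f" "smooth_at M p g" "j < mdim M" for f g j
    using DERIV_add[OF chart_has_partial[OF c that(1,3)] chart_has_partial[OF c that(2,3)]]
      DERIV_mult[OF chart_has_partial[OF c that(1,3)] chart_has_partial[OF c that(2,3)]] c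
    by (auto simp: chart_partial_def[of _ _ "\<lambda>q. f q + g q"] chart_partial_def[of _ _ "\<lambda>q. f q * g q"]
        algebra_simps intro!: partial_deriv_eqI)
  have cmult: "chart_partial (U, \<phi>) j (\<lambda>q. b * f q) p = b * chart_partial (U, \<phi>) j f p"
    if "smooth_at M p f" "j < mdim M" for b f j
    using DERIV_cmult[OF chart_has_partial[OF c that], of b]
    by (auto simp: chart_partial_def[of _ _ "\<lambda>q. b * f q"] intro!: partial_deriv_eqI)
  show ?thesis
    unfolding tangent_space_def tvec_def
  proof (intro CollectI conjI allI impI)
    fix f g assume "smooth_at M p f" "smooth_at M p g"
    then show "(if smooth_at M p (\<lambda>x. f x + g x) then \<Sum>j<mdim M. a j * chart_partial (U, \<phi>) j (\<lambda>x. f x + g x) p else 0) =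
       (if smooth_at M p f then \<Sum>j<mdim M. a j * chart_partial (U, \<phi>) j f p else 0) +
       (if smooth_at M p g then \<Sum>j<mdim M. a j * chart_partial (U, \<phi>) j g p else 0)"
      by (simp add: smooth_at_add add distrib_left sum.distrib)
  next
    fix b f assume "smooth_at M p f"
    then show "(if smooth_at M p (\<lambda>x. b * f x) then \<Sum>j<mdim M. a j * chart_partial (U, \<phi>) j (\<lambda>x. b * f x) p else 0) =
       b * (if smooth_at M p f then \<Sum>j<mdim M. a j * chart_partial (U, \<phi>) j f p else 0)"
      by (simp add: smooth_at_cmult cmult sum_distrib_left mult.left_commute)
  next
    fix f g assume "smooth_at M p f" "smooth_at M p g"
    then show "(if smooth_at M p (\<lambda>x. f x * g x) then \<Sum>j<mdim M. a j * chart_partial (U, \<phi>) j (\<lambda>x. f x * g x) p else 0) =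
       f p * (if smooth_at M p g then \<Sum>j<mdim M. a j * chart_partial (U, \<phi>) j g p else 0) +
       g p * (if smooth_at M p f then \<Sum>j<mdim M. a j * chart_partial (U, \<phi>) j f p else 0)"
      by (simp add: smooth_at_mult mult distrib_left sum.distrib sum_distrib_left mult.left_commute)
  next
    fix f g W assume *: "smooth_at M p f" "openin (mtop M) W" "p \<in> W" "\<forall>x\<in>W. f x = g x"
    have "smooth_at M p g" by (rule smooth_at_cong[OF *(1-3)]) (use *(4) in blast)
    moreover have "chart_partial (U, \<phi>) j f p = chart_partial (U, \<phi>) j g p" if "j < mdim M" for j
      by (rule chart_partial_cong[OF c that *(2,3)]) (use *(4) in blast)
    ultimately show "(if smooth_at M p f then \<Sum>j<mdim M. a j * chart_partial (U, \<phi>) j f p else 0) =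
       (if smooth_at M p g then \<Sum>j<mdim M. a j * chart_partial (U, \<phi>) j g p else 0)"
      using * by simp
  qed simp
qed

lemma tangent_spaceD:
  assumes "v \<in> tangent_space M p"
  shows tangent_add: "smooth_at M p f \<Longrightarrow> smooth_at M p g \<Longrightarrow> v (\<lambda>x. f x + g x) = v f + v g"
    and tangent_cmult: "smooth_at M p f \<Longrightarrow> v (\<lambda>x. c * f x) = c * v f"
    and tangent_mult: "smooth_at M p f \<Longrightarrow> smooth_at M p g \<Longrightarrow> v (\<lambda>x. f x * g x) = f p * v g + g p * v f"
    and tangent_cong: "smooth_at M p f \<Longrightarrow> openin (mtop M) W \<Longrightarrow> p \<in> W \<Longrightarrow> (\<And>x. x \<in> W \<Longrightarrow> f x = g x) \<Longrightarrow> v f = v g"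
    and tangent_nonsmooth: "\<not> smooth_at M p f \<Longrightarrow> v f = 0"
proof -
  note c = assms[unfolded tangent_space_def mem_Collect_eq]
  note * = c[THEN conjunct1] c[THEN conjunct2, THEN conjunct1] c[THEN conjunct2, THEN conjunct2, THEN conjunct1]
    c[THEN conjunct2, THEN conjunct2, THEN conjunct2, THEN conjunct1]
    c[THEN conjunct2, THEN conjunct2, THEN conjunct2, THEN conjunct2]
  show "smooth_at M p f \<Longrightarrow> smooth_at M p g \<Longrightarrow> v (\<lambda>x. f x + g x) = v f + v g" using *(1) by blast
  show "smooth_at M p f \<Longrightarrow> v (\<lambda>x. c * f x) = c * v f" using *(2) by blast
  show "smooth_at M p f \<Longrightarrow> smooth_at M p g \<Longrightarrow> v (\<lambda>x. f x * g x) = f p * v g + g p * v f" using *(3) by blast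
  show "smooth_at M p f \<Longrightarrow> openin (mtop M) W \<Longrightarrow> p \<in> W \<Longrightarrow> (\<And>x. x \<in> W \<Longrightarrow> f x = g x) \<Longrightarrow> v f = v g"
    using *(4) by blast
  show "\<not> smooth_at M p f \<Longrightarrow> v f = 0" using *(5) by blast
qed

lemma tangent_const:
  assumes "v \<in> tangent_space M p" "p \<in> mcarrier M"
  shows "v (\<lambda>q. c) = 0"
proof -
  have "v (\<lambda>q. 1) = 0"
    using tangent_mult[OF assms(1) smooth_at_const smooth_at_const, OF assms(2,2), of 1 1] by simp
  then show ?thesis using tangent_cmult[OF assms(1) smooth_at_const[OF assms(2)], of c 1] by simp
qed

lemma tangent_sum:
  assumes "v \<in> tangent_space M p" "p \<in> mcarrier M" "\<And>i. i \<in> I \<Longrightarrow> smooth_at M p (f i)"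
  shows "v (\<lambda>q. \<Sum>i\<in>I. f i q) = (\<Sum>i\<in>I. v (f i))"
  using assms(3)
proof (induction I rule: infinite_finite_induct)
  case (insert i I)
  have "v (\<lambda>q. f i q + (\<Sum>i\<in>I. f i q)) = v (f i) + v (\<lambda>q. \<Sum>i\<in>I. f i q)"
    using smooth_at_sum[OF assms(2), of I f] insert.prems by (intro tangent_add[OF assms(1)]) auto
  then show ?case using insert by simp
qed (simp_all add: tangent_const[OF assms(1,2)])

text \<open>By Hadamard's lemma \<open>f\<close> is, near \<open>p\<close>, a constant plus products
  of coordinate differences, which vanish at \<open>p\<close>, with smooth functions. The Leibniz
  rule leaves the derivation of each coordinate times the value of the other factor at
  \<open>p\<close>, which is a partial derivative of \<open>f\<close>.\<close>

lemma tangent_expand: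
  assumes c: "(U, \<phi>) \<in> mcharts M" "p \<in> U" and v: "v \<in> tangent_space M p" and f: "smooth_at M p f"
  shows "v f = (\<Sum>j<mdim M. v (\<lambda>q. \<phi> q j) * chart_partial (U, \<phi>) j f p)"
proof -
  let ?n = "mdim M"
  have pM: "p \<in> mcarrier M" by (rule smooth_at_carrier[OF f])
  obtain W where W: "p \<in> W" "smooth_fun_on M W f" using f unfolding smooth_at_def by blast
  obtain e where e: "e > 0" "cube ?n (\<phi> p) e \<subseteq> \<phi> ` (U \<inter> W)"
    by (rule chart_cube[OF c(1) smooth_fun_on_open[OF W(2)] W(1) c(2)])
  have sm: "smooth_on ?n (cube ?n (\<phi> p) e) (\<lambda>x. f (inv_into U \<phi> x))"
    by (rule smooth_on_subset[OF smooth_fun_onD[OF W(2) c(1)] openin_cube e(2)])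
  note pe = chart_espace[OF c]
  obtain g where g: "\<And>j. j < ?n \<Longrightarrow> smooth_on ?n (cube ?n (\<phi> p) e) (g j)"
    "\<And>j. j < ?n \<Longrightarrow> g j (\<phi> p) = partial_deriv j (\<lambda>x. f (inv_into U \<phi> x)) (\<phi> p)"
    "\<And>x. x \<in> cube ?n (\<phi> p) e \<Longrightarrow> f (inv_into U \<phi> x) = f (inv_into U \<phi> (\<phi> p)) + (\<Sum>j<?n. (x j - \<phi> p j) * g j x)"
    by (rule hadamard[OF sm pe], rule that)
  define V where "V = {q \<in> U. \<phi> q \<in> cube ?n (\<phi> p) e}"
  have V: "openin (mtop M) V" "p \<in> V"
    unfolding V_def using chart_open_preimage[OF c(1) openin_cube] centre_in_cube[OF pe e(1)] c(2) by auto
  have gsm: "smooth_at M p (\<lambda>q. g j (\<phi> q))" if "j < ?n" for j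
    by (rule smooth_atI[OF smooth_fun_on_chart_comp[OF c(1) g(1)[OF that]]]) (use V in \<open>auto simp: V_def\<close>)
  have csm: "smooth_at M p (\<lambda>q. \<phi> q j + (- \<phi> p j))" for j
    by (intro smooth_at_add smooth_at_coordinate[OF c] smooth_at_const pM)
  have tsm: "smooth_at M p (\<lambda>q. (\<phi> q j + (- \<phi> p j)) * g j (\<phi> q))" if "j < ?n" for j
    by (intro smooth_at_mult csm gsm that)
  have "v f = v (\<lambda>q. f p + (\<Sum>j<?n. (\<phi> q j + (- \<phi> p j)) * g j (\<phi> q)))"
  proof (rule tangent_cong[OF v f V])
    fix q assume q: "q \<in> V"
    then show "f q = f p + (\<Sum>j<?n. (\<phi> q j + (- \<phi> p j)) * g j (\<phi> q))"
      using g(3)[of "\<phi> q"] c by (simp add: V_def)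
  qed
  also have "\<dots> = v (\<lambda>q. f p) + v (\<lambda>q. \<Sum>j<?n. (\<phi> q j + (- \<phi> p j)) * g j (\<phi> q))"
    using tsm by (intro tangent_add[OF v] smooth_at_const pM smooth_at_sum) auto
  also have "\<dots> = (\<Sum>j<?n. v (\<lambda>q. (\<phi> q j + (- \<phi> p j)) * g j (\<phi> q)))"
    using tsm tangent_sum[OF v pM, of "{..<?n}" "\<lambda>j q. (\<phi> q j + (- \<phi> p j)) * g j (\<phi> q)"]
    by (simp add: tangent_const[OF v pM])
  also have "\<dots> = (\<Sum>j<?n. v (\<lambda>q. \<phi> q j) * chart_partial (U, \<phi>) j f p)"
  proof (intro sum.cong refl)
    fix j assume "j \<in> {..<?n}"
    then have j: "j < ?n" by simp
    have "v (\<lambda>q. \<phi> q j + (- \<phi> p j)) = v (\<lambda>q. \<phi> q j)"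
      using tangent_add[OF v smooth_at_coordinate[OF c, of j] smooth_at_const[OF pM, of "- \<phi> p j"]]
        tangent_const[OF v pM] by simp
    then show "v (\<lambda>q. (\<phi> q j + (- \<phi> p j)) * g j (\<phi> q)) = v (\<lambda>q. \<phi> q j) * chart_partial (U, \<phi>) j f p"
      using tangent_mult[OF v csm gsm[OF j], of j] g(2)[OF j] by (simp add: chart_partial_def)
  qed
  finally show ?thesis .
qed

lemma tangent_eq_tvec:
  assumes c: "(U, \<phi>) \<in> mcharts M" "p \<in> U" and v: "v \<in> tangent_space M p"
  shows "v = tvec (U, \<phi>) p (\<lambda>j. v (\<lambda>q. \<phi> q j))"
  using tangent_expand[OF c v] tangent_nonsmooth[OF v] unfolding tvec_def by fastforce

lemma tvec_coordinate:
  assumes c: "(U, \<phi>) \<in> mcharts M" "p \<in> U" and k: "k < mdim M"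
  shows "tvec (U, \<phi>) p a (\<lambda>q. \<phi> q k) = a k"
  using smooth_at_coordinate[OF c, of k] k
  by (simp add: tvec_def chart_partial_coordinate[OF c] if_distrib sum.delta cong: if_cong)

lemma tangent_eqI:
  assumes c: "(U, \<phi>) \<in> mcharts M" "p \<in> U" and v: "v \<in> tangent_space M p" and w: "w \<in> tangent_space M p"
    and eq: "\<And>j. j < mdim M \<Longrightarrow> v (\<lambda>q. \<phi> q j) = w (\<lambda>q. \<phi> q j)"
  shows "v = w"
proof -
  have "tvec (U, \<phi>) p (\<lambda>j. v (\<lambda>q. \<phi> q j)) = tvec (U, \<phi>) p (\<lambda>j. w (\<lambda>q. \<phi> q j))"
    unfolding tvec_def using eq by (intro ext) simp
  then show ?thesis using tangent_eq_tvec[OF c v] tangent_eq_tvec[OF c w] by simp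
qed

lemma tangent_subspace:
  assumes "p \<in> mcarrier M"
  shows "fun_vs.subspace (tangent_space M p)"
proof (rule fun_vs.subspaceI)
  show "0 \<in> tangent_space M p" unfolding tangent_space_def by simp
next
  fix v w assume "v \<in> tangent_space M p" "w \<in> tangent_space M p"
  note D = tangent_spaceD[OF this(1)] tangent_spaceD[OF this(2)]
  show "v + w \<in> tangent_space M p"
    unfolding tangent_space_def
  proof (intro CollectI conjI allI impI)
    fix f g W assume "smooth_at M p f" "openin (mtop M) W" "p \<in> W" "\<forall>x\<in>W. f x = g x"
    then have "v f = v g" "w f = w g" using D(4)[of f W g] D(9)[of f W g] by blast+
    then show "(v + w) f = (v + w) g" by simp
  qed (simp_all add: D(1-3,5-8,10) algebra_simps)
next
  fix c v assume "v \<in> tangent_space M p"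
  note D = tangent_spaceD[OF this]
  show "fun_scale c v \<in> tangent_space M p"
    unfolding tangent_space_def
  proof (intro CollectI conjI allI impI)
    fix f g W assume "smooth_at M p f" "openin (mtop M) W" "p \<in> W" "\<forall>x\<in>W. f x = g x"
    then have "v f = v g" using D(4)[of f W g] by blast
    then show "c * v f = c * v g" by simp
  qed (simp_all add: D(1-3,5) algebra_simps)
qed

end

section \<open>Covectors\<close>

lemma sum_fun_apply: "(\<Sum>i\<in>I. (f i :: 'b \<Rightarrow> 'c::comm_monoid_add)) x = (\<Sum>i\<in>I. f i x)"
  by (induction I rule: infinite_finite_induct) (simp_all add: plus_fun_apply zero_fun_apply)

lemma sum_delta_mult:
  assumes "finite I"
  shows "(\<Sum>j\<in>I. (if j = i then 1 else 0) * x j) = (if i \<in> I then x i else (0 :: real))"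
proof -
  have "(\<Sum>j\<in>I. (if j = i then 1 else 0) * x j) = (\<Sum>j\<in>I. if j = i then x j else 0)"
    by (intro sum.cong) auto
  then show ?thesis using assms by simp
qed

lemma independent_familyI:
  fixes b :: "'i \<Rightarrow> 'b \<Rightarrow> real"
  assumes I: "finite I" and z: "\<And>c j. (\<Sum>j\<in>I. fun_scale (c j) (b j)) = 0 \<Longrightarrow> j \<in> I \<Longrightarrow> c j = 0"
  shows "inj_on b I" "fun_vs.independent (b ` I)"
proof -
  show inj: "inj_on b I"
  proof (rule inj_onI, rule ccontr)
    fix i j assume *: "i \<in> I" "j \<in> I" "b i = b j" "i \<noteq> j"
    \<comment> \<open>A repeated member of the family would satisfy the nontrivial relation
      \<open>b i - b j = 0\<close>.\<close>
    define c :: "'i \<Rightarrow> real" where "c k = (if k = i then 1 else 0) - (if k = j then 1 else 0)" for k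
    have "(\<Sum>k\<in>I. fun_scale (c k) (b k)) x = 0" for x
      using * I by (simp add: sum_fun_apply c_def left_diff_distrib sum_subtractf sum_delta_mult)
    then have "(\<Sum>k\<in>I. fun_scale (c k) (b k)) = 0" by (intro ext) simp
    from z[OF this *(1)] show False using * by (simp add: c_def)
  qed
  show "fun_vs.independent (b ` I)"
    unfolding fun_vs.dependent_finite[OF finite_imageI[OF I]]
  proof clarify
    fix u i assume i: "i \<in> I" "u (b i) \<noteq> 0" and s: "(\<Sum>v\<in>b ` I. fun_scale (u v) v) = 0"
    have "(\<Sum>j\<in>I. fun_scale (u (b j)) (b j)) = 0"
      using s by (simp add: sum.reindex[OF inj] comp_def)
    from z[OF this i(1)] i(2) show False by simp
  qed
qed

text \<open>At a tuple \<open>v\<close> where the form is nonzero, its value is the determinant of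
  the matrix with entries \<open>\<omega> i (v k)\<close>; a linear relation between the covectors
  would be one between the rows of this matrix.\<close>

lemma wedge_independent:
  fixes \<omega> :: "nat \<Rightarrow> 'a cotangent"
  assumes "wedge s \<omega> \<noteq> 0"
  shows "inj_on \<omega> {..<s}" "fun_vs.independent (\<omega> ` {..<s})"
proof -
  obtain v where "wedge s \<omega> v \<noteq> 0" using assms by (auto simp: fun_eq_iff)
  then have v: "mdet s (\<lambda>i k. \<omega> i (v k)) \<noteq> 0" unfolding wedge_def mdet_def .
  have "c j = 0" if z: "(\<Sum>j<s. fun_scale (c j) (\<omega> j)) = 0" and j: "j \<in> {..<s}" for c j
  proof (rule ccontr)
    assume "c j \<noteq> 0"
    moreover have "(\<Sum>i<s. c i * \<omega> i (v k)) = 0" for k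
      using fun_cong[OF z, of "v k"] by (simp add: sum_fun_apply)
    ultimately show False using mdet_rows_dependent[of j s c "\<lambda>i k. \<omega> i (v k)"] v j by simp
  qed
  then show "inj_on \<omega> {..<s}" "fun_vs.independent (\<omega> ` {..<s})"
    using independent_familyI[OF finite_lessThan, where b = \<omega>] by blast+
qed

text \<open>Smoothness is local, so it is checked on a set mapped by \<open>h\<close> into a single
  chart of \<open>M\<close>; there the chart expressions of \<open>h\<close> and \<open>f\<close>
  compose.\<close>

lemma (in smooth_mfd) smooth_fun_on_pullback:
  assumes "smooth_manifold N" and h: "smooth_map N M h" and f: "smooth_fun_on M W f"
  shows "smooth_fun_on N {q \<in> mcarrier N. h q \<in> W} (\<lambda>q. f (h q))"
proof -
  interpret N: smooth_mfd N by unfold_locales fact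
  have hc: "continuous_map (mtop N) (mtop M) h" using h unfolding smooth_map_def by blast
  have op: "openin (mtop N) {q \<in> mcarrier N. h q \<in> V}" if "openin (mtop M) V" for V
    using hc that by (rule openin_continuous_map_preimage)
  note W = smooth_fun_on_open[OF f]
  show ?thesis
  proof (rule N.smooth_fun_on_local)
    fix p assume p: "p \<in> {q \<in> mcarrier N. h q \<in> W}"
    obtain U \<phi> where c: "(U, \<phi>) \<in> mcharts N" "p \<in> U" using N.chart_exists p by auto
    have "h p \<in> mcarrier M" using p openin_subset[OF W] by auto
    then obtain V \<psi> where d: "(V, \<psi>) \<in> mcharts M" "h p \<in> V" using chart_exists by blast
    define G where "G = U \<inter> {q \<in> mcarrier N. h q \<in> V \<inter> W}"
    have G: "openin (mtop N) G" "G \<subseteq> U" "p \<in> G"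
      unfolding G_def using op[OF openin_Int[OF chart_open[OF d(1)] W]] N.chart_open[OF c(1)] c d p by auto
    have oG: "openin (Euclidean_space (mdim N)) (\<phi> ` G)" by (rule N.chart_open_image[OF c(1) G(1,2)])
    have "smooth_fun_on N G (\<lambda>q. f (h q))"
    proof (rule N.smooth_fun_on_chartI[OF c(1) G(1,2)])
      have "smooth_on (mdim N) (\<phi> ` G) (\<lambda>x. f (inv_into V \<psi> (\<psi> (h (inv_into U \<phi> x)))))"
      proof (rule smooth_on_comp[OF oG smooth_fun_onD[OF f d(1)]])
        fix j assume j: "j < mdim M"
        have "\<forall>(U, \<phi>)\<in>mcharts N. \<forall>(V, \<psi>)\<in>mcharts M. \<forall>j<mdim M.
            smooth_on (mdim N) (\<phi> ` (U \<inter> h -` V)) (\<lambda>x. \<psi> (h (inv_into U \<phi> x)) j)"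
          using h unfolding smooth_map_def by blast
        then have "smooth_on (mdim N) (\<phi> ` (U \<inter> h -` V)) (\<lambda>x. \<psi> (h (inv_into U \<phi> x)) j)"
          using c(1) d(1) j by fast
        then show "smooth_on (mdim N) (\<phi> ` G) (\<lambda>x. \<psi> (h (inv_into U \<phi> x)) j)"
          by (rule smooth_on_subset[OF _ oG]) (auto simp: G_def)
      next
        fix x assume "x \<in> \<phi> ` G"
        then show "\<psi> (h (inv_into U \<phi> x)) \<in> \<psi> ` (V \<inter> W)" using c(1) by (auto simp: G_def)
      qed
      then show "smooth_on (mdim N) (\<phi> ` G) (\<lambda>x. f (h (inv_into U \<phi> x)))"
        by (rule smooth_on_cong[rotated]) (use c(1) d(1) in \<open>auto simp: G_def\<close>)
    qed
    then show "\<exists>W'. p \<in> W' \<and> W' \<subseteq> {q \<in> mcarrier N. h q \<in> W} \<and> smooth_fun_on N W' (\<lambda>q. f (h q))"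
      using G by (intro exI[of _ G]) (auto simp: G_def)
  qed
qed

context smooth_mfd begin

lemma differential_cotangent:
  assumes "p \<in> mcarrier M" shows "differential M f p \<in> cotangent_space M p"
proof -
  have "v + w \<in> tangent_space M p" if "v \<in> tangent_space M p" "w \<in> tangent_space M p" for v w
    by (rule fun_vs.subspace_add[OF tangent_subspace[OF assms] that])
  moreover have "fun_scale c v \<in> tangent_space M p" if "v \<in> tangent_space M p" for c v
    by (rule fun_vs.subspace_scale[OF tangent_subspace[OF assms] that])
  ultimately show ?thesis unfolding cotangent_space_def differential_def by auto
qed

lemma cotangent_subspace:
  assumes "p \<in> mcarrier M" shows "fun_vs.subspace (cotangent_space M p)"
  unfolding cotangent_space_def
  by (rule fun_vs.subspaceI) (auto simp: algebra_simps)

lemma cotangentD: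
  assumes "\<omega> \<in> cotangent_space M p"
  shows cotangent_add: "v \<in> tangent_space M p \<Longrightarrow> w \<in> tangent_space M p \<Longrightarrow> \<omega> (v + w) = \<omega> v + \<omega> w"
    and cotangent_scale: "v \<in> tangent_space M p \<Longrightarrow> \<omega> (fun_scale c v) = c * \<omega> v"
    and cotangent_outside: "v \<notin> tangent_space M p \<Longrightarrow> \<omega> v = 0"
  using assms unfolding cotangent_space_def by auto

lemma cotangent_sum:
  assumes "\<omega> \<in> cotangent_space M p" "p \<in> mcarrier M" "\<And>i. i \<in> I \<Longrightarrow> v i \<in> tangent_space M p"
  shows "\<omega> (\<Sum>i\<in>I. fun_scale (c i) (v i)) = (\<Sum>i\<in>I. c i * \<omega> (v i))"
  using assms(3)
proof (induction I rule: infinite_finite_induct)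
  case (insert i I)
  note S = tangent_subspace[OF assms(2)]
  have "fun_scale (c i) (v i) \<in> tangent_space M p" "(\<Sum>i\<in>I. fun_scale (c i) (v i)) \<in> tangent_space M p"
    using insert.prems by (auto intro!: fun_vs.subspace_scale[OF S] fun_vs.subspace_sum[OF S])
  from cotangent_add[OF assms(1) this]
  have "\<omega> (\<Sum>i\<in>insert i I. fun_scale (c i) (v i)) = \<omega> (fun_scale (c i) (v i)) + \<omega> (\<Sum>i\<in>I. fun_scale (c i) (v i))"
    by (simp only: sum.insert[OF insert.hyps])
  also have "\<omega> (fun_scale (c i) (v i)) = c i * \<omega> (v i)"
    by (rule cotangent_scale[OF assms(1)]) (simp add: insert.prems)
  also have "\<omega> (\<Sum>i\<in>I. fun_scale (c i) (v i)) = (\<Sum>i\<in>I. c i * \<omega> (v i))"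
    by (rule insert.IH) (simp add: insert.prems)
  finally show ?case by (simp only: sum.insert[OF insert.hyps])
next
  case (infinite I)
  show ?case using cotangent_scale[OF assms(1) fun_vs.subspace_0[OF tangent_subspace[OF assms(2)]], of 0] infinite
    by (simp add: zero_fun_def)
next
  case empty
  show ?case using cotangent_scale[OF assms(1) fun_vs.subspace_0[OF tangent_subspace[OF assms(2)]], of 0]
    by (simp add: zero_fun_def)
qed

definition unit_tvec :: "'a chart \<Rightarrow> 'a \<Rightarrow> nat \<Rightarrow> 'a tangent" where
  "unit_tvec c p j = tvec c p (\<lambda>i. if i = j then 1 else 0)"

lemma tvec_eq_sum: "tvec c p a = (\<Sum>j<mdim M. fun_scale (a j) (unit_tvec c p j))"
proof
  fix f
  show "tvec c p a f = (\<Sum>j<mdim M. fun_scale (a j) (unit_tvec c p j)) f"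
    unfolding sum_fun_apply unit_tvec_def tvec_def by (simp add: sum_delta_mult)
qed

lemma unit_tvec_independent:
  assumes c: "(U, \<phi>) \<in> mcharts M" "p \<in> U"
  shows "inj_on (unit_tvec (U, \<phi>) p) {..<mdim M}" "fun_vs.independent (unit_tvec (U, \<phi>) p ` {..<mdim M})"
proof -
  have "a j = 0" if "(\<Sum>j<mdim M. fun_scale (a j) (unit_tvec (U, \<phi>) p j)) = 0" "j \<in> {..<mdim M}" for a j
  proof -
    have "tvec (U, \<phi>) p a = 0" using that(1) unfolding tvec_eq_sum .
    then show ?thesis using tvec_coordinate[OF c, of j a] that(2) by simp
  qed
  then show "inj_on (unit_tvec (U, \<phi>) p) {..<mdim M}" "fun_vs.independent (unit_tvec (U, \<phi>) p ` {..<mdim M})"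
    using independent_familyI[OF finite_lessThan, where b = "unit_tvec (U, \<phi>) p"] by blast+
qed

lemma tangent_span_unit:
  assumes c: "(U, \<phi>) \<in> mcharts M" "p \<in> U"
  shows "tangent_space M p = fun_vs.span (unit_tvec (U, \<phi>) p ` {..<mdim M})"
proof
  have pM: "p \<in> mcarrier M" using chart_subset c by blast
  show "tangent_space M p \<subseteq> fun_vs.span (unit_tvec (U, \<phi>) p ` {..<mdim M})"
  proof
    fix v assume "v \<in> tangent_space M p"
    then have "v = (\<Sum>j<mdim M. fun_scale (v (\<lambda>q. \<phi> q j)) (unit_tvec (U, \<phi>) p j))"
      using tangent_eq_tvec[OF c] tvec_eq_sum by metis
    also have "\<dots> \<in> fun_vs.span (unit_tvec (U, \<phi>) p ` {..<mdim M})"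
      by (intro fun_vs.span_sum fun_vs.span_scale fun_vs.span_base) auto
    finally show "v \<in> fun_vs.span (unit_tvec (U, \<phi>) p ` {..<mdim M})" .
  qed
  show "fun_vs.span (unit_tvec (U, \<phi>) p ` {..<mdim M}) \<subseteq> tangent_space M p"
    by (intro fun_vs.span_minimal tangent_subspace[OF pM]) (auto simp: unit_tvec_def tvec_tangent[OF c])
qed

lemma cotangent_expand:
  assumes c: "(U, \<phi>) \<in> mcharts M" "p \<in> U" and \<omega>: "\<omega> \<in> cotangent_space M p"
  shows "\<omega> = (\<Sum>j<mdim M. fun_scale (\<omega> (unit_tvec (U, \<phi>) p j)) (differential M (\<lambda>q. \<phi> q j) p))"
proof
  fix v
  have pM: "p \<in> mcarrier M" using chart_subset c by blast
  show "\<omega> v = (\<Sum>j<mdim M. fun_scale (\<omega> (unit_tvec (U, \<phi>) p j)) (differential M (\<lambda>q. \<phi> q j) p)) v"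
  proof (cases "v \<in> tangent_space M p")
    case True
    have "\<omega> v = \<omega> (\<Sum>j<mdim M. fun_scale (v (\<lambda>q. \<phi> q j)) (unit_tvec (U, \<phi>) p j))"
      using tangent_eq_tvec[OF c True] tvec_eq_sum by metis
    also have "\<dots> = (\<Sum>j<mdim M. v (\<lambda>q. \<phi> q j) * \<omega> (unit_tvec (U, \<phi>) p j))"
      by (rule cotangent_sum[OF \<omega> pM]) (simp add: unit_tvec_def tvec_tangent[OF c])
    finally show ?thesis using True by (simp add: sum_fun_apply differential_def mult.commute)
  qed (simp add: sum_fun_apply differential_def cotangent_outside[OF \<omega>])
qed

lemma cotangent_span_coordinates:
  assumes c: "(U, \<phi>) \<in> mcharts M" "p \<in> U"
  shows "cotangent_space M p \<subseteq> fun_vs.span ((\<lambda>j. differential M (\<lambda>q. \<phi> q j) p) ` {..<mdim M})"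
proof
  fix \<omega> assume "\<omega> \<in> cotangent_space M p"
  have "(\<Sum>j<mdim M. fun_scale (\<omega> (unit_tvec (U, \<phi>) p j)) (differential M (\<lambda>q. \<phi> q j) p))
      \<in> fun_vs.span ((\<lambda>j. differential M (\<lambda>q. \<phi> q j) p) ` {..<mdim M})"
    by (intro fun_vs.span_sum fun_vs.span_scale fun_vs.span_base) auto
  then show "\<omega> \<in> fun_vs.span ((\<lambda>j. differential M (\<lambda>q. \<phi> q j) p) ` {..<mdim M})"
    using cotangent_expand[OF c \<open>\<omega> \<in> cotangent_space M p\<close>] by simp
qed

text \<open>Extend \<open>D\<close> to a basis \<open>B\<close> of the tangent space. A covector
  vanishing on \<open>D\<close> is a combination of the dual basis elements belonging to
  \<open>B - D\<close>, which leaves room for at most \<open>card B - card D\<close> independent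
  ones.\<close>

lemma annihilator_card_le:
  assumes p: "p \<in> mcarrier M" and A: "fun_vs.independent A" "A \<subseteq> cotangent_space M p"
    and D: "fun_vs.independent D" "D \<subseteq> tangent_space M p"
    and ann: "\<And>\<omega> v. \<omega> \<in> A \<Longrightarrow> v \<in> D \<Longrightarrow> \<omega> v = 0"
  shows "finite A" "finite D" "card A + card D \<le> mdim M"
proof -
  obtain U \<phi> where c: "(U, \<phi>) \<in> mcharts M" "p \<in> U" using chart_exists[OF p] by blast
  obtain B where B: "D \<subseteq> B" "B \<subseteq> tangent_space M p" "fun_vs.independent B" "tangent_space M p \<subseteq> fun_vs.span B"
    using fun_vs.maximal_independent_subset_extend[OF D(2,1)] by blast
  have "finite B \<and> card B \<le> card (unit_tvec (U, \<phi>) p ` {..<mdim M})"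
    using B(2,3) tangent_span_unit[OF c] by (intro fun_vs.independent_span_bound) auto
  moreover have "card (unit_tvec (U, \<phi>) p ` {..<mdim M}) \<le> mdim M"
    using card_image_le[of "{..<mdim M}"] by simp
  ultimately have fB: "finite B" "card B \<le> mdim M" by auto
  \<comment> \<open>Set to 0 off the tangent space, as covectors are, so that the expansion of
    \<omega> in the dual basis is an equality of functions.\<close>
  define dual where "dual b = (\<lambda>v. if v \<in> tangent_space M p then fun_vs.representation B v b else 0)" for b
  have "\<omega> \<in> fun_vs.span (dual ` (B - D))" if \<omega>: "\<omega> \<in> A" for \<omega>
  proof -
    have \<omega>c: "\<omega> \<in> cotangent_space M p" using \<omega> A(2) by blast
    have eq: "\<omega> = (\<Sum>b\<in>B - D. fun_scale (\<omega> b) (dual b))"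
    proof
      fix v
      show "\<omega> v = (\<Sum>b\<in>B - D. fun_scale (\<omega> b) (dual b)) v"
      proof (cases "v \<in> tangent_space M p")
        case True
        then have "v \<in> fun_vs.span B" using B(4) by blast
        then have "v = (\<Sum>b\<in>B. fun_scale (fun_vs.representation B v b) b)"
          using fun_vs.sum_representation_eq[OF B(3) _ fB(1) subset_refl] by simp
        then have "\<omega> v = \<omega> (\<Sum>b\<in>B. fun_scale (fun_vs.representation B v b) b)" by (rule arg_cong)
        also have "\<dots> = (\<Sum>b\<in>B. fun_vs.representation B v b * \<omega> b)"
          by (rule cotangent_sum[OF \<omega>c p]) (use B(2) in blast)
        also have "\<dots> = (\<Sum>b\<in>B - D. fun_vs.representation B v b * \<omega> b)"
          using ann[OF \<omega>] fB(1) by (intro sum.mono_neutral_right) auto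
        finally show ?thesis using True by (simp add: sum_fun_apply dual_def mult.commute)
      qed (simp add: sum_fun_apply dual_def cotangent_outside[OF \<omega>c])
    qed
    have "(\<Sum>b\<in>B - D. fun_scale (\<omega> b) (dual b)) \<in> fun_vs.span (dual ` (B - D))"
      by (intro fun_vs.span_sum fun_vs.span_scale fun_vs.span_base) auto
    with eq show ?thesis by simp
  qed
  then have "finite A \<and> card A \<le> card (dual ` (B - D))"
    using fB(1) A(1) by (intro fun_vs.independent_span_bound) auto
  moreover have "card (dual ` (B - D)) \<le> card (B - D)" using fB(1) by (intro card_image_le) auto
  moreover have fD: "finite D" using B(1) fB(1) finite_subset by blast
  moreover have "card (B - D) = card B - card D" "card D \<le> card B"
    using B(1) fD fB(1) by (auto intro: card_Diff_subset card_mono)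
  ultimately show "finite A" "finite D" "card A + card D \<le> mdim M" using fB(2) by linarith+
qed

end

section \<open>Hamiltonian vector fields\<close>

context smooth_mfd begin

lemma compactin_closed_cube:
  assumes a: "a \<in> espace n"
  shows "compactin (Euclidean_space n) {x \<in> espace n. \<forall>i<n. \<bar>x i - a i\<bar> \<le> d}"
proof -
  have "compactin (powertop_real UNIV) (\<Pi>\<^sub>E i\<in>UNIV. if i < n then {a i - d..a i + d} else {0 :: real})"
    by (subst compactin_PiE) auto
  also have "(\<Pi>\<^sub>E i\<in>UNIV. if i < n then {a i - d..a i + d} else {0}) = {x \<in> espace n. \<forall>i<n. \<bar>x i - a i\<bar> \<le> d}"
    by (auto simp: PiE_iff abs_le_iff split: if_splits) (smt (verit) linorder_not_less)+
  finally show ?thesis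
    unfolding Euclidean_space_def compactin_subtopology by auto
qed

text \<open>A function vanishing on a half-line, applied to 1 minus a squared distance in scaled
  coordinates and extended by 0. The closed set \<open>K\<close> is exported because a product of
  \<beta> with a function smooth on \<open>W\<close> then extends by 0 to the whole
  manifold.\<close>

lemma bump_function:
  assumes W: "openin (mtop M) W" "p \<in> W"
  obtains \<beta> K where "smooth_fun M \<beta>" "\<beta> p \<noteq> 0" "closedin (mtop M) K" "K \<subseteq> W"
    "\<And>q. q \<in> mcarrier M - K \<Longrightarrow> \<beta> q = 0"
proof -
  let ?n = "mdim M"
  have pM: "p \<in> mcarrier M" using W openin_subset by blast
  obtain U \<phi> where c: "(U, \<phi>) \<in> mcharts M" "p \<in> U" using chart_exists[OF pM] by blast
  obtain e where e: "e > 0" "cube ?n (\<phi> p) e \<subseteq> \<phi> ` (U \<inter> W)" by (rule chart_cube[OF c(1) W c(2)])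
  obtain u :: "nat \<Rightarrow> real \<Rightarrow> real" where u: "\<And>k t. (u k has_real_derivative u (Suc k) t) (at t)"
    "\<And>t. t \<le> 0 \<Longrightarrow> u 0 t = 0" "\<And>t. t > 0 \<Longrightarrow> u 0 t \<noteq> 0" by (rule smooth_half_line_function, rule that)
  define C where "C = {x \<in> espace ?n. \<forall>i<?n. \<bar>x i - \<phi> p i\<bar> \<le> e / 2}"
  define K where "K = inv_into U \<phi> ` C"
  have C: "C \<subseteq> \<phi> ` (U \<inter> W)" using e by (force simp: C_def cube_def)
  have KW: "K \<subseteq> W" "K \<subseteq> U" using C c(1) by (auto simp: K_def)
  have Kiff: "q \<in> K \<longleftrightarrow> \<phi> q \<in> C" if "q \<in> U" for q
  proof
    assume "q \<in> K"
    then obtain x where "x \<in> C" "q = inv_into U \<phi> x" by (auto simp: K_def)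
    moreover from this C have "\<phi> (inv_into U \<phi> x) = x" by (intro f_inv_into_f) blast
    ultimately show "\<phi> q \<in> C" by simp
  next
    assume "\<phi> q \<in> C"
    then have "inv_into U \<phi> (\<phi> q) \<in> K" unfolding K_def by (rule imageI)
    then show "q \<in> K" using that c(1) by simp
  qed
  have "compactin (subtopology (Euclidean_space ?n) (\<phi> ` U)) C"
    using compactin_closed_cube[OF chart_espace[OF c], of "e / 2"] C unfolding compactin_subtopology C_def by auto
  then have "compactin (mtop M) K"
    unfolding K_def by (rule image_compactin[OF _ chart_inv_continuous[OF c(1)]])
  \<comment> \<open>Compact sets are closed because the manifold is Hausdorff. Hence the complement
    of \<open>K\<close> is open, which is what makes the extension by 0 smooth.\<close>
  then have Kc: "closedin (mtop M) K" by (rule compactin_imp_closedin[OF Hausdorff_M])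
  \<comment> \<open>The factor \<open>2 / e\<close> makes a single summand exceed 1 as soon as one
    coordinate leaves the closed cube of radius \<open>e / 2\<close>, so \<rho> is negative off
    \<open>K\<close> and equals 1 at \<open>p\<close>.\<close>
  define \<rho> where "\<rho> q = 1 + (-1) * (\<Sum>j<?n. (2 / e * (\<phi> q j + (- \<phi> p j))) * (2 / e * (\<phi> q j + (- \<phi> p j))))" for q
  define \<beta> where "\<beta> q = (if q \<in> U then u 0 (\<rho> q) else 0)" for q
  have \<rho>: "smooth_fun_on M U \<rho>"
    unfolding \<rho>_def
    by (intro smooth_fun_on_add smooth_fun_on_const smooth_fun_on_cmult smooth_fun_on_sum smooth_fun_on_mult
        smooth_fun_on_coordinate[OF c(1)] chart_open[OF c(1)])
  have "smooth_fun_on M U (\<lambda>q. u 0 (\<rho> q))" by (rule smooth_fun_on_unary[where u = u, OF \<rho> u(1)])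
  then have s1: "smooth_fun_on M U \<beta>" by (rule smooth_fun_on_cong) (simp add: \<beta>_def)
  have zero: "\<beta> q = 0" if "q \<in> mcarrier M - K" for q
  proof (cases "q \<in> U")
    case True
    then have "\<phi> q \<notin> C" using that Kiff by blast
    then obtain i where i: "i < ?n" "\<bar>\<phi> q i - \<phi> p i\<bar> > e / 2"
      using chart_espace[OF c(1) True] by (auto simp: C_def)
    define z where "z = 2 / e * (\<phi> q i + (- \<phi> p i))"
    have "\<bar>z\<bar> = (2 / e) * \<bar>\<phi> q i - \<phi> p i\<bar>" unfolding z_def abs_mult using e(1) by simp
    moreover have "1 < (2 / e) * \<bar>\<phi> q i - \<phi> p i\<bar>" using i e(1) by (simp add: field_simps)
    ultimately have "1 < \<bar>z\<bar>" by simp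
    then have "1 < \<bar>z\<bar> ^ 2" by (intro one_less_power) auto
    also have "\<dots> = z * z" by (simp add: power2_eq_square)
    also have "\<dots> = (2 / e * (\<phi> q i + (- \<phi> p i))) * (2 / e * (\<phi> q i + (- \<phi> p i)))" by (simp only: z_def)
    also have "\<dots> \<le> (\<Sum>j<?n. (2 / e * (\<phi> q j + (- \<phi> p j))) * (2 / e * (\<phi> q j + (- \<phi> p j))))"
      using i(1) by (intro member_le_sum) auto
    finally show ?thesis using u(2)[of "\<rho> q"] True by (simp add: \<beta>_def \<rho>_def)
  qed (simp add: \<beta>_def)
  have s2: "smooth_fun_on M (mcarrier M - K) \<beta>"
    by (rule smooth_fun_on_cong[OF smooth_fun_on_const[of _ 0]]) (use Kc zero in auto)
  have "smooth_fun M \<beta>"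
  proof (rule smooth_fun_on_local)
    fix q assume "q \<in> mcarrier M"
    then have "q \<in> U \<or> q \<in> mcarrier M - K" using KW by blast
    then show "\<exists>W'. q \<in> W' \<and> W' \<subseteq> mcarrier M \<and> smooth_fun_on M W' \<beta>"
      using s1 s2 chart_subset[OF c(1)] by blast
  qed
  moreover have "\<beta> p \<noteq> 0" using u(3)[of 1] c(2) by (simp add: \<beta>_def \<rho>_def)
  ultimately show thesis using that Kc KW(1) zero by blast
qed

lemma differential_add:
  assumes "smooth_at M p f" "smooth_at M p g"
  shows "differential M (\<lambda>q. f q + g q) p = differential M f p + differential M g p"
  using tangent_add[OF _ assms] by (auto simp: differential_def fun_eq_iff)

lemma differential_mult:
  assumes "smooth_at M p f" "smooth_at M p g"
  shows "differential M (\<lambda>q. f q * g q) p = fun_scale (f p) (differential M g p) + fun_scale (g p) (differential M f p)"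
  using tangent_mult[OF _ assms] by (auto simp: differential_def fun_eq_iff)

lemma differential_cmult:
  assumes "smooth_at M p f"
  shows "differential M (\<lambda>q. b * f q) p = fun_scale b (differential M f p)"
  using tangent_cmult[OF _ assms] by (auto simp: differential_def fun_eq_iff)

lemma differential_cong:
  assumes "smooth_at M p f" "openin (mtop M) W" "p \<in> W" "\<And>q. q \<in> W \<Longrightarrow> f q = g q"
  shows "differential M f p = differential M g p"
  using tangent_cong[OF _ assms] by (auto simp: differential_def fun_eq_iff)

end

section \<open>Poisson brackets and commuting Hamiltonian fields\<close>

locale poisson_mfd = smooth_mfd M for M :: "'a manifold" +
  fixes P :: "'a bivector_field"
  assumes poisson: "poisson_manifold M P"
begin

lemma bivector: "bivector_field M P"
  using poisson unfolding poisson_manifold_def by blast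

lemma
  assumes "p \<in> mcarrier M" "\<omega> \<in> cotangent_space M p" "\<eta> \<in> cotangent_space M p" "\<theta> \<in> cotangent_space M p"
  shows P_add_left: "P p (\<omega> + \<eta>) \<theta> = P p \<omega> \<theta> + P p \<eta> \<theta>"
    and P_add_right: "P p \<theta> (\<omega> + \<eta>) = P p \<theta> \<omega> + P p \<theta> \<eta>"
    and P_scale_left: "P p (fun_scale b \<omega>) \<theta> = b * P p \<omega> \<theta>"
    and P_scale_right: "P p \<theta> (fun_scale b \<omega>) = b * P p \<theta> \<omega>"
    and P_alternating: "P p \<omega> \<omega> = 0"
proof -
  note b = bivector[unfolded bivector_field_def, THEN conjunct1, rule_format, OF assms(1)]
  note b1 = b[THEN conjunct1, rule_format]
    and b2 = b[THEN conjunct2, THEN conjunct1, rule_format]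
    and b3 = b[THEN conjunct2, THEN conjunct2, THEN conjunct1, rule_format]
  show "P p (\<omega> + \<eta>) \<theta> = P p \<omega> \<theta> + P p \<eta> \<theta>" "P p \<theta> (\<omega> + \<eta>) = P p \<theta> \<omega> + P p \<theta> \<eta>"
    using b1[OF assms(2-4)] by blast+
  show "P p (fun_scale b \<omega>) \<theta> = b * P p \<omega> \<theta>" using b2[OF assms(2,4), of b] by blast
  show "P p \<theta> (fun_scale b \<omega>) = b * P p \<theta> \<omega>" using b2[OF assms(4,2), of b] by blast
  show "P p \<omega> \<omega> = 0" using b3[OF assms(2)] .
qed

lemma P_outside:
  assumes "p \<in> mcarrier M" "\<omega> \<notin> cotangent_space M p \<or> \<eta> \<notin> cotangent_space M p"
  shows "P p \<omega> \<eta> = 0"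
  using bivector[unfolded bivector_field_def, THEN conjunct1, rule_format, OF assms(1)] assms(2) by blast

lemma P_antisym:
  assumes "p \<in> mcarrier M" "\<omega> \<in> cotangent_space M p" "\<eta> \<in> cotangent_space M p"
  shows "P p \<omega> \<eta> = - P p \<eta> \<omega>"
proof -
  have s: "\<omega> + \<eta> \<in> cotangent_space M p"
    by (rule fun_vs.subspace_add[OF cotangent_subspace[OF assms(1)] assms(2,3)])
  have "0 = P p (\<omega> + \<eta>) (\<omega> + \<eta>)" using P_alternating[OF assms(1) s s s] by simp
  also have "\<dots> = P p \<omega> (\<omega> + \<eta>) + P p \<eta> (\<omega> + \<eta>)" by (rule P_add_left[OF assms s])
  also have "P p \<omega> (\<omega> + \<eta>) = P p \<omega> \<omega> + P p \<omega> \<eta>" by (rule P_add_right[OF assms assms(2)])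
  also have "P p \<eta> (\<omega> + \<eta>) = P p \<eta> \<omega> + P p \<eta> \<eta>" by (rule P_add_right[OF assms assms(3)])
  finally show ?thesis
    using P_alternating[OF assms(1,2,2,2)] P_alternating[OF assms(1,3,3,3)] by linarith
qed

lemma P_zero_right:
  assumes "p \<in> mcarrier M" "\<omega> \<in> cotangent_space M p"
  shows "P p \<omega> 0 = 0"
  using P_scale_right[OF assms assms(2) assms(2), of 0] by (simp add: zero_fun_def)

lemma ham_tangent:
  assumes p: "p \<in> mcarrier M"
  shows "hamiltonian_vf M P f p \<in> tangent_space M p"
proof -
  let ?d = "\<lambda>f. differential M f p"
  note dc = differential_cotangent[OF p]
  have sc: "fun_scale b (?d f) \<in> cotangent_space M p" for b f
    by (rule fun_vs.subspace_scale[OF cotangent_subspace[OF p] dc])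
  show ?thesis
    unfolding tangent_space_def hamiltonian_vf_def
  proof (intro CollectI conjI allI impI)
    fix g h assume "smooth_at M p g" "smooth_at M p h"
    then show "(if smooth_at M p (\<lambda>x. g x + h x) then P p (?d f) (?d (\<lambda>x. g x + h x)) else 0) =
      (if smooth_at M p g then P p (?d f) (?d g) else 0) + (if smooth_at M p h then P p (?d f) (?d h) else 0)"
      using P_add_right[OF p dc[of g] dc[of h] dc[of f]] by (simp only: smooth_at_add differential_add if_True)
  next
    fix b g assume "smooth_at M p g"
    then show "(if smooth_at M p (\<lambda>x. b * g x) then P p (?d f) (?d (\<lambda>x. b * g x)) else 0) =
      b * (if smooth_at M p g then P p (?d f) (?d g) else 0)"
      using P_scale_right[OF p dc[of g] dc[of g] dc[of f], of b] by (simp only: smooth_at_cmult differential_cmult if_True)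
  next
    fix g h assume s: "smooth_at M p g" "smooth_at M p h"
    have "P p (?d f) (fun_scale (g p) (?d h) + fun_scale (h p) (?d g)) = g p * P p (?d f) (?d h) + h p * P p (?d f) (?d g)"
      using P_add_right[OF p sc[of "g p" h] sc[of "h p" g] dc[of f]] P_scale_right[OF p dc[of g] dc[of g] dc[of f]]
        P_scale_right[OF p dc[of h] dc[of h] dc[of f]] by simp
    then show "(if smooth_at M p (\<lambda>x. g x * h x) then P p (?d f) (?d (\<lambda>x. g x * h x)) else 0) =
      g p * (if smooth_at M p h then P p (?d f) (?d h) else 0) + h p * (if smooth_at M p g then P p (?d f) (?d g) else 0)"
      using s by (simp only: smooth_at_mult differential_mult if_True)
  next
    fix g h W assume s: "smooth_at M p g" "openin (mtop M) W" "p \<in> W" "\<forall>x\<in>W. g x = h x"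
    have "smooth_at M p h" by (rule smooth_at_cong[OF s(1-3)]) (use s(4) in blast)
    moreover have "?d g = ?d h" by (rule differential_cong[OF s(1-3)]) (use s(4) in blast)
    ultimately show "(if smooth_at M p g then P p (?d f) (?d g) else 0) = (if smooth_at M p h then P p (?d f) (?d h) else 0)"
      using s(1) by simp
  qed simp
qed

lemma ham_bracket: "smooth_at M p g \<Longrightarrow> hamiltonian_vf M P f p g = poisson_bracket M P f g p"
  by (simp add: hamiltonian_vf_def poisson_bracket_def)

lemma bracket_smooth:
  "smooth_fun_on M W f \<Longrightarrow> smooth_fun_on M W g \<Longrightarrow> smooth_fun_on M W (poisson_bracket M P f g)"
  unfolding poisson_bracket_def using bivector unfolding bivector_field_def by blast

lemma bracket_antisym: "p \<in> mcarrier M \<Longrightarrow> poisson_bracket M P f g p = - poisson_bracket M P g f p"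
  unfolding poisson_bracket_def by (rule P_antisym[OF _ differential_cotangent differential_cotangent])

context
  fixes f g assumes f: "smooth_fun M f" and g: "smooth_fun M g"
    and inv: "\<And>p. p \<in> mcarrier M \<Longrightarrow> poisson_bracket M P f g p = 0"
begin

text \<open>With \<open>{f, g} = 0\<close> the Jacobi identity loses the term in which the field of
  \<open>h\<close> acts, and antisymmetry turns the other two terms into the two orders of
  differentiation of \<open>h\<close>.\<close>

lemma ham_commute_global:
  assumes h: "smooth_fun M h" and p: "p \<in> mcarrier M"
  shows "hamiltonian_vf M P f p (poisson_bracket M P g h) = hamiltonian_vf M P g p (poisson_bracket M P f h)"
proof -
  have sm: "smooth_at M p k" if "smooth_fun M k" for k by (rule smooth_atI[OF that p])
  note T = ham_tangent[OF p]
  have "poisson_bracket M P f (poisson_bracket M P g h) p + poisson_bracket M P g (poisson_bracket M P h f) p +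
     poisson_bracket M P h (poisson_bracket M P f g) p = 0"
    using poisson f g h p unfolding poisson_manifold_def by blast
  then have "hamiltonian_vf M P f p (poisson_bracket M P g h) + hamiltonian_vf M P g p (poisson_bracket M P h f) +
     hamiltonian_vf M P h p (poisson_bracket M P f g) = 0"
    using f g h by (simp add: ham_bracket sm bracket_smooth)
  moreover have "hamiltonian_vf M P h p (poisson_bracket M P f g) = hamiltonian_vf M P h p (\<lambda>_. 0)"
    by (rule tangent_cong[OF T sm[OF bracket_smooth[OF f g]] openin_topspace p inv])
  moreover have "hamiltonian_vf M P h p (\<lambda>_. 0) = 0" by (rule tangent_const[OF T p])
  moreover have "hamiltonian_vf M P g p (poisson_bracket M P h f) = hamiltonian_vf M P g p (\<lambda>q. (-1) * poisson_bracket M P f h q)"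
    by (rule tangent_cong[OF T sm[OF bracket_smooth[OF h f]] openin_topspace p]) (simp add: bracket_antisym[of _ h f])
  moreover have "\<dots> = (-1) * hamiltonian_vf M P g p (poisson_bracket M P f h)"
    by (rule tangent_cmult[OF T sm[OF bracket_smooth[OF f h]]])
  ultimately show ?thesis by linarith
qed

text \<open>Both sides are differential operators in \<open>h\<close>; their difference is a derivation, so it can be
  tested on \<open>\<beta> h\<close> and \<open>\<beta>\<close>, which are globally smooth for a bump function \<open>\<beta>\<close>.\<close>

lemma ham_commute:
  assumes h: "smooth_fun_on M W h" and p: "p \<in> W"
  shows "hamiltonian_vf M P f p (poisson_bracket M P g h) = hamiltonian_vf M P g p (poisson_bracket M P f h)"
proof -
  note W = smooth_fun_on_open[OF h]
  have pM: "p \<in> mcarrier M" using W p openin_subset by blast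
  note T = ham_tangent[OF pM]
  obtain \<beta> K where \<beta>: "smooth_fun M \<beta>" "\<beta> p \<noteq> 0" and K: "closedin (mtop M) K" "K \<subseteq> W"
    "\<And>q. q \<in> mcarrier M - K \<Longrightarrow> \<beta> q = 0"
    by (rule bump_function[OF W p], rule that)
  \<comment> \<open>The product with \<beta>, extended by 0, is smooth on \<open>W\<close> and on
    the complement of \<open>K\<close>, and these two open sets cover the manifold.\<close>
  define k where "k q = (if q \<in> W then \<beta> q * h q else 0)" for q
  have \<beta>W: "smooth_fun_on M W \<beta>" by (rule smooth_fun_on_subset[OF \<beta>(1) W openin_subset[OF W]])
  have kW: "smooth_fun_on M W k"
    by (rule smooth_fun_on_cong[OF smooth_fun_on_mult[OF \<beta>W h]]) (simp add: k_def)
  have kK: "smooth_fun_on M (mcarrier M - K) k"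
    by (rule smooth_fun_on_cong[OF smooth_fun_on_const[of _ 0]]) (use K in \<open>auto simp: k_def\<close>)
  have k: "smooth_fun M k"
  proof (rule smooth_fun_on_local)
    fix q assume "q \<in> mcarrier M"
    then have "q \<in> W \<or> q \<in> mcarrier M - K" using K by blast
    then show "\<exists>W'. q \<in> W' \<and> W' \<subseteq> mcarrier M \<and> smooth_fun_on M W' k"
      using kW kK openin_subset[OF W] by blast
  qed
  have sm: "smooth_at M p k" if "smooth_fun_on M W k" for k by (rule smooth_atI[OF that p])
  \<comment> \<open>The mixed products of first derivatives are symmetric in \<open>a\<close> and
    \<open>b\<close>. They cancel when the two orders are compared, and only the second derivatives
    of \<open>h\<close> and of \<beta> remain.\<close>
  have leib: "hamiltonian_vf M P a p (poisson_bracket M P b k) =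
     \<beta> p * hamiltonian_vf M P a p (poisson_bracket M P b h) + h p * hamiltonian_vf M P a p (poisson_bracket M P b \<beta>) +
     poisson_bracket M P a \<beta> p * poisson_bracket M P b h p + poisson_bracket M P a h p * poisson_bracket M P b \<beta> p"
    if b: "smooth_fun M b" for a b
  proof -
    have bW: "smooth_fun_on M W b" by (rule smooth_fun_on_subset[OF b W openin_subset[OF W]])
    note bh = bracket_smooth[OF bW h] and b\<beta> = bracket_smooth[OF bW \<beta>W]
    have eq: "poisson_bracket M P b k q = \<beta> q * poisson_bracket M P b h q + h q * poisson_bracket M P b \<beta> q" if q: "q \<in> W" for q
    proof -
      have qM: "q \<in> mcarrier M" using W q openin_subset by blast
      have "poisson_bracket M P b k q = hamiltonian_vf M P b q k" by (rule ham_bracket[symmetric, OF smooth_atI[OF kW q]])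
      also have "\<dots> = hamiltonian_vf M P b q (\<lambda>x. \<beta> x * h x)"
        by (rule tangent_cong[OF ham_tangent[OF qM] smooth_atI[OF kW q] W q]) (simp add: k_def)
      also have "\<dots> = \<beta> q * hamiltonian_vf M P b q h + h q * hamiltonian_vf M P b q \<beta>"
        by (rule tangent_mult[OF ham_tangent[OF qM] smooth_atI[OF \<beta>W q] smooth_atI[OF h q]])
      finally show ?thesis by (simp add: ham_bracket smooth_atI[OF \<beta>W q] smooth_atI[OF h q])
    qed
    have "hamiltonian_vf M P a p (poisson_bracket M P b k) =
        hamiltonian_vf M P a p (\<lambda>q. \<beta> q * poisson_bracket M P b h q + h q * poisson_bracket M P b \<beta> q)"
      by (rule tangent_cong[OF T sm[OF bracket_smooth[OF bW kW]] W p eq])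
    also have "\<dots> = hamiltonian_vf M P a p (\<lambda>q. \<beta> q * poisson_bracket M P b h q) + hamiltonian_vf M P a p (\<lambda>q. h q * poisson_bracket M P b \<beta> q)"
      by (rule tangent_add[OF T sm[OF smooth_fun_on_mult[OF \<beta>W bh]] sm[OF smooth_fun_on_mult[OF h b\<beta>]]])
    also have "hamiltonian_vf M P a p (\<lambda>q. \<beta> q * poisson_bracket M P b h q) =
        \<beta> p * hamiltonian_vf M P a p (poisson_bracket M P b h) + poisson_bracket M P b h p * hamiltonian_vf M P a p \<beta>"
      by (rule tangent_mult[OF T sm[OF \<beta>W] sm[OF bh]])
    also have "hamiltonian_vf M P a p (\<lambda>q. h q * poisson_bracket M P b \<beta> q) =
        h p * hamiltonian_vf M P a p (poisson_bracket M P b \<beta>) + poisson_bracket M P b \<beta> p * hamiltonian_vf M P a p h"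
      by (rule tangent_mult[OF T sm[OF h] sm[OF b\<beta>]])
    finally show ?thesis by (simp add: ham_bracket sm[OF \<beta>W] sm[OF h] algebra_simps)
  qed
  have "\<beta> p * hamiltonian_vf M P f p (poisson_bracket M P g h) = \<beta> p * hamiltonian_vf M P g p (poisson_bracket M P f h)"
    using leib[OF g, of f] leib[OF f, of g] ham_commute_global[OF k pM]
      arg_cong[OF ham_commute_global[OF \<beta>(1) pM], of "\<lambda>y. h p * y"]
      mult.commute[of "poisson_bracket M P g \<beta> p" "poisson_bracket M P f h p"]
      mult.commute[of "poisson_bracket M P g h p" "poisson_bracket M P f \<beta> p"] by linarith
  then show ?thesis using \<beta>(2) by simp
qed

end

end

lemma span_familyE:
  assumes "finite I" "v \<in> fun_vs.span (b ` I)"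
  obtains c where "v = (\<Sum>i\<in>I. fun_scale (c i) (b i :: 'b \<Rightarrow> real))"
proof -
  have "fun_vs.span (b ` I) \<subseteq> {v. \<exists>c. v = (\<Sum>i\<in>I. fun_scale (c i) (b i))}"
  proof (rule fun_vs.span_minimal)
    show "b ` I \<subseteq> {v. \<exists>c. v = (\<Sum>i\<in>I. fun_scale (c i) (b i))}"
    proof clarify
      fix j assume j: "j \<in> I"
      have "b j = (\<Sum>i\<in>I. fun_scale (if i = j then 1 else 0) (b i))"
        using assms(1) j by (intro ext) (simp add: sum_fun_apply sum_delta_mult)
      then show "\<exists>c. b j = (\<Sum>i\<in>I. fun_scale (c i) (b i))" by (intro exI[of _ "\<lambda>i. if i = j then 1 else 0"])
    qed
    show "fun_vs.subspace {v. \<exists>c. v = (\<Sum>i\<in>I. fun_scale (c i) (b i))}"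
    proof (rule fun_vs.subspaceI; clarify)
      have "0 = (\<Sum>i\<in>I. fun_scale 0 (b i))" by (intro ext) (simp add: sum_fun_apply)
      then show "\<exists>c. 0 = (\<Sum>i\<in>I. fun_scale (c i) (b i))" by (intro exI[of _ "\<lambda>_. 0"])
      fix c d :: "'a \<Rightarrow> real" and k :: real
      have "(\<Sum>i\<in>I. fun_scale (c i) (b i)) + (\<Sum>i\<in>I. fun_scale (d i) (b i)) = (\<Sum>i\<in>I. fun_scale (c i + d i) (b i))"
        by (intro ext) (simp add: sum_fun_apply distrib_right sum.distrib)
      then show "\<exists>e. (\<Sum>i\<in>I. fun_scale (c i) (b i)) + (\<Sum>i\<in>I. fun_scale (d i) (b i)) = (\<Sum>i\<in>I. fun_scale (e i) (b i))"
        by (intro exI[of _ "\<lambda>i. c i + d i"])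
      have "k * (\<Sum>i\<in>I. fun_scale (c i) (b i)) x = (\<Sum>i\<in>I. fun_scale (k * c i) (b i)) x" for x
        unfolding sum_fun_apply sum_distrib_left mult.assoc ..
      then show "\<exists>e. fun_scale k (\<Sum>i\<in>I. fun_scale (c i) (b i)) = (\<Sum>i\<in>I. fun_scale (e i) (b i))"
        by (intro exI[of _ "\<lambda>i. k * c i"] ext)
    qed
  qed
  then show thesis using assms(2) that by blast
qed

section \<open>Smooth vector fields and their commutators\<close>

context smooth_mfd begin

lemma smooth_fun_on_inverse:
  assumes "smooth_fun_on M W f" "\<And>q. q \<in> W \<Longrightarrow> f q \<noteq> 0"
  shows "smooth_fun_on M W (\<lambda>q. inverse (f q))"
  unfolding smooth_fun_on_def
proof (intro conjI ballI smooth_fun_on_open[OF assms(1)], clarify)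
  fix U \<phi> assume c: "(U, \<phi>) \<in> mcharts M"
  show "smooth_on (mdim M) (\<phi> ` (U \<inter> W)) (\<lambda>x. inverse (f (inv_into U \<phi> x)))"
    by (rule smooth_on_inverse[OF smooth_fun_onD[OF assms(1) c]]) (use c assms(2) in auto)
qed

lemma
  assumes W: "openin (mtop M) W" and A: "\<And>i j. i < n \<Longrightarrow> j < n \<Longrightarrow> smooth_fun_on M W (\<lambda>q. A q i j)"
  shows smooth_fun_on_mdet: "smooth_fun_on M W (\<lambda>q. mdet n (A q))"
    and smooth_fun_on_madj: "i < n \<Longrightarrow> j < n \<Longrightarrow> smooth_fun_on M W (\<lambda>q. madj n (A q) i j)"
proof -
  have op: "openin (Euclidean_space (mdim M)) (\<phi> ` (U \<inter> W))" if "(U, \<phi>) \<in> mcharts M" for U \<phi>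
    by (rule chart_open_image[OF that]) (use W chart_open[OF that] in auto)
  show "smooth_fun_on M W (\<lambda>q. mdet n (A q))"
    unfolding smooth_fun_on_def
    by (intro conjI ballI W, clarify, rule smooth_on_mdet[OF op], assumption) (rule smooth_fun_onD[OF A])
  show "smooth_fun_on M W (\<lambda>q. madj n (A q) i j)" if "i < n" "j < n"
    unfolding smooth_fun_on_def
    by (intro conjI ballI W, clarify, rule smooth_on_madj[OF op _ that], assumption) (rule smooth_fun_onD[OF A])
qed

definition smooth_vf :: "('a \<Rightarrow> 'a tangent) \<Rightarrow> bool" where
  "smooth_vf A \<longleftrightarrow> (\<forall>q\<in>mcarrier M. A q \<in> tangent_space M q) \<and>
     (\<forall>W h. smooth_fun_on M W h \<longrightarrow> smooth_fun_on M W (\<lambda>q. A q h))"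

lemma smooth_vfD:
  assumes "smooth_vf A"
  shows smooth_vf_tangent: "q \<in> mcarrier M \<Longrightarrow> A q \<in> tangent_space M q"
    and smooth_vf_apply: "smooth_fun_on M W h \<Longrightarrow> smooth_fun_on M W (\<lambda>q. A q h)"
  using assms unfolding smooth_vf_def by blast+

lemma smooth_vf_apply_at: "smooth_vf A \<Longrightarrow> smooth_at M p h \<Longrightarrow> smooth_at M p (\<lambda>q. A q h)"
  unfolding smooth_at_def using smooth_vf_apply by blast

definition commutator :: "('a \<Rightarrow> 'a tangent) \<Rightarrow> ('a \<Rightarrow> 'a tangent) \<Rightarrow> 'a \<Rightarrow> 'a tangent" where
  "commutator A B p = (\<lambda>h. if smooth_at M p h then A p (\<lambda>q. B q h) - B p (\<lambda>q. A q h) else 0)"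

text \<open>An iterated derivative violates the Leibniz rule only by the mixed terms
  \<open>A g * B h + B g * A h\<close>. These are symmetric in the two fields and cancel in the
  difference.\<close>

lemma commutator_tangent:
  assumes A: "smooth_vf A" and B: "smooth_vf B" and p: "p \<in> mcarrier M"
  shows "commutator A B p \<in> tangent_space M p"
proof -
  have add: "F p (\<lambda>q. G q (\<lambda>x. g x + h x)) = F p (\<lambda>q. G q g) + F p (\<lambda>q. G q h)"
    and cmult: "F p (\<lambda>q. G q (\<lambda>x. b * g x)) = b * F p (\<lambda>q. G q g)"
    and mult: "F p (\<lambda>q. G q (\<lambda>x. g x * h x)) = (g p * F p (\<lambda>q. G q h) + G p h * F p g) + (h p * F p (\<lambda>q. G q g) + G p g * F p h)"
    if F: "smooth_vf F" and G: "smooth_vf G" and g: "smooth_at M p g" and h: "smooth_at M p h" for F G g h b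
  proof -
    note T = smooth_vf_tangent[OF F p]
    obtain W where W: "p \<in> W" "smooth_fun_on M W g" "smooth_fun_on M W h" by (rule smooth_at_binary[OF g h])
    note op = smooth_fun_on_open[OF W(2)]
    note S = smooth_atI[OF _ W(1)]
    have Tq: "G q \<in> tangent_space M q" and gq: "smooth_at M q g" and hq: "smooth_at M q h" if "q \<in> W" for q
      using smooth_vf_tangent[OF G] openin_subset[OF op] that smooth_atI W(2,3) by blast+
    have "F p (\<lambda>q. G q (\<lambda>x. g x + h x)) = F p (\<lambda>q. G q g + G q h)"
      by (rule tangent_cong[OF T S[OF smooth_vf_apply[OF G smooth_fun_on_add[OF W(2,3)]]] op W(1)])
         (rule tangent_add[OF Tq gq hq])
    also have "\<dots> = F p (\<lambda>q. G q g) + F p (\<lambda>q. G q h)"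
      by (rule tangent_add[OF T smooth_vf_apply_at[OF G g] smooth_vf_apply_at[OF G h]])
    finally show "F p (\<lambda>q. G q (\<lambda>x. g x + h x)) = F p (\<lambda>q. G q g) + F p (\<lambda>q. G q h)" .
    have "F p (\<lambda>q. G q (\<lambda>x. b * g x)) = F p (\<lambda>q. b * G q g)"
      by (rule tangent_cong[OF T S[OF smooth_vf_apply[OF G smooth_fun_on_cmult[OF W(2)]]] op W(1)])
         (rule tangent_cmult[OF Tq gq])
    also have "\<dots> = b * F p (\<lambda>q. G q g)" by (rule tangent_cmult[OF T smooth_vf_apply_at[OF G g]])
    finally show "F p (\<lambda>q. G q (\<lambda>x. b * g x)) = b * F p (\<lambda>q. G q g)" .
    have "F p (\<lambda>q. G q (\<lambda>x. g x * h x)) = F p (\<lambda>q. g q * G q h + h q * G q g)"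
      by (rule tangent_cong[OF T S[OF smooth_vf_apply[OF G smooth_fun_on_mult[OF W(2,3)]]] op W(1)])
         (rule tangent_mult[OF Tq gq hq])
    also have "\<dots> = F p (\<lambda>q. g q * G q h) + F p (\<lambda>q. h q * G q g)"
      by (rule tangent_add[OF T smooth_at_mult[OF g smooth_vf_apply_at[OF G h]] smooth_at_mult[OF h smooth_vf_apply_at[OF G g]]])
    also have "F p (\<lambda>q. g q * G q h) = g p * F p (\<lambda>q. G q h) + G p h * F p g"
      by (rule tangent_mult[OF T g smooth_vf_apply_at[OF G h]])
    also have "F p (\<lambda>q. h q * G q g) = h p * F p (\<lambda>q. G q g) + G p g * F p h"
      by (rule tangent_mult[OF T h smooth_vf_apply_at[OF G g]])
    finally show "F p (\<lambda>q. G q (\<lambda>x. g x * h x)) = (g p * F p (\<lambda>q. G q h) + G p h * F p g) + (h p * F p (\<lambda>q. G q g) + G p g * F p h)" .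
  qed
  show ?thesis
    unfolding tangent_space_def
  proof (intro CollectI conjI allI impI)
    fix g h assume s: "smooth_at M p g" "smooth_at M p h"
    show "commutator A B p (\<lambda>x. g x + h x) = commutator A B p g + commutator A B p h"
      using add[OF A B s] add[OF B A s] s smooth_at_add[OF s] by (simp add: commutator_def)
    show "commutator A B p (\<lambda>x. g x * h x) = g p * commutator A B p h + h p * commutator A B p g"
      using mult[OF A B s] mult[OF B A s] s smooth_at_mult[OF s] by (simp add: commutator_def algebra_simps)
  next
    fix b g assume s: "smooth_at M p g"
    show "commutator A B p (\<lambda>x. b * g x) = b * commutator A B p g"
      using cmult[OF A B s s, of b] cmult[OF B A s s, of b] s smooth_at_cmult[OF s, of b]
      by (simp add: commutator_def right_diff_distrib)
  next
    fix g h V assume s: "smooth_at M p g" "openin (mtop M) V" "p \<in> V" "\<forall>x\<in>V. g x = h x"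
    obtain W where W: "p \<in> W" "smooth_fun_on M W g" using s(1) unfolding smooth_at_def by blast
    note op = smooth_fun_on_open[OF W(2)]
    have h: "smooth_at M p h" by (rule smooth_at_cong[OF s(1-3)]) (use s(4) in blast)
    have eq: "F p (\<lambda>q. G q g) = F p (\<lambda>q. G q h)" if F: "smooth_vf F" and G: "smooth_vf G" for F G
    proof (rule tangent_cong[OF smooth_vf_tangent[OF F p] smooth_vf_apply_at[OF G s(1)]])
      show "openin (mtop M) (V \<inter> W)" "p \<in> V \<inter> W" using s op W by auto
      fix q assume q: "q \<in> V \<inter> W"
      show "G q g = G q h"
      proof (rule tangent_cong[where v = "G q" and p = q and W = V])
        show "G q \<in> tangent_space M q" using smooth_vf_tangent[OF G] q openin_subset[OF op] by blast
        show "smooth_at M q g" by (rule smooth_atI[OF W(2)]) (use q in blast)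
        show "openin (mtop M) V" "q \<in> V" using s q by auto
        show "g x = h x" if "x \<in> V" for x using s(4) that by blast
      qed
    qed
    show "commutator A B p g = commutator A B p h"
      using eq[OF A B] eq[OF B A] s(1) h by (simp add: commutator_def)
  qed (simp add: commutator_def)
qed

end

section \<open>The integral manifold\<close>

locale involutive_integral = poisson_mfd M P for M :: "'a manifold" and P +
  fixes N :: "'a manifold" and f :: "nat \<Rightarrow> 'a \<Rightarrow> real" and s :: nat
  assumes f_smooth: "\<And>i. i < s \<Longrightarrow> smooth_fun M (f i)"
    and involution: "\<And>i j p. i < s \<Longrightarrow> j < s \<Longrightarrow> p \<in> mcarrier M \<Longrightarrow> poisson_bracket M P (f i) (f j) p = 0"
    and integral: "integral_manifold M (hamiltonian_distribution M P s f) N"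
begin

sublocale N: smooth_mfd N
  by unfold_locales (use integral in \<open>simp add: integral_manifold_def\<close>)

abbreviation push :: "'a \<Rightarrow> 'a tangent \<Rightarrow> 'a tangent" where
  "push p \<equiv> pushforward N M (\<lambda>x. x) p"

abbreviation X :: "nat \<Rightarrow> 'a \<Rightarrow> 'a tangent" where
  "X i \<equiv> hamiltonian_vf M P (f i)"

lemma N_subset: "p \<in> mcarrier N \<Longrightarrow> p \<in> mcarrier M"
  using integral unfolding integral_manifold_def by blast

lemma push_inj: "p \<in> mcarrier N \<Longrightarrow> inj_on (push p) (tangent_space N p)"
  and push_image: "p \<in> mcarrier N \<Longrightarrow> push p ` tangent_space N p = hamiltonian_distribution M P s f p"
  using integral unfolding integral_manifold_def by blast+

lemma restrict_smooth:
  assumes "smooth_fun_on M W g" shows "smooth_fun_on N (mcarrier N \<inter> W) g"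
proof -
  have "smooth_fun_on N {q \<in> mcarrier N. q \<in> W} g"
    by (rule smooth_fun_on_pullback[OF N.smooth_M _ assms]) (use integral in \<open>simp add: integral_manifold_def\<close>)
  then show ?thesis by (simp add: Collect_conj_eq Int_commute)
qed

lemma restrict_smooth_at: "smooth_at M p g \<Longrightarrow> p \<in> mcarrier N \<Longrightarrow> smooth_at N p g"
  unfolding smooth_at_def using restrict_smooth by blast

lemma push_apply: "smooth_at M p g \<Longrightarrow> push p v g = v g"
  by (simp add: pushforward_def)

lemma distribution_tangent:
  assumes "p \<in> mcarrier N" shows "hamiltonian_distribution M P s f p \<subseteq> tangent_space M p"
  unfolding hamiltonian_distribution_def
  by (rule fun_vs.span_minimal[OF _ tangent_subspace]) (auto intro: ham_tangent N_subset assms)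

lemma push_tangent: "p \<in> mcarrier N \<Longrightarrow> v \<in> tangent_space N p \<Longrightarrow> push p v \<in> tangent_space M p"
  using push_image distribution_tangent by blast

text \<open>Ambient coordinates restricted to \<open>N\<close> are not a chart of \<open>N\<close>,
  but injectivity of the pushforward makes them detect tangent vectors of \<open>N\<close>.
  Identities on \<open>N\<close> are thereby reduced to computations in \<open>M\<close>.\<close>

lemma restricted_tangent_eqI:
  assumes c: "(V, \<psi>) \<in> mcharts M" "p \<in> V" and p: "p \<in> mcarrier N"
    and v: "v \<in> tangent_space N p" and w: "w \<in> tangent_space N p"
    and eq: "\<And>k. k < mdim M \<Longrightarrow> v (\<lambda>q. \<psi> q k) = w (\<lambda>q. \<psi> q k)"
  shows "v = w"
proof -
  have "push p v = push p w"
    by (rule tangent_eqI[OF c push_tangent[OF p v] push_tangent[OF p w]])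
       (simp add: push_apply smooth_at_coordinate[OF c] eq)
  then show ?thesis using push_inj[OF p] v w by (auto dest: inj_onD)
qed

text \<open>The Hamiltonian field \<open>X i\<close> read as a field on \<open>N\<close>. It is
  obtained pointwise by inverting the injective pushforward, so its smoothness in the structure of
  \<open>N\<close> is a separate matter.\<close>

definition Y :: "nat \<Rightarrow> 'a \<Rightarrow> 'a tangent" where
  "Y i p = inv_into (tangent_space N p) (push p) (X i p)"

lemma
  assumes i: "i < s" and p: "p \<in> mcarrier N"
  shows Y_tangent: "Y i p \<in> tangent_space N p" and push_Y: "push p (Y i p) = X i p"
proof -
  have "X i p \<in> push p ` tangent_space N p"
    unfolding push_image[OF p] hamiltonian_distribution_def using i by (intro fun_vs.span_base) auto
  then show "Y i p \<in> tangent_space N p" "push p (Y i p) = X i p"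
    unfolding Y_def by (rule inv_into_into, rule f_inv_into_f)
qed

lemma Y_apply: "i < s \<Longrightarrow> p \<in> mcarrier N \<Longrightarrow> smooth_at M p g \<Longrightarrow> Y i p g = X i p g"
  by (metis push_Y push_apply)

text \<open>The distribution is the span of the \<open>X i\<close> and is also the image of the
  tangent space of \<open>N\<close>; an expansion of the image vector pulls back because ambient
  coordinates separate tangent vectors of \<open>N\<close>.\<close>

lemma Y_span:
  assumes p: "p \<in> mcarrier N" and v: "v \<in> tangent_space N p"
  obtains a where "v = (\<Sum>i<s. fun_scale (a i) (Y i p))"
proof -
  obtain V \<psi> where c: "(V, \<psi>) \<in> mcharts M" "p \<in> V" using chart_exists[OF N_subset[OF p]] by blast
  have "push p v \<in> fun_vs.span ((\<lambda>i. X i p) ` {..<s})"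
    using push_image[OF p] v unfolding hamiltonian_distribution_def by blast
  then obtain a where a: "push p v = (\<Sum>i<s. fun_scale (a i) (X i p))"
    by (rule span_familyE[OF finite_lessThan])
  note S = N.tangent_subspace[OF p]
  have "v = (\<Sum>i<s. fun_scale (a i) (Y i p))"
  proof (rule restricted_tangent_eqI[OF c p v])
    show "(\<Sum>i<s. fun_scale (a i) (Y i p)) \<in> tangent_space N p"
      by (intro fun_vs.subspace_sum[OF S] fun_vs.subspace_scale[OF S] Y_tangent[OF _ p]) simp
    fix k
    have sm: "smooth_at M p (\<lambda>q. \<psi> q k)" by (rule smooth_at_coordinate[OF c])
    have "v (\<lambda>q. \<psi> q k) = (\<Sum>i<s. fun_scale (a i) (X i p)) (\<lambda>q. \<psi> q k)"
      using push_apply[OF sm, of v] a by simp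
    then show "v (\<lambda>q. \<psi> q k) = (\<Sum>i<s. fun_scale (a i) (Y i p)) (\<lambda>q. \<psi> q k)"
      by (simp add: sum_fun_apply Y_apply[OF _ p sm])
  qed
  then show thesis by (rule that)
qed

text \<open>The coefficients of a field \<open>Y i\<close> in a chart of \<open>N\<close> solve a linear system whose matrix, the Gram
  matrix of the inclusion, is smooth and invertible because the inclusion is an immersion.\<close>

lemma Y_coefficient_smooth:
  assumes c: "(U, \<phi>) \<in> mcharts N" and i: "i < s" and l: "l < mdim N"
  shows "smooth_fun_on N U (\<lambda>q. Y i q (\<lambda>x. \<phi> x l))"
proof (rule N.smooth_fun_on_local)
  fix p assume pU: "p \<in> U"
  then have p: "p \<in> mcarrier N" using N.chart_subset[OF c] by blast
  obtain V \<psi> where d: "(V, \<psi>) \<in> mcharts M" "p \<in> V" using chart_exists[OF N_subset[OF p]] by blast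
  define W where "W = U \<inter> (mcarrier N \<inter> V)"
  have coordN: "smooth_fun_on N (mcarrier N \<inter> V) (\<lambda>q. \<psi> q k)" for k
    by (rule restrict_smooth[OF smooth_fun_on_coordinate[OF d(1)]])
  have W: "openin (mtop N) W" "p \<in> W"
    unfolding W_def using N.chart_open[OF c] smooth_fun_on_open N.smooth_fun_on_open[OF coordN] pU p d by auto
  define J where "J l k q = N.chart_partial (U, \<phi>) l (\<lambda>x. \<psi> x k) q" for l k q
  have J: "smooth_fun_on N W (J l k)" if "l < mdim N" for l k
    using N.smooth_fun_on_chart_partial[OF c coordN that, of k] unfolding J_def W_def .
  define \<eta> where "\<eta> k q = poisson_bracket M P (f i) (\<lambda>x. \<psi> x k) q" for k q
  have \<eta>: "smooth_fun_on N W (\<eta> k)" for k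
  proof -
    have "smooth_fun_on M V (f i)"
      by (rule smooth_fun_on_subset[OF f_smooth[OF i] chart_open[OF d(1)] chart_subset[OF d(1)]])
    then have "smooth_fun_on M V (poisson_bracket M P (f i) (\<lambda>x. \<psi> x k))"
      by (rule bracket_smooth[OF _ smooth_fun_on_coordinate[OF d(1)]])
    from restrict_smooth[OF this] show ?thesis
      unfolding \<eta>_def by (rule N.smooth_fun_on_subset[OF _ W(1)]) (auto simp: W_def)
  qed
  \<comment> \<open>\<open>J\<close> is the Jacobian of the inclusion, in general not square.
    Contracting the ambient index gives a square system for the unknown components, with the Gram
    matrix \<open>Q\<close>.\<close>
  define Q where "Q q l l' = (\<Sum>k<mdim M. J l k q * J l' k q)" for q l l'
  define b where "b q l = (\<Sum>k<mdim M. \<eta> k q * J l k q)" for q l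
  have sys: "(\<Sum>j<mdim N. Y i q (\<lambda>x. \<phi> x j) * Q q j l) = b q l" if q: "q \<in> W" for q l
  proof -
    have qN: "q \<in> mcarrier N" "q \<in> U" "q \<in> V" using q by (auto simp: W_def)
    have "\<eta> k q = (\<Sum>j<mdim N. Y i q (\<lambda>x. \<phi> x j) * J j k q)" for k
    proof -
      have "\<eta> k q = X i q (\<lambda>x. \<psi> x k)"
        unfolding \<eta>_def by (rule ham_bracket[symmetric, OF smooth_at_coordinate[OF d(1) qN(3)]])
      also have "\<dots> = Y i q (\<lambda>x. \<psi> x k)"
        by (rule Y_apply[symmetric, OF i qN(1) smooth_at_coordinate[OF d(1) qN(3)]])
      also have "\<dots> = (\<Sum>j<mdim N. Y i q (\<lambda>x. \<phi> x j) * J j k q)"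
        unfolding J_def
        by (rule N.tangent_expand[OF c qN(2) Y_tangent[OF i qN(1)] restrict_smooth_at[OF smooth_at_coordinate[OF d(1) qN(3)] qN(1)]])
      finally show ?thesis .
    qed
    then have "b q l = (\<Sum>k<mdim M. \<Sum>j<mdim N. Y i q (\<lambda>x. \<phi> x j) * (J j k q * J l k q))"
      unfolding b_def by (simp add: sum_distrib_right mult.assoc)
    also have "\<dots> = (\<Sum>j<mdim N. \<Sum>k<mdim M. Y i q (\<lambda>x. \<phi> x j) * (J j k q * J l k q))" by (rule sum.swap)
    finally show ?thesis by (simp add: Q_def sum_distrib_left)
  qed
  have det: "mdet (mdim N) (Q q) \<noteq> 0" if q: "q \<in> W" for q
  proof
    assume "mdet (mdim N) (Q q) = 0"
    from mdet_zero_kernel[OF this]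
    obtain a where a: "\<exists>j<mdim N. a j \<noteq> 0" "\<And>i. i < mdim N \<Longrightarrow> (\<Sum>j<mdim N. Q q i j * a j) = 0"
      by blast
    have qN: "q \<in> mcarrier N" "q \<in> U" "q \<in> V" using q by (auto simp: W_def)
    \<comment> \<open>Pairing the kernel vector with itself gives the squared length of its image in
      ambient coordinates, so this image is 0 and injectivity is contradicted.\<close>
    have "0 = (\<Sum>i<mdim N. a i * (\<Sum>j<mdim N. Q q i j * a j))" using a(2) by simp
    also have "\<dots> = (\<Sum>i<mdim N. \<Sum>j<mdim N. \<Sum>k<mdim M. (a i * J i k q) * (a j * J j k q))"
      by (simp add: Q_def sum_distrib_left sum_distrib_right mult_ac)
    also have "\<dots> = (\<Sum>i<mdim N. \<Sum>k<mdim M. \<Sum>j<mdim N. (a i * J i k q) * (a j * J j k q))"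
      by (rule sum.cong[OF refl]) (rule sum.swap)
    also have "\<dots> = (\<Sum>k<mdim M. \<Sum>i<mdim N. \<Sum>j<mdim N. (a i * J i k q) * (a j * J j k q))" by (rule sum.swap)
    also have "\<dots> = (\<Sum>k<mdim M. (\<Sum>i<mdim N. a i * J i k q) ^ 2)"
      by (simp add: power2_eq_square sum_product)
    finally have "(\<Sum>k<mdim M. (\<Sum>i<mdim N. a i * J i k q) ^ 2) = 0" by simp
    then have z: "(\<Sum>i<mdim N. a i * J i k q) = 0" if "k < mdim M" for k
      using that by (subst (asm) sum_nonneg_eq_0_iff) auto
    have "N.tvec (U, \<phi>) q a = 0"
    proof (rule restricted_tangent_eqI[OF d(1) qN(3,1) N.tvec_tangent[OF c qN(2)] fun_vs.subspace_0[OF N.tangent_subspace[OF qN(1)]]])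
      fix k assume "k < mdim M"
      then show "N.tvec (U, \<phi>) q a (\<lambda>q. \<psi> q k) = 0 (\<lambda>q. \<psi> q k)"
        using z unfolding N.tvec_def J_def by simp
    qed
    then show False using a(1) N.tvec_coordinate[OF c qN(2), of _ a] by auto
  qed
  have Qs: "smooth_fun_on N W (\<lambda>q. Q q i j)" if "i < mdim N" "j < mdim N" for i j
    unfolding Q_def by (intro N.smooth_fun_on_sum W(1) N.smooth_fun_on_mult J that)
  have bs: "smooth_fun_on N W (\<lambda>q. b q j)" if "j < mdim N" for j
    unfolding b_def by (intro N.smooth_fun_on_sum W(1) N.smooth_fun_on_mult J \<eta> that)
  have "smooth_fun_on N W (\<lambda>q. inverse (mdet (mdim N) (Q q)) * (\<Sum>k<mdim N. b q k * madj (mdim N) (Q q) k l))"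
    by (intro N.smooth_fun_on_mult N.smooth_fun_on_inverse N.smooth_fun_on_mdet N.smooth_fun_on_sum
        N.smooth_fun_on_madj W(1) Qs bs det l) auto
  then have "smooth_fun_on N W (\<lambda>q. Y i q (\<lambda>x. \<phi> x l))"
    by (rule N.smooth_fun_on_cong) (rule madj_solve[symmetric, OF det sys l])
  then show "\<exists>W'. p \<in> W' \<and> W' \<subseteq> U \<and> smooth_fun_on N W' (\<lambda>q. Y i q (\<lambda>x. \<phi> x l))"
    using W by (intro exI[of _ W]) (auto simp: W_def)
qed

lemma Y_smooth_vf:
  assumes i: "i < s" shows "N.smooth_vf (Y i)"
  unfolding N.smooth_vf_def
proof (intro conjI ballI allI impI Y_tangent[OF i])
  fix W h assume h: "smooth_fun_on N W h"
  show "smooth_fun_on N W (\<lambda>q. Y i q h)"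
  proof (rule N.smooth_fun_on_local)
    fix p assume p: "p \<in> W"
    then have "p \<in> mcarrier N" using openin_subset[OF N.smooth_fun_on_open[OF h]] by blast
    then obtain U \<phi> where c: "(U, \<phi>) \<in> mcharts N" "p \<in> U" by (rule N.chart_exists)
    have op: "openin (mtop N) (U \<inter> W)" using N.chart_open[OF c(1)] N.smooth_fun_on_open[OF h] by blast
    have "smooth_fun_on N (U \<inter> W) (\<lambda>q. \<Sum>j<mdim N. Y i q (\<lambda>x. \<phi> x j) * N.chart_partial (U, \<phi>) j h q)"
    proof (rule N.smooth_fun_on_sum[OF op])
      fix j assume "j \<in> {..<mdim N}"
      then have j: "j < mdim N" by simp
      show "smooth_fun_on N (U \<inter> W) (\<lambda>q. Y i q (\<lambda>x. \<phi> x j) * N.chart_partial (U, \<phi>) j h q)"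
      proof (rule N.smooth_fun_on_mult)
        show "smooth_fun_on N (U \<inter> W) (\<lambda>q. Y i q (\<lambda>x. \<phi> x j))"
          by (rule N.smooth_fun_on_subset[OF Y_coefficient_smooth[OF c(1) i j] op]) simp
        show "smooth_fun_on N (U \<inter> W) (N.chart_partial (U, \<phi>) j h)"
          by (rule N.smooth_fun_on_chart_partial[OF c(1) h j])
      qed
    qed
    then have "smooth_fun_on N (U \<inter> W) (\<lambda>q. Y i q h)"
    proof (rule N.smooth_fun_on_cong)
      fix q assume q: "q \<in> U \<inter> W"
      then have "q \<in> mcarrier N" using N.chart_subset[OF c(1)] by blast
      then show "(\<Sum>j<mdim N. Y i q (\<lambda>x. \<phi> x j) * N.chart_partial (U, \<phi>) j h q) = Y i q h"
        using N.tangent_expand[OF c(1) _ Y_tangent[OF i] N.smooth_atI[OF h], of q] q by simp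
    qed
    then show "\<exists>W'. p \<in> W' \<and> W' \<subseteq> W \<and> smooth_fun_on N W' (\<lambda>q. Y i q h)"
      using p c(2) by (intro exI[of _ "U \<inter> W"]) auto
  qed
qed

text \<open>On an ambient coordinate \<open>Y b\<close> produces the restriction of a bracket
  defined on \<open>M\<close>, so the second field may again be replaced by the ambient one, and the
  commutation of Hamiltonian fields applies. Coordinates suffice because the commutator is a tangent
  vector.\<close>

lemma Y_commute:
  assumes i: "i < s" and j: "j < s" and p: "p \<in> mcarrier N"
  shows "N.commutator (Y i) (Y j) p = 0"
proof -
  obtain V \<psi> where d: "(V, \<psi>) \<in> mcharts M" "p \<in> V" using chart_exists[OF N_subset[OF p]] by blast
  have coord: "smooth_fun_on M V (\<lambda>q. \<psi> q k)" for k by (rule smooth_fun_on_coordinate[OF d(1)])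
  have second: "Y a p (\<lambda>q. Y b q (\<lambda>x. \<psi> x k)) = X a p (poisson_bracket M P (f b) (\<lambda>x. \<psi> x k))"
    if a: "a < s" and b: "b < s" for a b k
  proof -
    have "smooth_fun_on M V (f b)"
      by (rule smooth_fun_on_subset[OF f_smooth[OF b] chart_open[OF d(1)] chart_subset[OF d(1)]])
    then have sm: "smooth_at M p (poisson_bracket M P (f b) (\<lambda>x. \<psi> x k))"
      by (rule smooth_atI[OF bracket_smooth[OF _ coord] d(2)])
    have op: "openin (mtop N) (mcarrier N \<inter> V)" by (rule N.smooth_fun_on_open[OF restrict_smooth[OF coord]])
    have "Y a p (poisson_bracket M P (f b) (\<lambda>x. \<psi> x k)) = Y a p (\<lambda>q. Y b q (\<lambda>x. \<psi> x k))"
    proof (rule N.tangent_cong[OF Y_tangent[OF a p] restrict_smooth_at[OF sm p] op])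
      fix q assume q: "q \<in> mcarrier N \<inter> V"
      then have "smooth_at M q (\<lambda>x. \<psi> x k)" by (intro smooth_at_coordinate[OF d(1)]) auto
      then show "poisson_bracket M P (f b) (\<lambda>x. \<psi> x k) q = Y b q (\<lambda>x. \<psi> x k)"
        using Y_apply[OF b] ham_bracket q by simp
    qed (use p d in auto)
    then show ?thesis using Y_apply[OF a p sm] by simp
  qed
  show ?thesis
  proof (rule restricted_tangent_eqI[OF d p N.commutator_tangent[OF Y_smooth_vf[OF i] Y_smooth_vf[OF j] p]
        fun_vs.subspace_0[OF N.tangent_subspace[OF p]]])
    fix k
    show "N.commutator (Y i) (Y j) p (\<lambda>q. \<psi> q k) = 0 (\<lambda>q. \<psi> q k)"
      using second[OF i j, of k] second[OF j i, of k]
        ham_commute[OF f_smooth[OF i] f_smooth[OF j] involution[OF i j] coord d(2), of k]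
      by (simp add: N.commutator_def)
  qed
qed

end

section \<open>The dimension of the integral manifold\<close>

context involutive_integral begin

lemma push_sum: "push p (\<Sum>i\<in>I. fun_scale (c i) (v i)) = (\<Sum>i\<in>I. fun_scale (c i) (push p (v i)))"
  by (intro ext) (simp add: pushforward_def sum_fun_apply)

lemma P_sum_right:
  assumes p: "p \<in> mcarrier M" and \<omega>: "\<omega> \<in> cotangent_space M p" and \<eta>: "\<And>k. k \<in> K \<Longrightarrow> \<eta> k \<in> cotangent_space M p"
  shows "P p \<omega> (\<Sum>k\<in>K. fun_scale (c k) (\<eta> k)) = (\<Sum>k\<in>K. c k * P p \<omega> (\<eta> k))"
  using \<eta>
proof (induction K rule: infinite_finite_induct)
  case (insert k K)
  note S = cotangent_subspace[OF p]
  have m: "fun_scale (c k) (\<eta> k) \<in> cotangent_space M p" "(\<Sum>k\<in>K. fun_scale (c k) (\<eta> k)) \<in> cotangent_space M p"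
    using insert.prems by (auto intro!: fun_vs.subspace_scale[OF S] fun_vs.subspace_sum[OF S])
  have "P p \<omega> (\<Sum>k\<in>insert k K. fun_scale (c k) (\<eta> k)) = P p \<omega> (fun_scale (c k) (\<eta> k)) + P p \<omega> (\<Sum>k\<in>K. fun_scale (c k) (\<eta> k))"
    unfolding sum.insert[OF insert.hyps] by (rule P_add_right[OF p m \<omega>])
  also have "P p \<omega> (fun_scale (c k) (\<eta> k)) = c k * P p \<omega> (\<eta> k)"
    by (rule P_scale_right[OF p _ \<omega> \<omega>]) (simp add: insert.prems)
  also have "P p \<omega> (\<Sum>k\<in>K. fun_scale (c k) (\<eta> k)) = (\<Sum>k\<in>K. c k * P p \<omega> (\<eta> k))"
    by (rule insert.IH) (simp add: insert.prems)
  finally show ?case by (simp only: sum.insert[OF insert.hyps])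
qed (simp_all add: P_zero_right[OF p \<omega>])

context
  fixes m assumes m: "m \<in> mcarrier N"
    and df_inj: "inj_on (\<lambda>i. differential M (f i) m) {..<s}"
    and df_indep: "fun_vs.independent ((\<lambda>i. differential M (f i) m) ` {..<s})"
begin

lemma mdim_N_le: "mdim N + s \<le> mdim M"
proof -
  have mM: "m \<in> mcarrier M" by (rule N_subset[OF m])
  obtain U \<phi> where c: "(U, \<phi>) \<in> mcharts N" "m \<in> U" by (rule N.chart_exists[OF m])
  obtain V \<psi> where d: "(V, \<psi>) \<in> mcharts M" "m \<in> V" by (rule chart_exists[OF mM])
  let ?e = "N.unit_tvec (U, \<phi>) m"
  have e: "?e j \<in> tangent_space N m" for j unfolding N.unit_tvec_def by (rule N.tvec_tangent[OF c])
  have ind: "a j = 0" if z: "(\<Sum>j<mdim N. fun_scale (a j) (push m (?e j))) = 0" and j: "j \<in> {..<mdim N}" for a j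
  proof -
    have "N.tvec (U, \<phi>) m a = 0"
    proof (rule restricted_tangent_eqI[OF d m N.tvec_tangent[OF c] fun_vs.subspace_0[OF N.tangent_subspace[OF m]]])
      fix k
      have "push m (N.tvec (U, \<phi>) m a) = 0" unfolding N.tvec_eq_sum push_sum by (rule z)
      then have "push m (N.tvec (U, \<phi>) m a) (\<lambda>q. \<psi> q k) = 0" by simp
      then show "N.tvec (U, \<phi>) m a (\<lambda>q. \<psi> q k) = 0 (\<lambda>q. \<psi> q k)"
        by (simp add: push_apply[OF smooth_at_coordinate[OF d]])
    qed
    then show ?thesis using N.tvec_coordinate[OF c, of j a] j by simp
  qed
  have inj: "inj_on (\<lambda>j. push m (?e j)) {..<mdim N}"
    by (rule independent_familyI(1)) (simp, erule (1) ind)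
  have D: "fun_vs.independent ((\<lambda>j. push m (?e j)) ` {..<mdim N})"
    by (rule independent_familyI(2)) (simp, erule (1) ind)
  have ann: "differential M (f i) m v = 0" if "i < s" "v \<in> hamiltonian_distribution M P s f m" for i v
  proof -
    let ?Z = "{v \<in> tangent_space M m. differential M (f i) m v = 0}"
    note dc = differential_cotangent[OF mM, of "f i"] and S = tangent_subspace[OF mM]
    have "hamiltonian_distribution M P s f m \<subseteq> ?Z"
      unfolding hamiltonian_distribution_def
    proof (rule fun_vs.span_minimal)
      show "fun_vs.subspace ?Z"
      proof (rule fun_vs.subspaceI)
        show "0 \<in> ?Z" using fun_vs.subspace_0[OF S] by (simp add: differential_def)
        fix v w assume "v \<in> ?Z" "w \<in> ?Z"
        then have vw: "v \<in> tangent_space M m" "w \<in> tangent_space M m" "differential M (f i) m v = 0" "differential M (f i) m w = 0"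
          by auto
        show "v + w \<in> ?Z"
          using cotangent_add[OF dc vw(1,2)] fun_vs.subspace_add[OF S vw(1,2)] vw(3,4) by (intro CollectI) linarith
      next
        fix b v assume "v \<in> ?Z"
        then have v: "v \<in> tangent_space M m" "differential M (f i) m v = 0" by auto
        show "fun_scale b v \<in> ?Z"
          using cotangent_scale[OF dc v(1), of b] fun_vs.subspace_scale[OF S v(1), of b] v(2) by simp
      qed
      show "(\<lambda>i. X i m) ` {..<s} \<subseteq> ?Z"
      proof (rule image_subsetI)
        fix j assume j: "j \<in> {..<s}"
        have "X j m (f i) = 0"
          using ham_bracket[OF smooth_atI[OF f_smooth[OF that(1)] mM], of "f j"] involution[OF _ that(1) mM, of j] j by simp
        then show "X j m \<in> ?Z"
          using ham_tangent[OF mM] by (simp add: differential_def)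
      qed
    qed
    then show ?thesis using that(2) by blast
  qed
  have pe: "push m (?e j) \<in> hamiltonian_distribution M P s f m" for j using push_image[OF m] e by blast
  have "card ((\<lambda>i. differential M (f i) m) ` {..<s}) + card ((\<lambda>j. push m (?e j)) ` {..<mdim N}) \<le> mdim M"
    by (rule annihilator_card_le(3)[OF mM df_indep _ D])
       (use differential_cotangent[OF mM] distribution_tangent[OF m] pe ann in auto)
  then show ?thesis by (simp add: card_image[OF df_inj] card_image[OF inj])
qed

text \<open>The count is made on the image of \<open>P\<close> at \<open>m\<close>. Complete the
  differentials of the \<open>f i\<close> to a basis of covectors: the image is spanned by an
  independent subfamily of the fields together with at most \<open>mdim M - s = r\<close> further
  vectors. Rank \<open>2 * r\<close> leaves at least \<open>r\<close> independent fields, all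
  tangent to \<open>N\<close>.\<close>

lemma mdim_N_ge:
  assumes "rank_at M P m = 2 * r" "r + s = mdim M"
  shows "r \<le> mdim N"
proof -
  have mM: "m \<in> mcarrier M" by (rule N_subset[OF m])
  obtain U \<phi> where c: "(U, \<phi>) \<in> mcharts N" "m \<in> U" by (rule N.chart_exists[OF m])
  obtain V \<psi> where d: "(V, \<psi>) \<in> mcharts M" "m \<in> V" by (rule chart_exists[OF mM])
  let ?df = "\<lambda>i. differential M (f i) m" and ?T = "cotangent_space M m"
  let ?e = "N.unit_tvec (U, \<phi>) m"
  note dc = differential_cotangent[OF mM]
  have DN: "hamiltonian_distribution M P s f m \<subseteq> fun_vs.span ((\<lambda>j. push m (?e j)) ` {..<mdim N})"
  proof
    fix v assume "v \<in> hamiltonian_distribution M P s f m"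
    then obtain w where w: "w \<in> tangent_space N m" "v = push m w" using push_image[OF m] by blast
    have "w \<in> fun_vs.span (?e ` {..<mdim N})" using w(1) N.tangent_span_unit[OF c] by simp
    then obtain a where "w = (\<Sum>j<mdim N. fun_scale (a j) (?e j))" by (rule span_familyE[OF finite_lessThan])
    then have "v = (\<Sum>j<mdim N. fun_scale (a j) (push m (?e j)))" using w(2) push_sum by simp
    then show "v \<in> fun_vs.span ((\<lambda>j. push m (?e j)) ` {..<mdim N})"
      by (simp only:) (intro fun_vs.span_sum fun_vs.span_scale fun_vs.span_base, auto)
  qed
  obtain B where B: "B \<subseteq> (\<lambda>i. X i m) ` {..<s}" "fun_vs.independent B" "(\<lambda>i. X i m) ` {..<s} \<subseteq> fun_vs.span B"
    using fun_vs.maximal_independent_subset by blast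
  obtain I0 where I0: "I0 \<subseteq> {..<s}" "inj_on (\<lambda>i. X i m) I0" "B = (\<lambda>i. X i m) ` I0"
    using B(1) by (auto simp: subset_image_inj)
  have fI0: "finite I0" using I0(1) finite_subset by blast
  have "B \<subseteq> fun_vs.span ((\<lambda>j. push m (?e j)) ` {..<mdim N})"
  proof (rule order_trans[OF _ DN])
    show "B \<subseteq> hamiltonian_distribution M P s f m"
      unfolding hamiltonian_distribution_def using B(1) fun_vs.span_superset by blast
  qed
  then have "card B \<le> card ((\<lambda>j. push m (?e j)) ` {..<mdim N})"
    using fun_vs.independent_span_bound[OF _ B(2)] by simp
  also have "\<dots> \<le> mdim N" using card_image_le[of "{..<mdim N}"] by simp
  finally have cI0: "card I0 \<le> mdim N" using I0 by (simp add: card_image)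
  have "?df ` {..<s} \<subseteq> ?T" using dc by auto
  from fun_vs.maximal_independent_subset_extend[OF this df_indep]
  obtain A where A: "?df ` {..<s} \<subseteq> A" "A \<subseteq> ?T" "fun_vs.independent A" "?T \<subseteq> fun_vs.span A" by blast
  have "finite A \<and> card A \<le> card ((\<lambda>j. differential M (\<lambda>q. \<psi> q j) m) ` {..<mdim M})"
    by (rule fun_vs.independent_span_bound[OF _ A(3)]) (use A(2) cotangent_span_coordinates[OF d] in auto)
  moreover have "card ((\<lambda>j. differential M (\<lambda>q. \<psi> q j) m) ` {..<mdim M}) \<le> mdim M"
    using card_image_le[of "{..<mdim M}"] by simp
  ultimately have fA: "finite A" "card A \<le> mdim M" by auto
  \<comment> \<open>A spanning set for the image of \<open>P\<close>: the selected fields, and one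
    vector for each basis covector outside the differentials of the \<open>f i\<close>.\<close>
  define S where "S = (\<lambda>i. P m (?df i)) ` I0 \<union> P m ` (A - ?df ` {..<s})"
  have fS: "finite S" using fI0 fA by (simp add: S_def)
  let ?Z = "{\<omega> \<in> ?T. P m \<omega> \<in> fun_vs.span S}"
  have "?T \<subseteq> ?Z"
  proof (rule order_trans[OF A(4)], rule fun_vs.span_minimal)
    note CS = cotangent_subspace[OF mM]
    show "fun_vs.subspace ?Z"
    proof (rule fun_vs.subspaceI)
      have z: "P m 0 = 0"
      proof
        fix \<eta>
        have "P m (fun_scale 0 0) \<eta> = 0 * P m 0 \<eta>" if "\<eta> \<in> ?T"
          by (rule P_scale_left[OF mM _ _ that]) (rule fun_vs.subspace_0[OF CS])+
        then show "P m 0 \<eta> = 0 \<eta>" using P_outside[OF mM, of 0 \<eta>] by (cases "\<eta> \<in> ?T") (auto simp: zero_fun_def)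
      qed
      show "0 \<in> ?Z" using fun_vs.subspace_0[OF CS] fun_vs.span_zero[of S] by (simp add: z)
    next
      fix \<omega> \<eta> assume "\<omega> \<in> ?Z" "\<eta> \<in> ?Z"
      then have *: "\<omega> \<in> ?T" "\<eta> \<in> ?T" "P m \<omega> \<in> fun_vs.span S" "P m \<eta> \<in> fun_vs.span S" by auto
      have "P m (\<omega> + \<eta>) = P m \<omega> + P m \<eta>"
      proof
        fix \<theta>
        show "P m (\<omega> + \<eta>) \<theta> = (P m \<omega> + P m \<eta>) \<theta>"
          using P_add_left[OF mM *(1,2), of \<theta>] P_outside[OF mM, of _ \<theta>] by (cases "\<theta> \<in> ?T") auto
      qed
      then show "\<omega> + \<eta> \<in> ?Z" using fun_vs.subspace_add[OF CS *(1,2)] fun_vs.span_add[OF *(3,4)] by simp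
    next
      fix b \<omega> assume "\<omega> \<in> ?Z"
      then have *: "\<omega> \<in> ?T" "P m \<omega> \<in> fun_vs.span S" by auto
      have "P m (fun_scale b \<omega>) = fun_scale b (P m \<omega>)"
      proof
        fix \<theta>
        show "P m (fun_scale b \<omega>) \<theta> = b * P m \<omega> \<theta>"
          using P_scale_left[OF mM *(1,1), of \<theta> b] P_outside[OF mM, of _ \<theta>] by (cases "\<theta> \<in> ?T") auto
      qed
      then show "fun_scale b \<omega> \<in> ?Z" using fun_vs.subspace_scale[OF CS *(1)] fun_vs.span_scale[OF *(2)] by simp
    qed
    show "A \<subseteq> ?Z"
    proof
      fix a assume a: "a \<in> A"
      show "a \<in> ?Z"
      proof (cases "a \<in> ?df ` {..<s}")
        case False
        then have "P m a \<in> fun_vs.span S" using a by (intro fun_vs.span_base) (auto simp: S_def)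
        then show ?thesis using a A(2) by blast
      next
        case True
        then obtain i where i: "i < s" "a = ?df i" by auto
        have "X i m \<in> fun_vs.span ((\<lambda>i. X i m) ` I0)" using B(3) i(1) I0(3) by auto
        then obtain b where b: "X i m = (\<Sum>j\<in>I0. fun_scale (b j) (X j m))" by (rule span_familyE[OF fI0])
        \<comment> \<open>The relation is one between derivations, so it is known only on
          differentials of smooth functions. Coordinate differentials span the covectors, which
          carries it over to \<open>P m\<close> as a function on the cotangent space.\<close>
        have on_coord: "P m (?df i) (differential M (\<lambda>q. \<psi> q k) m) = (\<Sum>j\<in>I0. b j * P m (?df j) (differential M (\<lambda>q. \<psi> q k) m))" for k
          using fun_cong[OF b, of "\<lambda>q. \<psi> q k"] smooth_at_coordinate[OF d]
          by (simp add: sum_fun_apply hamiltonian_vf_def)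
        have "P m (?df i) \<eta> = (\<Sum>j\<in>I0. fun_scale (b j) (P m (?df j))) \<eta>" for \<eta>
        proof (cases "\<eta> \<in> ?T")
          case True
          define h where "h k = \<eta> (unit_tvec (V, \<psi>) m k)" for k
          have \<eta>: "\<eta> = (\<Sum>k<mdim M. fun_scale (h k) (differential M (\<lambda>q. \<psi> q k) m))"
            unfolding h_def by (rule cotangent_expand[OF d True])
          have ex: "P m (?df j) \<eta> = (\<Sum>k<mdim M. h k * P m (?df j) (differential M (\<lambda>q. \<psi> q k) m))" for j
            by (subst \<eta>) (rule P_sum_right[OF mM dc dc])
          have "P m (?df i) \<eta> = (\<Sum>k<mdim M. \<Sum>j\<in>I0. b j * (h k * P m (?df j) (differential M (\<lambda>q. \<psi> q k) m)))"
            unfolding ex on_coord by (simp add: sum_distrib_left mult.left_commute)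
          also have "\<dots> = (\<Sum>j\<in>I0. \<Sum>k<mdim M. b j * (h k * P m (?df j) (differential M (\<lambda>q. \<psi> q k) m)))"
            by (rule sum.swap)
          also have "\<dots> = (\<Sum>j\<in>I0. b j * P m (?df j) \<eta>)" unfolding ex by (simp add: sum_distrib_left)
          finally show ?thesis by (simp add: sum_fun_apply)
        qed (simp add: sum_fun_apply P_outside[OF mM])
        then have "P m a = (\<Sum>j\<in>I0. fun_scale (b j) (P m (?df j)))" unfolding i(2) by (intro ext)
        moreover have "(\<Sum>j\<in>I0. fun_scale (b j) (P m (?df j))) \<in> fun_vs.span S"
          by (intro fun_vs.span_sum fun_vs.span_scale fun_vs.span_base) (auto simp: S_def)
        ultimately show ?thesis using a A(2) by auto
      qed
    qed
  qed
  then have PS: "P m ` ?T \<subseteq> fun_vs.span S" by blast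
  have "2 * r \<le> card S" using fun_vs.dim_le_card[OF PS fS] assms(1) by (simp add: rank_at_def)
  also have "\<dots> \<le> card ((\<lambda>i. P m (?df i)) ` I0) + card (P m ` (A - ?df ` {..<s}))"
    unfolding S_def by (rule card_Un_le)
  also have "\<dots> \<le> card I0 + card (A - ?df ` {..<s})"
    using fI0 fA by (intro add_mono card_image_le) auto
  also have "card (A - ?df ` {..<s}) = card A - s"
    using A(1) by (subst card_Diff_subset) (auto simp: card_image[OF df_inj])
  finally show ?thesis using cI0 fA(2) assms(2) by linarith
qed

end

end

section \<open>Commuting vector fields spanning the tangent spaces\<close>

lemma madj_inverse_left:
  assumes "mdet n A \<noteq> 0" "l < n"
  shows "(\<Sum>k<n. (\<Sum>j<n. v j * madj n A j k) * A k l) = mdet n A * v l"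
proof -
  have "(\<Sum>k<n. (\<Sum>j<n. v j * madj n A j k) * A k l) = (\<Sum>j<n. v j * (\<Sum>k<n. madj n A j k * A k l))"
    by (simp add: sum_distrib_left sum_distrib_right mult.assoc) (rule sum.swap)
  also have "\<dots> = (\<Sum>j<n. v j * (if j = l then mdet n A else 0))"
    using assms(2) by (intro sum.cong refl arg_cong2[where f = "(*)"]) (simp add: madj_mult(1))
  also have "\<dots> = mdet n A * v l"
    using assms(2) by (simp add: if_distrib sum.delta cong: if_cong)
  finally show ?thesis .
qed

lemma mdet_nonzero_rows:
  assumes "mdet n A \<noteq> 0" "\<And>l. l < n \<Longrightarrow> (\<Sum>k<n. c k * A k l) = 0" "k < n"
  shows "c k = 0"
  using mdet_rows_dependent[of k n c A] assms by blast

lemma mdet_nonzero_cols: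
  assumes "mdet n A \<noteq> 0" "\<And>k. k < n \<Longrightarrow> (\<Sum>l<n. A k l * c l) = 0" "l < n"
  shows "c l = 0"
proof -
  have "c l * mdet n A = (\<Sum>j<n. (if l = j then mdet n A else 0) * c j)"
  proof -
    have "(\<Sum>j<n. (if l = j then mdet n A else 0) * c j) = (\<Sum>j<n. if j = l then mdet n A * c l else 0)"
      by (intro sum.cong) auto
    then show ?thesis using assms(3) by simp
  qed
  also have "\<dots> = (\<Sum>j<n. (\<Sum>k<n. madj n A l k * A k j) * c j)"
    using assms(3) by (intro sum.cong refl arg_cong2[where f = "(*)"]) (simp add: madj_mult(1))
  also have "\<dots> = (\<Sum>k<n. madj n A l k * (\<Sum>j<n. A k j * c j))"
    by (simp add: sum_distrib_left sum_distrib_right mult.assoc) (rule sum.swap)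
  also have "\<dots> = 0" using assms(2) by simp
  finally show ?thesis using assms(1) by simp
qed

context smooth_mfd begin

lemma smooth_fun_on_nonzero_open:
  assumes f: "smooth_fun_on M W f"
  shows "openin (mtop M) {q \<in> W. f q \<noteq> 0}"
proof -
  have "openin (subtopology (mtop M) W) {q \<in> topspace (subtopology (mtop M) W). f q \<in> - {0}}"
    by (rule openin_continuous_map_preimage[OF smooth_fun_on_continuous[OF f]]) auto
  then have "openin (mtop M) {q \<in> topspace (subtopology (mtop M) W). f q \<in> - {0}}"
    using openin_trans_full smooth_fun_on_open[OF f] by blast
  also have "{q \<in> topspace (subtopology (mtop M) W). f q \<in> - {0}} = {q \<in> W. f q \<noteq> 0}"
    using openin_subset[OF smooth_fun_on_open[OF f]] by auto
  finally show ?thesis .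
qed

lemma unit_tvec_apply:
  assumes "j < mdim M" "smooth_at M p f"
  shows "unit_tvec c p j f = chart_partial c j f p"
  using assms by (simp add: unit_tvec_def tvec_def sum_delta_mult)

lemma locally_constant:
  assumes f: "smooth_fun_on M W f" and p: "p \<in> W" and z: "\<And>q v. q \<in> W \<Longrightarrow> v \<in> tangent_space M q \<Longrightarrow> v f = 0"
  obtains V where "openin (mtop M) V" "p \<in> V" "V \<subseteq> W" "\<And>q. q \<in> V \<Longrightarrow> f q = f p"
proof -
  have pM: "p \<in> mcarrier M" using openin_subset[OF smooth_fun_on_open[OF f]] p by blast
  obtain U \<phi> where c: "(U, \<phi>) \<in> mcharts M" "p \<in> U" by (rule chart_exists[OF pM])
  obtain e where e: "e > 0" "cube (mdim M) (\<phi> p) e \<subseteq> \<phi> ` (U \<inter> W)"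
    by (rule chart_cube[OF c(1) smooth_fun_on_open[OF f] p c(2)])
  let ?F = "\<lambda>x. f (inv_into U \<phi> x)"
  have F: "smooth_on (mdim M) (\<phi> ` (U \<inter> W)) ?F" by (rule smooth_fun_onD[OF f c(1)])
  have zero: "partial_deriv j ?F x = 0" if j: "j < mdim M" and x: "x \<in> \<phi> ` (U \<inter> W)" for j x
  proof -
    obtain q where q: "q \<in> U" "q \<in> W" "x = \<phi> q" using x by blast
    have "unit_tvec (U, \<phi>) q j f = 0"
      by (rule z[OF q(2)]) (simp add: unit_tvec_def tvec_tangent[OF c(1) q(1)])
    then show ?thesis using unit_tvec_apply[OF j smooth_atI[OF f q(2)], of "(U, \<phi>)"] by (simp add: chart_partial_def q(3))
  qed
  define V where "V = {q \<in> U. \<phi> q \<in> cube (mdim M) (\<phi> p) e}"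
  have pe: "\<phi> p \<in> espace (mdim M)" by (rule chart_espace[OF c])
  show thesis
  proof (rule that[of V])
    show "openin (mtop M) V" unfolding V_def by (rule chart_open_preimage[OF c(1) openin_cube])
    show "p \<in> V" using c(2) centre_in_cube[OF pe e(1)] by (simp add: V_def)
    show "V \<subseteq> W"
    proof
      fix q assume "q \<in> V"
      then have "q \<in> U" "\<phi> q \<in> \<phi> ` (U \<inter> W)" using e(2) by (auto simp: V_def)
      then show "q \<in> W" using chart_inj[OF c(1)] by (auto dest: inj_onD)
    qed
    fix q assume "q \<in> V"
    then have q: "q \<in> U" "\<phi> q \<in> cube (mdim M) (\<phi> p) e" by (auto simp: V_def)
    obtain \<xi> where \<xi>: "\<And>j d. j < mdim M \<Longrightarrow> \<phi> q \<in> cube (mdim M) (\<phi> p) d \<Longrightarrow> \<xi> j \<in> cube (mdim M) (\<phi> p) d"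
      "?F (\<phi> q) - ?F (\<phi> p) = (\<Sum>j<mdim M. partial_deriv j ?F (\<xi> j) * (\<phi> q j - \<phi> p j))"
      by (rule cube_mean_value[OF F pe q(2) e(2)], rule that)
    have "partial_deriv j ?F (\<xi> j) = 0" if "j < mdim M" for j
      by (rule zero[OF that subsetD[OF e(2) \<xi>(1)[OF that q(2)]]])
    then show "f q = f p" using \<xi>(2) c q(1) by simp
  qed
qed

end

text \<open>As many commuting fields as the dimension, but not assumed independent anywhere: where
  they form a basis is tracked point by point, because independence is known at one point first and
  spreads later.\<close>

locale commuting_fields = smooth_mfd M for M :: "'a manifold" +
  fixes Z :: "nat \<Rightarrow> 'a \<Rightarrow> 'a tangent"
  assumes Z_vf: "\<And>k. k < mdim M \<Longrightarrow> smooth_vf (Z k)"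
    and Z_comm: "\<And>j k p. j < mdim M \<Longrightarrow> k < mdim M \<Longrightarrow> p \<in> mcarrier M \<Longrightarrow> commutator (Z j) (Z k) p = 0"
begin

definition A :: "('a \<Rightarrow> nat \<Rightarrow> real) \<Rightarrow> 'a \<Rightarrow> nat \<Rightarrow> nat \<Rightarrow> real" where
  "A \<phi> q k l = Z k q (\<lambda>x. \<phi> x l)"

text \<open>Because the number of fields is the dimension, this amounts to invertibility of the
  matrix \<open>A\<close> in any chart around the point, hence is an open condition; the formulation
  itself is free of charts.\<close>

definition spans :: "'a \<Rightarrow> bool" where
  "spans q \<longleftrightarrow> (\<forall>v\<in>tangent_space M q. \<exists>c. v = (\<Sum>k<mdim M. fun_scale (c k) (Z k q)))"

lemma A_smooth:
  assumes "(U, \<phi>) \<in> mcharts M" "k < mdim M"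
  shows "smooth_fun_on M U (\<lambda>q. A \<phi> q k l)"
  unfolding A_def by (rule smooth_vf_apply[OF Z_vf[OF assms(2)] smooth_fun_on_coordinate[OF assms(1)]])

lemma Z_tangent: "k < mdim M \<Longrightarrow> q \<in> mcarrier M \<Longrightarrow> Z k q \<in> tangent_space M q"
  by (rule smooth_vf_tangent[OF Z_vf])

lemma Z_sum_tangent: "q \<in> mcarrier M \<Longrightarrow> (\<Sum>k<mdim M. fun_scale (c k) (Z k q)) \<in> tangent_space M q"
  by (intro fun_vs.subspace_sum fun_vs.subspace_scale tangent_subspace Z_tangent) auto

text \<open>A kernel vector \<open>d\<close> of the matrix is a combination of the chart
  differentials that kills every \<open>Z k\<close>. It then kills the coordinate vectors, which the
  fields span, so \<open>d\<close> is 0.\<close>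

lemma spans_mdet:
  assumes c: "(U, \<phi>) \<in> mcharts M" "q \<in> U" and s: "spans q"
  shows "mdet (mdim M) (A \<phi> q) \<noteq> 0"
proof
  assume "mdet (mdim M) (A \<phi> q) = 0"
  from mdet_zero_kernel[OF this]
  obtain d where d: "\<exists>j<mdim M. d j \<noteq> 0" "\<And>k. k < mdim M \<Longrightarrow> (\<Sum>l<mdim M. A \<phi> q k l * d l) = 0" by blast
  have "d j = 0" if j: "j < mdim M" for j
  proof -
    have "unit_tvec (U, \<phi>) q j \<in> tangent_space M q" unfolding unit_tvec_def by (rule tvec_tangent[OF c])
    then obtain b where b: "unit_tvec (U, \<phi>) q j = (\<Sum>k<mdim M. fun_scale (b k) (Z k q))"
      using s unfolding spans_def by blast
    have bl: "(\<Sum>k<mdim M. b k * A \<phi> q k l) = (if l = j then 1 else 0)" if "l < mdim M" for l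
      using fun_cong[OF b, of "\<lambda>x. \<phi> x l"] tvec_coordinate[OF c that, of "\<lambda>i. if i = j then 1 else 0"]
      by (simp add: sum_fun_apply A_def unit_tvec_def)
    have "d j = (\<Sum>l<mdim M. (if l = j then 1 else 0) * d l)" using j by (simp add: sum_delta_mult)
    also have "\<dots> = (\<Sum>l<mdim M. (\<Sum>k<mdim M. b k * A \<phi> q k l) * d l)" using bl by simp
    also have "\<dots> = (\<Sum>k<mdim M. b k * (\<Sum>l<mdim M. A \<phi> q k l * d l))"
      by (simp add: sum_distrib_left sum_distrib_right mult.assoc) (rule sum.swap)
    also have "\<dots> = 0" using d(2) by simp
    finally show ?thesis .
  qed
  then show False using d(1) by blast
qed

lemma mdet_expand:
  assumes c: "(U, \<phi>) \<in> mcharts M" "q \<in> U" and d: "mdet (mdim M) (A \<phi> q) \<noteq> 0" and v: "v \<in> tangent_space M q"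
  shows "v = (\<Sum>k<mdim M. fun_scale (inverse (mdet (mdim M) (A \<phi> q)) * (\<Sum>l<mdim M. v (\<lambda>x. \<phi> x l) * madj (mdim M) (A \<phi> q) l k)) (Z k q))"
    (is "v = (\<Sum>k<mdim M. fun_scale (?c k) (Z k q))")
proof (rule tangent_eqI[OF c v Z_sum_tangent])
  show "q \<in> mcarrier M" using chart_subset c by blast
  fix l assume l: "l < mdim M"
  define S where "S k = (\<Sum>l<mdim M. v (\<lambda>x. \<phi> x l) * madj (mdim M) (A \<phi> q) l k)" for k
  have A: "Z k q (\<lambda>x. \<phi> x l) = A \<phi> q k l" for k by (simp add: A_def)
  have "(\<Sum>k<mdim M. fun_scale (?c k) (Z k q)) (\<lambda>x. \<phi> x l) =
      inverse (mdet (mdim M) (A \<phi> q)) * (\<Sum>k<mdim M. S k * A \<phi> q k l)"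
    unfolding sum_fun_apply S_def[symmetric] A sum_distrib_left mult.assoc ..
  also have "\<dots> = v (\<lambda>x. \<phi> x l)" unfolding S_def madj_inverse_left[OF d l] using d by simp
  finally show "v (\<lambda>q. \<phi> q l) = (\<Sum>k<mdim M. fun_scale (?c k) (Z k q)) (\<lambda>q. \<phi> q l)" by simp
qed

lemma spansI: "(U, \<phi>) \<in> mcharts M \<Longrightarrow> q \<in> U \<Longrightarrow> mdet (mdim M) (A \<phi> q) \<noteq> 0 \<Longrightarrow> spans q"
  unfolding spans_def by (intro ballI exI, rule mdet_expand)

lemma spans_unique:
  assumes "q \<in> mcarrier M" "spans q" "(\<Sum>k<mdim M. fun_scale (a k) (Z k q)) = (\<Sum>k<mdim M. fun_scale (b k) (Z k q))" "k < mdim M"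
  shows "a k = b k"
proof -
  obtain U \<phi> where c: "(U, \<phi>) \<in> mcharts M" "q \<in> U" by (rule chart_exists[OF assms(1)])
  have "(\<Sum>k<mdim M. (a k - b k) * A \<phi> q k l) = 0" for l
    using fun_cong[OF assms(3), of "\<lambda>x. \<phi> x l"] by (simp add: sum_fun_apply A_def left_diff_distrib sum_subtractf)
  from mdet_nonzero_rows[OF spans_mdet[OF c assms(2)] this assms(4)] show ?thesis by simp
qed

text \<open>Expand \<open>Y\<close> near \<open>p\<close> with coefficients \<open>b k\<close> and
  let \<open>Z j\<close> act on a coordinate of both sides. Since all fields commute, everything
  cancels except the sum of \<open>Z j q (b k)\<close> times the components of \<open>Z k\<close>.
  Invertibility of the matrix makes these derivatives 0, and the coefficients are locally
  constant.\<close>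

lemma commuting_coefficients_constant:
  assumes Y: "smooth_vf Y" and comm: "\<And>k q. k < mdim M \<Longrightarrow> q \<in> mcarrier M \<Longrightarrow> commutator (Z k) Y q = 0"
    and p: "p \<in> mcarrier M" and s: "spans p" and a: "Y p = (\<Sum>k<mdim M. fun_scale (a k) (Z k p))"
  obtains V where "openin (mtop M) V" "p \<in> V" "\<And>q. q \<in> V \<Longrightarrow> Y q = (\<Sum>k<mdim M. fun_scale (a k) (Z k q))"
proof -
  let ?n = "mdim M"
  obtain U \<phi> where c: "(U, \<phi>) \<in> mcharts M" "p \<in> U" by (rule chart_exists[OF p])
  have det: "smooth_fun_on M U (\<lambda>q. mdet ?n (A \<phi> q))"
    by (rule smooth_fun_on_mdet[OF chart_open[OF c(1)] A_smooth[OF c(1)]])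
  define W where "W = {q \<in> U. mdet ?n (A \<phi> q) \<noteq> 0}"
  have W: "openin (mtop M) W" "p \<in> W" "W \<subseteq> U"
    unfolding W_def using smooth_fun_on_nonzero_open[OF det] c(2) spans_mdet[OF c s] by auto
  have Wc: "q \<in> mcarrier M" if "q \<in> W" for q using that chart_subset[OF c(1)] W(3) by blast
  define b where "b k q = inverse (mdet ?n (A \<phi> q)) * (\<Sum>l<?n. Y q (\<lambda>x. \<phi> x l) * madj ?n (A \<phi> q) l k)" for k q
  have Yb: "Y q = (\<Sum>k<?n. fun_scale (b k q) (Z k q))" if "q \<in> W" for q
    unfolding b_def
    by (rule mdet_expand[OF c(1) _ _ smooth_vf_tangent[OF Y Wc[OF that]]]) (use that in \<open>auto simp: W_def\<close>)
  have sub: "smooth_fun_on M W h" if "smooth_fun_on M U h" for h by (rule smooth_fun_on_subset[OF that W(1,3)])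
  have b: "smooth_fun_on M W (b k)" if k: "k < ?n" for k
    unfolding b_def
  proof (intro smooth_fun_on_mult smooth_fun_on_inverse smooth_fun_on_sum W(1))
    show "smooth_fun_on M W (\<lambda>q. mdet ?n (A \<phi> q))" by (rule sub[OF det])
    show "mdet ?n (A \<phi> q) \<noteq> 0" if "q \<in> W" for q using that by (simp add: W_def)
    fix l assume "l \<in> {..<?n}"
    then have l: "l < ?n" by simp
    show "smooth_fun_on M W (\<lambda>q. Y q (\<lambda>x. \<phi> x l))"
      by (rule sub[OF smooth_vf_apply[OF Y smooth_fun_on_coordinate[OF c(1)]]])
    show "smooth_fun_on M W (\<lambda>q. madj ?n (A \<phi> q) l k)"
      by (rule sub[OF smooth_fun_on_madj[OF chart_open[OF c(1)] A_smooth[OF c(1)] l k]])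
  qed
  have zero: "Z j q (b k) = 0" if j: "j < ?n" and k: "k < ?n" and q: "q \<in> W" for j k q
  proof (rule mdet_nonzero_rows[where c = "\<lambda>k. Z j q (b k)" and A = "A \<phi> q", OF _ _ k])
    show "mdet ?n (A \<phi> q) \<noteq> 0" using q by (simp add: W_def)
    fix l assume l: "l < ?n"
    have qM: "q \<in> mcarrier M" by (rule Wc[OF q])
    have qU: "q \<in> U" using q W(3) by blast
    have cs: "smooth_at M q (\<lambda>x. \<phi> x l)" by (rule smooth_at_coordinate[OF c(1) qU])
    have swap: "Z j q (\<lambda>x. F x (\<lambda>x. \<phi> x l)) = F q (\<lambda>x. Z j x (\<lambda>x. \<phi> x l))" if "commutator (Z j) F q = 0" for F
      using fun_cong[OF that, of "\<lambda>x. \<phi> x l"] cs by (simp add: commutator_def)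
    note T = Z_tangent[OF j qM]
    have As: "smooth_at M q (\<lambda>x. A \<phi> x k l)" if "k < ?n" for k by (rule smooth_atI[OF A_smooth[OF c(1) that] qU])
    have bs: "smooth_at M q (b k)" if "k < ?n" for k by (rule smooth_atI[OF b[OF that] q])
    have "Z j q (\<lambda>x. Y x (\<lambda>x. \<phi> x l)) = Z j q (\<lambda>x. \<Sum>k<?n. b k x * A \<phi> x k l)"
      by (rule tangent_cong[OF T smooth_vf_apply_at[OF Y cs] W(1) q]) (simp add: Yb sum_fun_apply A_def)
    also have "\<dots> = (\<Sum>k<?n. Z j q (\<lambda>x. b k x * A \<phi> x k l))"
      by (rule tangent_sum[OF T qM]) (simp add: smooth_at_mult bs As)
    also have "\<dots> = (\<Sum>k<?n. b k q * Z j q (\<lambda>x. A \<phi> x k l) + A \<phi> q k l * Z j q (b k))"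
      by (intro sum.cong refl tangent_mult[OF T]) (simp_all add: bs As)
    also have "\<dots> = (\<Sum>k<?n. b k q * Z k q (\<lambda>x. Z j x (\<lambda>x. \<phi> x l))) + (\<Sum>k<?n. Z j q (b k) * A \<phi> q k l)"
      using swap[OF Z_comm[OF j _ qM]] by (simp add: sum.distrib A_def mult.commute)
    also have "(\<Sum>k<?n. b k q * Z k q (\<lambda>x. Z j x (\<lambda>x. \<phi> x l))) = Y q (\<lambda>x. Z j x (\<lambda>x. \<phi> x l))"
      by (simp add: Yb[OF q] sum_fun_apply)
    also have "\<dots> = Z j q (\<lambda>x. Y x (\<lambda>x. \<phi> x l))" by (rule swap[symmetric, OF comm[OF j qM]])
    finally show "(\<Sum>k<?n. Z j q (b k) * A \<phi> q k l) = 0" by simp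
  qed
  have const: "\<exists>V. openin (mtop M) V \<and> p \<in> V \<and> V \<subseteq> W \<and> (\<forall>q\<in>V. b k q = b k p)" if k: "k < ?n" for k
  proof (rule locally_constant[OF b[OF k] W(2)])
    fix q v assume q: "q \<in> W" and v: "v \<in> tangent_space M q"
    have "spans q" by (rule spansI[OF c(1)]) (use q in \<open>auto simp: W_def\<close>)
    then obtain d where "v = (\<Sum>k<?n. fun_scale (d k) (Z k q))" using v unfolding spans_def by blast
    then show "v (b k) = 0" using zero[OF _ k q] by (simp add: sum_fun_apply)
  qed blast
  have bp: "b k p = a k" if "k < ?n" for k
    by (rule spans_unique[OF p s _ that, symmetric]) (use a Yb[OF W(2)] in simp)
  have "\<exists>V. \<forall>k<?n. openin (mtop M) (V k) \<and> p \<in> V k \<and> V k \<subseteq> W \<and> (\<forall>q\<in>V k. b k q = a k)"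
    using const bp by (intro choice allI) metis
  then obtain V where V: "\<And>k. k < ?n \<Longrightarrow> openin (mtop M) (V k) \<and> p \<in> V k \<and> V k \<subseteq> W \<and> (\<forall>q\<in>V k. b k q = a k)" by blast
  show thesis
  \<comment> \<open>Inserting \<open>W\<close> keeps the intersected family nonempty when the
    dimension is 0.\<close>
  proof (rule that[of "W \<inter> \<Inter> (insert W (V ` {..<?n}))"])
    show "openin (mtop M) (W \<inter> \<Inter> (insert W (V ` {..<?n})))"
      using V W(1) by (intro openin_Int openin_Inter) auto
    show "p \<in> W \<inter> \<Inter> (insert W (V ` {..<?n}))" using V W(2) by auto
    fix q assume "q \<in> W \<inter> \<Inter> (insert W (V ` {..<?n}))"
    then have q: "q \<in> W" "\<And>k. k < ?n \<Longrightarrow> q \<in> V k" by auto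
    then have "b k q = a k" if "k < ?n" for k using V that by blast
    then show "Y q = (\<Sum>k<?n. fun_scale (a k) (Z k q))" using Yb[OF q(1)] by simp
  qed
qed

end

section \<open>A commuting frame on a connected manifold\<close>

context smooth_mfd begin

lemma commuting_frame_exists:
  fixes s :: nat
  assumes Y: "\<And>i. i < s \<Longrightarrow> smooth_vf (Y i)"
    and comm: "\<And>i j p. i < s \<Longrightarrow> j < s \<Longrightarrow> p \<in> mcarrier M \<Longrightarrow> commutator (Y i) (Y j) p = 0"
    and span: "\<And>p v. p \<in> mcarrier M \<Longrightarrow> v \<in> tangent_space M p \<Longrightarrow> \<exists>a. v = (\<Sum>i<s. fun_scale (a i) (Y i p))"
    and con: "connected_space (mtop M)" and m: "m \<in> mcarrier M"
  obtains Z where "commuting_fields M Z" "\<And>q. q \<in> mcarrier M \<Longrightarrow> commuting_fields.spans M Z q"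
proof -
  let ?n = "mdim M"
  obtain U \<phi> where c: "(U, \<phi>) \<in> mcharts M" "m \<in> U" by (rule chart_exists[OF m])
  have Ym: "(\<lambda>i. Y i m) ` {..<s} \<subseteq> tangent_space M m" using smooth_vf_tangent[OF Y m] by blast
  obtain B where B: "B \<subseteq> (\<lambda>i. Y i m) ` {..<s}" "fun_vs.independent B" "(\<lambda>i. Y i m) ` {..<s} \<subseteq> fun_vs.span B"
    using fun_vs.maximal_independent_subset by blast
  have TB: "tangent_space M m \<subseteq> fun_vs.span B"
  proof
    fix v assume "v \<in> tangent_space M m"
    then obtain a where "v = (\<Sum>i<s. fun_scale (a i) (Y i m))" using span[OF m] by blast
    moreover have "(\<Sum>i<s. fun_scale (a i) (Y i m)) \<in> fun_vs.span B"
      using B(3) by (intro fun_vs.span_sum fun_vs.span_scale) auto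
    ultimately show "v \<in> fun_vs.span B" by simp
  qed
  have fB: "finite B" using B(1) finite_subset by blast
  note ui = unit_tvec_independent[OF c] and us = tangent_span_unit[OF c]
  have cu: "card (unit_tvec (U, \<phi>) m ` {..<?n}) = ?n" using card_image[OF ui(1)] by simp
  have "B \<subseteq> fun_vs.span (unit_tvec (U, \<phi>) m ` {..<?n})"
    using order_trans[OF B(1) Ym] us by simp
  from fun_vs.independent_span_bound[OF _ B(2) this]
  have "card B \<le> card (unit_tvec (U, \<phi>) m ` {..<?n})" by simp
  moreover have "unit_tvec (U, \<phi>) m ` {..<?n} \<subseteq> fun_vs.span B"
    by (rule order_trans[OF _ TB]) (unfold us, rule fun_vs.span_superset)
  then have "card (unit_tvec (U, \<phi>) m ` {..<?n}) \<le> card B"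
    using fun_vs.independent_span_bound[OF fB ui(2)] by simp
  ultimately have cB: "card B = ?n" using cu by simp
  obtain g where g: "bij_betw g {..<?n} B"
    using ex_bij_betw_nat_finite[OF fB] cB by (auto simp: lessThan_atLeast0)
  have "\<exists>e. \<forall>k\<in>{..<?n}. e k < s \<and> g k = Y (e k) m"
  proof (rule bchoice, rule ballI)
    fix k assume "k \<in> {..<?n}"
    then have "g k \<in> B" using g by (auto simp: bij_betw_def)
    then show "\<exists>i. i < s \<and> g k = Y i m" using B(1) by auto
  qed
  then obtain e where e: "\<And>k. k < ?n \<Longrightarrow> e k < s \<and> g k = Y (e k) m" by auto
  define Z where "Z k = Y (e k)" for k
  interpret C: commuting_fields M Z
    by unfold_locales (use Y comm e in \<open>auto simp: Z_def\<close>)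
  have gZ: "g ` {..<?n} = B" using g by (simp add: bij_betw_def)
  have sm: "C.spans m"
    unfolding C.spans_def
  proof
    fix v assume "v \<in> tangent_space M m"
    then have "v \<in> fun_vs.span (g ` {..<?n})" using TB gZ by blast
    then obtain a where "v = (\<Sum>k<?n. fun_scale (a k) (g k))" by (rule span_familyE[OF finite_lessThan])
    also have "\<dots> = (\<Sum>k<?n. fun_scale (a k) (Z k m))"
      by (intro sum.cong refl) (simp add: Z_def e)
    finally show "\<exists>a. v = (\<Sum>k<?n. fun_scale (a k) (Z k m))" by blast
  qed
  have "\<exists>a. Y j m = (\<Sum>k<?n. fun_scale (a k) (Z k m))" if "j < s" for j
    using sm smooth_vf_tangent[OF Y[OF that] m] unfolding C.spans_def by blast
  then have "\<exists>a. \<forall>j\<in>{..<s}. Y j m = (\<Sum>k<?n. fun_scale (a j k) (Z k m))" by (intro bchoice) auto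
  then obtain a where a: "\<And>j. j < s \<Longrightarrow> Y j m = (\<Sum>k<?n. fun_scale (a j k) (Z k m))" by auto
  \<comment> \<open>Spanning alone is an open condition and need not be closed. The equations with
    coefficients fixed at \<open>m\<close> are closed, and they imply spanning because the
    \<open>Y j\<close> span everywhere.\<close>
  define S where "S = {q \<in> mcarrier M. \<forall>j<s. Y j q = (\<Sum>k<?n. fun_scale (a j k) (Z k q))}"
  have spS: "C.spans q" if q: "q \<in> S" for q
    unfolding C.spans_def
  proof
    fix v assume v: "v \<in> tangent_space M q"
    have "q \<in> mcarrier M" using q by (simp add: S_def)
    from span[OF this v] obtain b where "v = (\<Sum>j<s. fun_scale (b j) (Y j q))" by blast
    also have "\<dots> = (\<Sum>j<s. fun_scale (b j) (\<Sum>k<?n. fun_scale (a j k) (Z k q)))"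
      using q by (intro sum.cong refl) (simp add: S_def)
    also have "\<dots> = (\<Sum>k<?n. fun_scale (\<Sum>j<s. b j * a j k) (Z k q))"
    proof
      fix h
      show "(\<Sum>j<s. fun_scale (b j) (\<Sum>k<?n. fun_scale (a j k) (Z k q))) h = (\<Sum>k<?n. fun_scale (\<Sum>j<s. b j * a j k) (Z k q)) h"
        by (simp add: sum_fun_apply sum_distrib_left sum_distrib_right mult.assoc) (rule sum.swap)
    qed
    finally show "\<exists>c. v = (\<Sum>k<?n. fun_scale (c k) (Z k q))"
      by (intro exI[of _ "\<lambda>k. \<Sum>j<s. b j * a j k"])
  qed
  have open_S: "openin (mtop M) S"
  proof (subst openin_subopen, rule ballI)
    fix p assume p: "p \<in> S"
    then have pM: "p \<in> mcarrier M" by (simp add: S_def)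
    have "\<exists>V. openin (mtop M) V \<and> p \<in> V \<and> (\<forall>q\<in>V. Y j q = (\<Sum>k<?n. fun_scale (a j k) (Z k q)))" if j: "j < s" for j
    proof (rule C.commuting_coefficients_constant[OF Y[OF j] _ pM spS[OF p], of "a j"])
      show "commutator (Z k) (Y j) q = 0" if "k < ?n" "q \<in> mcarrier M" for k q
        unfolding Z_def by (rule comm) (use e that j in auto)
      show "Y j p = (\<Sum>k<?n. fun_scale (a j k) (Z k p))" using p j by (simp add: S_def)
    qed blast
    then have "\<exists>V. \<forall>j\<in>{..<s}. openin (mtop M) (V j) \<and> p \<in> V j \<and> (\<forall>q\<in>V j. Y j q = (\<Sum>k<?n. fun_scale (a j k) (Z k q)))"
      by (intro bchoice) auto
    then obtain V where V: "\<And>j. j < s \<Longrightarrow> openin (mtop M) (V j) \<and> p \<in> V j \<and> (\<forall>q\<in>V j. Y j q = (\<Sum>k<?n. fun_scale (a j k) (Z k q)))"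
      by auto
    show "\<exists>T. openin (mtop M) T \<and> p \<in> T \<and> T \<subseteq> S"
    proof (intro exI[of _ "\<Inter> (insert (mcarrier M) (V ` {..<s}))"] conjI)
      show "openin (mtop M) (\<Inter> (insert (mcarrier M) (V ` {..<s})))"
        using V by (intro openin_Inter) auto
      show "p \<in> \<Inter> (insert (mcarrier M) (V ` {..<s}))" using V pM by auto
      show "\<Inter> (insert (mcarrier M) (V ` {..<s})) \<subseteq> S" using V by (auto simp: S_def)
    qed
  qed
  \<comment> \<open>Two tangent vectors that differ already differ on some coordinate function. The
    difference of the two sides on that coordinate is smooth, so it stays nonzero nearby.\<close>
  have open_co: "openin (mtop M) (mcarrier M - S)"
  proof (subst openin_subopen, rule ballI)
    fix p assume p: "p \<in> mcarrier M - S"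
    then obtain j where j: "j < s" "Y j p \<noteq> (\<Sum>k<?n. fun_scale (a j k) (Z k p))" by (auto simp: S_def)
    obtain V \<psi> where d: "(V, \<psi>) \<in> mcharts M" "p \<in> V" using chart_exists p by blast
    have "\<exists>l<?n. Y j p (\<lambda>q. \<psi> q l) \<noteq> (\<Sum>k<?n. fun_scale (a j k) (Z k p)) (\<lambda>q. \<psi> q l)"
      using tangent_eqI[OF d smooth_vf_tangent[OF Y[OF j(1)]] C.Z_sum_tangent] j(2) p by blast
    then obtain l where l: "l < ?n" "Y j p (\<lambda>q. \<psi> q l) \<noteq> (\<Sum>k<?n. a j k * Z k p (\<lambda>q. \<psi> q l))"
      by (auto simp: sum_fun_apply)
    define F where "F q = Y j q (\<lambda>q. \<psi> q l) + (-1) * (\<Sum>k<?n. a j k * Z k q (\<lambda>q. \<psi> q l))" for q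
    have "smooth_fun_on M V F"
      unfolding F_def
      by (intro smooth_fun_on_add smooth_fun_on_cmult smooth_fun_on_sum chart_open[OF d(1)]
          smooth_vf_apply[OF Y[OF j(1)] smooth_fun_on_coordinate[OF d(1)]]
          smooth_vf_apply[OF C.Z_vf smooth_fun_on_coordinate[OF d(1)]]) simp
    from smooth_fun_on_nonzero_open[OF this]
    show "\<exists>T. openin (mtop M) T \<and> p \<in> T \<and> T \<subseteq> mcarrier M - S"
    proof (intro exI[of _ "{q \<in> V. F q \<noteq> 0}"] conjI)
      show "p \<in> {q \<in> V. F q \<noteq> 0}" using d l by (simp add: F_def)
      have "F q = 0" if "q \<in> S" for q
      proof -
        have "Y j q = (\<Sum>k<?n. fun_scale (a j k) (Z k q))" using that j(1) by (simp add: S_def)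
        then show ?thesis by (simp add: F_def sum_fun_apply)
      qed
      then show "{q \<in> V. F q \<noteq> 0} \<subseteq> mcarrier M - S" using chart_subset[OF d(1)] by blast
    qed
  qed
  have "m \<in> S" using m a by (simp add: S_def)
  have "S = mcarrier M"
  proof -
    have "closedin (mtop M) S" using open_co by (simp add: closedin_def S_def)
    then show ?thesis using con open_S \<open>m \<in> S\<close> unfolding connected_space_clopen_in by blast
  qed
  then have "C.spans q" if "q \<in> mcarrier M" for q using spS that by blast
  then show thesis by (intro that[of Z] C.commuting_fields_axioms)
qed

end

section \<open>Straightening a commuting frame\<close>

text \<open>An inverse function theorem for a map whose inverse Jacobian \<open>A\<close> is given
  on the whole cube. Nearly constant derivatives bound distances by distances of images, which gives
  injectivity; invariance of domain gives an open image and continuity of the inverse; the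
  derivatives of the inverse are then the entries of \<open>A\<close>, without any fixed point
  argument.\<close>

lemma local_inverse:
  fixes g :: "nat \<Rightarrow> (nat \<Rightarrow> real) \<Rightarrow> real" and n :: nat
  defines "G \<equiv> (\<lambda>x k. if k < n then g k x else 0)"
  assumes a: "a \<in> espace n" and e: "e > 0" and g: "\<And>k. k < n \<Longrightarrow> smooth_on n (cube n a e) (g k)"
    and A: "\<And>j l. j < n \<Longrightarrow> l < n \<Longrightarrow> smooth_on n (cube n a e) (\<lambda>x. A x j l)"
    and inv: "\<And>x i l. x \<in> cube n a e \<Longrightarrow> i < n \<Longrightarrow> l < n \<Longrightarrow>
      (\<Sum>k<n. A x k i * partial_deriv l (g k) x) = (if l = i then 1 else 0)"
  obtains d where "0 < d" "d \<le> e" "inj_on G (cube n a d)" "openin (Euclidean_space n) (G ` cube n a d)"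
    "homeomorphic_map (subtopology (Euclidean_space n) (cube n a d)) (subtopology (Euclidean_space n) (G ` cube n a d)) G"
    "\<And>F. smooth_on n (cube n a d) F \<Longrightarrow> smooth_on n (G ` cube n a d) (\<lambda>y. F (inv_into (cube n a d) G y))"
proof -
  \<comment> \<open>A common bound for the absolute column sums of \<open>A\<close> at
    \<open>a\<close>; the summand 1 keeps it positive in every case.\<close>
  define C where "C = (\<Sum>i<n. \<Sum>k<n. \<bar>A a k i\<bar>) + 1"
  have C: "C > 0" unfolding C_def by (intro add_nonneg_pos sum_nonneg) auto
  \<comment> \<open>Chosen so that \<open>real n * C * \<epsilon> \<le> 1 / 2\<close>: the error
    term in the Lipschitz estimate can be absorbed in the left-hand side.\<close>
  define \<epsilon> where "\<epsilon> = 1 / (2 * (real n + 1) * C)"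
  have \<epsilon>: "\<epsilon> > 0" using C by (simp add: \<epsilon>_def)
  have aQ: "a \<in> cube n a e" by (rule centre_in_cube[OF a e])
  have nb: "\<exists>d>0. cube n a d \<subseteq> cube n a e \<and> (\<forall>y\<in>cube n a d. \<bar>partial_deriv l (g k) y - partial_deriv l (g k) a\<bar> < \<epsilon>)"
    if "k < n" "l < n" for k l
    by (rule continuous_on_open_cube[OF openin_cube smooth_on_continuous[OF smooth_on_partial[OF g[OF that(1)] that(2)]] aQ \<epsilon>])
       blast
  have "\<exists>d. \<forall>z\<in>{..<n} \<times> {..<n}. d z > 0 \<and> (\<forall>y\<in>cube n a (d z). \<bar>partial_deriv (snd z) (g (fst z)) y - partial_deriv (snd z) (g (fst z)) a\<bar> < \<epsilon>)"
  proof (rule bchoice, rule ballI)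
    fix z assume "z \<in> {..<n} \<times> {..<n}"
    then have "fst z < n" "snd z < n" by auto
    from nb[OF this] show "\<exists>d. d > 0 \<and> (\<forall>y\<in>cube n a d. \<bar>partial_deriv (snd z) (g (fst z)) y - partial_deriv (snd z) (g (fst z)) a\<bar> < \<epsilon>)"
      by blast
  qed
  then obtain \<delta> where \<delta>: "\<And>k l. k < n \<Longrightarrow> l < n \<Longrightarrow> \<delta> (k, l) > 0"
    "\<And>k l y. k < n \<Longrightarrow> l < n \<Longrightarrow> y \<in> cube n a (\<delta> (k, l)) \<Longrightarrow> \<bar>partial_deriv l (g k) y - partial_deriv l (g k) a\<bar> < \<epsilon>"
    by auto
  define d0 where "d0 = Min (insert e (\<delta> ` ({..<n} \<times> {..<n})))"
  have d0: "d0 > 0" "d0 \<le> e" unfolding d0_def using e \<delta>(1) by (auto simp: Min_gr_iff)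
  have d0\<delta>: "d0 \<le> \<delta> (k, l)" if "k < n" "l < n" for k l
    unfolding d0_def using that by (intro Min_le) auto
  have near: "\<bar>partial_deriv l (g k) y - partial_deriv l (g k) a\<bar> < \<epsilon>" if "k < n" "l < n" "y \<in> cube n a d0" for k l y
    by (rule \<delta>(2)[OF that(1,2)]) (use that(3) cube_mono[OF d0\<delta>[OF that(1,2)]] in blast)
  \<comment> \<open>Points of \<open>Q\<close> are less than \<open>2 * d\<close> apart in each
    coordinate, so the cube of radius \<open>2 * d\<close> about a point of \<open>Q\<close>
    contains \<open>Q\<close>. With radius \<open>d\<close> of \<open>Q\<close> itself added, it
    stays inside the cube of radius \<open>d0\<close>.\<close>
  define d where "d = d0 / 3"
  have d: "0 < d" "d \<le> e" "3 * d = d0" using d0 by (auto simp: d_def)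
  define Q where "Q = cube n a d"
  have Qe: "Q \<subseteq> cube n a e" unfolding Q_def by (rule cube_mono[OF d(2)])
  have Qs: "x \<in> espace n" if "x \<in> Q" for x using that by (simp add: Q_def cube_def)
  have big: "cube n x (2 * d) \<subseteq> cube n a d0" if x: "x \<in> Q" for x
  proof
    fix y assume y: "y \<in> cube n x (2 * d)"
    have "\<bar>y i - a i\<bar> < d0" if "i < n" for i
    proof -
      have "\<bar>y i - x i\<bar> < 2 * d" "\<bar>x i - a i\<bar> < d" using x y that by (auto simp: Q_def cube_def)
      then show ?thesis using d(3) by linarith
    qed
    then show "y \<in> cube n a d0" using y by (simp add: cube_def)
  qed
  have mv: "\<exists>\<xi>. (\<forall>j r. j < n \<longrightarrow> y \<in> cube n x r \<longrightarrow> \<xi> j \<in> cube n x r) \<and> (\<forall>j<n. \<xi> j \<in> cube n a d0) \<and>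
      g k y - g k x = (\<Sum>j<n. partial_deriv j (g k) (\<xi> j) * (y j - x j))"
    if x: "x \<in> Q" and y: "y \<in> Q" and k: "k < n" for x y k
  proof -
    have y2: "y \<in> cube n x (2 * d)"
    proof -
      have "\<bar>y i - x i\<bar> < 2 * d" if "i < n" for i
      proof -
        have "\<bar>y i - a i\<bar> < d" "\<bar>x i - a i\<bar> < d" using x y that by (auto simp: Q_def cube_def)
        then show ?thesis by linarith
      qed
      then show ?thesis using Qs[OF y] by (simp add: cube_def)
    qed
    have sub: "cube n x (2 * d) \<subseteq> cube n a e" using big[OF x] cube_mono[OF d0(2)] by blast
    obtain \<xi> where \<xi>: "\<And>j d. j < n \<Longrightarrow> y \<in> cube n x d \<Longrightarrow> \<xi> j \<in> cube n x d"
      "g k y - g k x = (\<Sum>j<n. partial_deriv j (g k) (\<xi> j) * (y j - x j))"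
      by (rule cube_mean_value[OF g[OF k] Qs[OF x] y2 sub], rule that)
    have "\<xi> j \<in> cube n a d0" if "j < n" for j using \<xi>(1)[OF that y2] big[OF x] by blast
    then show ?thesis using \<xi> by (intro exI[of _ \<xi>]) auto
  qed
  define K where "K = 2 * real n * C"
  \<comment> \<open>Recover \<open>y - x\<close> by applying \<open>A\<close> at \<open>a\<close> to
    the Jacobian at \<open>a\<close>. Replacing this Jacobian by derivatives at intermediate points
    costs at most \<epsilon> \<open>D\<close> per row, hence at most half of \<open>D\<close> in
    total, and \<open>K = 2 * real n * C\<close> results.\<close>
  have lipschitz: "(\<Sum>l<n. \<bar>y l - x l\<bar>) \<le> K * (\<Sum>k<n. \<bar>g k y - g k x\<bar>)" if x: "x \<in> Q" and y: "y \<in> Q" for x y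
  proof -
    define D where "D = (\<Sum>l<n. \<bar>y l - x l\<bar>)"
    define H where "H = (\<Sum>k<n. \<bar>g k y - g k x\<bar>)"
    have D0: "D \<ge> 0" "H \<ge> 0" by (auto simp: D_def H_def intro!: sum_nonneg)
    have "\<exists>\<xi>. \<forall>k\<in>{..<n}. (\<forall>j<n. \<xi> k j \<in> cube n a d0) \<and> g k y - g k x = (\<Sum>j<n. partial_deriv j (g k) (\<xi> k j) * (y j - x j))"
    proof (rule bchoice, rule ballI)
      fix k assume "k \<in> {..<n}"
      then have "k < n" by simp
      from mv[OF x y this]
      show "\<exists>\<xi>. (\<forall>j<n. \<xi> j \<in> cube n a d0) \<and> g k y - g k x = (\<Sum>j<n. partial_deriv j (g k) (\<xi> j) * (y j - x j))" by blast
    qed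
    then obtain \<xi> where \<xi>: "\<And>k j. k < n \<Longrightarrow> j < n \<Longrightarrow> \<xi> k j \<in> cube n a d0"
      "\<And>k. k < n \<Longrightarrow> g k y - g k x = (\<Sum>j<n. partial_deriv j (g k) (\<xi> k j) * (y j - x j))" by auto
    define R where "R k = (\<Sum>j<n. (partial_deriv j (g k) a - partial_deriv j (g k) (\<xi> k j)) * (y j - x j))" for k
    have Rb: "\<bar>R k\<bar> \<le> \<epsilon> * D" if k: "k < n" for k
    proof -
      have "\<bar>R k\<bar> \<le> (\<Sum>j<n. \<bar>(partial_deriv j (g k) a - partial_deriv j (g k) (\<xi> k j)) * (y j - x j)\<bar>)"
        unfolding R_def by (rule sum_abs)
      also have "\<dots> \<le> (\<Sum>j<n. \<epsilon> * \<bar>y j - x j\<bar>)"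
      proof (rule sum_mono)
        fix j assume "j \<in> {..<n}"
        then have "\<bar>partial_deriv j (g k) a - partial_deriv j (g k) (\<xi> k j)\<bar> \<le> \<epsilon>"
          using near[OF k _ \<xi>(1)[OF k], of j j] by (simp add: abs_minus_commute)
        then show "\<bar>(partial_deriv j (g k) a - partial_deriv j (g k) (\<xi> k j)) * (y j - x j)\<bar> \<le> \<epsilon> * \<bar>y j - x j\<bar>"
          unfolding abs_mult by (rule mult_right_mono) simp
      qed
      also have "\<dots> = \<epsilon> * D" by (simp add: D_def sum_distrib_left)
      finally show ?thesis .
    qed
    have comp: "\<bar>y i - x i\<bar> \<le> (\<Sum>k<n. \<bar>A a k i\<bar>) * (H + \<epsilon> * D)" if i: "i < n" for i
    proof -
      have "y i - x i = (\<Sum>l<n. (if l = i then 1 else 0) * (y l - x l))" using i by (simp add: sum_delta_mult)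
      also have "\<dots> = (\<Sum>l<n. (\<Sum>k<n. A a k i * partial_deriv l (g k) a) * (y l - x l))"
        by (intro sum.cong refl) (simp add: inv[OF aQ i])
      also have "\<dots> = (\<Sum>k<n. A a k i * (\<Sum>l<n. partial_deriv l (g k) a * (y l - x l)))"
        by (simp add: sum_distrib_left sum_distrib_right mult.assoc) (rule sum.swap)
      also have "\<dots> = (\<Sum>k<n. A a k i * (R k + (g k y - g k x)))"
        by (intro sum.cong refl) (simp add: R_def \<xi>(2) sum.distrib[symmetric] left_diff_distrib)
      finally have "\<bar>y i - x i\<bar> \<le> (\<Sum>k<n. \<bar>A a k i * (R k + (g k y - g k x))\<bar>)" by (simp add: sum_abs)
      also have "\<dots> \<le> (\<Sum>k<n. \<bar>A a k i\<bar> * (H + \<epsilon> * D))"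
        unfolding abs_mult
      proof (rule sum_mono, rule mult_left_mono)
        fix k assume "k \<in> {..<n}"
        then have k: "k < n" by simp
        have "\<bar>g k y - g k x\<bar> \<le> H" unfolding H_def using k by (intro member_le_sum) auto
        then show "\<bar>R k + (g k y - g k x)\<bar> \<le> H + \<epsilon> * D" using Rb[OF k] by linarith
      qed simp
      finally show ?thesis by (simp add: sum_distrib_right)
    qed
    have AC: "(\<Sum>k<n. \<bar>A a k i\<bar>) \<le> C" if "i < n" for i
    proof -
      have "(\<Sum>k<n. \<bar>A a k i\<bar>) \<le> (\<Sum>i<n. \<Sum>k<n. \<bar>A a k i\<bar>)"
        using that by (intro member_le_sum[of i "{..<n}" "\<lambda>i. \<Sum>k<n. \<bar>A a k i\<bar>"]) (auto intro: sum_nonneg)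
      then show ?thesis by (simp add: C_def)
    qed
    have HD: "H + \<epsilon> * D \<ge> 0" using D0 \<epsilon> by (intro add_nonneg_nonneg mult_nonneg_nonneg) auto
    have "\<bar>y i - x i\<bar> \<le> C * (H + \<epsilon> * D)" if "i < n" for i
      by (rule order_trans[OF comp[OF that] mult_right_mono[OF AC[OF that] HD]])
    then have "D \<le> (\<Sum>i<n. C * (H + \<epsilon> * D))" unfolding D_def by (intro sum_mono) auto
    also have "\<dots> = real n * C * H + (real n * C * \<epsilon>) * D" by (simp add: algebra_simps)
    also have "(real n * C * \<epsilon>) * D \<le> (1 / 2) * D"
    proof (rule mult_right_mono[OF _ D0(1)])
      have "real n * C * \<epsilon> = real n / (2 * (real n + 1))" using C by (simp add: \<epsilon>_def)
      also have "\<dots> \<le> 1 / 2" by (simp add: field_simps)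
      finally show "real n * C * \<epsilon> \<le> 1 / 2" .
    qed
    finally show ?thesis by (simp add: K_def D_def[symmetric] H_def[symmetric])
  qed
  have gx: "g k x = G x k" if "k < n" for k x using that by (simp add: G_def)
  have inj: "inj_on G Q"
  proof (rule inj_onI)
    fix x y assume xy: "x \<in> Q" "y \<in> Q" "G x = G y"
    then have "(\<Sum>k<n. \<bar>g k y - g k x\<bar>) = 0" by (simp add: gx)
    then have "(\<Sum>l<n. \<bar>y l - x l\<bar>) \<le> 0" using lipschitz[OF xy(1,2)] by simp
    then have "(\<Sum>l<n. \<bar>y l - x l\<bar>) = 0" by (intro antisym sum_nonneg) auto
    then have "y l = x l" if "l < n" for l using that by (subst (asm) sum_nonneg_eq_0_iff) auto
    then show "x = y" using Qs[OF xy(1)] Qs[OF xy(2)] by (intro ext) (metis (mono_tags) mem_Collect_eq not_less)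
  qed
  have Qo: "openin (Euclidean_space n) Q" unfolding Q_def by (rule openin_cube)
  have gQ: "smooth_on n Q (g k)" if "k < n" for k by (rule smooth_on_subset[OF g[OF that] Qo Qe])
  have cont: "continuous_map (subtopology (Euclidean_space n) Q) (Euclidean_space n) G"
    by (rule smooth_on_continuous_map[OF Qo]) (use gQ in \<open>auto simp: G_def\<close>)
  have op: "openin (Euclidean_space n) (G ` Q)" by (rule invariance_of_domain_Euclidean_space[OF Qo cont inj])
  have homeo: "homeomorphic_map (subtopology (Euclidean_space n) Q) (subtopology (Euclidean_space n) (G ` Q)) G"
  proof -
    have "topspace (subtopology (Euclidean_space n) Q) = Q" using openin_subset[OF Qo] by auto
    then show ?thesis
      using invariance_of_domain_Euclidean_space_embedding_map[OF Qo cont inj] unfolding embedding_map_def by simp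
  qed
  define h where "h = inv_into Q G"
  have hQ: "h y \<in> Q" and Gh: "G (h y) = y" if "y \<in> G ` Q" for y
    unfolding h_def using that by (rule inv_into_into, rule f_inv_into_f)
  \<comment> \<open>When only the j-th target coordinate changes, \<open>G\<close> changes only in
    that component. Applying \<open>A\<close> at \<open>x\<close> to the mean value expansions of
    all components recovers the increment of \<open>h\<close>, up to an error controlled by the
    Lipschitz bound.\<close>
  have hder: "((\<lambda>t. h (y(j := t)) i) has_real_derivative A (h y) j i) (at (y j))"
    if y: "y \<in> G ` Q" and j: "j < n" and i: "i < n" for y i j
  proof -
    define x where "x = h y"
    define \<gamma> where "\<gamma> t = h (y(j := t))" for t
    have x: "x \<in> Q" "G x = y" unfolding x_def using hQ Gh y by auto
    have xe: "x \<in> cube n a e" using x Qe by blast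
    have ev: "\<forall>\<^sub>F t in at (y j). y(j := t) \<in> G ` Q"
      using eventually_upd_in_open[OF op y j] unfolding eventually_at_filter by (rule eventually_mono) simp
    have good: "\<gamma> t \<in> Q \<and> G (\<gamma> t) = y(j := t)" if "y(j := t) \<in> G ` Q" for t
      unfolding \<gamma>_def using hQ[OF that] Gh[OF that] by simp
    have dg: "g k (\<gamma> t) - g k x = (if k = j then t - y j else 0)" if "y(j := t) \<in> G ` Q" "k < n" for t k
      using good[OF that(1)] x(2) that(2) by (simp add: gx)
    have lip: "\<bar>\<gamma> t l - x l\<bar> \<le> K * \<bar>t - y j\<bar>" if t: "y(j := t) \<in> G ` Q" and l: "l < n" for t l
    proof -
      have "\<bar>\<gamma> t l - x l\<bar> \<le> (\<Sum>l<n. \<bar>\<gamma> t l - x l\<bar>)" using l by (intro member_le_sum) auto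
      also have "\<dots> \<le> K * (\<Sum>k<n. \<bar>g k (\<gamma> t) - g k x\<bar>)" using lipschitz[OF x(1)] good[OF t] by blast
      also have "(\<Sum>k<n. \<bar>g k (\<gamma> t) - g k x\<bar>) = (\<Sum>k<n. if k = j then \<bar>t - y j\<bar> else 0)"
        by (intro sum.cong refl) (simp add: dg[OF t])
      also have "\<dots> = \<bar>t - y j\<bar>" using j by simp
      finally show ?thesis .
    qed
    have K0: "K \<ge> 0" using C by (simp add: K_def)
    have evc: "\<forall>\<^sub>F t in at (y j). \<gamma> t \<in> cube n x r" if r: "r > 0" for r
    proof -
      have "\<forall>\<^sub>F t in at (y j). \<bar>t - y j\<bar> < r / (K + 1)"
        unfolding eventually_at using r K0 by (intro exI[of _ "r / (K + 1)"]) (auto simp: dist_real_def)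
      with ev show ?thesis
      proof eventually_elim
        case (elim t)
        have "K * \<bar>t - y j\<bar> \<le> (K + 1) * \<bar>t - y j\<bar>" by (intro mult_right_mono) auto
        also have "\<dots> < r" using elim(2) K0 by (simp add: field_simps)
        finally have "\<bar>\<gamma> t l - x l\<bar> < r" if "l < n" for l using lip[OF elim(1) that] by linarith
        then show ?case using good[OF elim(1)] Qs by (simp add: cube_def)
      qed
    qed
    define P where "P t k \<xi> \<longleftrightarrow> (\<forall>l r. l < n \<longrightarrow> \<gamma> t \<in> cube n x r \<longrightarrow> \<xi> l \<in> cube n x r) \<and>
      g k (\<gamma> t) - g k x = (\<Sum>l<n. partial_deriv l (g k) (\<xi> l) * (\<gamma> t l - x l))" for t k \<xi>
    define \<xi> where "\<xi> t k = (SOME \<xi>. P t k \<xi>)" for t k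
    have \<xi>: "P t k (\<xi> t k)" if k: "k < n" and t: "y(j := t) \<in> G ` Q" for t k
    proof -
      have "\<gamma> t \<in> Q" using good[OF t] by blast
      from mv[OF x(1) this k] have "\<exists>\<xi>. P t k \<xi>" unfolding P_def by blast
      then show ?thesis unfolding \<xi>_def by (rule someI_ex)
    qed
    have lim: "((\<lambda>t. partial_deriv l (g k) (\<xi> t k l)) \<longlongrightarrow> partial_deriv l (g k) x) (at (y j))" if k: "k < n" and l: "l < n" for k l
      unfolding tendsto_iff dist_real_def
    proof safe
      fix \<eta> :: real assume "\<eta> > 0"
      obtain r where r: "r > 0" "\<And>z. z \<in> cube n x r \<Longrightarrow> \<bar>partial_deriv l (g k) z - partial_deriv l (g k) x\<bar> < \<eta>"
        by (rule continuous_on_open_cube[OF openin_cube smooth_on_continuous[OF smooth_on_partial[OF g[OF k] l]] xe \<open>\<eta> > 0\<close>], rule that)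
      from ev evc[OF r(1)] show "\<forall>\<^sub>F t in at (y j). \<bar>partial_deriv l (g k) (\<xi> t k l) - partial_deriv l (g k) x\<bar> < \<eta>"
      proof eventually_elim
        case (elim t)
        then have "\<xi> t k l \<in> cube n x r" using \<xi>[OF k] l unfolding P_def by blast
        then show ?case by (rule r(2))
      qed
    qed
    \<comment> \<open>The double sum is the error of evaluating derivatives at \<open>x\<close>
      instead of at the intermediate points. Each summand contains a difference tending to 0 times a
      quotient bounded by \<open>K\<close>.\<close>
    have "((\<lambda>t. A x j i + (\<Sum>k<n. \<Sum>l<n. A x k i * ((partial_deriv l (g k) x - partial_deriv l (g k) (\<xi> t k l)) * ((\<gamma> t l - x l) / (t - y j)))))
      \<longlongrightarrow> A x j i + (\<Sum>k<n. \<Sum>l<n. A x k i * 0)) (at (y j))"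
    proof (intro tendsto_add tendsto_sum tendsto_mult tendsto_const)
      fix k l assume "k \<in> {..<n}" "l \<in> {..<n}"
      then have kl: "k < n" "l < n" by auto
      have z: "((\<lambda>t. K * \<bar>partial_deriv l (g k) x - partial_deriv l (g k) (\<xi> t k l)\<bar>) \<longlongrightarrow> K * \<bar>partial_deriv l (g k) x - partial_deriv l (g k) x\<bar>) (at (y j))"
        by (intro tendsto_intros lim kl)
      show "((\<lambda>t. (partial_deriv l (g k) x - partial_deriv l (g k) (\<xi> t k l)) * ((\<gamma> t l - x l) / (t - y j))) \<longlongrightarrow> 0) (at (y j))"
      proof (rule Lim_null_comparison)
        have "\<forall>\<^sub>F t in at (y j). t \<noteq> y j" by (simp add: eventually_at_filter)
        with ev show "\<forall>\<^sub>F t in at (y j). norm ((partial_deriv l (g k) x - partial_deriv l (g k) (\<xi> t k l)) * ((\<gamma> t l - x l) / (t - y j)))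
            \<le> K * \<bar>partial_deriv l (g k) x - partial_deriv l (g k) (\<xi> t k l)\<bar>"
        proof eventually_elim
          case (elim t)
          have "\<bar>(\<gamma> t l - x l) / (t - y j)\<bar> \<le> K"
            using lip[OF elim(1) kl(2)] elim(2) by (simp add: abs_divide divide_le_eq)
          then show ?case unfolding real_norm_def abs_mult mult.commute[of K] by (rule mult_left_mono) simp
        qed
      qed (use z in simp)
    qed
    then have "((\<lambda>t. A x j i + (\<Sum>k<n. \<Sum>l<n. A x k i * ((partial_deriv l (g k) x - partial_deriv l (g k) (\<xi> t k l)) * ((\<gamma> t l - x l) / (t - y j)))))
      \<longlongrightarrow> A x j i) (at (y j))" by simp
    moreover have "\<forall>\<^sub>F t in at (y j). t \<noteq> y j" by (simp add: eventually_at_filter)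
    with ev have "\<forall>\<^sub>F t in at (y j). A x j i + (\<Sum>k<n. \<Sum>l<n. A x k i * ((partial_deriv l (g k) x - partial_deriv l (g k) (\<xi> t k l)) * ((\<gamma> t l - x l) / (t - y j))))
       = (\<gamma> t i - x i) / (t - y j)"
    proof eventually_elim
      case (elim t)
      define \<Delta> where "\<Delta> l = \<gamma> t l - x l" for l
      have e1: "(\<Sum>k<n. \<Sum>l<n. A x k i * (partial_deriv l (g k) x * \<Delta> l)) = \<Delta> i"
      proof -
        have "(\<Sum>k<n. \<Sum>l<n. A x k i * (partial_deriv l (g k) x * \<Delta> l)) = (\<Sum>l<n. (\<Sum>k<n. A x k i * partial_deriv l (g k) x) * \<Delta> l)"
          by (subst sum.swap) (simp add: sum_distrib_right mult.assoc)
        also have "\<dots> = (\<Sum>l<n. (if l = i then 1 else 0) * \<Delta> l)" by (intro sum.cong refl) (simp add: inv[OF xe i])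
        finally show ?thesis using i by (simp add: sum_delta_mult)
      qed
      have e2: "(\<Sum>k<n. \<Sum>l<n. A x k i * (partial_deriv l (g k) (\<xi> t k l) * \<Delta> l)) = A x j i * (t - y j)"
      proof -
        have "(\<Sum>k<n. \<Sum>l<n. A x k i * (partial_deriv l (g k) (\<xi> t k l) * \<Delta> l)) = (\<Sum>k<n. A x k i * (g k (\<gamma> t) - g k x))"
          using \<xi>[OF _ elim(1)] by (intro sum.cong refl) (simp add: P_def \<Delta>_def sum_distrib_left)
        also have "\<dots> = (\<Sum>k<n. if k = j then A x j i * (t - y j) else 0)"
          by (intro sum.cong refl) (simp add: dg[OF elim(1)])
        finally show ?thesis using j by simp
      qed
      have "A x k i * ((u - v) * (\<Delta> l / (t - y j))) = (A x k i * (u * \<Delta> l) - A x k i * (v * \<Delta> l)) / (t - y j)" for k l u v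
        by (simp add: algebra_simps diff_divide_distrib)
      then have "(\<Sum>k<n. \<Sum>l<n. A x k i * ((partial_deriv l (g k) x - partial_deriv l (g k) (\<xi> t k l)) * (\<Delta> l / (t - y j))))
         = ((\<Sum>k<n. \<Sum>l<n. A x k i * (partial_deriv l (g k) x * \<Delta> l)) - (\<Sum>k<n. \<Sum>l<n. A x k i * (partial_deriv l (g k) (\<xi> t k l) * \<Delta> l))) / (t - y j)"
        by (simp only: sum_subtractf sum_divide_distrib[symmetric])
      also have "\<dots> = \<Delta> i / (t - y j) - A x j i" unfolding e1 e2 using elim(2) by (simp add: diff_divide_distrib)
      finally show ?case by (simp add: \<Delta>_def)
    qed
    ultimately have "((\<lambda>t. (\<gamma> t i - x i) / (t - y j)) \<longlongrightarrow> A x j i) (at (y j))" by (rule Lim_transform_eventually)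
    then show ?thesis by (simp add: has_field_derivative_iff \<gamma>_def x_def)
  qed
  \<comment> \<open>The composites of smooth functions on \<open>Q\<close> with \<open>h\<close>
    form a class closed under partial derivatives, because the Jacobian of \<open>h\<close> is again
    such a composite, with entries of \<open>A\<close>.\<close>
  have hsmooth: "smooth_on n (G ` Q) (\<lambda>y. F (h y))" if F: "smooth_on n Q F" for F
  proof (rule smooth_on_coinduct[OF op, where S = "{f. \<exists>F. smooth_on n Q F \<and> f = (\<lambda>y. F (h y))}"])
    show "(\<lambda>y. F (h y)) \<in> {f. \<exists>F. smooth_on n Q F \<and> f = (\<lambda>y. F (h y))}" using F by blast
  next
    fix f assume "f \<in> {f. \<exists>F. smooth_on n Q F \<and> f = (\<lambda>y. F (h y))}"
    then obtain F where F: "smooth_on n Q F" "f = (\<lambda>y. F (h y))" by blast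
    have sub: "Q \<subseteq> espace n" "G ` Q \<subseteq> espace n" using Qo op unfolding openin_Euclidean_space_iff by blast+
    obtain h' where h': "homeomorphic_maps (subtopology (Euclidean_space n) Q) (subtopology (Euclidean_space n) (G ` Q)) G h'"
      using homeo homeomorphic_map_maps by blast
    then have h'c: "continuous_map (subtopology (Euclidean_space n) (G ` Q)) (subtopology (Euclidean_space n) Q) h'"
      and h'i: "\<forall>x\<in>topspace (subtopology (Euclidean_space n) Q). h' (G x) = x"
      unfolding homeomorphic_maps_def by blast+
    have Fc: "continuous_map (subtopology (Euclidean_space n) Q) euclideanreal F"
      unfolding continuous_map_Euclidean_subspace[OF sub(1)] by (rule smooth_on_continuous[OF F(1)])
    have "continuous_map (subtopology (Euclidean_space n) (G ` Q)) euclideanreal (F \<circ> h')"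
      by (rule continuous_map_compose[OF h'c Fc])
    then have "continuous_map (subtopology (Euclidean_space n) (G ` Q)) euclideanreal f"
    proof (rule continuous_map_eq)
      fix y assume "y \<in> topspace (subtopology (Euclidean_space n) (G ` Q))"
      then have y: "y \<in> G ` Q" by simp
      have "h' (G (h y)) = h y" using h'i hQ[OF y] openin_subset[OF Qo] by auto
      then show "(F \<circ> h') y = f y" using Gh[OF y] F(2) by simp
    qed
    then show "continuous_on (G ` Q) f" unfolding continuous_map_Euclidean_subspace[OF sub(2)] .
    fix j assume j: "j < n"
    have "smooth_on n Q (\<lambda>x. \<Sum>i<n. partial_deriv i F x * A x j i)"
      by (intro smooth_on_sum Qo smooth_on_mult smooth_on_partial[OF F(1)] smooth_on_subset[OF A[OF j] Qo Qe]) auto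
    moreover have "((\<lambda>t. f (y(j := t))) has_real_derivative (\<Sum>i<n. partial_deriv i F (h y) * A (h y) j i)) (at (y j))"
      if y: "y \<in> G ` Q" for y
    proof -
      have ev: "\<forall>\<^sub>F t in at (y j). y(j := t) \<in> G ` Q"
        using eventually_upd_in_open[OF op y j] unfolding eventually_at_filter by (rule eventually_mono) simp
      have "((\<lambda>t. F (h (y(j := t)))) has_real_derivative (\<Sum>i<n. partial_deriv i F (h (y(j := y j))) * A (h y) j i)) (at (y j))"
      proof (rule smooth_on_chain_rule[OF F(1)])
        show "h (y(j := y j)) \<in> Q" using hQ[OF y] by simp
        show "((\<lambda>t. h (y(j := t)) i) has_real_derivative A (h y) j i) (at (y j))" if "i < n" for i
          by (rule hder[OF y j that])
        show "\<forall>\<^sub>F t in at (y j). h (y(j := t)) \<in> espace n"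
          using ev by eventually_elim (rule Qs[OF hQ])
      qed
      then show ?thesis using F(2) by simp
    qed
    ultimately show "\<exists>g\<in>{f. \<exists>F. smooth_on n Q F \<and> f = (\<lambda>y. F (h y))}. \<forall>y\<in>G ` Q. ((\<lambda>t. f (y(j := t))) has_real_derivative g y) (at (y j))"
      by (intro bexI[of _ "\<lambda>y. \<Sum>i<n. partial_deriv i F (h y) * A (h y) j i"]) blast+
  qed
  show thesis
    by (rule that[OF d(1,2)]) (use inj op homeo hsmooth in \<open>simp_all add: Q_def h_def\<close>)
qed

section \<open>Charts adapted to the frame\<close>

locale commuting_frame = commuting_fields +
  assumes all_span: "\<And>q. q \<in> mcarrier M \<Longrightarrow> spans q"
begin

text \<open>A chart in which \<open>Z j\<close> is the j-th coordinate field. It need not belong to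
  the atlas, so smoothness of its inverse is included as a clause about arbitrary smooth
  functions.\<close>

definition straight :: "'a set \<Rightarrow> ('a \<Rightarrow> nat \<Rightarrow> real) \<Rightarrow> bool" where
  "straight U x \<longleftrightarrow> openin (mtop M) U \<and> openin (Euclidean_space (mdim M)) (x ` U) \<and>
     homeomorphic_map (subtopology (mtop M) U) (subtopology (Euclidean_space (mdim M)) (x ` U)) x \<and>
     (\<forall>k<mdim M. smooth_fun_on M U (\<lambda>q. x q k) \<and> (\<forall>j<mdim M. \<forall>q\<in>U. Z j q (\<lambda>q. x q k) = (if j = k then 1 else 0))) \<and>
     (\<forall>W F. smooth_fun_on M W F \<longrightarrow> W \<subseteq> U \<longrightarrow> smooth_on (mdim M) (x ` W) (\<lambda>y. F (inv_into U x y)))"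

lemma straight_exists:
  assumes p: "p \<in> mcarrier M"
  obtains U x where "straight U x" "p \<in> U"
proof -
  let ?n = "mdim M"
  obtain U \<phi> where c: "(U, \<phi>) \<in> mcharts M" "p \<in> U" by (rule chart_exists[OF p])
  have Uc: "q \<in> mcarrier M" if "q \<in> U" for q using chart_subset[OF c(1)] that by blast
  have det: "mdet ?n (A \<phi> q) \<noteq> 0" if "q \<in> U" for q
    by (rule spans_mdet[OF c(1) that all_span[OF Uc[OF that]]])
  \<comment> \<open>The inverse of the frame matrix: \<open>b l k\<close> is the l-th component, in
    the chart, of the one-form dual to \<open>Z k\<close>.\<close>
  define b where "b l k q = inverse (mdet ?n (A \<phi> q)) * madj ?n (A \<phi> q) l k" for l k q
  have As: "smooth_fun_on M U (\<lambda>q. A \<phi> q k l)" if "k < ?n" for k l by (rule A_smooth[OF c(1) that])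
  have bs: "smooth_fun_on M U (b l k)" if "k < ?n" "l < ?n" for k l
    unfolding b_def
    by (intro smooth_fun_on_mult smooth_fun_on_inverse smooth_fun_on_mdet smooth_fun_on_madj chart_open[OF c(1)] As det that)
  have Ab: "(\<Sum>l<?n. A \<phi> q k l * b l k' q) = (if k = k' then 1 else 0)" if "q \<in> U" "k < ?n" "k' < ?n" for q k k'
  proof -
    have "(\<Sum>l<?n. A \<phi> q k l * b l k' q) = inverse (mdet ?n (A \<phi> q)) * (\<Sum>l<?n. A \<phi> q k l * madj ?n (A \<phi> q) l k')"
      by (simp add: b_def sum_distrib_left mult.left_commute)
    then show ?thesis using madj_mult(2)[OF that(2,3), of "A \<phi> q"] det[OF that(1)] by simp
  qed
  have bA: "(\<Sum>k<?n. A \<phi> q k l' * b l k q) = (if l = l' then 1 else 0)" if "q \<in> U" "l < ?n" "l' < ?n" for q l l'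
  proof -
    have "(\<Sum>k<?n. A \<phi> q k l' * b l k q) = inverse (mdet ?n (A \<phi> q)) * (\<Sum>k<?n. madj ?n (A \<phi> q) l k * A \<phi> q k l')"
      by (simp add: b_def sum_distrib_left mult_ac)
    then show ?thesis using madj_mult(1)[OF that(2,3), of "A \<phi> q"] det[OF that(1)] by simp
  qed
  \<comment> \<open>For a dual form \<theta> the values on the frame are constant, so d\<theta>(Z j,
    Z k) reduces to minus \<theta> on the commutator, which is 0. The computation below is this
    argument in components.\<close>
  have closed: "chart_partial (U, \<phi>) i (b l k') q = chart_partial (U, \<phi>) l (b i k') q"
    if q: "q \<in> U" and il: "i < ?n" "l < ?n" and k': "k' < ?n" for i l k' q
  proof -
    note qM = Uc[OF q]
    define D where "D i l = chart_partial (U, \<phi>) i (b l k') q" for i l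
    have at: "smooth_at M q (b l k')" if "l < ?n" for l by (rule smooth_atI[OF bs[OF k' that] q])
    have Aat: "smooth_at M q (\<lambda>q. A \<phi> q k l)" if "k < ?n" for k l by (rule smooth_atI[OF As[OF that] q])
    have ZD: "Z j q (b l k') = (\<Sum>i<?n. A \<phi> q j i * D i l)" if "j < ?n" "l < ?n" for j l
      unfolding A_def D_def by (rule tangent_expand[OF c(1) q Z_tangent[OF that(1) qM] at[OF that(2)]])
    have ZA: "Z j q (\<lambda>q. A \<phi> q k l) = Z k q (\<lambda>q. A \<phi> q j l)" if "j < ?n" "k < ?n" for j k l
      using fun_cong[OF Z_comm[OF that qM], of "\<lambda>x. \<phi> x l"] smooth_at_coordinate[OF c(1) q]
      by (simp add: commutator_def A_def)
    have prod: "(\<Sum>l<?n. A \<phi> q k l * Z j q (b l k')) = - (\<Sum>l<?n. b l k' q * Z j q (\<lambda>q. A \<phi> q k l))"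
      if j: "j < ?n" and k: "k < ?n" for j k
    proof -
      note T = Z_tangent[OF j qM]
      have sm: "smooth_at M q (\<lambda>q. A \<phi> q k l * b l k' q)" if "l < ?n" for l by (rule smooth_at_mult[OF Aat[OF k] at[OF that]])
      have "0 = Z j q (\<lambda>q. if k = k' then 1 else 0)" by (rule tangent_const[OF T qM, symmetric])
      also have "\<dots> = Z j q (\<lambda>q. \<Sum>l<?n. A \<phi> q k l * b l k' q)"
        by (rule tangent_cong[OF T smooth_at_const[OF qM] chart_open[OF c(1)] q]) (simp add: Ab k k')
      also have "\<dots> = (\<Sum>l<?n. Z j q (\<lambda>q. A \<phi> q k l * b l k' q))" by (rule tangent_sum[OF T qM]) (simp add: sm)
      also have "\<dots> = (\<Sum>l<?n. A \<phi> q k l * Z j q (b l k') + b l k' q * Z j q (\<lambda>q. A \<phi> q k l))"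
        by (intro sum.cong refl tangent_mult[OF T]) (simp_all add: at Aat[OF k])
      finally show ?thesis by (simp add: sum.distrib)
    qed
    have sym: "(\<Sum>l<?n. A \<phi> q k l * Z j q (b l k')) = (\<Sum>l<?n. A \<phi> q j l * Z k q (b l k'))" if "j < ?n" "k < ?n" for j k
      unfolding prod[OF that] prod[OF that(2,1)] using ZA[OF that] by simp
    \<comment> \<open>The matrix of differences \<open>D i l - D l i\<close> vanishes when
      contracted with rows of the frame matrix on both sides. Invertibility removes the two
      contractions one after the other.\<close>
    have "(\<Sum>l<?n. A \<phi> q k l * (\<Sum>i<?n. A \<phi> q j i * (D i l - D l i))) = 0" if "j < ?n" "k < ?n" for j k
    proof -
      have "(\<Sum>l<?n. A \<phi> q k l * (\<Sum>i<?n. A \<phi> q j i * D i l)) = (\<Sum>l<?n. A \<phi> q j l * (\<Sum>i<?n. A \<phi> q k i * D i l))"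
        using sym[OF that] ZD that by simp
      also have "\<dots> = (\<Sum>l<?n. A \<phi> q k l * (\<Sum>i<?n. A \<phi> q j i * D l i))"
        by (simp add: sum_distrib_left mult.left_commute) (rule sum.swap)
      finally show ?thesis by (simp add: right_diff_distrib sum_subtractf)
    qed
    then have "(\<Sum>i<?n. A \<phi> q j i * (D i l - D l i)) = 0" if "j < ?n" "l < ?n" for j l
      using mdet_nonzero_cols[OF det[OF q], of "\<lambda>l. \<Sum>i<?n. A \<phi> q j i * (D i l - D l i)"] that by blast
    then have "D i l - D l i = 0"
      using mdet_nonzero_cols[OF det[OF q], of "\<lambda>i. D i l - D l i"] il by blast
    then show ?thesis by (simp add: D_def)
  qed
  note pe = chart_espace[OF c]
  obtain e where e: "e > 0" "cube ?n (\<phi> p) e \<subseteq> \<phi> ` (U \<inter> U)"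
    by (rule chart_cube[OF c(1) chart_open[OF c(1)] c(2,2)])
  have inU: "inv_into U \<phi> x \<in> U" "\<phi> (inv_into U \<phi> x) = x" if "x \<in> cube ?n (\<phi> p) e" for x
    using that e(2) by (auto intro: inv_into_into f_inv_into_f)
  have rep: "smooth_on ?n (cube ?n (\<phi> p) e) (\<lambda>x. F (inv_into U \<phi> x))" if "smooth_fun_on M U F" for F
    by (rule smooth_on_subset[OF smooth_fun_onD[OF that c(1)] openin_cube e(2)])
  have "\<exists>g. smooth_on ?n (cube ?n (\<phi> p) e) g \<and>
      (\<forall>l<?n. \<forall>x\<in>cube ?n (\<phi> p) e. partial_deriv l g x = b l k (inv_into U \<phi> x))" if k: "k < ?n" for k
  proof (rule poincare_one_forms[where B = "\<lambda>l x. b l k (inv_into U \<phi> x)" and n = ?n and a = "\<phi> p" and e = e, OF _ pe])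
    show "smooth_on ?n (cube ?n (\<phi> p) e) (\<lambda>x. b j k (inv_into U \<phi> x))" if "j < ?n" for j by (rule rep[OF bs[OF k that]])
    show "partial_deriv i (\<lambda>x. b j k (inv_into U \<phi> x)) x = partial_deriv j (\<lambda>x. b i k (inv_into U \<phi> x)) x"
      if "i < ?n" "j < ?n" "x \<in> cube ?n (\<phi> p) e" for i j x
      using closed[OF inU(1)[OF that(3)] that(1,2) k] inU(2)[OF that(3)] by (simp add: chart_partial_def)
  qed blast
  then have "\<exists>g. \<forall>k\<in>{..<?n}. smooth_on ?n (cube ?n (\<phi> p) e) (g k) \<and>
      (\<forall>l<?n. \<forall>x\<in>cube ?n (\<phi> p) e. partial_deriv l (g k) x = b l k (inv_into U \<phi> x))"
    by (intro bchoice) auto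
  then obtain g where g: "\<And>k. k < ?n \<Longrightarrow> smooth_on ?n (cube ?n (\<phi> p) e) (g k)"
    "\<And>k l x. k < ?n \<Longrightarrow> l < ?n \<Longrightarrow> x \<in> cube ?n (\<phi> p) e \<Longrightarrow> partial_deriv l (g k) x = b l k (inv_into U \<phi> x)"
    by auto
  define G where "G x = (\<lambda>k. if k < ?n then g k x else 0)" for x
  have Geq: "G = (\<lambda>x k. if k < ?n then g k x else 0)" by (simp add: G_def fun_eq_iff)
  have Asm: "smooth_on ?n (cube ?n (\<phi> p) e) (\<lambda>x. A \<phi> (inv_into U \<phi> x) j l)" if "j < ?n" "l < ?n" for j l
    by (rule rep[OF As[OF that(1)]])
  \<comment> \<open>The partial derivatives of the integrated functions are the entries of
    \<open>b\<close>, whose inverse is the frame matrix: this is the a priori knowledge that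
    \<open>local_inverse\<close> requires.\<close>
  have invA: "(\<Sum>k<?n. A \<phi> (inv_into U \<phi> x) k i * partial_deriv l (g k) x) = (if l = i then 1 else 0)"
    if "x \<in> cube ?n (\<phi> p) e" "i < ?n" "l < ?n" for x i l
    using bA[OF inU(1)[OF that(1)] that(3,2)] g(2)[OF _ that(3,1)] by simp
  obtain d where d: "0 < d" "d \<le> e" "inj_on G (cube ?n (\<phi> p) d)" "openin (Euclidean_space ?n) (G ` cube ?n (\<phi> p) d)"
    "homeomorphic_map (subtopology (Euclidean_space ?n) (cube ?n (\<phi> p) d)) (subtopology (Euclidean_space ?n) (G ` cube ?n (\<phi> p) d)) G"
    "\<And>F. smooth_on ?n (cube ?n (\<phi> p) d) F \<Longrightarrow> smooth_on ?n (G ` cube ?n (\<phi> p) d) (\<lambda>y. F (inv_into (cube ?n (\<phi> p) d) G y))"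
    by (rule local_inverse[where g = g and n = ?n and a = "\<phi> p" and e = e and A = "\<lambda>x. A \<phi> (inv_into U \<phi> x)",
          OF pe e(1) g(1) Asm invA, folded Geq], assumption+, rule that)
  define Q where "Q = cube ?n (\<phi> p) d"
  have Qo: "openin (Euclidean_space ?n) Q" unfolding Q_def by (rule openin_cube)
  have Qe: "Q \<subseteq> cube ?n (\<phi> p) e" unfolding Q_def by (rule cube_mono[OF d(2)])
  define U0 where "U0 = {q \<in> U. \<phi> q \<in> Q}"
  have U0: "openin (mtop M) U0" "p \<in> U0" "U0 \<subseteq> U"
    unfolding U0_def using chart_open_preimage[OF c(1) Qo] c(2) centre_in_cube[OF pe d(1)] by (auto simp: Q_def)
  have img: "\<phi> ` U0 = Q"
  proof
    show "Q \<subseteq> \<phi> ` U0"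
    proof
      fix x assume x: "x \<in> Q"
      then have "inv_into U \<phi> x \<in> U" "\<phi> (inv_into U \<phi> x) = x" using inU Qe by blast+
      then have "inv_into U \<phi> x \<in> U0" "x = \<phi> (inv_into U \<phi> x)" using x by (auto simp: U0_def)
      then show "x \<in> \<phi> ` U0" by blast
    qed
    show "\<phi> ` U0 \<subseteq> Q" by (auto simp: U0_def)
  qed
  define x where "x q = G (\<phi> q)" for q
  have xU0: "x ` U0 = G ` Q" unfolding x_def img[symmetric] by auto
  have injx: "inj_on x U0"
  proof (rule inj_onI)
    fix q q' assume *: "q \<in> U0" "q' \<in> U0" "x q = x q'"
    then have "\<phi> q = \<phi> q'" using d(3) by (auto simp: x_def U0_def Q_def dest: inj_onD)
    then show "q = q'" using chart_inj[OF c(1)] * U0(3) by (auto dest: inj_onD)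
  qed
  have opx: "openin (Euclidean_space ?n) (x ` U0)" unfolding xU0 Q_def by (rule d(4))
  have homx: "homeomorphic_map (subtopology (mtop M) U0) (subtopology (Euclidean_space ?n) (x ` U0)) x"
  proof -
    have "homeomorphic_map (subtopology (subtopology (mtop M) U) U0) (subtopology (subtopology (Euclidean_space ?n) (\<phi> ` U)) Q) \<phi>"
    proof (rule homeomorphic_map_subtopologies[OF chart_homeo[OF c(1)]])
      have "topspace (subtopology (mtop M) U) \<inter> U0 = U0" using U0(3) chart_subset[OF c(1)] by auto
      moreover have "topspace (subtopology (Euclidean_space ?n) (\<phi> ` U)) \<inter> Q = Q"
        using img U0(3) openin_subset[OF chart_image_open[OF c(1)]] by auto
      ultimately show "\<phi> ` (topspace (subtopology (mtop M) U) \<inter> U0) = topspace (subtopology (Euclidean_space ?n) (\<phi> ` U)) \<inter> Q"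
        using img by simp
    qed
    moreover have "subtopology (subtopology (mtop M) U) U0 = subtopology (mtop M) U0"
      using U0(3) by (simp add: subtopology_subtopology inf.absorb2)
    moreover have "subtopology (subtopology (Euclidean_space ?n) (\<phi> ` U)) Q = subtopology (Euclidean_space ?n) Q"
      using img U0(3) by (simp add: subtopology_subtopology inf.absorb2 image_mono[OF U0(3), of \<phi>, unfolded img])
    ultimately have "homeomorphic_map (subtopology (mtop M) U0) (subtopology (Euclidean_space ?n) Q) \<phi>" by simp
    from homeomorphic_map_compose[OF this d(5)[folded Q_def]]
    show ?thesis unfolding xU0 by (rule homeomorphic_map_eq) (simp add: x_def)
  qed
  have "straight U0 x"
    unfolding straight_def
  proof (intro conjI allI impI ballI)
    show "openin (mtop M) U0" by (rule U0(1))
    show "openin (Euclidean_space ?n) (x ` U0)" by (rule opx)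
    show "homeomorphic_map (subtopology (mtop M) U0) (subtopology (Euclidean_space ?n) (x ` U0)) x" by (rule homx)
  next
    fix k assume k: "k < ?n"
    have "smooth_fun_on M {q \<in> U. \<phi> q \<in> Q} (\<lambda>q. g k (\<phi> q))"
      by (rule smooth_fun_on_chart_comp[OF c(1) smooth_on_subset[OF g(1)[OF k] Qo Qe]])
    then show sm: "smooth_fun_on M U0 (\<lambda>q. x q k)" by (simp add: U0_def x_def G_def k)
    fix j q assume j: "j < ?n" and q: "q \<in> U0"
    have qU: "q \<in> U" "\<phi> q \<in> Q" "q \<in> mcarrier M" using q U0(3) Uc by (auto simp: U0_def)
    have cp: "chart_partial (U, \<phi>) l (\<lambda>q. x q k) q = b l k q" if l: "l < ?n" for l
    proof -
      have "chart_partial (U, \<phi>) l (\<lambda>q. x q k) q = partial_deriv l (g k) (\<phi> q)"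
        unfolding chart_partial_def fst_conv snd_conv
      proof (rule partial_deriv_cong[OF Qo qU(2) l])
        fix z assume "z \<in> Q"
        then show "x (inv_into U \<phi> z) k = g k z" using inU(2) Qe k by (auto simp: x_def G_def)
      qed
      also have "\<dots> = b l k (inv_into U \<phi> (\<phi> q))" by (rule g(2)[OF k l]) (use qU Qe in blast)
      finally show ?thesis using c(1) qU(1) by simp
    qed
    have "Z j q (\<lambda>q. x q k) = (\<Sum>l<?n. A \<phi> q j l * chart_partial (U, \<phi>) l (\<lambda>q. x q k) q)"
      unfolding A_def by (rule tangent_expand[OF c(1) qU(1) Z_tangent[OF j qU(3)] smooth_atI[OF sm q]])
    also have "\<dots> = (\<Sum>l<?n. A \<phi> q j l * b l k q)" using cp by simp
    finally show "Z j q (\<lambda>q. x q k) = (if j = k then 1 else 0)" using Ab[OF qU(1) j k] by simp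
  next
    fix W F assume F: "smooth_fun_on M W F" and W: "W \<subseteq> U0"
    have "openin (subtopology (mtop M) U0) W"
      using W smooth_fun_on_open[OF F] by (simp add: openin_open_subtopology[OF U0(1)])
    then have "openin (subtopology (Euclidean_space ?n) (x ` U0)) (x ` W)"
      using homeomorphic_imp_open_map[OF homx] unfolding open_map_def by blast
    then have opW: "openin (Euclidean_space ?n) (x ` W)" using openin_trans_full opx by blast
    have inv: "inv_into Q G (x q) = \<phi> q" if "q \<in> U0" for q
      using that d(3) by (simp add: x_def U0_def Q_def)
    have "smooth_on ?n (x ` W) (\<lambda>y. F (inv_into U \<phi> (inv_into Q G y)))"
    proof (rule smooth_on_comp[OF opW smooth_fun_onD[OF F c(1)]])
      fix j assume "j < ?n"
      have "smooth_on ?n (G ` Q) (\<lambda>y. inv_into Q G y j)"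
        using d(6)[OF smooth_on_coordinate[OF openin_cube], of j] by (simp add: Q_def)
      then show "smooth_on ?n (x ` W) (\<lambda>y. inv_into Q G y j)"
        by (rule smooth_on_subset[OF _ opW]) (use W xU0 in blast)
    next
      fix y assume "y \<in> x ` W"
      then obtain q where "q \<in> W" "y = x q" by blast
      then show "inv_into Q G y \<in> \<phi> ` (U \<inter> W)" using inv W U0(3) by auto
    qed
    then show "smooth_on ?n (x ` W) (\<lambda>y. F (inv_into U0 x y))"
    proof (rule smooth_on_cong[rotated])
      fix y assume "y \<in> x ` W"
      then obtain q where q: "q \<in> W" "y = x q" by blast
      then have q0: "q \<in> U0" "q \<in> U" using W U0(3) by blast+
      have "inv_into U0 x y = q" using q(2) q0(1) injx by simp
      moreover have "inv_into U \<phi> (inv_into Q G y) = q" using inv[OF q0(1)] chart_inv[OF c(1) q0(2)] q(2) by simp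
      ultimately show "F (inv_into U \<phi> (inv_into Q G y)) = F (inv_into U0 x y)" by simp
    qed
  qed
  then show thesis using that U0(2) by blast
qed

text \<open>Every \<open>Z j\<close> takes the same value on the k-th coordinate of both charts, so
  their difference is killed by all tangent vectors and is locally constant.\<close>

lemma straight_translation:
  assumes x: "straight U x" and y: "straight V y" and p: "p \<in> U" "p \<in> V"
  obtains W where "openin (mtop M) W" "p \<in> W" "W \<subseteq> U \<inter> V"
    "\<And>q k. q \<in> W \<Longrightarrow> k < mdim M \<Longrightarrow> x q k - x p k = y q k - y p k"
proof -
  let ?n = "mdim M"
  have op: "openin (mtop M) (U \<inter> V)" using x y unfolding straight_def by blast
  have "\<exists>W. openin (mtop M) W \<and> p \<in> W \<and> W \<subseteq> U \<inter> V \<and> (\<forall>q\<in>W. x q k - x p k = y q k - y p k)" if k: "k < ?n" for k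
  proof -
    have "smooth_fun_on M U (\<lambda>q. x q k)" "smooth_fun_on M V (\<lambda>q. y q k)"
      using x y k unfolding straight_def by simp_all
    then have sx: "smooth_fun_on M (U \<inter> V) (\<lambda>q. x q k)" and sy: "smooth_fun_on M (U \<inter> V) (\<lambda>q. y q k)"
      using smooth_fun_on_subset[OF _ op] by auto
    define F where "F q = x q k + (-1) * y q k" for q
    have F: "smooth_fun_on M (U \<inter> V) F"
      unfolding F_def by (rule smooth_fun_on_add[OF sx smooth_fun_on_cmult[OF sy]])
    have zero: "v F = 0" if q: "q \<in> U \<inter> V" and v: "v \<in> tangent_space M q" for q v
    proof -
      have qM: "q \<in> mcarrier M" using q openin_subset[OF op] by blast
      obtain a where a: "v = (\<Sum>j<?n. fun_scale (a j) (Z j q))" using all_span[OF qM] v unfolding spans_def by blast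
      have "Z j q F = 0" if j: "j < ?n" for j
      proof -
        have "Z j q F = Z j q (\<lambda>q. x q k) + Z j q (\<lambda>q. (-1) * y q k)"
          unfolding F_def by (rule tangent_add[OF Z_tangent[OF j qM] smooth_atI[OF sx q] smooth_at_cmult[OF smooth_atI[OF sy q]]])
        also have "Z j q (\<lambda>q. (-1) * y q k) = (-1) * Z j q (\<lambda>q. y q k)"
          by (rule tangent_cmult[OF Z_tangent[OF j qM] smooth_atI[OF sy q]])
        finally show ?thesis using x y j k q unfolding straight_def by simp
      qed
      then show ?thesis using a by (simp add: sum_fun_apply)
    qed
    have pUV: "p \<in> U \<inter> V" using p by blast
    obtain W where W: "openin (mtop M) W" "p \<in> W" "W \<subseteq> U \<inter> V" "\<And>q. q \<in> W \<Longrightarrow> F q = F p"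
      by (rule locally_constant[where f = F, OF F pUV], erule (1) zero, rule that)
    show ?thesis
    proof (intro exI[of _ W] conjI ballI W(1-3))
      fix q assume "q \<in> W"
      from W(4)[OF this] show "x q k - x p k = y q k - y p k" by (simp add: F_def)
    qed
  qed
  then have "\<exists>W. \<forall>k\<in>{..<?n}. openin (mtop M) (W k) \<and> p \<in> W k \<and> W k \<subseteq> U \<inter> V \<and> (\<forall>q\<in>W k. x q k - x p k = y q k - y p k)"
    by (intro bchoice) auto
  then obtain W where "\<forall>k\<in>{..<?n}. openin (mtop M) (W k) \<and> p \<in> W k \<and> W k \<subseteq> U \<inter> V \<and> (\<forall>q\<in>W k. x q k - x p k = y q k - y p k)"
    by blast
  then have W: "\<And>k. k < ?n \<Longrightarrow> openin (mtop M) (W k) \<and> p \<in> W k \<and> W k \<subseteq> U \<inter> V \<and> (\<forall>q\<in>W k. x q k - x p k = y q k - y p k)"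
    by blast
  show thesis
  proof (rule that[of "\<Inter> (insert (U \<inter> V) (W ` {..<?n}))"])
    show "openin (mtop M) (\<Inter> (insert (U \<inter> V) (W ` {..<?n})))" using W op by (intro openin_Inter) auto
    show "p \<in> \<Inter> (insert (U \<inter> V) (W ` {..<?n}))" using W p by auto
    show "\<Inter> (insert (U \<inter> V) (W ` {..<?n})) \<subseteq> U \<inter> V" by auto
    show "x q k - x p k = y q k - y p k" if "q \<in> \<Inter> (insert (U \<inter> V) (W ` {..<?n}))" "k < ?n" for q k
      using that W[OF that(2)] by auto
  qed
qed

end

section \<open>Lattices\<close>

lemma espace_subspace: "fun_vs.subspace (espace n)"
  by (rule fun_vs.subspaceI) auto

definition axis_vec :: "nat \<Rightarrow> nat \<Rightarrow> real" where
  "axis_vec j = (\<lambda>i. if i = j then 1 else 0)"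

lemma espace_expand: "v \<in> espace n \<Longrightarrow> v = (\<Sum>j<n. fun_scale (v j) (axis_vec j))"
proof
  fix i assume v: "v \<in> espace n"
  have "(\<Sum>j<n. fun_scale (v j) (axis_vec j)) i = (\<Sum>j<n. (if j = i then 1 else 0) * v j)"
    by (simp add: sum_fun_apply axis_vec_def mult.commute eq_commute[of i])
  also have "\<dots> = v i" using v by (simp add: sum_delta_mult)
  finally show "v i = (\<Sum>j<n. fun_scale (v j) (axis_vec j)) i" by simp
qed

lemma espace_span: "espace n = fun_vs.span (axis_vec ` {..<n})"
proof
  show "espace n \<subseteq> fun_vs.span (axis_vec ` {..<n})"
  proof
    fix v assume v: "v \<in> espace n"
    have "(\<Sum>j<n. fun_scale (v j) (axis_vec j)) \<in> fun_vs.span (axis_vec ` {..<n})"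
      by (intro fun_vs.span_sum fun_vs.span_scale fun_vs.span_base) auto
    then show "v \<in> fun_vs.span (axis_vec ` {..<n})" by (subst espace_expand[OF v])
  qed
  show "fun_vs.span (axis_vec ` {..<n}) \<subseteq> espace n"
    by (rule fun_vs.span_minimal[OF _ espace_subspace]) (auto simp: axis_vec_def)
qed

lemma axis_vec_independent: "inj_on axis_vec {..<n}" "fun_vs.independent (axis_vec ` {..<n})"
proof -
  have z: "c j = 0" if "(\<Sum>j<n. fun_scale (c j) (axis_vec j)) = 0" "j \<in> {..<n}" for c j
  proof -
    have "(\<Sum>i<n. (if i = j then 1 else 0) * c i) = 0"
      using fun_cong[OF that(1), of j] by (simp add: sum_fun_apply axis_vec_def mult.commute eq_commute[of j])
    then show ?thesis using that(2) by (simp add: sum_delta_mult)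
  qed
  show "inj_on axis_vec {..<n}" by (rule independent_familyI(1)) (simp, erule (1) z)
  show "fun_vs.independent (axis_vec ` {..<n})" by (rule independent_familyI(2)) (simp, erule (1) z)
qed

text \<open>Discreteness is asked at 0 only, since differences carry it to every lattice point.
  Cocompactness is recorded by a radius \<open>R\<close> such that every vector is within
  \<open>R\<close>, coordinatewise, of the lattice.\<close>

locale euclidean_lattice =
  fixes n :: nat and \<Lambda> :: "(nat \<Rightarrow> real) set" and \<epsilon> R :: real
  assumes in_espace: "\<Lambda> \<subseteq> espace n"
    and zero: "0 \<in> \<Lambda>" and diff: "\<And>v w. v \<in> \<Lambda> \<Longrightarrow> w \<in> \<Lambda> \<Longrightarrow> v - w \<in> \<Lambda>"
    and \<epsilon>: "\<epsilon> > 0" and discrete: "\<And>v. v \<in> \<Lambda> \<Longrightarrow> v \<in> cube n 0 \<epsilon> \<Longrightarrow> v = 0"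
    and cocompact: "\<And>v. v \<in> espace n \<Longrightarrow> \<exists>w\<in>\<Lambda>. v - w \<in> cube n 0 R"
begin

lemma add: "v \<in> \<Lambda> \<Longrightarrow> w \<in> \<Lambda> \<Longrightarrow> v + w \<in> \<Lambda>"
  using diff[of v "0 - w"] diff[OF zero, of w] by simp

lemma int_scale: "v \<in> \<Lambda> \<Longrightarrow> fun_scale (of_int k) v \<in> \<Lambda>"
proof -
  assume v: "v \<in> \<Lambda>"
  have nat: "fun_scale (of_nat k) v \<in> \<Lambda>" for k
  proof (induction k)
    case 0
    then show ?case using zero by (simp add: zero_fun_def)
  next
    case (Suc k)
    have "fun_scale (of_nat (Suc k)) v = fun_scale (of_nat k) v + v" by (simp add: fun_eq_iff algebra_simps)
    then show ?case using add[OF Suc v] by simp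
  qed
  show ?thesis
  proof (cases "k \<ge> 0")
    case True
    then show ?thesis using nat[of "nat k"] by simp
  next
    case False
    then have "fun_scale (of_int k) v = 0 - fun_scale (of_nat (nat (- k))) v" by (simp add: fun_eq_iff)
    then show ?thesis using diff[OF zero nat[of "nat (- k)"]] by simp
  qed
qed

text \<open>Two vectors in the same cell of a grid of width \<epsilon> differ by a lattice vector
  inside the cube of radius \<epsilon>, which is 0. A bounded set meets only finitely many
  cells.\<close>

lemma finite_bounded:
  assumes "F \<subseteq> \<Lambda>" "\<And>v i. v \<in> F \<Longrightarrow> i < n \<Longrightarrow> \<bar>v i\<bar> \<le> C"
  shows "finite F"
proof -
  define \<Phi> where "\<Phi> v = (\<lambda>i\<in>{..<n}. \<lfloor>v i / \<epsilon>\<rfloor>)" for v :: "nat \<Rightarrow> real"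
  have "inj_on \<Phi> F"
  proof (rule inj_onI)
    fix v w assume vw: "v \<in> F" "w \<in> F" "\<Phi> v = \<Phi> w"
    have "\<bar>v i - w i\<bar> < \<epsilon>" if "i < n" for i
    proof -
      have "\<lfloor>v i / \<epsilon>\<rfloor> = \<lfloor>w i / \<epsilon>\<rfloor>" using fun_cong[OF vw(3), of i] that by (simp add: \<Phi>_def)
      then have "\<bar>v i / \<epsilon> - w i / \<epsilon>\<bar> < 1" by linarith
      then have "\<bar>(v i - w i) / \<epsilon>\<bar> < 1" by (simp add: diff_divide_distrib)
      then show ?thesis using \<epsilon> by (simp add: abs_divide divide_less_eq)
    qed
    moreover have m: "v - w \<in> \<Lambda>" using vw assms(1) diff by blast
    ultimately have "v - w \<in> cube n 0 \<epsilon>" using in_espace by (auto simp: cube_def)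
    with discrete[OF m] show "v = w" by simp
  qed
  moreover have "\<Phi> ` F \<subseteq> (\<Pi>\<^sub>E i\<in>{..<n}. {- \<lceil>C / \<epsilon>\<rceil> - 1..\<lceil>C / \<epsilon>\<rceil> + 1})"
  proof (rule image_subsetI, rule PiE_I)
    fix v i assume v: "v \<in> F" and i: "i \<in> {..<n}"
    have "\<bar>v i / \<epsilon>\<bar> \<le> C / \<epsilon>" using assms(2)[OF v, of i] i \<epsilon> by (simp add: abs_divide divide_right_mono)
    then have "- \<lceil>C / \<epsilon>\<rceil> - 1 \<le> \<lfloor>v i / \<epsilon>\<rfloor>" "\<lfloor>v i / \<epsilon>\<rfloor> \<le> \<lceil>C / \<epsilon>\<rceil> + 1" by linarith+
    then show "\<Phi> v i \<in> {- \<lceil>C / \<epsilon>\<rceil> - 1..\<lceil>C / \<epsilon>\<rceil> + 1}" using i by (simp add: \<Phi>_def)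
  qed (simp add: \<Phi>_def)
  ultimately show ?thesis by (rule inj_on_finite) (auto intro: finite_PiE)
qed

text \<open>Otherwise some basis vector \<open>c\<close> lies outside the real span of the lattice.
  Its coefficient is a linear function that vanishes on the lattice and is bounded on the cube of
  radius \<open>R\<close>, yet large multiples of \<open>c\<close> are still within \<open>R\<close>
  of the lattice.\<close>

lemma lattice_real_basis:
  obtains b where "\<And>i. i < n \<Longrightarrow> b i \<in> \<Lambda>" "inj_on b {..<n}" "fun_vs.independent (b ` {..<n})" "espace n \<subseteq> fun_vs.span (b ` {..<n})"
proof -
  obtain B where B: "B \<subseteq> \<Lambda>" "fun_vs.independent B" "\<Lambda> \<subseteq> fun_vs.span B"
    using fun_vs.maximal_independent_subset by blast
  obtain B' where B': "B \<subseteq> B'" "B' \<subseteq> espace n" "fun_vs.independent B'" "espace n \<subseteq> fun_vs.span B'"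
    using fun_vs.maximal_independent_subset_extend[OF order_trans[OF B(1) in_espace] B(2)] by blast
  have "B' \<subseteq> B"
  proof (rule ccontr)
    assume "\<not> B' \<subseteq> B"
    then obtain c where c: "c \<in> B'" "c \<notin> B" by blast
    define lc where "lc v = fun_vs.representation B' v c" for v
    have sp: "v \<in> fun_vs.span B'" if "v \<in> espace n" for v using that B'(4) by blast
    have ue: "axis_vec j \<in> espace n" if "j < n" for j using that by (auto simp: axis_vec_def)
    have lin: "lc v = (\<Sum>j<n. v j * lc (axis_vec j))" if v: "v \<in> espace n" for v
    proof -
      have "lc v = lc (\<Sum>j<n. fun_scale (v j) (axis_vec j))" using espace_expand[OF v] by simp
      also have "\<dots> = (\<Sum>j<n. lc (fun_scale (v j) (axis_vec j)))"
        unfolding lc_def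
        by (subst fun_vs.representation_sum[OF B'(3)], rule fun_vs.span_scale, rule sp, rule ue) simp_all
      also have "\<dots> = (\<Sum>j<n. v j * lc (axis_vec j))"
        unfolding lc_def
        by (intro sum.cong refl) (subst fun_vs.representation_scale[OF B'(3)], auto intro!: sp ue)
      finally show ?thesis .
    qed
    have zeroB: "lc v = 0" if "v \<in> fun_vs.span B" for v
      unfolding lc_def using fun_vs.representation_extend[OF B'(3) that B'(1)] fun_vs.representation_ne_zero[of B v c] c(2) by auto
    define C where "C = (\<Sum>j<n. \<bar>R\<bar> * \<bar>lc (axis_vec j)\<bar>)"
    obtain N :: nat where N: "real N > C" using reals_Archimedean2 by blast
    have ce: "c \<in> espace n" using c B'(2) by blast
    have Nc: "fun_scale (real N) c \<in> espace n" by (rule fun_vs.subspace_scale[OF espace_subspace ce])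
    obtain w where w: "w \<in> \<Lambda>" "fun_scale (real N) c - w \<in> cube n 0 R" using cocompact[OF Nc] by blast
    have we: "w \<in> espace n" using w in_espace by blast
    define q where "q = fun_scale (real N) c - w"
    have qe: "q \<in> espace n" unfolding q_def by (rule fun_vs.subspace_diff[OF espace_subspace Nc we])
    have "lc q = lc (fun_scale (real N) c) - lc w"
      unfolding q_def lin[OF qe[unfolded q_def]] lin[OF Nc] lin[OF we]
      by (simp add: left_diff_distrib sum_subtractf)
    also have "lc w = 0" using zeroB B(3) w(1) by blast
    also have "lc (fun_scale (real N) c) = real N * lc c"
      unfolding lc_def by (subst fun_vs.representation_scale[OF B'(3) sp[OF ce]]) simp
    also have "lc c = 1" unfolding lc_def using fun_vs.representation_basis[OF B'(3) c(1)] by simp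
    finally have "lc q = real N" by simp
    moreover have "\<bar>lc q\<bar> \<le> C"
    proof -
      have "\<bar>lc q\<bar> \<le> (\<Sum>j<n. \<bar>q j * lc (axis_vec j)\<bar>)" unfolding lin[OF qe] by (rule sum_abs)
      also have "\<dots> \<le> C"
        unfolding C_def abs_mult
      proof (intro sum_mono mult_right_mono)
        fix j assume "j \<in> {..<n}"
        then show "\<bar>q j\<bar> \<le> \<bar>R\<bar>" using w(2) by (fastforce simp: q_def cube_def)
      qed simp
      finally show ?thesis .
    qed
    ultimately show False using N by linarith
  qed
  then have BB: "B' = B" using B'(1) by blast
  note u = axis_vec_independent[of n]
  have "finite B \<and> card B \<le> card (axis_vec ` {..<n})"
    by (rule fun_vs.independent_span_bound[OF _ B(2)]) (use B(1) in_espace espace_span in auto)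
  then have fB: "finite B" "card B \<le> n" using card_image[OF u(1)] by auto
  have "axis_vec ` {..<n} \<subseteq> fun_vs.span B"
    by (rule order_trans[OF _ B'(4)[unfolded BB]]) (auto simp: axis_vec_def)
  from fun_vs.independent_span_bound[OF fB(1) u(2) this]
  have "card B = n" using fB(2) card_image[OF u(1)] by simp
  then obtain b where b: "bij_betw b {..<n} B"
    using ex_bij_betw_nat_finite[OF fB(1)] by (auto simp: lessThan_atLeast0)
  then have bi: "b ` {..<n} = B" "inj_on b {..<n}" by (auto simp: bij_betw_def)
  show thesis
  proof (rule that[of b])
    show "b i \<in> \<Lambda>" if "i < n" for i using bi(1) B(1) that by blast
  qed (use bi B(2) B'(4) BB in simp_all)
qed

text \<open>A triangular basis. In coordinates for a real basis of lattice vectors, let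
  \<open>L i\<close> be the lattice vectors without coordinates beyond \<open>i\<close>, and let
  \<open>h i\<close> have the least positive i-th coordinate in \<open>L i\<close>. Division with
  remainder, from the last coordinate down, then expresses lattice vectors with integer
  coefficients.\<close>

theorem lattice_basis:
  obtains h where "\<And>i. i < n \<Longrightarrow> h i \<in> \<Lambda>"
    "\<And>a i. (\<Sum>k<n. fun_scale (a k) (h k)) = 0 \<Longrightarrow> i < n \<Longrightarrow> a i = 0"
    "\<And>v. v \<in> espace n \<Longrightarrow> \<exists>a. v = (\<Sum>k<n. fun_scale (a k) (h k))"
    "\<And>a i. (\<Sum>k<n. fun_scale (a k) (h k)) \<in> \<Lambda> \<Longrightarrow> i < n \<Longrightarrow> a i \<in> \<int>"
proof -
  obtain b where b: "\<And>i. i < n \<Longrightarrow> b i \<in> \<Lambda>" "inj_on b {..<n}" "fun_vs.independent (b ` {..<n})" "espace n \<subseteq> fun_vs.span (b ` {..<n})"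
    by (rule lattice_real_basis, rule that)
  define c where "c i v = fun_vs.representation (b ` {..<n}) v (b i)" for i v
  have be: "b i \<in> espace n" if "i < n" for i using b(1)[OF that] in_espace by blast
  have sp: "v \<in> fun_vs.span (b ` {..<n})" if "v \<in> espace n" for v using that b(4) by blast
  have c_scale: "c i (fun_scale a v) = a * c i v" if "v \<in> espace n" for i a v
    unfolding c_def by (subst fun_vs.representation_scale[OF b(3) sp[OF that]]) simp
  have c_diff: "c i (v - w) = c i v - c i w" if "v \<in> espace n" "w \<in> espace n" for i v w
    unfolding c_def by (subst fun_vs.representation_diff[OF b(3) sp[OF that(2)] sp[OF that(1)]]) simp
  have c_b: "c i (b j) = (if i = j then 1 else 0)" if "i < n" "j < n" for i j
    unfolding c_def using fun_vs.representation_basis[OF b(3), of "b j"] b(2) that by (auto simp: inj_on_def)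
  have c_sum: "v = (\<Sum>i<n. fun_scale (c i v) (b i))" if v: "v \<in> espace n" for v
  proof -
    have "(\<Sum>x\<in>b ` {..<n}. fun_scale (fun_vs.representation (b ` {..<n}) v x) x) = v"
      by (rule fun_vs.sum_representation_eq[OF b(3) sp[OF v]]) auto
    then show ?thesis using b(2) by (simp add: sum.reindex c_def comp_def)
  qed
  have \<Lambda>e: "v \<in> espace n" if "v \<in> \<Lambda>" for v using that in_espace by blast
  \<comment> \<open>The lattice points in the closed unit box of the real basis. Their finiteness is
    the source of the minima below.\<close>
  define F where "F = {v \<in> \<Lambda>. \<forall>i<n. 0 \<le> c i v \<and> c i v \<le> 1}"
  have "finite F"
  proof (rule finite_bounded)
    show "F \<subseteq> \<Lambda>" by (auto simp: F_def)
    fix v j assume v: "v \<in> F" and j: "j < n"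
    have "\<bar>v j\<bar> = \<bar>\<Sum>i<n. c i v * b i j\<bar>"
      using fun_cong[OF c_sum[OF \<Lambda>e], of v j] v by (simp add: F_def sum_fun_apply)
    also have "\<dots> \<le> (\<Sum>i<n. \<bar>c i v * b i j\<bar>)" by (rule sum_abs)
    also have "\<dots> \<le> (\<Sum>i<n. 1 * \<bar>b i j\<bar>)"
      unfolding abs_mult using v by (intro sum_mono mult_right_mono) (auto simp: F_def)
    also have "\<dots> \<le> (\<Sum>j<n. \<Sum>i<n. 1 * \<bar>b i j\<bar>)"
      using j by (intro member_le_sum[of j "{..<n}" "\<lambda>j. \<Sum>i<n. 1 * \<bar>b i j\<bar>"]) (auto intro: sum_nonneg)
    finally show "\<bar>v j\<bar> \<le> (\<Sum>j<n. \<Sum>i<n. 1 * \<bar>b i j\<bar>)" .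
  qed
  define L where "L i = {v \<in> \<Lambda>. \<forall>j<n. i < j \<longrightarrow> c j v = 0}" for i
  have ex: "\<exists>h. h \<in> L i \<and> c i h > 0 \<and> (\<forall>v\<in>L i. c i v > 0 \<longrightarrow> c i h \<le> c i v)" if i: "i < n" for i
  proof -
    define S where "S = {v \<in> F. v \<in> L i \<and> c i v > 0}"
    have "finite S" using \<open>finite F\<close> by (simp add: S_def)
    moreover have bS: "b i \<in> S" using b(1)[OF i] c_b i by (auto simp: S_def F_def L_def)
    ultimately obtain h where h: "h \<in> S" "\<And>v. v \<in> S \<Longrightarrow> c i h \<le> c i v"
      using arg_min_if_finite[of S "c i"] arg_min_least[of S _ "c i"] by blast
    have "c i h \<le> c i v" if v: "v \<in> L i" "c i v > 0" for v
    proof (cases "c i v \<le> 1")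
      case False
      have "c i h \<le> c i (b i)" by (rule h(2)[OF bS])
      then show ?thesis using c_b[OF i i] False by simp
    next
      case True
      \<comment> \<open>Subtracting the integer parts of the coordinates below \<open>i\<close>
        moves \<open>v\<close> into the finite box without changing its i-th coordinate, so a
        minimum over the box is a minimum over \<open>L i\<close>.\<close>
      define u where "u k = (\<Sum>j<k. fun_scale (of_int \<lfloor>c j v\<rfloor>) (b j))" for k
      have u: "u k \<in> \<Lambda>" "\<And>l. l < n \<Longrightarrow> c l (u k) = (if l < k then of_int \<lfloor>c l v\<rfloor> else 0)" if "k \<le> n" for k
        using that
      proof (induction k)
        case 0
        {
          case 1
          show ?case using zero by (simp only: u_def lessThan_0 sum.empty)
        next
          case 2
          have "c l 0 = 0" using c_scale[of 0 l 0] zero \<Lambda>e by (simp add: zero_fun_def)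
          then show ?case by (simp only: u_def lessThan_0 sum.empty not_less0 if_False)
        }
      next
        case (Suc k)
        have k: "k < n" if "Suc k \<le> n" using that by simp
        have eq: "u (Suc k) = u k - fun_scale (of_int (- \<lfloor>c k v\<rfloor>)) (b k)" by (simp add: u_def fun_eq_iff)
        {
          case 1
          show ?case unfolding eq using Suc.IH(1) k 1 by (intro diff int_scale b(1)) auto
        next
          case 2
          have m: "u k \<in> espace n" "fun_scale (of_int (- \<lfloor>c k v\<rfloor>)) (b k) \<in> espace n"
            by (rule \<Lambda>e, rule Suc.IH(1), use 2(2) in simp, rule fun_vs.subspace_scale[OF espace_subspace be[OF k[OF 2(2)]]])
          have "c l (u (Suc k)) = c l (u k) + of_int \<lfloor>c k v\<rfloor> * c l (b k)"
            unfolding eq c_diff[OF m] using c_scale[OF be, of k l "of_int (- \<lfloor>c k v\<rfloor>)"] k 2 by simp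
          then show ?case using Suc.IH(2)[OF 2(1)] c_b[OF 2(1) k[OF 2(2)]] 2(2) by (auto simp: less_Suc_eq)
        }
      qed
      have iv: "i \<le> n" using i by simp
      define v' where "v' = v - u i"
      have v\<Lambda>: "v \<in> \<Lambda>" using v by (simp add: L_def)
      have v': "v' \<in> \<Lambda>" unfolding v'_def by (rule diff[OF v\<Lambda> u(1)[OF iv]])
      have cv': "c l v' = (if l < i then c l v - of_int \<lfloor>c l v\<rfloor> else c l v)" if "l < n" for l
        unfolding v'_def c_diff[OF \<Lambda>e[OF v\<Lambda>] \<Lambda>e[OF u(1)[OF iv]]] u(2)[OF iv that] by simp
      have "v' \<in> S"
      proof -
        have "0 \<le> c l v' \<and> c l v' \<le> 1" if l: "l < n" for l
        proof (cases l i rule: linorder_cases)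
          case less
          have "0 \<le> c l v - of_int \<lfloor>c l v\<rfloor>" "c l v - of_int \<lfloor>c l v\<rfloor> \<le> 1" by linarith+
          then show ?thesis using cv'[OF l] less by simp
        next
          case equal
          then show ?thesis using cv'[OF l] v(2) True by simp
        next
          case greater
          then show ?thesis using cv'[OF l] v(1) l by (simp add: L_def)
        qed
        moreover have "c i v' = c i v" using cv'[OF i] by simp
        moreover have "c j v' = 0" if "j < n" "i < j" for j using cv'[OF that(1)] that v(1) by (simp add: L_def)
        ultimately show ?thesis using v' v(2) by (auto simp: S_def F_def L_def)
      qed
      from h(2)[OF this] show ?thesis using cv'[OF i] by simp
    qed
    then show ?thesis using h(1) by (intro exI[of _ h]) (auto simp: S_def)
  qed
  have "\<exists>h. \<forall>i\<in>{..<n}. h i \<in> L i \<and> c i (h i) > 0 \<and> (\<forall>v\<in>L i. c i v > 0 \<longrightarrow> c i (h i) \<le> c i v)"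
    using ex by (intro bchoice) auto
  then obtain h where "\<forall>i\<in>{..<n}. h i \<in> L i \<and> c i (h i) > 0 \<and> (\<forall>v\<in>L i. c i v > 0 \<longrightarrow> c i (h i) \<le> c i v)" by blast
  then have h: "h i \<in> L i" "c i (h i) > 0" "\<And>v. v \<in> L i \<Longrightarrow> c i v > 0 \<Longrightarrow> c i (h i) \<le> c i v" if "i < n" for i
    using that by blast+
  have h\<Lambda>: "h i \<in> \<Lambda>" and hc: "\<And>j. j < n \<Longrightarrow> i < j \<Longrightarrow> c j (h i) = 0" if "i < n" for i
    using h(1)[OF that] by (auto simp: L_def)
  have he: "h i \<in> espace n" if "i < n" for i by (rule \<Lambda>e[OF h\<Lambda>[OF that]])
  \<comment> \<open>Real and integral expansion are obtained together: removing the right multiple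
    of the last basis vector kills the top coordinate, and for lattice vectors this multiple is an
    integer.\<close>
  have combine: "\<exists>a. v = (\<Sum>k<i. fun_scale (a k) (h k)) \<and> (v \<in> \<Lambda> \<longrightarrow> (\<forall>k<i. a k \<in> \<int>))"
    if "i \<le> n" "v \<in> espace n" "\<And>j. j < n \<Longrightarrow> i \<le> j \<Longrightarrow> c j v = 0" for i v
    using that
  proof (induction i arbitrary: v)
    case 0
    have "v = 0" using c_sum[OF 0(2)] 0(3) by (intro ext) (simp add: sum_fun_apply fun_eq_iff)
    then show ?case by simp
  next
    case (Suc i)
    have i: "i < n" using Suc.prems(1) by simp
    define t where "t = c i v / c i (h i)"
    define w where "w = v - fun_scale t (h i)"
    have the: "fun_scale t (h i) \<in> espace n" by (rule fun_vs.subspace_scale[OF espace_subspace he[OF i]])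
    have we: "w \<in> espace n" unfolding w_def by (rule fun_vs.subspace_diff[OF espace_subspace Suc.prems(2) the])
    have cw: "c j w = c j v - t * c j (h i)" for j
      unfolding w_def c_diff[OF Suc.prems(2) the] c_scale[OF he[OF i]] ..
    have "c j w = 0" if "j < n" "i \<le> j" for j
    proof (cases "j = i")
      case True
      then show ?thesis using cw h(2)[OF i] by (simp add: t_def)
    next
      case False
      then show ?thesis using cw hc[OF i that(1)] Suc.prems(3)[OF that(1)] that(2) by simp
    qed
    with Suc.IH[OF _ we] i obtain a where a: "w = (\<Sum>k<i. fun_scale (a k) (h k))" "w \<in> \<Lambda> \<longrightarrow> (\<forall>k<i. a k \<in> \<int>)" by auto
    have tint: "t \<in> \<int>" if v: "v \<in> \<Lambda>"
    proof -
      define v' where "v' = v - fun_scale (of_int \<lfloor>t\<rfloor>) (h i)"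
      have v': "v' \<in> \<Lambda>" unfolding v'_def by (rule diff[OF v int_scale[OF h\<Lambda>[OF i]]])
      have cv': "c j v' = c j v - of_int \<lfloor>t\<rfloor> * c j (h i)" for j
        unfolding v'_def c_diff[OF Suc.prems(2) \<Lambda>e[OF int_scale[OF h\<Lambda>[OF i]]]] c_scale[OF he[OF i]] ..
      have "v' \<in> L i" using v' cv' hc[OF i] Suc.prems(3) by (simp add: L_def)
      moreover have "c i v' = (t - of_int \<lfloor>t\<rfloor>) * c i (h i)"
        using cv'[of i] h(2)[OF i] by (simp add: t_def left_diff_distrib)
      moreover have "(t - of_int \<lfloor>t\<rfloor>) * c i (h i) < 1 * c i (h i)"
        using h(2)[OF i] by (intro mult_strict_right_mono) linarith+
      \<comment> \<open>The remainder after division by \<open>h i\<close> is a lattice vector in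
        \<open>L i\<close> with a smaller i-th coordinate than \<open>h i\<close>; minimality
        forbids that this coordinate be positive.\<close>
      ultimately have "\<not> (t - of_int \<lfloor>t\<rfloor>) * c i (h i) > 0" using h(3)[OF i, of v'] by linarith
      then have "t = of_int \<lfloor>t\<rfloor>" using h(2)[OF i] by (smt (verit) mult_pos_pos of_int_floor_le)
      then show ?thesis by (metis Ints_of_int)
    qed
    have w\<Lambda>: "w \<in> \<Lambda>" if v: "v \<in> \<Lambda>"
    proof -
      obtain k where "t = of_int k" using tint[OF v] by (rule Ints_cases)
      then show ?thesis unfolding w_def using diff[OF v int_scale[OF h\<Lambda>[OF i]]] by simp
    qed
    show ?case
    proof (intro exI[of _ "a(i := t)"] conjI impI allI)
      have "v = w + fun_scale t (h i)" by (simp add: w_def)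
      then show "v = (\<Sum>k<Suc i. fun_scale ((a(i := t)) k) (h k))" using a(1) by simp
      show "(a(i := t)) k \<in> \<int>" if "v \<in> \<Lambda>" "k < Suc i" for k
        using a(2) w\<Lambda>[OF that(1)] tint[OF that(1)] that(2) by (auto simp: less_Suc_eq)
    qed
  qed
  have indep: "a k = 0" if "i \<le> n" "(\<Sum>k<i. fun_scale (a k) (h k)) = 0" "k < i" for a i k
    using that
  proof (induction i)
    case (Suc i)
    have i: "i < n" using Suc.prems(1) by simp
    define S where "S = (\<Sum>k<i. fun_scale (a k) (h k))"
    have S: "S = 0 - fun_scale (a i) (h i)" using Suc.prems(2) by (simp add: S_def fun_eq_iff add_eq_0_iff)
    \<comment> \<open>For \<open>k < i\<close> the vector \<open>h k\<close> has i-th coordinate 0,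
      so the i-th coordinate of a relation sees only its last term.\<close>
    have cS: "S' \<in> espace n \<and> c i S' = 0" if "S' = (\<Sum>k<j. fun_scale (a k) (h k))" "j \<le> i" for S' j
      using that
    proof (induction j arbitrary: S')
      case 0
      have "c i 0 = 0" using c_scale[of 0 i 0] zero \<Lambda>e by (simp add: zero_fun_def)
      moreover have "S' = 0" using 0(1) by (simp only: lessThan_0 sum.empty)
      ultimately show ?case using fun_vs.subspace_0[OF espace_subspace] by (simp only: simp_thms)
    next
      case (Suc j)
      have j: "j < n" using Suc.prems(2) i by simp
      define T where "T = (\<Sum>k<j. fun_scale (a k) (h k))"
      have T: "T \<in> espace n" "c i T = 0" using Suc.IH[OF T_def] Suc.prems(2) by auto
      have m: "fun_scale (- a j) (h j) \<in> espace n" by (rule fun_vs.subspace_scale[OF espace_subspace he[OF j]])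
      have eq: "S' = T - fun_scale (- a j) (h j)" using Suc.prems(1) by (simp add: T_def fun_eq_iff)
      have "c i (h j) = 0" by (rule hc[OF j i]) (use Suc.prems(2) in simp)
      then have "c i S' = 0" unfolding eq c_diff[OF T(1) m] c_scale[OF he[OF j]] using T(2) by simp
      moreover have "S' \<in> espace n" unfolding eq by (rule fun_vs.subspace_diff[OF espace_subspace T(1) m])
      ultimately show ?case by (simp only: simp_thms)
    qed
    have z: "(0 :: nat \<Rightarrow> real) \<in> espace n" by simp
    have m: "fun_scale (a i) (h i) \<in> espace n" by (rule fun_vs.subspace_scale[OF espace_subspace he[OF i]])
    have "c i 0 = 0" using c_scale[OF z, of i 0] by (simp add: zero_fun_def)
    then have "c i S = - (a i * c i (h i))" unfolding S c_diff[OF z m] c_scale[OF he[OF i]] by simp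
    then have ai: "a i = 0" using cS[OF S_def] h(2)[OF i] by simp
    then have "S = 0" using S by (simp add: fun_eq_iff)
    then show ?case using Suc.IH Suc.prems ai i by (auto simp: S_def less_Suc_eq)
  qed simp
  show thesis
  proof (rule that[of h])
    show "h i \<in> \<Lambda>" if "i < n" for i by (rule h\<Lambda>[OF that])
    show "a i = 0" if "(\<Sum>k<n. fun_scale (a k) (h k)) = 0" "i < n" for a i by (rule indep[OF order_refl that])
    show "\<exists>a. v = (\<Sum>k<n. fun_scale (a k) (h k))" if "v \<in> espace n" for v using combine[OF order_refl that] by auto
    show "a i \<in> \<int>" if s: "(\<Sum>k<n. fun_scale (a k) (h k)) \<in> \<Lambda>" and i: "i < n" for a i
    proof -
      obtain a' where a': "(\<Sum>k<n. fun_scale (a k) (h k)) = (\<Sum>k<n. fun_scale (a' k) (h k))" "\<And>k. k < n \<Longrightarrow> a' k \<in> \<int>"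
        using combine[OF order_refl \<Lambda>e[OF s]] s by auto
      have "(\<Sum>k<n. fun_scale (a k - a' k) (h k)) = 0"
      proof
        fix x
        show "(\<Sum>k<n. fun_scale (a k - a' k) (h k)) x = 0 x"
          using fun_cong[OF a'(1), of x] by (simp add: sum_fun_apply left_diff_distrib sum_subtractf)
      qed
      from indep[OF order_refl this i] a'(2)[OF i] show ?thesis by simp
    qed
  qed
qed

end

section \<open>The translation action on a compact integral manifold\<close>

lemma cube_shift: "x \<in> espace n \<Longrightarrow> w \<in> cube n 0 e \<Longrightarrow> x + w \<in> cube n x e"
  by (auto simp: cube_def)

lemma cube_shift_diff: "x \<in> espace n \<Longrightarrow> y \<in> cube n x e \<Longrightarrow> y - x \<in> cube n 0 e"
  by (auto simp: cube_def)

lemma cube_convex: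
  assumes u: "u \<in> cube n 0 e" and w: "u + w \<in> cube n 0 e" and t: "0 \<le> t" "t \<le> 1"
  shows "u + fun_scale t w \<in> cube n 0 e"
proof -
  have "\<bar>u i + t * w i\<bar> < e" if i: "i < n" for i
  proof -
    have *: "\<bar>u i\<bar> < e" "\<bar>u i + w i\<bar> < e" using u w i by (auto simp: cube_def)
    have "u i + t * w i = (1 - t) * u i + t * (u i + w i)" by (simp add: algebra_simps)
    also have "\<bar>\<dots>\<bar> \<le> (1 - t) * \<bar>u i\<bar> + t * \<bar>u i + w i\<bar>"
      using t by (intro order_trans[OF abs_triangle_ineq]) (simp add: abs_mult)
    also have "\<dots> < e"
    proof (cases "t = 1")
      case False
      then have "(1 - t) * \<bar>u i\<bar> < (1 - t) * e" using t * by (intro mult_strict_left_mono) auto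
      moreover have "t * \<bar>u i + w i\<bar> \<le> t * e" using t * by (intro mult_left_mono) auto
      ultimately show ?thesis by (simp add: algebra_simps)
    qed (use * in simp)
    finally show ?thesis .
  qed
  moreover have "w \<in> espace n"
  proof -
    have "w i = 0" if "i \<ge> n" for i
    proof -
      have "u i = 0" "u i + w i = 0" using u w that by (auto simp: cube_def)
      then show ?thesis by simp
    qed
    then show ?thesis by simp
  qed
  ultimately show ?thesis using u by (auto simp: cube_def)
qed

lemma cube_neg: "w \<in> cube n 0 e \<Longrightarrow> - w \<in> cube n 0 e"
  by (auto simp: cube_def)

text \<open>Stated relative to an invariant set because the identities between moves hold only on
  the points of the manifold, not on the whole type.\<close>

lemma funpow_on_cong:
  assumes "\<And>q. q \<in> S \<Longrightarrow> f q = g q" "\<And>q. q \<in> S \<Longrightarrow> g q \<in> S" "q \<in> S"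
  shows "(f ^^ k) q = (g ^^ k) q \<and> (g ^^ k) q \<in> S"
  by (induction k) (use assms in auto)

lemma funpow_on_commute:
  assumes c: "\<And>q. q \<in> S \<Longrightarrow> f (g q) = g (f q)" and f: "\<And>q. q \<in> S \<Longrightarrow> f q \<in> S" and g: "\<And>q. q \<in> S \<Longrightarrow> g q \<in> S"
    and q: "q \<in> S"
  shows "((\<lambda>x. f (g x)) ^^ k) q = (f ^^ k) ((g ^^ k) q)"
proof -
  have gS: "(g ^^ k) q \<in> S" if "q \<in> S" for k q by (induction k) (use that g in auto)
  have fS: "(f ^^ k) q \<in> S" if "q \<in> S" for k q by (induction k) (use that f in auto)
  have fg: "(f ^^ k) (g q) = g ((f ^^ k) q)" if "q \<in> S" for k q
    by (induction k) (use that c fS in auto)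
  show ?thesis
  proof (induction k)
    case (Suc k)
    have "((\<lambda>x. f (g x)) ^^ Suc k) q = f (g ((f ^^ k) ((g ^^ k) q)))" by (simp add: Suc)
    also have "g ((f ^^ k) ((g ^^ k) q)) = (f ^^ k) (g ((g ^^ k) q))" by (rule fg[symmetric, OF gS[OF q]])
    finally show ?case by simp
  qed simp
qed

section \<open>Curves of constant velocity with respect to the frame\<close>

context commuting_frame begin

lemma straightD:
  assumes "straight U x"
  shows straight_open: "openin (mtop M) U" and straight_image: "openin (Euclidean_space (mdim M)) (x ` U)"
    and straight_homeo: "homeomorphic_map (subtopology (mtop M) U) (subtopology (Euclidean_space (mdim M)) (x ` U)) x"
    and straight_coordinate: "k < mdim M \<Longrightarrow> smooth_fun_on M U (\<lambda>q. x q k)"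
    and straight_smooth: "smooth_fun_on M W F \<Longrightarrow> W \<subseteq> U \<Longrightarrow> smooth_on (mdim M) (x ` W) (\<lambda>y. F (inv_into U x y))"
  using assms unfolding straight_def by simp_all

lemma straight_inj: "straight U x \<Longrightarrow> inj_on x U"
proof -
  assume s: "straight U x"
  have "topspace (subtopology (mtop M) U) = U" using openin_subset[OF straight_open[OF s]] by auto
  then show ?thesis using homeomorphic_imp_injective_map[OF straight_homeo[OF s]] by simp
qed

lemma straight_espace: "straight U x \<Longrightarrow> q \<in> U \<Longrightarrow> x q \<in> espace (mdim M)"
  using straight_image unfolding openin_Euclidean_space_iff by blast

lemma straight_open_image:
  assumes s: "straight U x" and W: "openin (mtop M) W" "W \<subseteq> U"
  shows "openin (Euclidean_space (mdim M)) (x ` W)"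
proof -
  have "openin (subtopology (mtop M) U) W" using W by (simp add: openin_open_subtopology[OF straight_open[OF s]])
  then have "openin (subtopology (Euclidean_space (mdim M)) (x ` U)) (x ` W)"
    using homeomorphic_imp_open_map[OF straight_homeo[OF s]] unfolding open_map_def by blast
  then show ?thesis using openin_trans_full straight_image[OF s] by blast
qed

lemma straight_open_preimage:
  assumes s: "straight U x" and V: "openin (Euclidean_space (mdim M)) V"
  shows "openin (mtop M) {q \<in> U. x q \<in> V}"
proof -
  have "continuous_map (subtopology (mtop M) U) (Euclidean_space (mdim M)) x"
    using homeomorphic_imp_continuous_map[OF straight_homeo[OF s]] continuous_map_in_subtopology by blast
  from openin_continuous_map_preimage[OF this V]
  have "openin (subtopology (mtop M) U) {q \<in> topspace (subtopology (mtop M) U). x q \<in> V}" .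
  moreover have "topspace (subtopology (mtop M) U) = U" using openin_subset[OF straight_open[OF s]] by auto
  ultimately show ?thesis using openin_trans_full straight_open[OF s] by metis
qed

text \<open>An integral curve of the field with constant coefficients \<open>w\<close>, described
  without derivatives: near each time it is affine with velocity \<open>w\<close> in some straight
  chart. The filter stays within the unit interval, so the end points are treated
  one-sidedly.\<close>

definition parallel :: "(real \<Rightarrow> 'a) \<Rightarrow> (nat \<Rightarrow> real) \<Rightarrow> bool" where
  "parallel c w \<longleftrightarrow> (\<forall>t0\<in>{0..1}. \<exists>U x. straight U x \<and> c t0 \<in> U \<and>
     (\<forall>\<^sub>F t in at t0 within {0..1}. c t \<in> U \<and> x (c t) = x (c t0) + fun_scale (t - t0) w))"

text \<open>The image of \<open>W\<close> in the straight chart contains a cube about the current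
  point, and the affine expression keeps the curve in this cube for times close to
  \<open>t0\<close>.\<close>

lemma parallel_continuous:
  assumes c: "parallel c w" and t0: "t0 \<in> {0..1}" and W: "openin (mtop M) W" "c t0 \<in> W"
  shows "\<forall>\<^sub>F t in at t0 within {0..1}. c t \<in> W"
proof -
  obtain U x where s: "straight U x" "c t0 \<in> U"
    and ev: "\<forall>\<^sub>F t in at t0 within {0..1}. c t \<in> U \<and> x (c t) = x (c t0) + fun_scale (t - t0) w"
    using c t0 unfolding parallel_def by blast
  have "openin (Euclidean_space (mdim M)) (x ` (U \<inter> W))"
    by (rule straight_open_image[OF s(1)]) (use W straight_open[OF s(1)] in auto)
  moreover have "x (c t0) \<in> x ` (U \<inter> W)" using s W by blast
  ultimately obtain e where e: "e > 0" "cube (mdim M) (x (c t0)) e \<subseteq> x ` (U \<inter> W)"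
    unfolding openin_Euclidean_space_iff by meson
  have "\<forall>\<^sub>F t in at t0 within {0..1}. \<forall>i\<in>{..<mdim M}. \<bar>(t - t0) * w i\<bar> < e"
  proof (rule eventually_ball_finite)
    show "\<forall>i\<in>{..<mdim M}. \<forall>\<^sub>F t in at t0 within {0..1}. \<bar>(t - t0) * w i\<bar> < e"
    proof
      fix i
      have "((\<lambda>t. \<bar>(t - t0) * w i\<bar>) \<longlongrightarrow> \<bar>(t0 - t0) * w i\<bar>) (at t0 within {0..1})" by (intro tendsto_intros)
      then show "\<forall>\<^sub>F t in at t0 within {0..1}. \<bar>(t - t0) * w i\<bar> < e" using e(1) by (auto dest: order_tendstoD)
    qed
  qed simp
  with ev show ?thesis
  proof eventually_elim
    case (elim t)
    have "x (c t) \<in> espace (mdim M)" using straight_espace[OF s(1)] elim(1) by blast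
    then have "x (c t) \<in> cube (mdim M) (x (c t0)) e" using elim by (auto simp: cube_def)
    then obtain q where q: "q \<in> U" "q \<in> W" "x (c t) = x q" using e(2) by blast
    then have "c t = q" using straight_inj[OF s(1)] elim(1) by (auto dest: inj_onD)
    then show ?case using q by simp
  qed
qed

text \<open>The truth value of agreement is locally constant in time. Where the curves agree,
  straight charts differ by a translation, so equal velocities keep them together; where they
  disagree, Hausdorff separation keeps them apart. Connectedness of the interval concludes.\<close>

lemma parallel_unique:
  assumes c: "parallel c w" and c': "parallel c' w" and "c 0 = c' 0" and t: "t \<in> {0..1}"
  shows "c t = c' t"
proof -
  have inM: "c t \<in> mcarrier M" if "parallel c w" "t \<in> {0..1}" for c t
    using that openin_subset[OF straight_open] unfolding parallel_def by blast
  have "(c 0 = c' 0) = (c t = c' t)"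
  proof (rule connected_local_const[of "{0..1 :: real}" 0 t "\<lambda>t. c t = c' t"])
    show "\<forall>t0\<in>{0..1}. \<forall>\<^sub>F t in at t0 within {0..1}. (c t0 = c' t0) = (c t = c' t)"
    proof
      fix t0 :: real assume t0: "t0 \<in> {0..1}"
      show "\<forall>\<^sub>F t in at t0 within {0..1}. (c t0 = c' t0) = (c t = c' t)"
      proof (cases "c t0 = c' t0")
        case False
        obtain A B where AB: "openin (mtop M) A" "openin (mtop M) B" "c t0 \<in> A" "c' t0 \<in> B" "disjnt A B"
          using Hausdorff_M inM[OF c t0] inM[OF c' t0] False unfolding Hausdorff_space_def by metis
        from parallel_continuous[OF c t0 AB(1,3)] parallel_continuous[OF c' t0 AB(2,4)]
        show ?thesis
        proof eventually_elim
          case (elim t)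
          then show ?case using AB(5) False by (auto simp: disjnt_def)
        qed
      next
        case True
        obtain U x where s: "straight U x" "c t0 \<in> U"
          and ev: "\<forall>\<^sub>F t in at t0 within {0..1}. c t \<in> U \<and> x (c t) = x (c t0) + fun_scale (t - t0) w"
          using c t0 unfolding parallel_def by blast
        obtain V y where s': "straight V y" "c' t0 \<in> V"
          and ev': "\<forall>\<^sub>F t in at t0 within {0..1}. c' t \<in> V \<and> y (c' t) = y (c' t0) + fun_scale (t - t0) w"
          using c' t0 unfolding parallel_def by blast
        have s'2: "c t0 \<in> V" using s'(2) True by simp
        obtain W where W: "openin (mtop M) W" "c t0 \<in> W" "W \<subseteq> U \<inter> V"
          "\<And>q k. q \<in> W \<Longrightarrow> k < mdim M \<Longrightarrow> x q k - x (c t0) k = y q k - y (c t0) k"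
          by (rule straight_translation[OF s(1) s'(1) s(2) s'2], rule that)
        have W': "c' t0 \<in> W" using W(2) True by simp
        from ev ev' parallel_continuous[OF c t0 W(1,2)] parallel_continuous[OF c' t0 W(1) W']
        show ?thesis
        proof eventually_elim
          case (elim t)
          have cU: "c t \<in> U" "c' t \<in> U" using elim W(3) by auto
          have "x (c t) k = x (c' t) k" for k
          proof (cases "k < mdim M")
            case True
            show ?thesis
              using W(4)[OF elim(3) True] W(4)[OF elim(4) True] elim(1,2) \<open>c t0 = c' t0\<close> by simp
          next
            case False
            then show ?thesis using straight_espace[OF s(1) cU(1)] straight_espace[OF s(1) cU(2)] by simp
          qed
          then have "x (c t) = x (c' t)" by (rule ext)
          then have "c t = c' t" using straight_inj[OF s(1)] cU by (auto dest: inj_onD)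
          then show ?case using True by simp
        qed
      qed
    qed
  qed (use t in auto)
  then show ?thesis using assms(3) by simp
qed

text \<open>A Lebesgue number argument. A chart containing a cube of radius \<open>e\<close> about
  \<open>p\<close> serves every point of the half cube with radius \<open>e / 2\<close>, and
  finitely many half cubes cover a compact manifold.\<close>

lemma uniform_straight_charts:
  assumes "compact_space (mtop M)"
  obtains e where "e > 0" "\<And>q. q \<in> mcarrier M \<Longrightarrow> \<exists>U x. straight U x \<and> q \<in> U \<and> cube (mdim M) (x q) e \<subseteq> x ` U"
proof -
  define Good where "Good e q \<longleftrightarrow> (\<exists>U x. straight U x \<and> q \<in> U \<and> cube (mdim M) (x q) e \<subseteq> x ` U)" for e q
  define \<U> where "\<U> = {W. openin (mtop M) W \<and> (\<exists>e>0. \<forall>q\<in>W. Good e q)}"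
  have "mcarrier M \<subseteq> \<Union>\<U>"
  proof
    fix p assume "p \<in> mcarrier M"
    then obtain U x where s: "straight U x" "p \<in> U" by (rule straight_exists)
    have "x p \<in> x ` U" using s by blast
    then obtain e where e: "e > 0" "cube (mdim M) (x p) e \<subseteq> x ` U"
      using straight_image[OF s(1)] unfolding openin_Euclidean_space_iff by meson
    define W where "W = {q \<in> U. x q \<in> cube (mdim M) (x p) (e / 2)}"
    have "openin (mtop M) W" unfolding W_def by (rule straight_open_preimage[OF s(1) openin_cube])
    moreover have "Good (e / 2) q" if "q \<in> W" for q
    proof -
      have q: "q \<in> U" "x q \<in> cube (mdim M) (x p) (e / 2)" using that by (auto simp: W_def)
      have "cube (mdim M) (x q) (e / 2) \<subseteq> cube (mdim M) (x p) e"
      proof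
        fix y assume y: "y \<in> cube (mdim M) (x q) (e / 2)"
        have "\<bar>y i - x p i\<bar> < e" if "i < mdim M" for i
        proof -
          have "\<bar>y i - x q i\<bar> < e / 2" "\<bar>x q i - x p i\<bar> < e / 2" using y q(2) that by (auto simp: cube_def)
          then show ?thesis by linarith
        qed
        then show "y \<in> cube (mdim M) (x p) e" using y by (simp add: cube_def)
      qed
      then show ?thesis unfolding Good_def using s(1) q(1) e(2) by blast
    qed
    ultimately have "W \<in> \<U>" unfolding \<U>_def using e(1) half_gt_zero by blast
    moreover have "p \<in> W" using s e centre_in_cube[OF straight_espace[OF s]] by (simp add: W_def)
    ultimately show "p \<in> \<Union>\<U>" by blast
  qed
  moreover have "\<forall>U\<in>\<U>. openin (mtop M) U" by (simp add: \<U>_def)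
  ultimately obtain \<F> where F: "finite \<F>" "\<F> \<subseteq> \<U>" "mcarrier M \<subseteq> \<Union>\<F>"
    using assms unfolding compact_space_alt by meson
  have "\<exists>e. \<forall>W\<in>\<F>. e W > 0 \<and> (\<forall>q\<in>W. Good (e W) q)"
    using F(2) unfolding \<U>_def by (intro bchoice) blast
  then obtain e where e: "\<And>W. W \<in> \<F> \<Longrightarrow> e W > 0" "\<And>W q. W \<in> \<F> \<Longrightarrow> q \<in> W \<Longrightarrow> Good (e W) q" by blast
  \<comment> \<open>The element 1 keeps the minimum defined for an empty cover.\<close>
  define d where "d = Min (insert 1 (e ` \<F>))"
  have d: "d > 0" unfolding d_def using F(1) e(1) by (auto simp: Min_gr_iff)
  have "Good d q" if q: "q \<in> mcarrier M" for q
  proof -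
    obtain W where W: "W \<in> \<F>" "q \<in> W" using F(3) q by blast
    have "d \<le> e W" unfolding d_def using F(1) W by (intro Min_le) auto
    then show ?thesis using e(2)[OF W] cube_mono unfolding Good_def by blast
  qed
  then show thesis using that d unfolding Good_def by blast
qed

end

section \<open>The action of the translation group and its orbit map\<close>

locale compact_frame = commuting_frame +
  fixes \<epsilon> :: real and m :: 'a
  assumes compact: "compact_space (mtop M)" and connected: "connected_space (mtop M)" and m: "m \<in> mcarrier M"
    and \<epsilon>: "\<epsilon> > 0"
    and uniform: "\<And>q. q \<in> mcarrier M \<Longrightarrow> \<exists>U x. straight U x \<and> q \<in> U \<and> cube (mdim M) (x q) \<epsilon> \<subseteq> x ` U"
begin

abbreviation n :: nat where "n \<equiv> mdim M"

text \<open>One straight chart per point is fixed by choice, with no relation between the choices at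
  different points; comparing moves made in different charts is the task of
  \<open>parallel_unique\<close>.\<close>

definition dom :: "'a \<Rightarrow> 'a set" where
  "dom q = (SOME U. \<exists>x. straight U x \<and> q \<in> U \<and> cube n (x q) \<epsilon> \<subseteq> x ` U)"

definition crd :: "'a \<Rightarrow> 'a \<Rightarrow> nat \<Rightarrow> real" where
  "crd q = (SOME x. straight (dom q) x \<and> q \<in> dom q \<and> cube n (x q) \<epsilon> \<subseteq> x ` dom q)"

lemma chosen_chart:
  assumes "q \<in> mcarrier M"
  shows "straight (dom q) (crd q)" "q \<in> dom q" "cube n (crd q q) \<epsilon> \<subseteq> crd q ` dom q"
proof -
  have "\<exists>x. straight (dom q) x \<and> q \<in> dom q \<and> cube n (x q) \<epsilon> \<subseteq> x ` dom q"
    unfolding dom_def by (rule someI_ex[OF uniform[OF assms]])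
  from someI_ex[OF this] show "straight (dom q) (crd q)" "q \<in> dom q" "cube n (crd q q) \<epsilon> \<subseteq> crd q ` dom q"
    unfolding crd_def by blast+
qed

definition step :: "(nat \<Rightarrow> real) \<Rightarrow> 'a \<Rightarrow> 'a" where
  "step w q = inv_into (dom q) (crd q) (crd q q + w)"

lemma
  assumes q: "q \<in> mcarrier M" and w: "w \<in> cube n 0 \<epsilon>"
  shows step_dom: "step w q \<in> dom q" and step_crd: "crd q (step w q) = crd q q + w" and step_carrier: "step w q \<in> mcarrier M"
proof -
  note c = chosen_chart[OF q]
  have "crd q q + w \<in> crd q ` dom q"
    using c(3) cube_shift[OF straight_espace[OF c(1,2)] w] by blast
  then show s: "step w q \<in> dom q" and "crd q (step w q) = crd q q + w"
    unfolding step_def by (rule inv_into_into, rule f_inv_into_f)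
  show "step w q \<in> mcarrier M" using s openin_subset[OF straight_open[OF c(1)]] by blast
qed

lemma step_eqI:
  assumes "q \<in> mcarrier M" "q' \<in> dom q" "crd q q' = crd q q + w"
  shows "step w q = q'"
  unfolding step_def assms(3)[symmetric] by (rule inv_into_f_f[OF straight_inj[OF chosen_chart(1)[OF assms(1)]] assms(2)])

lemma step_0: "q \<in> mcarrier M \<Longrightarrow> step 0 q = q"
  by (rule step_eqI) (simp_all add: chosen_chart)

text \<open>A straight line inside the cube of the chosen chart. Starting it at \<open>u\<close>
  instead of 0 allows a move already made in this chart to be continued.\<close>

lemma step_parallel:
  assumes q: "q \<in> mcarrier M" and u: "u \<in> cube n 0 \<epsilon>" and uw: "u + w \<in> cube n 0 \<epsilon>"
  shows "parallel (\<lambda>t. step (u + fun_scale t w) q) w"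
  unfolding parallel_def
proof
  fix t0 :: real assume t0: "t0 \<in> {0..1}"
  have cv: "u + fun_scale t w \<in> cube n 0 \<epsilon>" if "t \<in> {0..1}" for t using cube_convex[OF u uw] that by simp
  have "\<forall>\<^sub>F t in at t0 within {0..1}. t \<in> {0..1}" by (simp add: eventually_at_filter)
  then have "\<forall>\<^sub>F t in at t0 within {0..1}. step (u + fun_scale t w) q \<in> dom q \<and>
      crd q (step (u + fun_scale t w) q) = crd q (step (u + fun_scale t0 w) q) + fun_scale (t - t0) w"
  proof eventually_elim
    case (elim t)
    then show ?case
      unfolding step_crd[OF q cv[OF elim]] step_crd[OF q cv[OF t0]]
      using step_dom[OF q cv[OF elim]] by (simp add: fun_eq_iff algebra_simps)
  qed
  then show "\<exists>U x. straight U x \<and> step (u + fun_scale t0 w) q \<in> U \<and> (\<forall>\<^sub>F t in at t0 within {0..1}.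
      step (u + fun_scale t w) q \<in> U \<and> x (step (u + fun_scale t w) q) = x (step (u + fun_scale t0 w) q) + fun_scale (t - t0) w)"
    using chosen_chart(1)[OF q] step_dom[OF q cv[OF t0]] by blast
qed

lemma zero_cube: "0 \<in> cube n 0 \<epsilon>"
  by (rule centre_in_cube) (simp_all add: \<epsilon>)

text \<open>Moving by \<open>w\<close> in the chart chosen at \<open>step u q\<close>, and
  continuing in the chart chosen at \<open>q\<close>, are curves with the same start and the same
  velocity, hence with the same end. The condition on \<open>u + w\<close> keeps the continued curve
  inside the cube at \<open>q\<close>.\<close>

lemma step_add:
  assumes q: "q \<in> mcarrier M" and u: "u \<in> cube n 0 \<epsilon>" and w: "w \<in> cube n 0 \<epsilon>" and uw: "u + w \<in> cube n 0 \<epsilon>"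
  shows "step w (step u q) = step (u + w) q"
proof -
  have q': "step u q \<in> mcarrier M" by (rule step_carrier[OF q u])
  have "0 + w \<in> cube n 0 \<epsilon>" using w by simp
  note p1 = step_parallel[OF q u uw] and p2 = step_parallel[OF q' zero_cube this]
  have start: "step (u + fun_scale 0 w) q = step (0 + fun_scale 0 w) (step u q)"
  proof -
    have z: "fun_scale 0 w = 0" by (simp add: fun_eq_iff)
    show ?thesis unfolding z by (simp add: step_0[OF q'])
  qed
  have one: "fun_scale 1 w = w" by (simp add: fun_eq_iff)
  have "step (u + fun_scale 1 w) q = step (0 + fun_scale 1 w) (step u q)"
    by (rule parallel_unique[OF p1 p2 start]) simp
  then show ?thesis unfolding one add_0 by (rule sym)
qed

lemma step_comm:
  assumes q: "q \<in> mcarrier M" and u: "u \<in> cube n 0 \<epsilon>" and w: "w \<in> cube n 0 \<epsilon>" and uw: "u + w \<in> cube n 0 \<epsilon>"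
  shows "step w (step u q) = step u (step w q)"
  using step_add[OF q u w uw] step_add[OF q w u] uw by (simp add: add.commute)

definition adm :: "nat \<Rightarrow> (nat \<Rightarrow> real) \<Rightarrow> bool" where
  "adm k v \<longleftrightarrow> k > 0 \<and> fun_scale (1 / real k) v \<in> cube n 0 \<epsilon>"

definition iter :: "nat \<Rightarrow> (nat \<Rightarrow> real) \<Rightarrow> 'a \<Rightarrow> 'a" where
  "iter k v = step (fun_scale (1 / real k) v) ^^ k"

lemma adm_mono:
  assumes "adm k v" "k \<le> l" shows "adm l v"
proof -
  have k: "k > 0" "l > 0" using assms by (auto simp: adm_def)
  have "\<bar>v i / real l\<bar> < \<epsilon>" if "i < n" for i
  proof -
    have "\<bar>v i / real l\<bar> \<le> \<bar>v i / real k\<bar>"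
      using assms(2) k by (simp add: abs_divide frac_le)
    also have "\<dots> < \<epsilon>" using assms(1) that by (simp add: adm_def cube_def)
    finally show ?thesis .
  qed
  moreover have "v i = 0" if "i \<ge> n" for i using assms(1) that k by (auto simp: adm_def cube_def)
  ultimately show ?thesis using k by (simp add: adm_def cube_def)
qed

lemma adm_ex:
  assumes "v \<in> espace n" obtains k where "adm k v"
proof -
  define C where "C = (\<Sum>i<n. \<bar>v i\<bar>)"
  obtain k :: nat where k: "real k > C / \<epsilon>" using reals_Archimedean2 by blast
  have C: "C \<ge> 0" unfolding C_def by (intro sum_nonneg) auto
  have k0: "real k > 0" using k C \<epsilon> by (smt (verit) divide_nonneg_pos)
  have "\<bar>v i\<bar> / real k < \<epsilon>" if "i < n" for i
  proof -
    have "\<bar>v i\<bar> \<le> C" unfolding C_def using that by (intro member_le_sum) auto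
    also have "C < \<epsilon> * real k" using k \<epsilon> by (simp add: divide_less_eq mult.commute)
    finally show ?thesis using k0 by (simp add: divide_less_eq)
  qed
  then have "adm k v" using assms k0 by (auto simp: adm_def cube_def abs_divide)
  then show thesis by (rule that)
qed

text \<open>Convexity of the cube keeps all intermediate multiples of \<open>v\<close> short enough,
  so the pieces can be added one by one in the chart of the starting point.\<close>

lemma step_iterate:
  assumes q: "q \<in> mcarrier M" and v: "v \<in> cube n 0 \<epsilon>" and k: "k > 0"
  shows "(step (fun_scale (1 / real k) v) ^^ k) q = step v q"
proof -
  have sc: "fun_scale t v \<in> cube n 0 \<epsilon>" if "0 \<le> t" "t \<le> 1" for t
    using cube_convex[OF zero_cube, of v t] v that by simp
  have "(step (fun_scale (1 / real k) v) ^^ j) q = step (fun_scale (real j / real k) v) q" if "j \<le> k" for j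
    using that
  proof (induction j)
    case 0
    have "fun_scale (real 0 / real k) v = 0" by (simp add: fun_eq_iff)
    then show ?case using step_0[OF q] by simp
  next
    case (Suc j)
    have e: "fun_scale (real j / real k) v + fun_scale (1 / real k) v = fun_scale (real (Suc j) / real k) v"
      by (simp add: fun_eq_iff add_divide_distrib algebra_simps)
    have "step (fun_scale (1 / real k) v) (step (fun_scale (real j / real k) v) q) = step (fun_scale (real j / real k) v + fun_scale (1 / real k) v) q"
      by (rule step_add[OF q]) (use Suc.prems k in \<open>simp_all only: e\<close>, (intro sc, simp, simp)+)
    then show ?case using Suc e by simp
  qed
  from this[of k] show ?thesis using k by simp
qed

lemma iter_refine:
  assumes q: "q \<in> mcarrier M" and a: "adm k v" and l: "l > 0"
  shows "iter (k * l) v q = iter k v q"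
proof -
  have v: "fun_scale (1 / real k) v \<in> cube n 0 \<epsilon>" using a by (simp add: adm_def)
  have e: "fun_scale (1 / real l) (fun_scale (1 / real k) v) = fun_scale (1 / real (k * l)) v" by (simp add: fun_eq_iff)
  have "iter (k * l) v q = ((step (fun_scale (1 / real (k * l)) v) ^^ l) ^^ k) q"
    unfolding iter_def by (simp add: funpow_mult mult.commute)
  also have "\<dots> = (step (fun_scale (1 / real k) v) ^^ k) q"
    by (rule conjunct1[OF funpow_on_cong[of "mcarrier M"]])
       (use step_iterate[OF _ v l] step_carrier[OF _ v] q in \<open>simp_all only: e\<close>)
  finally show ?thesis by (simp add: iter_def)
qed

text \<open>The time-one flow of the field with constant coefficients \<open>v\<close> in the frame: \<open>v\<close> is cut
  into pieces so short that one chart suffices for each, and the result does not depend on the number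
  of pieces.\<close>

definition act :: "(nat \<Rightarrow> real) \<Rightarrow> 'a \<Rightarrow> 'a" where
  "act v = iter (SOME k. adm k v) v"

lemma act_eq_iter:
  assumes q: "q \<in> mcarrier M" and a: "adm k v"
  shows "act v q = iter k v q"
proof -
  define l where "l = (SOME k. adm k v)"
  have l: "adm l v" unfolding l_def using a by (rule someI)
  have "iter l v q = iter (l * k) v q" by (rule iter_refine[symmetric, OF q l]) (use a in \<open>simp add: adm_def\<close>)
  also have "\<dots> = iter (k * l) v q" by (simp add: mult.commute)
  also have "\<dots> = iter k v q" by (rule iter_refine[OF q a]) (use l in \<open>simp add: adm_def\<close>)
  finally show ?thesis by (simp add: act_def l_def)
qed

lemma act_small: "q \<in> mcarrier M \<Longrightarrow> w \<in> cube n 0 \<epsilon> \<Longrightarrow> act w q = step w q"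
  using act_eq_iter[of q 1 w] by (simp add: adm_def iter_def)

lemma act_carrier:
  assumes q: "q \<in> mcarrier M" and v: "v \<in> espace n" shows "act v q \<in> mcarrier M"
proof -
  obtain k where k: "adm k v" by (rule adm_ex[OF v])
  then have w: "fun_scale (1 / real k) v \<in> cube n 0 \<epsilon>" by (simp add: adm_def)
  have "iter k v q \<in> mcarrier M"
    unfolding iter_def using funpow_on_cong[of "mcarrier M" "step (fun_scale (1 / real k) v)", OF refl step_carrier[OF _ w] q] by blast
  then show ?thesis using act_eq_iter[OF q k] by simp
qed

text \<open>One common number of pieces serves \<open>v\<close>, \<open>w\<close> and
  \<open>v + w\<close>. The short moves commute, so the power of their composite splits into the
  composite of their powers.\<close>

lemma act_add:
  assumes q: "q \<in> mcarrier M" and v: "v \<in> espace n" and w: "w \<in> espace n"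
  shows "act (v + w) q = act w (act v q)"
proof -
  have vw: "v + w \<in> espace n" using v w by simp
  obtain k1 k2 k3 where k: "adm k1 v" "adm k2 w" "adm k3 (v + w)"
    using adm_ex[OF v] adm_ex[OF w] adm_ex[OF vw] by metis
  define k where "k = k1 + k2 + k3"
  have a: "adm k v" "adm k w" "adm k (v + w)" using k by (auto simp: k_def intro: adm_mono)
  let ?v = "fun_scale (1 / real k) v" and ?w = "fun_scale (1 / real k) w"
  have e: "fun_scale (1 / real k) (v + w) = ?v + ?w" by (simp add: fun_eq_iff add_divide_distrib)
  have c: "?v \<in> cube n 0 \<epsilon>" "?w \<in> cube n 0 \<epsilon>" "?v + ?w \<in> cube n 0 \<epsilon>" using a unfolding adm_def e by auto
  have "act (v + w) q = (step (?v + ?w) ^^ k) q" unfolding act_eq_iter[OF q a(3)] iter_def e ..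
  also have "\<dots> = ((\<lambda>x. step ?w (step ?v x)) ^^ k) q"
    by (rule conjunct1[OF funpow_on_cong[of "mcarrier M"]])
       (use step_add[OF _ c] step_carrier[OF step_carrier[OF _ c(1)] c(2)] q in simp_all)
  also have "\<dots> = (step ?w ^^ k) ((step ?v ^^ k) q)"
    by (rule funpow_on_commute[of "mcarrier M"])
       (use step_comm[OF _ c] step_carrier[OF _ c(1)] step_carrier[OF _ c(2)] q in simp_all)
  also have "(step ?v ^^ k) q = act v q" unfolding act_eq_iter[OF q a(1)] iter_def ..
  also have "(step ?w ^^ k) (act v q) = act w (act v q)"
    unfolding act_eq_iter[OF act_carrier[OF q v] a(2)] iter_def ..
  finally show ?thesis .
qed

definition orb :: "(nat \<Rightarrow> real) \<Rightarrow> 'a" where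
  "orb v = act v m"

lemma orb_carrier: "v \<in> espace n \<Longrightarrow> orb v \<in> mcarrier M"
  unfolding orb_def by (rule act_carrier[OF m])

lemma cube_espace: "w \<in> cube n a e \<Longrightarrow> w \<in> espace n"
  by (simp add: cube_def)

lemma orb_step:
  assumes v: "v \<in> espace n" and w: "w \<in> cube n 0 \<epsilon>"
  shows "orb (v + w) = step w (orb v)"
  unfolding orb_def act_add[OF m v cube_espace[OF w]] by (rule act_small[OF orb_carrier[OF v, unfolded orb_def] w])

lemma orb_near:
  assumes v: "v \<in> espace n" and q: "q \<in> dom (orb v)" "crd (orb v) q \<in> cube n (crd (orb v) (orb v)) \<epsilon>"
  shows "orb (v + (crd (orb v) q - crd (orb v) (orb v))) = q"
proof -
  note c = chosen_chart[OF orb_carrier[OF v]]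
  have "crd (orb v) q - crd (orb v) (orb v) \<in> cube n 0 \<epsilon>"
    by (rule cube_shift_diff[OF straight_espace[OF c(1,2)] q(2)])
  from orb_step[OF v this] show ?thesis using step_eqI[OF orb_carrier[OF v] q(1)] by simp
qed

text \<open>Seen in the chart chosen at \<open>orb v\<close>, the orbit map near \<open>v\<close> is
  a translation of a small cube, so the image of a neighbourhood of \<open>v\<close> fills a
  coordinate cube.\<close>

lemma orb_open_map:
  assumes V: "openin (Euclidean_space n) V"
  shows "openin (mtop M) (orb ` V)"
proof (subst openin_subopen, rule ballI)
  fix p assume "p \<in> orb ` V"
  then obtain v where v: "v \<in> V" "p = orb v" by blast
  have ve: "v \<in> espace n" using V v(1) unfolding openin_Euclidean_space_iff by blast
  obtain e where e: "e > 0" "cube n v e \<subseteq> V" using V v(1) unfolding openin_Euclidean_space_iff by meson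
  define d where "d = min e \<epsilon>"
  have d: "d > 0" "d \<le> e" "d \<le> \<epsilon>" using e(1) \<epsilon> by (auto simp: d_def)
  note c = chosen_chart[OF orb_carrier[OF ve]]
  note ce = straight_espace[OF c(1,2)]
  show "\<exists>T. openin (mtop M) T \<and> p \<in> T \<and> T \<subseteq> orb ` V"
  proof (intro exI[of _ "{q \<in> dom p. crd p q \<in> cube n (crd p p) d}"] conjI subsetI)
    show "openin (mtop M) {q \<in> dom p. crd p q \<in> cube n (crd p p) d}"
      unfolding v(2) by (rule straight_open_preimage[OF c(1) openin_cube])
    show "p \<in> {q \<in> dom p. crd p q \<in> cube n (crd p p) d}"
      unfolding v(2) using c(2) centre_in_cube[OF ce d(1)] by simp
    fix q assume "q \<in> {q \<in> dom p. crd p q \<in> cube n (crd p p) d}"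
    then have q: "q \<in> dom (orb v)" "crd (orb v) q \<in> cube n (crd (orb v) (orb v)) d" by (auto simp: v(2))
    have "crd (orb v) q - crd (orb v) (orb v) \<in> cube n 0 d" by (rule cube_shift_diff[OF ce q(2)])
    then have "crd (orb v) q - crd (orb v) (orb v) \<in> cube n 0 e" using cube_mono[OF d(2)] by blast
    from cube_shift[OF ve this] have "v + (crd (orb v) q - crd (orb v) (orb v)) \<in> V" using e(2) by blast
    moreover have "orb (v + (crd (orb v) q - crd (orb v) (orb v))) = q"
      by (rule orb_near[OF ve q(1)]) (use q(2) cube_mono[OF d(3)] in blast)
    ultimately show "q \<in> orb ` V" by (metis imageI)
  qed
qed

lemma orb_continuous: "continuous_map (Euclidean_space n) (mtop M) orb"
  unfolding continuous_map_def topspace_Euclidean_space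
proof (intro conjI allI impI)
  show "orb \<in> espace n \<rightarrow> mcarrier M" using orb_carrier by blast
  fix G assume G: "openin (mtop M) G"
  show "openin (Euclidean_space n) {v \<in> espace n. orb v \<in> G}"
    unfolding openin_Euclidean_space_iff
  proof (intro conjI ballI)
    fix v assume "v \<in> {v \<in> espace n. orb v \<in> G}"
    then have v: "v \<in> espace n" "orb v \<in> G" by auto
    note c = chosen_chart[OF orb_carrier[OF v(1)]]
    let ?x = "crd (orb v)"
    have "openin (Euclidean_space n) (?x ` (dom (orb v) \<inter> G))"
      by (rule straight_open_image[OF c(1)]) (use straight_open[OF c(1)] G in auto)
    moreover have "?x (orb v) \<in> ?x ` (dom (orb v) \<inter> G)" using c(2) v(2) by blast
    ultimately obtain e where e: "e > 0" "cube n (?x (orb v)) e \<subseteq> ?x ` (dom (orb v) \<inter> G)"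
      unfolding openin_Euclidean_space_iff by meson
    define d where "d = min e \<epsilon>"
    have d: "d > 0" "d \<le> e" "d \<le> \<epsilon>" using e(1) \<epsilon> by (auto simp: d_def)
    have "cube n v d \<subseteq> {v \<in> espace n. orb v \<in> G}"
    proof
      fix u assume u: "u \<in> cube n v d"
      have w: "u - v \<in> cube n 0 d" by (rule cube_shift_diff[OF v(1) u])
      then have w\<epsilon>: "u - v \<in> cube n 0 \<epsilon>" using cube_mono[OF d(3)] by blast
      have "orb u = step (u - v) (orb v)" using orb_step[OF v(1) w\<epsilon>] by simp
      moreover have "step (u - v) (orb v) \<in> G"
      proof -
        have "?x (orb v) + (u - v) \<in> cube n (?x (orb v)) d" by (rule cube_shift[OF straight_espace[OF c(1,2)] w])
        then have "?x (orb v) + (u - v) \<in> ?x ` (dom (orb v) \<inter> G)" using e(2) cube_mono[OF d(2)] by blast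
        then obtain q where q: "q \<in> dom (orb v)" "q \<in> G" "?x q = ?x (orb v) + (u - v)" by auto
        then show ?thesis using step_eqI[OF orb_carrier[OF v(1)] q(1,3)] by simp
      qed
      ultimately show "u \<in> {v \<in> espace n. orb v \<in> G}" using cube_espace[OF u] by simp
    qed
    then show "\<exists>e>0. cube n v e \<subseteq> {v \<in> espace n. orb v \<in> G}" using d(1) by blast
  qed auto
qed

text \<open>The orbit is open. A point reached from \<open>q\<close> by a short move returns to
  \<open>q\<close> by the opposite move, so near a point off the orbit no point lies on it.
  Connectedness leaves a single orbit.\<close>

lemma orb_surj: "orb ` espace n = mcarrier M"
proof -
  have E: "openin (Euclidean_space n) (espace n)" using openin_topspace[of "Euclidean_space n"] by (simp add: topspace_Euclidean_space)
  have o: "openin (mtop M) (orb ` espace n)" by (rule orb_open_map[OF E])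
  have "openin (mtop M) (mcarrier M - orb ` espace n)"
  proof (subst openin_subopen, rule ballI)
    fix q assume q: "q \<in> mcarrier M - orb ` espace n"
    then have qM: "q \<in> mcarrier M" by blast
    note c = chosen_chart[OF qM]
    note ce = straight_espace[OF c(1,2)]
    show "\<exists>T. openin (mtop M) T \<and> q \<in> T \<and> T \<subseteq> mcarrier M - orb ` espace n"
    proof (intro exI[of _ "{p \<in> dom q. crd q p \<in> cube n (crd q q) \<epsilon>}"] conjI subsetI)
      show "openin (mtop M) {p \<in> dom q. crd q p \<in> cube n (crd q q) \<epsilon>}"
        by (rule straight_open_preimage[OF c(1) openin_cube])
      show "q \<in> {p \<in> dom q. crd q p \<in> cube n (crd q q) \<epsilon>}" using c(2) centre_in_cube[OF ce \<epsilon>] by simp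
      fix p assume "p \<in> {p \<in> dom q. crd q p \<in> cube n (crd q q) \<epsilon>}"
      then have p: "p \<in> dom q" "crd q p \<in> cube n (crd q q) \<epsilon>" by auto
      define w where "w = crd q p - crd q q"
      have w: "w \<in> cube n 0 \<epsilon>" unfolding w_def by (rule cube_shift_diff[OF ce p(2)])
      have sp: "step w q = p" by (rule step_eqI[OF qM p(1)]) (simp add: w_def)
      have "p \<notin> orb ` espace n"
      proof
        assume "p \<in> orb ` espace n"
        then obtain u where u: "u \<in> espace n" "p = orb u" by blast
        have "orb (u + - w) = step (- w) p" using orb_step[OF u(1) cube_neg[OF w]] u(2) by simp
        also have "\<dots> = q" using step_add[OF qM w cube_neg[OF w]] zero_cube sp step_0[OF qM] by simp
        finally have "q = orb (u + - w)" by simp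
        moreover have "u + - w \<in> espace n" using u(1) cube_espace[OF w] by simp
        ultimately show False using q by blast
      qed
      then show "p \<in> mcarrier M - orb ` espace n" using p(1) openin_subset[OF straight_open[OF c(1)]] by blast
    qed
  qed
  then have "closedin (mtop M) (orb ` espace n)" using orb_carrier by (auto simp: closedin_def)
  moreover have "orb 0 \<in> orb ` espace n" by (rule imageI) simp
  ultimately show ?thesis using connected o unfolding connected_space_clopen_in by blast
qed

lemma orb_0: "orb 0 = m"
  unfolding orb_def using act_small[OF m zero_cube] step_0[OF m] by simp

definition periods :: "(nat \<Rightarrow> real) set" where
  "periods = {v \<in> espace n. orb v = m}"

text \<open>Acting by the opposite of \<open>w\<close> turns equality of the two points into a
  condition at the base point, and acting by \<open>w\<close> undoes this.\<close>

lemma orb_eq_iff: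
  assumes v: "v \<in> espace n" and w: "w \<in> espace n"
  shows "orb v = orb w \<longleftrightarrow> v - w \<in> periods"
proof -
  have mw: "- w \<in> espace n" and vw: "v - w \<in> espace n" using v w by simp_all
  have a: "orb (v + - w) = act (- w) (orb v)" "orb (w + - w) = act (- w) (orb w)"
    unfolding orb_def by (rule act_add[OF m v mw], rule act_add[OF m w mw])
  have b: "orb ((v - w) + w) = act w (orb (v - w))" "orb (0 + w) = act w (orb 0)"
    unfolding orb_def by (rule act_add[OF m vw w], rule act_add[OF m _ w]) simp
  show ?thesis
  proof
    assume "orb v = orb w"
    then have "orb (v - w) = m" using a orb_0 by simp
    then show "v - w \<in> periods" using vw by (simp add: periods_def)
  next
    assume "v - w \<in> periods"
    then have "orb (v - w) = orb 0" by (simp add: periods_def orb_0)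
    then show "orb v = orb w" using b by simp
  qed
qed

text \<open>A short nonzero period would fix \<open>m\<close> while shifting its chart coordinates;
  this gives discreteness. For cocompactness, the images of the cubes of integer radius are open,
  increasing and cover the compact manifold, so a single cube already maps onto it.\<close>

lemma periods_lattice: obtains R where "euclidean_lattice n periods \<epsilon> R"
proof -
  have "\<exists>\<F>. finite \<F> \<and> \<F> \<subseteq> range (\<lambda>j::nat. orb ` cube n 0 (real j)) \<and> mcarrier M \<subseteq> \<Union>\<F>"
  proof -
    have "mcarrier M \<subseteq> \<Union>(range (\<lambda>j::nat. orb ` cube n 0 (real j)))"
    proof
      fix q assume "q \<in> mcarrier M"
      then obtain v where v: "v \<in> espace n" "q = orb v" using orb_surj by blast
      obtain j :: nat where j: "real j > (\<Sum>i<n. \<bar>v i\<bar>)" using reals_Archimedean2 by blast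
      have "\<bar>v i\<bar> < real j" if "i < n" for i
      proof -
        have "\<bar>v i\<bar> \<le> (\<Sum>i<n. \<bar>v i\<bar>)" using that by (intro member_le_sum) auto
        then show ?thesis using j by linarith
      qed
      then have "v \<in> cube n 0 (real j)" using v(1) by (simp add: cube_def)
      then show "q \<in> \<Union>(range (\<lambda>j::nat. orb ` cube n 0 (real j)))" using v(2) by blast
    qed
    moreover have "\<forall>U\<in>range (\<lambda>j::nat. orb ` cube n 0 (real j)). openin (mtop M) U"
      using orb_open_map[OF openin_cube] by blast
    ultimately show ?thesis using compact unfolding compact_space_alt by meson
  qed
  then obtain \<F> where F: "finite \<F>" "\<F> \<subseteq> range (\<lambda>j::nat. orb ` cube n 0 (real j))" "mcarrier M \<subseteq> \<Union>\<F>" by blast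
  obtain J where J: "finite J" "\<F> = (\<lambda>j::nat. orb ` cube n 0 (real j)) ` J"
    using finite_subset_image[OF F(1,2)] by blast
  \<comment> \<open>The inserted 0 guards the maximum against an empty index set.\<close>
  define R where "R = real (Max (insert 0 J))"
  have cov: "\<exists>u\<in>cube n 0 R. q = orb u" if q: "q \<in> mcarrier M" for q
  proof -
    obtain S where S: "S \<in> \<F>" "q \<in> S" using F(3) q by blast
    then obtain j where j: "j \<in> J" "q \<in> orb ` cube n 0 (real j)" unfolding J(2) by blast
    have "real j \<le> R" unfolding R_def using j(1) J(1) by simp
    then show ?thesis using j(2) cube_mono by blast
  qed
  have "euclidean_lattice n periods \<epsilon> R"
  proof
    show "periods \<subseteq> espace n" by (auto simp: periods_def)
    show "0 \<in> periods" by (simp add: periods_def orb_0)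
    show "v - w \<in> periods" if "v \<in> periods" "w \<in> periods" for v w
      using that orb_eq_iff[of v w] by (simp add: periods_def)
    show "\<epsilon> > 0" by (rule \<epsilon>)
    show "v = 0" if "v \<in> periods" "v \<in> cube n 0 \<epsilon>" for v
    proof -
      have "step v m = m" using orb_step[OF _ that(2), of 0] that(1) orb_0 by (simp add: periods_def)
      then have "crd m m + v = crd m m" using step_crd[OF m that(2)] by simp
      then show ?thesis by simp
    qed
    show "\<exists>w\<in>periods. v - w \<in> cube n 0 R" if v: "v \<in> espace n" for v
    proof -
      obtain u where u: "u \<in> cube n 0 R" "orb v = orb u" using cov[OF orb_carrier[OF v]] by blast
      then have "v - u \<in> periods" using orb_eq_iff[OF v cube_espace[OF u(1)]] by blast
      then show ?thesis using u(1) by (intro bexI[of _ "v - u"]) simp_all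
    qed
  qed
  then show thesis by (rule that)
qed

end

section \<open>The diffeomorphism with the torus\<close>

lemma Arg_cis_eq: "- pi < x \<Longrightarrow> x \<le> pi \<Longrightarrow> Arg (cis x) = x"
  by (rule cis_Arg_unique) (simp_all add: sgn_div_norm)

lemma cis_eq_iff_int: "cis (2 * pi * x) = cis (2 * pi * y) \<longleftrightarrow> x - y \<in> \<int>"
proof -
  have "cis (2 * pi * x) = cis (2 * pi * y) \<longleftrightarrow> cis (2 * pi * (x - y)) = 1"
    by (simp add: cis_divide[symmetric] right_diff_distrib)
  also have "\<dots> \<longleftrightarrow> cos (2 * pi * (x - y)) = 1"
  proof
    assume "cos (2 * pi * (x - y)) = 1"
    moreover from this have "sin (2 * pi * (x - y)) = 0" by (rule cos_one_sin_zero)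
    ultimately show "cis (2 * pi * (x - y)) = 1" by (simp add: complex_eq_iff)
  qed (simp add: complex_eq_iff)
  also have "\<dots> \<longleftrightarrow> x - y \<in> \<int>"
  proof -
    have "2 * pi * (x - y) = of_int k * 2 * pi \<longleftrightarrow> x - y = of_int k" for k
      using mult_cancel_left[of "2 * pi" "x - y" "of_int k"] by (simp add: ac_simps)
    then show ?thesis unfolding cos_one_2pi_int by (simp only: Ints_def image_iff bex_UNIV)
  qed
  finally show ?thesis .
qed

lemma cis_Arg_sphere: "norm z = 1 \<Longrightarrow> cis (Arg z) = z"
  by (subst cis_Arg) (auto simp: sgn_div_norm)

lemma torus_chart_props:
  shows torus_chart_dom: "z \<in> fst (torus_chart r a) \<longleftrightarrow> z \<in> (\<Pi>\<^sub>E i\<in>{..<r}. sphere 0 1) \<and> (\<forall>i<r. z i \<noteq> - cis (a i))"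
  by (auto simp: torus_chart_def PiE_iff)

lemma torus_angle:
  assumes "norm z = 1" "z \<noteq> - cis a"
  shows "cis (a + Arg (z / cis a)) = z" "\<bar>Arg (z / cis a)\<bar> < pi"
proof -
  have n: "norm (z / cis a) = 1" using assms(1) by (simp add: norm_divide)
  have "cis (a + Arg (z / cis a)) = cis a * (z / cis a)" by (simp add: cis_mult[symmetric] cis_Arg_sphere[OF n])
  then show "cis (a + Arg (z / cis a)) = z" by simp
  have "Arg (z / cis a) \<noteq> pi"
  proof
    assume "Arg (z / cis a) = pi"
    then have "z / cis a = -1" using cis_Arg_sphere[OF n] by simp
    then show False using assms(2) by (simp add: divide_eq_eq)
  qed
  then show "\<bar>Arg (z / cis a)\<bar> < pi" using Arg_bounded[of "z / cis a"] by (auto simp: abs_less_iff)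
qed

lemma cis_neq: "\<bar>y - a\<bar> < pi \<Longrightarrow> cis y \<noteq> - cis a"
proof
  assume y: "\<bar>y - a\<bar> < pi" and "cis y = - cis a"
  then have "cis (y - a) = cis pi" by (simp add: cis_divide[symmetric])
  moreover have "Arg (cis (y - a)) = y - a" using y by (intro Arg_cis_eq) auto
  moreover have "Arg (cis pi) = pi" by (intro Arg_cis_eq) auto
  ultimately have "y - a = pi" by (simp only:)
  then show False using y by simp
qed

text \<open>The chart is inverted by \<open>cis\<close> in every coordinate: a number closer than pi
  to \<open>a i\<close> is recovered by the principal argument, and the removed point
  \<open>- cis (a i)\<close> corresponds to distance exactly pi.\<close>

lemma torus_chart_image:
  shows "inj_on (snd (torus_chart r a)) (fst (torus_chart r a))"
    and "snd (torus_chart r a) ` fst (torus_chart r a) = cube r (\<lambda>i. if i < r then a i else 0) pi"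
    and "y \<in> cube r (\<lambda>i. if i < r then a i else 0) pi \<Longrightarrow>
      inv_into (fst (torus_chart r a)) (snd (torus_chart r a)) y = (\<lambda>i\<in>{..<r}. cis (y i))"
    and "y \<in> cube r (\<lambda>i. if i < r then a i else 0) pi \<Longrightarrow> (\<lambda>i\<in>{..<r}. cis (y i)) \<in> fst (torus_chart r a)"
proof -
  let ?D = "fst (torus_chart r a)" and ?x = "snd (torus_chart r a)" and ?C = "cube r (\<lambda>i. if i < r then a i else 0) pi"
  have D: "norm (z i) = 1" "z i \<noteq> - cis (a i)" if "z \<in> ?D" "i < r" for z i
    using that(2) torus_chart_dom[THEN iffD1, OF that(1)] PiE_mem[of z "{..<r}" "\<lambda>i. sphere 0 1" i] by simp_all
  have x: "?x z i = (if i < r then a i + Arg (z i / cis (a i)) else 0)" for z i by (simp add: torus_chart_def)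
  have xC: "?x z \<in> ?C" if "z \<in> ?D" for z using torus_angle(2)[OF D[OF that]] by (auto simp: cube_def x)
  show inj: "inj_on ?x ?D"
  proof (rule inj_onI)
    fix z w assume zw: "z \<in> ?D" "w \<in> ?D" "?x z = ?x w"
    have "z i = w i" for i
    proof (cases "i < r")
      case True
      have "a i + Arg (z i / cis (a i)) = a i + Arg (w i / cis (a i))" using fun_cong[OF zw(3), of i] True by (simp add: x)
      then have "cis (a i + Arg (z i / cis (a i))) = cis (a i + Arg (w i / cis (a i)))" by (simp only:)
      then show ?thesis unfolding torus_angle(1)[OF D[OF zw(1) True]] torus_angle(1)[OF D[OF zw(2) True]] .
    next
      case False
      have "z \<in> (\<Pi>\<^sub>E i\<in>{..<r}. sphere 0 1)" "w \<in> (\<Pi>\<^sub>E i\<in>{..<r}. sphere 0 1)"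
        using zw(1,2) torus_chart_dom by blast+
      from this[THEN PiE_arb[where x = i]] False show ?thesis by simp
    qed
    then show "z = w" by (rule ext)
  qed
  have C: "\<bar>y i - a i\<bar> < pi" if "y \<in> ?C" "i < r" for y i
  proof -
    have "\<bar>y i - (if i < r then a i else 0)\<bar> < pi" using that unfolding cube_def by blast
    then show ?thesis using that(2) by simp
  qed
  show mem: "(\<lambda>i\<in>{..<r}. cis (y i)) \<in> ?D" if "y \<in> ?C" for y
    using cis_neq[OF C[OF that]] by (auto simp: torus_chart_dom PiE_iff)
  have xc: "?x (\<lambda>i\<in>{..<r}. cis (y i)) = y" if y: "y \<in> ?C" for y
  proof
    fix i
    show "?x (\<lambda>i\<in>{..<r}. cis (y i)) i = y i"
    proof (cases "i < r")
      case True
      have "Arg (cis (y i) / cis (a i)) = y i - a i"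
        unfolding cis_divide using C[OF y True] by (intro Arg_cis_eq) auto
      then show ?thesis using True by (simp add: x)
    next
      case False
      then show ?thesis using y by (simp add: x cube_def)
    qed
  qed
  show "?x ` ?D = ?C"
  proof
    show "?x ` ?D \<subseteq> ?C" using xC by blast
    show "?C \<subseteq> ?x ` ?D"
    proof
      fix y assume y: "y \<in> ?C"
      show "y \<in> ?x ` ?D" using imageI[OF mem[OF y], of ?x] unfolding xc[OF y] .
    qed
  qed
  show "inv_into ?D ?x y = (\<lambda>i\<in>{..<r}. cis (y i))" if "y \<in> ?C" for y
    using inv_into_f_f[OF inj mem[OF that]] unfolding xc[OF that] .
qed

lemma mem_torus: "z \<in> mcarrier (torus r) \<longleftrightarrow> z \<in> (\<Pi>\<^sub>E i\<in>{..<r}. sphere 0 1)"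
  by (simp add: torus_def)

text \<open>Two continuous choices of an angle for the same point of the circle differ by a locally
  constant amount. The radius \<open>pi - \<bar>s\<bar>\<close> is the distance from the branch cut
  of the argument.\<close>

lemma angle_locally_shift:
  assumes "cis t0 \<noteq> - cis a"
  obtains d c where "d > 0" "\<And>t. \<bar>t - t0\<bar> < d \<Longrightarrow> a + Arg (cis t / cis a) = t + c"
proof -
  define s where "s = Arg (cis t0 / cis a)"
  have s: "cis (a + s) = cis t0" "\<bar>s\<bar> < pi" unfolding s_def using torus_angle[of "cis t0" a] assms by auto
  define d where "d = pi - \<bar>s\<bar>"
  have "a + Arg (cis t / cis a) = t + (a + s - t0)" if "\<bar>t - t0\<bar> < d" for t
  proof -
    have "cis t / cis a = cis (s + (t - t0))"
    proof -
      have "cis t = cis t0 * cis (t - t0)" by (simp add: cis_mult)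
      also have "\<dots> = cis a * cis (s + (t - t0))" unfolding s(1)[symmetric] by (simp add: cis_mult add.assoc)
      finally show ?thesis by simp
    qed
    moreover have "Arg (cis (s + (t - t0))) = s + (t - t0)" using that by (intro Arg_cis_eq) (auto simp: d_def)
    ultimately show ?thesis by simp
  qed
  moreover have "d > 0" using s by (simp add: d_def)
  ultimately show thesis using that by blast
qed

context compact_frame begin

text \<open>In coordinates with respect to a lattice basis, the orbit map identifies real vectors
  modulo integer vectors with \<open>M\<close>, and \<open>cis\<close> of \<open>2 * pi\<close>
  times the coordinates identifies them with the torus. Both comparison maps are smooth because they
  have smooth local lifts: affine maps in straight charts, and shifted angles on the circle.\<close>

theorem diffeomorphic_torus: "diffeomorphic M (torus n)"
proof -
  obtain R where "euclidean_lattice n periods \<epsilon> R" by (rule periods_lattice)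
  then interpret L: euclidean_lattice n periods \<epsilon> R .
  obtain h where h: "\<And>i. i < n \<Longrightarrow> h i \<in> periods"
    and h_indep: "\<And>a i. (\<Sum>k<n. fun_scale (a k) (h k)) = 0 \<Longrightarrow> i < n \<Longrightarrow> a i = 0"
    and h_span: "\<And>v. v \<in> espace n \<Longrightarrow> \<exists>a. v = (\<Sum>k<n. fun_scale (a k) (h k))"
    and h_int: "\<And>a i. (\<Sum>k<n. fun_scale (a k) (h k)) \<in> periods \<Longrightarrow> i < n \<Longrightarrow> a i \<in> \<int>"
    by (rule L.lattice_basis, rule that)
  have he: "h i \<in> espace n" if "i < n" for i using h[OF that] L.in_espace by blast
  define lin where "lin a = (\<Sum>k<n. fun_scale (a k) (h k))" for a
  have lin_apply: "lin a i = (\<Sum>k<n. a k * h k i)" for a i by (simp add: lin_def sum_fun_apply)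
  have line: "lin a \<in> espace n" for a
    unfolding lin_def by (intro fun_vs.subspace_sum[OF espace_subspace] fun_vs.subspace_scale[OF espace_subspace] he) simp
  have lin_diff: "lin a - lin b = lin (\<lambda>k. a k - b k)" for a b
    by (intro ext) (simp add: lin_apply left_diff_distrib sum_subtractf)
  have lin_period: "lin a \<in> periods \<longleftrightarrow> (\<forall>k<n. a k \<in> \<int>)" for a
  proof
    assume "lin a \<in> periods"
    then show "\<forall>k<n. a k \<in> \<int>" using h_int unfolding lin_def by blast
  next
    assume int: "\<forall>k<n. a k \<in> \<int>"
    have "(\<Sum>k<j. fun_scale (a k) (h k)) \<in> periods" if "j \<le> n" for j
      using that
    proof (induction j)
      case 0
      show ?case using L.zero by (simp only: lessThan_0 sum.empty)
    next
      case (Suc j)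
      have "a j \<in> \<int>" using int Suc.prems by simp
      then obtain k where k: "a j = of_int k" by (rule Ints_cases)
      have "(\<Sum>k<j. fun_scale (a k) (h k)) + fun_scale (of_int k) (h j) \<in> periods"
        by (rule L.add[OF Suc.IH L.int_scale[OF h]]) (use Suc.prems in simp_all)
      moreover have "(\<Sum>k<Suc j. fun_scale (a k) (h k)) = (\<Sum>k<j. fun_scale (a k) (h k)) + fun_scale (of_int k) (h j)"
        by (simp only: sum.lessThan_Suc k)
      ultimately show ?case by (simp only:)
    qed
    from this[OF order_refl] show "lin a \<in> periods" by (simp only: lin_def)
  qed
  \<comment> \<open>Coordinates with respect to the lattice basis. Only the components below
    \<open>n\<close> are determined, and only arguments in \<open>espace n\<close> are
    meaningful.\<close>
  define crds where "crds v = (SOME a. v = lin a)" for v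
  have crds: "lin (crds v) = v" if "v \<in> espace n" for v
  proof -
    have "\<exists>a. v = lin a" using h_span[OF that] by (simp add: lin_def)
    then show ?thesis unfolding crds_def by (metis (mono_tags, lifting) someI_ex)
  qed
  have lin_inj: "a i = b i" if "lin a = lin b" "i < n" for a b i
  proof -
    have "lin (\<lambda>k. a k - b k) = 0" using lin_diff[of a b] that(1) by simp
    from h_indep[OF this[unfolded lin_def] that(2)] show ?thesis by simp
  qed
  have crds_lin: "crds (lin a) i = a i" if "i < n" for a i
    by (rule lin_inj[OF crds[OF line] that])
  have crds_expand: "crds v i = (\<Sum>j<n. v j * crds (axis_vec j) i)" if v: "v \<in> espace n" and i: "i < n" for v i
  proof (rule lin_inj[OF _ i])
    have ue: "axis_vec j \<in> espace n" if "j < n" for j using that by (auto simp: axis_vec_def)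
    have "lin (crds v) = v" by (rule crds[OF v])
    also have "\<dots> = (\<Sum>j<n. fun_scale (v j) (axis_vec j))" by (rule espace_expand[OF v])
    also have "\<dots> = (\<Sum>j<n. fun_scale (v j) (lin (crds (axis_vec j))))"
      using crds[OF ue] by (intro sum.cong refl) simp
    also have "\<dots> = lin (\<lambda>i. \<Sum>j<n. v j * crds (axis_vec j) i)"
    proof
      fix x
      show "(\<Sum>j<n. fun_scale (v j) (lin (crds (axis_vec j)))) x = lin (\<lambda>i. \<Sum>j<n. v j * crds (axis_vec j) i) x"
        by (simp add: sum_fun_apply lin_apply sum_distrib_left sum_distrib_right mult.assoc) (rule sum.swap)
    qed
    finally show "lin (crds v) = lin (\<lambda>i. \<Sum>j<n. v j * crds (axis_vec j) i)" .
  qed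
  have orb_lin_eq: "orb (lin a) = orb (lin b) \<longleftrightarrow> (\<forall>k<n. a k - b k \<in> \<int>)" for a b
    unfolding orb_eq_iff[OF line line] lin_diff lin_period ..
  define lift where "lift q = (SOME v. v \<in> espace n \<and> orb v = q)" for q
  have lift: "lift q \<in> espace n" "orb (lift q) = q" if "q \<in> mcarrier M" for q
  proof -
    have "\<exists>v. v \<in> espace n \<and> orb v = q" using orb_surj that by (metis (no_types, lifting) imageE)
    from someI_ex[OF this] show "lift q \<in> espace n" "orb (lift q) = q" unfolding lift_def by blast+
  qed
  \<comment> \<open>The lift is an arbitrary and possibly discontinuous choice, but two lifts differ
    by integers, which \<open>cis\<close> does not see. Likewise \<open>K\<close> may use principal
    arguments, since \<open>orb\<close> does not see integer changes of lattice coordinates.\<close>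
  define H where "H q = (\<lambda>k\<in>{..<n}. cis (2 * pi * crds (lift q) k))" for q
  define K where "K z = orb (lin (\<lambda>k. Arg (z k) / (2 * pi)))" for z
  have H_orb: "H (orb v) k = cis (2 * pi * crds v k)" if v: "v \<in> espace n" and k: "k < n" for v k
  proof -
    note l = lift[OF orb_carrier[OF v]]
    have "orb (lin (crds (lift (orb v)))) = orb (lin (crds v))" by (simp add: crds[OF v] crds[OF l(1)] l(2))
    then have "crds (lift (orb v)) k - crds v k \<in> \<int>" using orb_lin_eq k by blast
    then show ?thesis using k cis_eq_iff_int by (simp add: H_def)
  qed
  have K_cis: "K (\<lambda>k\<in>{..<n}. cis (2 * pi * a k)) = orb (lin a)" for a
    unfolding K_def orb_lin_eq
  proof (intro allI impI)
    fix k assume k: "k < n"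
    have "Arg (cis (2 * pi * a k)) / (2 * pi) - a k \<in> \<int>"
      unfolding cis_eq_iff_int[symmetric] by (simp add: cis_Arg_sphere)
    then show "Arg ((\<lambda>k\<in>{..<n}. cis (2 * pi * a k)) k) / (2 * pi) - a k \<in> \<int>"
      using k by simp
  qed
  have H_torus: "H q \<in> mcarrier (torus n)" for q unfolding mem_torus by (auto simp: H_def)
  have KH: "K (H q) = q" if q: "q \<in> mcarrier M" for q
    unfolding H_def K_cis crds[OF lift(1)[OF q]] by (rule lift(2)[OF q])
  have HK: "H (K z) = z" if z: "z \<in> mcarrier (torus n)" for z
  proof
    fix k
    show "H (K z) k = z k"
    proof (cases "k < n")
      case True
      have "norm (z k) = 1" using z True by (auto simp: mem_torus PiE_iff)
      then show ?thesis unfolding K_def H_orb[OF line True] crds_lin[OF True] by (simp add: cis_Arg_sphere)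
    next
      case False
      then show ?thesis using z by (auto simp: H_def mem_torus PiE_iff extensional_def)
    qed
  qed
  have K_carrier: "K z \<in> mcarrier M" for z unfolding K_def by (rule orb_carrier[OF line])

  \<comment> \<open>A smooth lift of the angles near \<open>p\<close>: the lift of \<open>p\<close>
    is kept and displaced along the straight chart, instead of choosing a new lift at every
    point.\<close>
  define ang where "ang p k q = 2 * pi * crds (lift p + (crd p q - crd p p)) k" for p k q
  define nb where "nb p = {q \<in> dom p. crd p q \<in> cube n (crd p p) \<epsilon>}" for p
  have nb: "openin (mtop M) (nb p)" "p \<in> nb p" "nb p \<subseteq> mcarrier M" if p: "p \<in> mcarrier M" for p
  proof -
    note c = chosen_chart[OF p]
    show "openin (mtop M) (nb p)" unfolding nb_def by (rule straight_open_preimage[OF c(1) openin_cube])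
    then show "nb p \<subseteq> mcarrier M" by (rule openin_subset)
    show "p \<in> nb p" unfolding nb_def using c(2) centre_in_cube[OF straight_espace[OF c(1,2)] \<epsilon>] by simp
  qed
  have H_ang: "H q k = cis (ang p k q)" if p: "p \<in> mcarrier M" and q: "q \<in> nb p" and k: "k < n" for p q k
  proof -
    note c = chosen_chart[OF p] and l = lift[OF p]
    have q': "q \<in> dom (orb (lift p))" "crd (orb (lift p)) q \<in> cube n (crd (orb (lift p)) (orb (lift p))) \<epsilon>"
      using q unfolding l(2) nb_def by auto
    have "q = orb (lift p + (crd p q - crd p p))" using orb_near[OF l(1) q'] unfolding l(2) by simp
    moreover have "lift p + (crd p q - crd p p) \<in> espace n"
      using l(1) straight_espace[OF c(1), of q] straight_espace[OF c(1,2)] q by (simp add: nb_def)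
    ultimately show ?thesis using H_orb[of "lift p + (crd p q - crd p p)" k] k by (simp add: ang_def)
  qed
  have ang_smooth: "smooth_fun_on M (nb p) (ang p k)" if p: "p \<in> mcarrier M" and k: "k < n" for p k
  proof -
    note c = chosen_chart[OF p] and l = lift[OF p]
    have sub: "nb p \<subseteq> dom p" by (auto simp: nb_def)
    have cs: "smooth_fun_on M (nb p) (\<lambda>q. crd p q j)" if "j < n" for j
      by (rule smooth_fun_on_subset[OF straight_coordinate[OF c(1) that] nb(1)[OF p] sub])
    have "smooth_fun_on M (nb p) (\<lambda>q. 2 * pi * (\<Sum>j<n. (lift p j + (crd p q j + (- crd p p j))) * crds (axis_vec j) k))"
      by (intro smooth_fun_on_cmult smooth_fun_on_sum smooth_fun_on_mult smooth_fun_on_add smooth_fun_on_const nb(1)[OF p] cs) simp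
    then show ?thesis
    proof (rule smooth_fun_on_cong)
      fix q assume q: "q \<in> nb p"
      have "lift p + (crd p q - crd p p) \<in> espace n"
        using l(1) straight_espace[OF c(1), of q] straight_espace[OF c(1,2)] q by (simp add: nb_def)
      from crds_expand[OF this k]
      show "2 * pi * (\<Sum>j<n. (lift p j + (crd p q j + (- crd p p j))) * crds (axis_vec j) k) = ang p k q"
        by (simp add: ang_def)
    qed
  qed
  have H_cont: "continuous_map (mtop M) (mtop (torus n)) H"
  proof -
    have comp: "continuous_map (mtop M) (top_of_set (sphere 0 1)) (\<lambda>q. H q k)" if k: "k < n" for k
    proof (rule continuous_map_locally)
      fix p assume p: "p \<in> mcarrier M"
      have "continuous_map (subtopology (mtop M) (nb p)) euclideanreal (ang p k)"
        by (rule smooth_fun_on_continuous[OF ang_smooth[OF p k]])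
      then have "continuous_map (subtopology (mtop M) (nb p)) euclidean (cis \<circ> ang p k)"
        by (rule continuous_map_compose) (auto intro: continuous_on_cis)
      then have "continuous_map (subtopology (mtop M) (nb p)) (top_of_set (sphere 0 1)) (cis \<circ> ang p k)"
        by (simp add: continuous_map_in_subtopology image_subset_iff)
      then have "continuous_map (subtopology (mtop M) (nb p)) (top_of_set (sphere 0 1)) (\<lambda>q. H q k)"
        by (rule continuous_map_eq) (use H_ang[OF p _ k] in simp)
      then show "\<exists>V. p \<in> V \<and> openin (mtop M) V \<and> continuous_map (subtopology (mtop M) V) (top_of_set (sphere 0 1)) (\<lambda>q. H q k)"
        using nb[OF p] by blast
    qed
    show ?thesis
      unfolding torus_def manifold.simps continuous_map_componentwise
      using comp by (auto simp: H_def)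
  qed
  have H_smooth: "smooth_map M (torus n) H"
    unfolding smooth_map_def
  proof (intro conjI H_cont ballI, clarify)
    fix U \<phi> V \<psi> j assume c: "(U, \<phi>) \<in> mcharts M" and d: "(V, \<psi>) \<in> mcharts (torus n)" and "j < mdim (torus n)"
    then have j: "j < n" by (simp add: torus_def)
    obtain a where a: "torus_chart n a = (V, \<psi>)" using d by (auto simp: torus_def)
    have V: "z \<in> V \<longleftrightarrow> z \<in> (\<Pi>\<^sub>E i\<in>{..<n}. sphere 0 1) \<and> (\<forall>i<n. z i \<noteq> - cis (a i))" for z
      using torus_chart_dom[of z n a] a by simp
    have \<psi>: "\<psi> z j = a j + Arg (z j / cis (a j))" for z
      using a j by (auto simp: torus_chart_def)
    define W where "W = {q \<in> mcarrier M. H q \<in> V}"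
    have "smooth_fun_on M W (\<lambda>q. \<psi> (H q) j)"
    proof (rule smooth_fun_on_local)
      fix p assume p: "p \<in> W"
      then have pM: "p \<in> mcarrier M" by (simp add: W_def)
      have ne: "cis (ang p i p) \<noteq> - cis (a i)" if "i < n" for i
        using p that unfolding H_ang[OF pM nb(2)[OF pM] that, symmetric] by (simp add: W_def V)
      \<comment> \<open>Shrinking around \<open>p\<close> keeps the i-th component off the cut of
        the torus chart and makes the chart angle equal to the lifted angle up to a
        constant.\<close>
      have near: "\<exists>G c. openin (mtop M) G \<and> p \<in> G \<and> G \<subseteq> nb p \<and> (\<forall>q\<in>G. H q i \<noteq> - cis (a i) \<and> a i + Arg (H q i / cis (a i)) = ang p i q + c)"
        if i: "i < n" for i
      proof -
        obtain \<delta> c0 where \<delta>: "\<delta> > 0" "\<And>t. \<bar>t - ang p i p\<bar> < \<delta> \<Longrightarrow> a i + Arg (cis t / cis (a i)) = t + c0"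
          by (rule angle_locally_shift[OF ne[OF i]], rule that)
        have nz: "openin (mtop M) {q \<in> nb p. cis (ang p i q) \<noteq> - cis (a i)}"
        proof -
          have "continuous_map (subtopology (mtop M) (nb p)) euclidean (cis \<circ> ang p i)"
            by (rule continuous_map_compose[OF smooth_fun_on_continuous[OF ang_smooth[OF pM i]]]) (auto intro: continuous_on_cis)
          from openin_continuous_map_preimage[OF this, of "- {- cis (a i)}"]
          have "openin (subtopology (mtop M) (nb p)) {q \<in> topspace (subtopology (mtop M) (nb p)). (cis \<circ> ang p i) q \<in> - {- cis (a i)}}"
            by (simp add: open_Compl)
          moreover have "{q \<in> topspace (subtopology (mtop M) (nb p)). (cis \<circ> ang p i) q \<in> - {- cis (a i)}} = {q \<in> nb p. cis (ang p i q) \<noteq> - cis (a i)}"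
            using nb(3)[OF pM] by auto
          ultimately show ?thesis using openin_trans_full nb(1)[OF pM] by metis
        qed
        have bd: "openin (mtop M) {q \<in> nb p. ang p i q \<in> {ang p i p - \<delta> <..< ang p i p + \<delta>}}"
        proof -
          have "openin (subtopology (mtop M) (nb p)) {q \<in> topspace (subtopology (mtop M) (nb p)). ang p i q \<in> {ang p i p - \<delta> <..< ang p i p + \<delta>}}"
            by (rule openin_continuous_map_preimage[OF smooth_fun_on_continuous[OF ang_smooth[OF pM i]]]) simp
          moreover have "{q \<in> topspace (subtopology (mtop M) (nb p)). ang p i q \<in> {ang p i p - \<delta> <..< ang p i p + \<delta>}}
              = {q \<in> nb p. ang p i q \<in> {ang p i p - \<delta> <..< ang p i p + \<delta>}}"
            using nb(3)[OF pM] by auto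
          ultimately show ?thesis using openin_trans_full nb(1)[OF pM] by metis
        qed
        let ?G = "{q \<in> nb p. cis (ang p i q) \<noteq> - cis (a i)} \<inter> {q \<in> nb p. ang p i q \<in> {ang p i p - \<delta> <..< ang p i p + \<delta>}}"
        have "openin (mtop M) ?G" by (rule openin_Int[OF nz bd])
        moreover have "p \<in> ?G" using nb(2)[OF pM] ne[OF i] \<delta>(1) by simp
        moreover have "H q i \<noteq> - cis (a i) \<and> a i + Arg (H q i / cis (a i)) = ang p i q + c0" if "q \<in> ?G" for q
          using that \<delta>(2)[of "ang p i q"] H_ang[OF pM _ i, of q] by (simp add: abs_less_iff)
        ultimately show ?thesis by (intro exI[of _ ?G] exI[of _ c0]) blast
      qed
      \<comment> \<open>All components are controlled, although only the j-th coordinate is shown to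
        be smooth, because membership in the chart domain \<open>V\<close> restricts each of
        them.\<close>
      have "\<exists>G. \<forall>i\<in>{..<n}. openin (mtop M) (G i) \<and> p \<in> G i \<and> G i \<subseteq> nb p \<and> (\<exists>c. \<forall>q\<in>G i. H q i \<noteq> - cis (a i) \<and> a i + Arg (H q i / cis (a i)) = ang p i q + c)"
        using near by (intro bchoice) (metis lessThan_iff)
      then obtain G where G: "\<forall>i\<in>{..<n}. openin (mtop M) (G i) \<and> p \<in> G i \<and> G i \<subseteq> nb p \<and> (\<exists>c. \<forall>q\<in>G i. H q i \<noteq> - cis (a i) \<and> a i + Arg (H q i / cis (a i)) = ang p i q + c)"
        by blast
      define S where "S = \<Inter> (insert (nb p) (G ` {..<n}))"
      have S: "openin (mtop M) S" "p \<in> S" "S \<subseteq> nb p"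
      proof -
        show "openin (mtop M) S" unfolding S_def using G nb(1)[OF pM] by (intro openin_Inter) auto
        show "p \<in> S" unfolding S_def using G nb(2)[OF pM] by auto
        show "S \<subseteq> nb p" unfolding S_def by blast
      qed
      obtain c0 where c0: "\<And>q. q \<in> G j \<Longrightarrow> a j + Arg (H q j / cis (a j)) = ang p j q + c0" using G j by blast
      have "smooth_fun_on M S (\<lambda>q. ang p j q + c0)"
        by (rule smooth_fun_on_add[OF smooth_fun_on_subset[OF ang_smooth[OF pM j] S(1,3)] smooth_fun_on_const[OF S(1)]])
      then have "smooth_fun_on M S (\<lambda>q. \<psi> (H q) j)"
      proof (rule smooth_fun_on_cong)
        fix q assume "q \<in> S"
        then have "q \<in> G j" using j by (auto simp: S_def)
        then show "ang p j q + c0 = \<psi> (H q) j" unfolding \<psi> by (rule c0[symmetric])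
      qed
      moreover have "S \<subseteq> W"
      proof
        fix q assume q: "q \<in> S"
        have qM: "q \<in> mcarrier M" using q S(3) nb(3)[OF pM] by blast
        have "H q i \<noteq> - cis (a i)" if "i < n" for i
        proof -
          have "q \<in> G i" using q that by (auto simp: S_def)
          then show ?thesis using G that by blast
        qed
        then show "q \<in> W" using qM H_torus[of q] by (simp add: W_def V mem_torus)
      qed
      ultimately show "\<exists>W'. p \<in> W' \<and> W' \<subseteq> W \<and> smooth_fun_on M W' (\<lambda>q. \<psi> (H q) j)" using S(2) by blast
    qed
    from smooth_fun_onD[OF this c]
    have "smooth_on n (\<phi> ` (U \<inter> W)) (\<lambda>x. \<psi> (H (inv_into U \<phi> x)) j)" .
    moreover have "U \<inter> W = U \<inter> H -` V" using chart_subset[OF c] by (auto simp: W_def)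
    ultimately show "smooth_on n (\<phi> ` (U \<inter> H -` V)) (\<lambda>x. \<psi> (H (inv_into U \<phi> x)) j)" by simp
  qed

  \<comment> \<open>From angles in radians to coordinates of period 1.\<close>
  define sc where "sc y = (\<lambda>k. y k / (2 * pi))" for y :: "nat \<Rightarrow> real"
  have K_sc: "K (\<lambda>k\<in>{..<n}. cis (y k)) = orb (lin (sc y))" for y
    using K_cis[of "sc y"] by (simp add: sc_def)
  \<comment> \<open>Near a given point the composite is affine in the straight chart at its image,
    since straight coordinates change by the same vector as the argument of
    \<open>orb\<close>.\<close>
  have orb_lin_smooth: "smooth_on n {y \<in> espace n. orb (lin (sc y)) \<in> W} (\<lambda>y. F (orb (lin (sc y))))"
    if F: "smooth_fun_on M W F" for F W
  proof (rule smooth_on_local)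
    let ?O = "{y \<in> espace n. orb (lin (sc y)) \<in> W}"
    fix y0 assume "y0 \<in> ?O"
    then have y0: "y0 \<in> espace n" "orb (lin (sc y0)) \<in> W" by auto
    define v0 where "v0 = lin (sc y0)"
    define p where "p = orb v0"
    have pM: "p \<in> mcarrier M" unfolding p_def v0_def by (rule orb_carrier[OF line])
    note c = chosen_chart[OF pM]
    have W: "openin (mtop M) (dom p \<inter> W)" using straight_open[OF c(1)] smooth_fun_on_open[OF F] by blast
    have pW: "p \<in> dom p \<inter> W" using c(2) y0(2) by (simp add: p_def v0_def)
    let ?X = "crd p ` (dom p \<inter> W)"
    have Xo: "openin (Euclidean_space n) ?X" by (rule straight_open_image[OF c(1) W]) simp
    \<comment> \<open>The chart expression of the composite near \<open>y0\<close>; it takes the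
      value \<open>crd p p\<close> at \<open>y0\<close>.\<close>
    define g where "g y = crd p p + (lin (sc y) - v0)" for y
    have gs: "g y j = crd p p j + ((\<Sum>k<n. (1 / (2 * pi)) * (y k * h k j)) - v0 j)" for y j
      by (simp add: g_def lin_apply sc_def)
    have E: "openin (Euclidean_space n) (espace n)" using openin_topspace[of "Euclidean_space n"] by (simp add: topspace_Euclidean_space)
    have gsm: "smooth_on n (espace n) (\<lambda>y. g y j)" for j
    proof -
      have "smooth_on n (espace n) (\<lambda>y. y k * h k j)" for k
        by (rule smooth_on_mult[OF smooth_on_coordinate[OF E] smooth_on_const[OF E]])
      then show ?thesis unfolding gs by (intro smooth_on_add smooth_on_diff smooth_on_const smooth_on_sum smooth_on_cmult E)
    qed
    have ge: "g y \<in> espace n" for y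
      using straight_espace[OF c(1,2)] line[of "sc y"] line[of "sc y0"] by (simp add: g_def v0_def)
    have gc: "continuous_map (Euclidean_space n) (Euclidean_space n) g"
      using smooth_on_continuous_map[OF E gsm ge] by (simp add: subtopology_topspace[of "Euclidean_space n", unfolded topspace_Euclidean_space])
    obtain e where e: "e > 0" "cube n (crd p p) e \<subseteq> ?X" using Xo pW unfolding openin_Euclidean_space_iff by blast
    define d where "d = min e \<epsilon>"
    have d: "d > 0" "d \<le> e" "d \<le> \<epsilon>" using e(1) \<epsilon> by (auto simp: d_def)
    define V where "V = {y \<in> espace n. g y \<in> cube n (crd p p) d}"
    have Vo: "openin (Euclidean_space n) V"
      using openin_continuous_map_preimage[OF gc openin_cube, of "crd p p" d] by (simp add: V_def topspace_Euclidean_space)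
    have g0: "g y0 = crd p p" by (simp add: g_def v0_def)
    have inv: "orb (lin (sc y)) = inv_into (dom p) (crd p) (g y) \<and> orb (lin (sc y)) \<in> W" if y: "y \<in> V" for y
    proof -
      have gy: "g y \<in> cube n (crd p p) d" using y by (simp add: V_def)
      have this0: "lin (sc y) - v0 \<in> cube n 0 \<epsilon>"
        using cube_shift_diff[OF straight_espace[OF c(1,2)] gy] cube_mono[OF d(3)] by (auto simp: g_def)
      have vv: "v0 + (lin (sc y) - v0) = lin (sc y)" by (simp add: fun_eq_iff)
      have s: "orb (lin (sc y)) = step (lin (sc y) - v0) p"
        using orb_step[OF line[of "sc y0", folded v0_def] this0] unfolding vv p_def .
      have "g y \<in> cube n (crd p p) e" using gy by (rule subsetD[OF cube_mono[OF d(2)]])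
      then have "g y \<in> ?X" by (rule subsetD[OF e(2)])
      then obtain q where q: "q \<in> dom p" "q \<in> W" "g y = crd p q" by blast
      have "step (lin (sc y) - v0) p = q" by (rule step_eqI[OF pM q(1)]) (simp add: q(3)[symmetric] g_def)
      moreover have "inv_into (dom p) (crd p) (g y) = q" unfolding q(3) by (rule inv_into_f_f[OF straight_inj[OF c(1)] q(1)])
      ultimately show ?thesis using s q(2) by simp
    qed
    have "smooth_on n V (\<lambda>y. F (inv_into (dom p) (crd p) (g y)))"
    proof (rule smooth_on_comp[OF Vo straight_smooth[OF c(1) smooth_fun_on_subset[OF F W]]])
      show "smooth_on n V (\<lambda>x. g x j)" for j by (rule smooth_on_subset[OF gsm Vo]) (auto simp: V_def)
      show "g y \<in> ?X" if "y \<in> V" for y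
      proof -
        have "g y \<in> cube n (crd p p) d" using that by (simp add: V_def)
        then have "g y \<in> cube n (crd p p) e" by (rule subsetD[OF cube_mono[OF d(2)]])
        then show ?thesis by (rule subsetD[OF e(2)])
      qed
    qed auto
    then have "smooth_on n V (\<lambda>y. F (orb (lin (sc y))))"
      by (rule smooth_on_cong[rotated]) (use inv in simp)
    moreover have "y0 \<in> V" using y0(1) g0 centre_in_cube[OF straight_espace[OF c(1,2)] d(1)] by (simp add: V_def)
    moreover have "V \<subseteq> ?O" using inv by (auto simp: V_def)
    ultimately show "\<exists>V. y0 \<in> V \<and> V \<subseteq> ?O \<and> smooth_on n V (\<lambda>y. F (orb (lin (sc y))))" by blast
  qed
  have K_cont: "continuous_map (mtop (torus n)) (mtop M) K"
  proof (rule continuous_map_locally)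
    fix z0 assume z0: "z0 \<in> mcarrier (torus n)"
    \<comment> \<open>A torus chart centred at the point itself, which therefore avoids the cut in
      every component.\<close>
    define a where "a i = Arg (z0 i)" for i
    let ?V = "fst (torus_chart n a)" and ?\<psi> = "snd (torus_chart n a)"
    have n0: "norm (z0 i) = 1" if "i < n" for i using z0 that by (auto simp: mem_torus PiE_iff)
    have Vo: "openin (mtop (torus n)) ?V"
    proof -
      have "openin (top_of_set (sphere 0 1)) (sphere 0 1 - {- cis (a i)})" for i
        unfolding Diff_eq by (intro openin_open_Int open_Compl closed_singleton)
      then show ?thesis by (simp add: torus_def torus_chart_def openin_PiE_gen)
    qed
    have "z0 i \<noteq> - cis (a i)" if "i < n" for i
      using cis_neq[of "a i" "a i"] cis_Arg_sphere[OF n0[OF that]] by (simp add: a_def)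
    then have z0V: "z0 \<in> ?V" using z0 unfolding torus_chart_dom mem_torus by blast
    have comp: "continuous_map (subtopology (mtop (torus n)) ?V) euclideanreal (\<lambda>z. a i + Arg (z i / cis (a i)))" if i: "i < n" for i
    proof -
      have pr: "continuous_map (subtopology (mtop (torus n)) ?V) (top_of_set (sphere 0 1 - {- cis (a i)})) (\<lambda>z. z i)"
      proof -
        have "continuous_map (mtop (torus n)) (top_of_set (sphere 0 1)) (\<lambda>z. z i)"
          unfolding torus_def manifold.simps by (rule continuous_map_product_projection) (use i in simp)
        then have "continuous_map (subtopology (mtop (torus n)) ?V) (top_of_set (sphere 0 1)) (\<lambda>z. z i)"
          by (rule continuous_map_from_subtopology)
        then show ?thesis using i by (auto simp: continuous_map_in_subtopology torus_chart_def PiE_iff)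
      qed
      have "continuous_on (sphere 0 1 - {- cis (a i)}) (\<lambda>z. Arg (z / cis (a i)))"
      proof (rule continuous_on_compose2[of "- \<real>\<^sub>\<le>\<^sub>0" Arg])
        show "continuous_on (- \<real>\<^sub>\<le>\<^sub>0) Arg"
          using continuous_at_Arg by (intro continuous_at_imp_continuous_on) auto
        show "(\<lambda>z. z / cis (a i)) ` (sphere 0 1 - {- cis (a i)}) \<subseteq> - \<real>\<^sub>\<le>\<^sub>0"
        proof (rule image_subsetI)
          fix z assume z: "z \<in> sphere 0 1 - {- cis (a i)}"
          then have "norm z = 1" "z \<noteq> - cis (a i)" by auto
          note t = torus_angle(2)[OF this]
          show "z / cis (a i) \<in> - \<real>\<^sub>\<le>\<^sub>0"
          proof
            assume "z / cis (a i) \<in> \<real>\<^sub>\<le>\<^sub>0"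
            then obtain x where x: "x \<le> 0" "z / cis (a i) = of_real x" by (auto elim!: nonpos_Reals_cases)
            moreover have "norm (z / cis (a i)) = 1" using \<open>norm z = 1\<close> by (simp add: norm_divide)
            ultimately have "z / cis (a i) = -1" by (simp add: abs_real_def split: if_splits)
            moreover have "Arg (-1) = pi" using Arg_cis_eq[of pi] by simp
            ultimately show False using t by simp
          qed
        qed
        show "continuous_on (sphere 0 1 - {- cis (a i)}) (\<lambda>z. z / cis (a i))"
          by (rule continuous_on_divide[OF continuous_on_id continuous_on_const]) simp
      qed
      then have "continuous_on (sphere 0 1 - {- cis (a i)}) (\<lambda>z. a i + Arg (z / cis (a i)))"
        by (rule continuous_on_add[OF continuous_on_const])
      then have "continuous_map (top_of_set (sphere 0 1 - {- cis (a i)})) euclideanreal (\<lambda>z. a i + Arg (z / cis (a i)))" by simp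
      from continuous_map_compose[OF pr this] show ?thesis by (simp add: comp_def)
    qed
    have "continuous_map (subtopology (mtop (torus n)) ?V) euclideanreal (\<lambda>z. a i / (2 * pi) + Arg (z i / cis (a i)) / (2 * pi))" if "i < n" for i
      using continuous_map_real_mult_right[OF comp[OF that], of "1 / (2 * pi)"] by (simp add: add_divide_distrib)
    then have 1: "continuous_map (subtopology (mtop (torus n)) ?V) (Euclidean_space n) (\<lambda>z i. if i < n then a i / (2 * pi) + Arg (z i / cis (a i)) / (2 * pi) else 0)"
      unfolding continuous_map_componentwise_Euclidean_space by blast
    have 2: "continuous_map (Euclidean_space n) (Euclidean_space n) lin"
    proof -
      have E: "openin (Euclidean_space n) (espace n)" using openin_topspace[of "Euclidean_space n"] by (simp add: topspace_Euclidean_space)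
      have "smooth_on n (espace n) (\<lambda>y. lin y j)" for j
        unfolding lin_apply
        by (rule smooth_on_sum[OF E smooth_on_mult[OF smooth_on_coordinate[OF E] smooth_on_const[OF E]]])
      from smooth_on_continuous_map[OF E this line]
      show ?thesis by (simp add: subtopology_topspace[of "Euclidean_space n", unfolded topspace_Euclidean_space])
    qed
    have "continuous_map (subtopology (mtop (torus n)) ?V) (mtop M) (orb \<circ> (lin \<circ> (\<lambda>z i. if i < n then a i / (2 * pi) + Arg (z i / cis (a i)) / (2 * pi) else 0)))"
      by (rule continuous_map_compose[OF continuous_map_compose[OF 1 2] orb_continuous])
    then have "continuous_map (subtopology (mtop (torus n)) ?V) (mtop M) K"
    proof (rule continuous_map_eq)
      fix z assume "z \<in> topspace (subtopology (mtop (torus n)) ?V)"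
      then have z: "z \<in> ?V" by simp
      have zi: "norm (z i) = 1" "z i \<noteq> - cis (a i)" if "i < n" for i using z that by (auto simp: torus_chart_dom PiE_iff)
      let ?b = "\<lambda>i. if i < n then a i / (2 * pi) + Arg (z i / cis (a i)) / (2 * pi) else 0"
      have "(\<lambda>i\<in>{..<n}. cis (2 * pi * ?b i)) = z"
      proof
        fix i
        show "(\<lambda>i\<in>{..<n}. cis (2 * pi * ?b i)) i = z i"
        proof (cases "i < n")
          case True
          have "2 * pi * ?b i = a i + Arg (z i / cis (a i))" using True by (simp add: field_simps)
          then show ?thesis using torus_angle(1)[OF zi[OF True]] True by simp
        next
          case False
          then show ?thesis using z by (auto simp: torus_chart_dom PiE_iff extensional_def)
        qed
      qed
      then show "(orb \<circ> (lin \<circ> (\<lambda>z i. if i < n then a i / (2 * pi) + Arg (z i / cis (a i)) / (2 * pi) else 0))) z = K z"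
        using K_cis[of ?b] by simp
    qed
    then show "\<exists>V. z0 \<in> V \<and> openin (mtop (torus n)) V \<and> continuous_map (subtopology (mtop (torus n)) V) (mtop M) K"
      using Vo z0V by blast
  qed
  have K_smooth: "smooth_map (torus n) M K"
    unfolding smooth_map_def
  proof (intro conjI K_cont ballI, clarify)
    fix V \<psi> U \<phi> j assume d: "(V, \<psi>) \<in> mcharts (torus n)" and c: "(U, \<phi>) \<in> mcharts M" and j: "j < n"
    obtain a where a: "torus_chart n a = (V, \<psi>)" using d by (auto simp: torus_def)
    let ?C = "cube n (\<lambda>i. if i < n then a i else 0) pi"
    note T = torus_chart_image[where r = n and a = a, unfolded a fst_conv snd_conv]
    let ?O = "{y \<in> espace n. orb (lin (sc y)) \<in> U}"
    have sm: "smooth_on n ?O (\<lambda>y. \<phi> (orb (lin (sc y))) j)"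
      by (rule orb_lin_smooth[OF smooth_fun_on_coordinate[OF c]])
    \<comment> \<open>In the torus chart \<open>K\<close> reads \<open>orb (lin (sc y))\<close>,
      restricted to the cube of half-width pi; the relevant coordinate domain is thus an
      intersection of two open sets.\<close>
    have img: "\<psi> ` (V \<inter> K -` U) = ?C \<inter> ?O"
    proof (intro equalityI subsetI)
      fix y assume "y \<in> \<psi> ` (V \<inter> K -` U)"
      then obtain z where z: "z \<in> V" "K z \<in> U" "y = \<psi> z" by blast
      have yC: "y \<in> ?C" unfolding T(2)[symmetric] z(3) by (rule imageI[OF z(1)])
      have "inv_into V \<psi> y = z" unfolding z(3) by (rule inv_into_f_f[OF T(1) z(1)])
      then have "z = (\<lambda>i\<in>{..<n}. cis (y i))" using T(3)[OF yC] by (simp only:)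
      then have "K z = orb (lin (sc y))" using K_sc by (simp only:)
      then show "y \<in> ?C \<inter> ?O" using yC z(2) cube_espace[OF yC] by simp
    next
      fix y assume y: "y \<in> ?C \<inter> ?O"
      then have yC: "y \<in> ?C" by blast
      have V: "(\<lambda>i\<in>{..<n}. cis (y i)) \<in> V" by (rule T(4)[OF yC])
      have U: "K (\<lambda>i\<in>{..<n}. cis (y i)) \<in> U" using y unfolding K_sc by simp
      have "y \<in> \<psi> ` V" using yC unfolding T(2) .
      then have "\<psi> (\<lambda>i\<in>{..<n}. cis (y i)) = y" unfolding T(3)[OF yC, symmetric] by (rule f_inv_into_f)
      moreover have "\<psi> (\<lambda>i\<in>{..<n}. cis (y i)) \<in> \<psi> ` (V \<inter> K -` U)"
        by (rule imageI) (intro IntI V vimageI2 U)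
      ultimately show "y \<in> \<psi> ` (V \<inter> K -` U)" by (simp only:)
    qed
    have "smooth_on n (?C \<inter> ?O) (\<lambda>y. \<phi> (orb (lin (sc y))) j)"
      by (rule smooth_on_subset[OF sm openin_Int[OF openin_cube smooth_on_open[OF sm]]]) blast
    then have "smooth_on n (\<psi> ` (V \<inter> K -` U)) (\<lambda>y. \<phi> (K (inv_into V \<psi> y)) j)"
      unfolding img
    proof (rule smooth_on_cong[rotated])
      fix y assume "y \<in> ?C \<inter> ?O"
      then have "inv_into V \<psi> y = (\<lambda>i\<in>{..<n}. cis (y i))" by (intro T(3)) blast
      then show "\<phi> (orb (lin (sc y))) j = \<phi> (K (inv_into V \<psi> y)) j" using K_sc by (simp only:)
    qed
    then show "smooth_on (mdim (torus n)) (\<psi> ` (V \<inter> K -` U)) (\<lambda>y. \<phi> (K (inv_into V \<psi> y)) j)"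
      by (simp add: torus_def)
  qed
  show ?thesis
    unfolding diffeomorphic_def using H_smooth K_smooth KH HK by blast
qed

end

theorem corollary3p12:
  fixes M :: "'a manifold" and P :: "'a bivector_field" and f :: "nat \<Rightarrow> 'a \<Rightarrow> real"
    and n r s :: nat and m :: 'a and F\<^sub>m :: "'a manifold"
  assumes "poisson_manifold M P"
    and "mdim M = n"
    and "maximal_rank M P (2 * r)"
    and "liouville_integrable M P s f"
    and "m \<in> mcarrier M"
    and "wedge s (\<lambda>i. differential M (f i) m) \<noteq> 0"
    and "rank_at M P m = 2 * r"
    and "maximal_integral_manifold M (hamiltonian_distribution M P s f) m F\<^sub>m"
    and "compact_space (mtop F\<^sub>m)"
  shows "diffeomorphic F\<^sub>m (torus r)"
proof -
  have "smooth_manifold M" using assms(1) unfolding poisson_manifold_def by blast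
  then interpret poisson_mfd M P using assms(1) by unfold_locales
  obtain r' where r': "maximal_rank M P (2 * r')" "r' + s = mdim M" and fs: "\<And>i. i < s \<Longrightarrow> smooth_fun M (f i)"
    and inv: "\<And>i j p. i < s \<Longrightarrow> j < s \<Longrightarrow> p \<in> mcarrier M \<Longrightarrow> poisson_bracket M P (f i) (f j) p = 0"
    using assms(4) unfolding liouville_integrable_def by blast
  \<comment> \<open>Integrability comes with its own number \<open>r'\<close>. A maximal rank is
    attained and bounds all ranks, so \<open>2 * r\<close> and \<open>2 * r'\<close> bound each
    other.\<close>
  obtain p q where "p \<in> mcarrier M" "rank_at M P p = 2 * r" "q \<in> mcarrier M" "rank_at M P q = 2 * r'"
    using assms(3) r'(1) unfolding maximal_rank_def by blast
  then have "2 * r \<le> 2 * r'" "2 * r' \<le> 2 * r" using assms(3) r'(1) unfolding maximal_rank_def by metis+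
  then have rs: "r + s = mdim M" using r'(2) by simp
  have N: "integral_manifold M (hamiltonian_distribution M P s f) F\<^sub>m" "connected_space (mtop F\<^sub>m)" "m \<in> mcarrier F\<^sub>m"
    using assms(8) unfolding maximal_integral_manifold_def by blast+
  interpret I: involutive_integral M P F\<^sub>m f s
    by unfold_locales (fact fs inv N(1))+
  note w = wedge_independent[OF assms(6)]
  have dim: "mdim F\<^sub>m = r"
    using I.mdim_N_le[OF N(3) w] I.mdim_N_ge[OF N(3) w assms(7) rs] rs by linarith
  have Y_span: "\<exists>a. v = (\<Sum>i<s. fun_scale (a i) (I.Y i p))" if "p \<in> mcarrier F\<^sub>m" "v \<in> tangent_space F\<^sub>m p" for p v
    by (rule I.Y_span[OF that]) blast
  obtain Z where Z: "commuting_fields F\<^sub>m Z" "\<And>q. q \<in> mcarrier F\<^sub>m \<Longrightarrow> commuting_fields.spans F\<^sub>m Z q"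
    by (rule I.N.commuting_frame_exists[OF I.Y_smooth_vf I.Y_commute Y_span N(2,3)], assumption+, rule that)
  interpret C: commuting_frame F\<^sub>m Z
    using Z by (intro commuting_frame.intro commuting_frame_axioms.intro)
  obtain e where e: "e > 0" "\<And>q. q \<in> mcarrier F\<^sub>m \<Longrightarrow> \<exists>U x. C.straight U x \<and> q \<in> U \<and> cube (mdim F\<^sub>m) (x q) e \<subseteq> x ` U"
    by (rule C.uniform_straight_charts[OF assms(9)], rule that)
  interpret T: compact_frame F\<^sub>m Z e m
    by (intro compact_frame.intro compact_frame_axioms.intro C.commuting_frame_axioms assms(9) N(2,3) e)
  show ?thesis using T.diffeomorphic_torus unfolding dim .
qed

end
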